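(* Let $\mathbb T^2=(\mathbb R/2\pi\mathbb Z)^2$, $\mathcal H=L^2(\mathbb T^2\times\mathbb S^1)$, and consider the Lorentz kinetic equation (in dimension $d=2$ with relaxation rate $\sigma=1$) $$\partial_tf+\mathbf v\cdot\nabla_{\mathbf x}f=\tilde f-f,\qquad \tilde f(\mathbf x)=\frac1{2\pi}\int_{\mathbb S^1}f(\mathbf x,\mathbf v)\,d\mathbf v,$$ i.e. $\partial_tf=-\mathbf Cf$ with $\mathbf C=\mathbf R-\mathbf J$, $\mathbf Rf=f-\tilde f$, $\mathbf Jf=-\mathbf v\cdot\nabla_{\mathbf x}f$. Let $\mathcal D_\circ=\{f\in\mathcal H:\ \partial^2f/\partial\mathbf x^2\in\mathcal H\}$. Then: (a) The operator $\mathbf C=\mathbf R-\mathbf J$ is hypocoercive on $\mathcal D_\circ\cap\{\int_{\mathbb T^2\times\mathbb S^1}f\,d\mathbf x\,d\mathbf v=0\}$ with hypocoercivity index $m_{HC}=1$. In particular, on this set the inequality $$\mathbf R+\mathbf J\mathbf R\mathbf J^*\ge\kappa\mathbf I$$ holds with $\kappa=\frac{3-\sqrt5}{2}$. (b) For any $f_0\in\mathcal H$ the solution $f(t)=e^{-\mathbf Ct}f_0$ satisfies, for all $t\ge0$, $$\|f(t)-f_\infty\|_{\mathcal H}\le\sqrt3\,e^{-\lambda_0t}\|f_0-f_\infty\|_{\mathcal H},$$ where $f_\infty=\frac1{(2\pi)^3}\int_{\mathbb T^2\times\mathbb S^1}f_0(\mathbf x,\mathbf v)\,d\mathbf v\,d\mathbf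 x$ denotes the unique equilibrium corresponding to $f_0$ and $$\lambda_0=\frac12-\frac1{6\sqrt2}-\frac13\sqrt{\frac7{16}+\frac1{\sqrt8}}.$$ (c) The propagator $\mathbf P(t)=e^{-\mathbf Ct}$ satisfies $$1-\tilde ct^3\le\|\mathbf P(t)-\Pi_\infty\|_{\mathcal B(\mathcal H)}\le1-ct^3,\qquad0\le t\le\tau,$$ where $\Pi_\infty$ denotes the $\mathcal H$-orthogonal projection onto $\operatorname{span}[f_\infty]$, i.e. onto the constant functions, and $c,\tau,\tilde c>0$ are the following constants. On $H=L^2(\mathbb S^1)$ put, for $\mathbf n\in\mathbb Z^2\setminus\{0\}$, $\mathbf R\phi=\phi-\frac1{2\pi}\int_{\mathbb S^1}\phi\,d\mathbf v$ (same letter), $(\mathbf J_{\mathbf n}\phi)(\mathbf v)=-i(\mathbf v\cdot\mathbf n)\phi(\mathbf v)$, $\mathbf C_{\mathbf n}=\mathbf R-\mathbf J_{\mathbf n}$. Fix constants $\kappa_1,\kappa_3>0$, independent of $\mathbf n$, with $\mathbf R+\mathbf J_{\mathbf n}\mathbf R\mathbf J_{\mathbf n}^*\ge\kappa_1\mathbf I$ and $\mathbf R+\mathbf C_{\mathbf n}^*\mathbf R\mathbf C_{\mathbf n}\ge\kappa_3\mathbf I$ for all $\mathbf n\in\mathbb Z^2\setminus\{0\}$ (such constants exist), and set $\delta=\min(\kappa_1/5,\kappa_3/2)$. Let $\tau_1,\tau_3>0$ be determined by $$\frac{e^{4\tau_1}-1-4\tau_1}{2\tau_1}=\delta,\qquad\frac{e^{4\tau_3}-1-4\tau_3-8\tau_3^2-\frac{32}3\tau_3^3}{2\tau_3^3}=\frac\delta{12},$$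 let $$\tau_2=\frac{\sqrt{12\delta}}{\inf\{\|\sqrt{\mathbf R}\,\mathbf J_{(1,0)}x\|:\ x\in H,\ \|x\|=1,\ \langle x,\mathbf Rx\rangle\le\delta\}+\sqrt\delta},$$ and $$\tau=\min(\tau_1,\tau_2,\tau_3,1),\qquad c_1=\frac\delta{12},\qquad c_2=\frac{c_1}{\left(1+\frac1{\lambda_0\tau}\right)^3}.$$ Let $r>1$ be the real number with $\frac\tau r+\frac1{2\lambda_0}\ln\!\big(1+\frac1{r-1/2}\big)=\tau$, and let $c_3$ be the unique number with $$\Big(1-\frac{\delta\tau^3}{12r}\Big)\sqrt{1+\frac1{r-1/2}}\;e^{-\lambda_0\frac{r-1}r\tau}=1-c_3\tau^3.$$ Then $c=\min(c_2,c_3)$. The constant $\tilde c>0$ is the one from the cubic lower bound for the $(1,0)$-Fourier mode, i.e. a constant such that $\|e^{-\mathbf C_{(1,0)}t}\|_{\mathcal B(H)}\ge1-\tilde ct^3$ for $0\le t\le\tau$ (which exists because $\mathbf C_{(1,0)}$ has hypocoercivity index $1$).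
   Context: $\mathbb S^1\subset\mathbb R^2$ is the unit circle with arc-length measure. $\mathbf J$ (on $\mathcal H$) is an unbounded skew-adjoint operator with domain $\{f\in\mathcal H:\mathbf v\cdot\nabla_{\mathbf x}f\in\mathcal H\}\supseteq\mathcal D_\circ$; $\mathbf R$ is bounded, self-adjoint, nonnegative; $\sqrt{\mathbf R}$ is its nonnegative square root; $-\mathbf C$ generates a $C_0$-semigroup $(e^{-\mathbf Ct})_{t\ge0}$ on $\mathcal H$. The operator $\mathbf R+\mathbf J\mathbf R\mathbf J^*$ is defined on $\mathcal D_\circ$, and the inequality in (a) means $\langle(\mathbf R+\mathbf J\mathbf R\mathbf J^* )f,f\rangle\ge\kappa\|f\|^2$ for all $f$ in the indicated set. For this unbounded operator, being hypocoercive with index $m_{HC}=1$ on the indicated set means that $m=1$ is the smallest $m\in\mathbb N_0$ for which $\sum_{j=0}^m\mathbf J^j\mathbf R(\mathbf J^* )^j\ge\kappa\mathbf I$ holds on that set for some $\kappa>0$. For the bounded accretive operators $\mathbf C_{\mathbf n}$ the hypocoercivity index is the smallest $m\in\mathbb N_0$ such that $\sum_{j=0}^m(\mathbf C_{\mathbf n}^* )^j\mathbf R\,\mathbf C_{\mathbf n}^j\ge\kappa\mathbf I$ for some $\kappa>0$. *)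

theory Defs
  imports "HOL-Analysis.Analysis"
begin

section \<open>The Hilbert space of square-integrable functions\<close>

text \<open>
  Elements of the complex Hilbert space over a measure \<open>M\<close> are represented by functions, and
  \<open>f\<close>, \<open>g\<close> denote the same element iff they agree almost everywhere. The inner product is linear
  in its first argument.
\<close>

definition L2 :: "'a measure \<Rightarrow> ('a \<Rightarrow> complex) set" where
  "L2 M = {f \<in> borel_measurable M. integrable M (\<lambda>z. (cmod (f z))\<^sup>2)}"

definition l2_inner :: "'a measure \<Rightarrow> ('a \<Rightarrow> complex) \<Rightarrow> ('a \<Rightarrow> complex) \<Rightarrow> complex" where
  "l2_inner M f g = (LINT z|M. f z * cnj (g z))"

definition l2_norm :: "'a measure \<Rightarrow> ('a \<Rightarrow> complex) \<Rightarrow> real" where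
  "l2_norm M f = sqrt (LINT z|M. (cmod (f z))\<^sup>2)"

definition bounded_op :: "'a measure \<Rightarrow> (('a \<Rightarrow> complex) \<Rightarrow> ('a \<Rightarrow> complex)) \<Rightarrow> bool" where
  "bounded_op M A \<longleftrightarrow>
     (\<forall>f\<in>L2 M. A f \<in> L2 M) \<and>
     (\<forall>f\<in>L2 M. \<forall>g\<in>L2 M. \<forall>a b. AE z in M. A (\<lambda>y. a * f y + b * g y) z = a * A f z + b * A g z) \<and>
     (\<exists>K. \<forall>f\<in>L2 M. l2_norm M (A f) \<le> K * l2_norm M f)"

definition op_norm :: "'a measure \<Rightarrow> (('a \<Rightarrow> complex) \<Rightarrow> ('a \<Rightarrow> complex)) \<Rightarrow> real" where
  "op_norm M A = (SUP f\<in>{f \<in> L2 M. l2_norm M f \<le> 1}. l2_norm M (A f))"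

definition orth_proj ::
    "'a measure \<Rightarrow> ('a \<Rightarrow> complex) set \<Rightarrow> ('a \<Rightarrow> complex) \<Rightarrow> ('a \<Rightarrow> complex)" where
  "orth_proj M S f = (SOME g. g \<in> S \<and> (\<forall>h\<in>S. l2_inner M (\<lambda>z. f z - g z) h = 0))"

definition is_nonneg_sqrt :: "'a measure \<Rightarrow> (('a \<Rightarrow> complex) \<Rightarrow> ('a \<Rightarrow> complex)) \<Rightarrow>
    (('a \<Rightarrow> complex) \<Rightarrow> ('a \<Rightarrow> complex)) \<Rightarrow> bool" where
  "is_nonneg_sqrt M A S \<longleftrightarrow>
     bounded_op M S \<and>
     (\<forall>f\<in>L2 M. \<forall>g\<in>L2 M. l2_inner M (S f) g = l2_inner M f (S g)) \<and>
     (\<forall>f\<in>L2 M. 0 \<le> Re (l2_inner M (S f) f)) \<and>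
     (\<forall>f\<in>L2 M. AE z in M. S (S f) z = A f z)"

definition nonneg_sqrt :: "'a measure \<Rightarrow> (('a \<Rightarrow> complex) \<Rightarrow> ('a \<Rightarrow> complex)) \<Rightarrow>
    ('a \<Rightarrow> complex) \<Rightarrow> ('a \<Rightarrow> complex)" where
  "nonneg_sqrt M A = (SOME S. is_nonneg_sqrt M A S)"

definition op_exp :: "'a measure \<Rightarrow> (('a \<Rightarrow> complex) \<Rightarrow> ('a \<Rightarrow> complex)) \<Rightarrow>
    ('a \<Rightarrow> complex) \<Rightarrow> ('a \<Rightarrow> complex)" where
  "op_exp M A f = (SOME g. g \<in> L2 M \<and>
     (\<lambda>N. l2_norm M (\<lambda>z. (\<Sum>k<N. (A ^^ k) f z / fact k) - g z)) \<longlonglongrightarrow> 0)"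


section \<open>Unbounded operators\<close>

text \<open>
  A possibly unbounded operator is given by its graph, which is closed under almost-everywhere
  modification in both components. Note that in \<open>S O T\<close> the operator \<open>S\<close> is applied first.
\<close>

type_synonym 'a op_graph = "(('a \<Rightarrow> complex) \<times> ('a \<Rightarrow> complex)) set"

definition graph_of :: "'a measure \<Rightarrow> (('a \<Rightarrow> complex) \<Rightarrow> ('a \<Rightarrow> complex)) \<Rightarrow> 'a op_graph" where
  "graph_of M A = {(f, g). f \<in> L2 M \<and> g \<in> L2 M \<and> (AE z in M. g z = A f z)}"

definition adj :: "'a measure \<Rightarrow> 'a op_graph \<Rightarrow> 'a op_graph" where
  "adj M T = {(g, h). g \<in> L2 M \<and> h \<in> L2 M \<and> (\<forall>(f, f')\<in>T. l2_inner M f' g = l2_inner M f h)}"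

definition op_uminus :: "'a op_graph \<Rightarrow> 'a op_graph" where
  "op_uminus T = {(f, \<lambda>z. - g z) |f g. (f, g) \<in> T}"

definition op_minus :: "'a op_graph \<Rightarrow> 'a op_graph \<Rightarrow> 'a op_graph" where
  "op_minus S T = {(f, \<lambda>z. g z - h z) |f g h. (f, g) \<in> S \<and> (f, h) \<in> T}"

text \<open>The operator \<open>A\<^sup>0 R B\<^sup>0 + \<dots> + A\<^sup>m R B\<^sup>m\<close> on its natural domain.\<close>

definition hc_sum :: "'a op_graph \<Rightarrow> 'a op_graph \<Rightarrow> 'a op_graph \<Rightarrow> nat \<Rightarrow> 'a op_graph" where
  "hc_sum A R B m =
     {(f, \<lambda>z. \<Sum>j\<le>m. g j z) |f g. \<forall>j\<le>m. (f, g j) \<in> (B ^^ j) O R O (A ^^ j)}"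

text \<open>
  \<open>T \<ge> \<kappa> I\<close> on \<open>D\<close>; this includes that \<open>T\<close> is defined on \<open>D\<close> and that its quadratic form is real
  there.
\<close>

definition op_ge_on ::
    "'a measure \<Rightarrow> ('a \<Rightarrow> complex) set \<Rightarrow> 'a op_graph \<Rightarrow> real \<Rightarrow> bool" where
  "op_ge_on M D T \<kappa> \<longleftrightarrow>
     D \<subseteq> Domain T \<and>
     (\<forall>(f, g)\<in>T. f \<in> D \<longrightarrow>
        Im (l2_inner M g f) = 0 \<and> \<kappa> * (l2_norm M f)\<^sup>2 \<le> Re (l2_inner M g f))"

definition hypocoercivity_index :: "'a measure \<Rightarrow> ('a \<Rightarrow> complex) set \<Rightarrow>
    'a op_graph \<Rightarrow> 'a op_graph \<Rightarrow> 'a op_graph \<Rightarrow> nat \<Rightarrow> bool" where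
  "hypocoercivity_index M D A R B m \<longleftrightarrow>
     (\<exists>\<kappa>>0. op_ge_on M D (hc_sum A R B m) \<kappa>) \<and>
     (\<forall>k<m. \<not> (\<exists>\<kappa>>0. op_ge_on M D (hc_sum A R B k) \<kappa>))"

definition C0_semigroup ::
    "'a measure \<Rightarrow> (real \<Rightarrow> ('a \<Rightarrow> complex) \<Rightarrow> ('a \<Rightarrow> complex)) \<Rightarrow> bool" where
  "C0_semigroup M P \<longleftrightarrow>
     (\<forall>t\<ge>0. bounded_op M (P t)) \<and>
     (\<forall>f\<in>L2 M. AE z in M. P 0 f z = f z) \<and>
     (\<forall>s\<ge>0. \<forall>t\<ge>0. \<forall>f\<in>L2 M. AE z in M. P (s + t) f z = P s (P t f) z) \<and>
     (\<forall>f\<in>L2 M. ((\<lambda>t. l2_norm M (\<lambda>z. P t f z - f z)) \<longlongrightarrow> 0) (at_right 0))"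

definition generator ::
    "'a measure \<Rightarrow> (real \<Rightarrow> ('a \<Rightarrow> complex) \<Rightarrow> ('a \<Rightarrow> complex)) \<Rightarrow> 'a op_graph" where
  "generator M P = {(f, g). f \<in> L2 M \<and> g \<in> L2 M \<and>
     ((\<lambda>t. l2_norm M (\<lambda>z. (P t f z - f z) / complex_of_real t - g z)) \<longlongrightarrow> 0) (at_right 0)}"

definition generates ::
    "'a measure \<Rightarrow> 'a op_graph \<Rightarrow> (real \<Rightarrow> ('a \<Rightarrow> complex) \<Rightarrow> ('a \<Rightarrow> complex)) \<Rightarrow> bool" where
  "generates M A P \<longleftrightarrow> C0_semigroup M P \<and> generator M P = A"


section \<open>Phase space\<close>

text \<open>The torus is represented by the fundamental domain \<open>[0, 2\<pi>)\<^sup>2\<close>.\<close>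

definition torus :: "(real^2) measure" where
  "torus = restrict_space lborel {x. \<forall>i. 0 \<le> x $ i \<and> x $ i < 2 * pi}"

definition circle :: "(real^2) measure" where
  "circle = distr (restrict_space lborel {0..<2 * pi}) (restrict_space borel (sphere 0 1))
     (\<lambda>\<theta>. vector [cos \<theta>, sin \<theta>])"

definition phase :: "((real^2) \<times> (real^2)) measure" where
  "phase = torus \<Otimes>\<^sub>M circle"

primrec Ck :: "nat \<Rightarrow> ('a::euclidean_space \<Rightarrow> 'b::real_normed_vector) \<Rightarrow> bool" where
  "Ck 0 \<psi> \<longleftrightarrow> continuous_on UNIV \<psi>"
| "Ck (Suc k) \<psi> \<longleftrightarrow> \<psi> differentiable_on UNIV \<and> (\<forall>w. Ck k (\<lambda>z. frechet_derivative \<psi> (at z) w))"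

text \<open>
  Smooth functions on torus times circle: those which extend to a smooth function of
  \<open>(x, v)\<close> in the ambient space that is \<open>2\<pi>\<close>-periodic in each coordinate of \<open>x\<close>. Every smooth
  function on this compact submanifold has such an extension.
\<close>

definition test_fun :: "((real^2) \<times> (real^2) \<Rightarrow> complex) \<Rightarrow> bool" where
  "test_fun \<psi> \<longleftrightarrow> (\<forall>k. Ck k \<psi>) \<and> (\<forall>x v i. \<psi> (x + axis i (2 * pi), v) = \<psi> (x, v))"

definition dx :: "2 \<Rightarrow> ((real^2) \<times> (real^2) \<Rightarrow> complex) \<Rightarrow> ((real^2) \<times> (real^2) \<Rightarrow> complex)" where
  "dx i \<psi> = (\<lambda>z. frechet_derivative \<psi> (at z) (axis i 1, 0))"

definition v_grad :: "((real^2) \<times> (real^2) \<Rightarrow> complex) \<Rightarrow> ((real^2) \<times> (real^2) \<Rightarrow> complex)" where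
  "v_grad \<psi> = (\<lambda>(x, v). frechet_derivative \<psi> (at (x, v)) (v, 0))"

text \<open>\<open>g = v \<cdot> \<nabla>\<^sub>x f\<close>, respectively \<open>g = \<partial>\<^sub>i \<partial>\<^sub>j f\<close>, in the sense of distributions.\<close>

definition weak_v_grad :: "((real^2) \<times> (real^2) \<Rightarrow> complex) \<Rightarrow> ((real^2) \<times> (real^2) \<Rightarrow> complex) \<Rightarrow> bool" where
  "weak_v_grad f g \<longleftrightarrow>
     (\<forall>\<psi>. test_fun \<psi> \<longrightarrow> (LINT z|phase. f z * v_grad \<psi> z) = - (LINT z|phase. g z * \<psi> z))"

definition weak_dxdx ::
    "2 \<Rightarrow> 2 \<Rightarrow> ((real^2) \<times> (real^2) \<Rightarrow> complex) \<Rightarrow> ((real^2) \<times> (real^2) \<Rightarrow> complex) \<Rightarrow> bool" where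
  "weak_dxdx i j f g \<longleftrightarrow>
     (\<forall>\<psi>. test_fun \<psi> \<longrightarrow> (LINT z|phase. f z * dx i (dx j \<psi>) z) = (LINT z|phase. g z * \<psi> z))"

definition D_circ :: "((real^2) \<times> (real^2) \<Rightarrow> complex) set" where
  "D_circ = {f \<in> L2 phase. \<forall>i j. \<exists>g\<in>L2 phase. weak_dxdx i j f g}"


section \<open>The Lorentz kinetic operator\<close>

definition v_mean :: "(real^2 \<Rightarrow> complex) \<Rightarrow> complex" where
  "v_mean \<phi> = (LINT v|circle. \<phi> v) / complex_of_real (2 * pi)"

definition R_op :: "((real^2) \<times> (real^2)) op_graph" where
  "R_op = graph_of phase (\<lambda>f (x, v). f (x, v) - v_mean (\<lambda>w. f (x, w)))"

definition J_op :: "((real^2) \<times> (real^2)) op_graph" where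
  "J_op = {(f, \<lambda>z. - g z) |f g. f \<in> L2 phase \<and> g \<in> L2 phase \<and> weak_v_grad f g}"

definition C_op :: "((real^2) \<times> (real^2)) op_graph" where
  "C_op = op_minus R_op J_op"

definition constants :: "((real^2) \<times> (real^2) \<Rightarrow> complex) set" where
  "constants = range (\<lambda>a z. a)"

definition equilibrium :: "((real^2) \<times> (real^2) \<Rightarrow> complex) \<Rightarrow> complex" where
  "equilibrium f = (LINT z|phase. f z) / complex_of_real ((2 * pi) ^ 3)"

definition lambda0 :: real where
  "lambda0 = 1 / 2 - 1 / (6 * sqrt 2) - 1 / 3 * sqrt (7 / 16 + 1 / sqrt 8)"


section \<open>The Fourier modes\<close>

definition Rv :: "(real^2 \<Rightarrow> complex) \<Rightarrow> (real^2 \<Rightarrow> complex)" where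
  "Rv \<phi> = (\<lambda>v. \<phi> v - v_mean \<phi>)"

definition Jn :: "int^2 \<Rightarrow> (real^2 \<Rightarrow> complex) \<Rightarrow> (real^2 \<Rightarrow> complex)" where
  "Jn n \<phi> = (\<lambda>v. - \<i> * complex_of_real (v \<bullet> (\<chi> i. real_of_int (n $ i))) * \<phi> v)"

definition Cn :: "int^2 \<Rightarrow> (real^2 \<Rightarrow> complex) \<Rightarrow> (real^2 \<Rightarrow> complex)" where
  "Cn n \<phi> = (\<lambda>v. Rv \<phi> v - Jn n \<phi> v)"

definition exp_Cn :: "int^2 \<Rightarrow> real \<Rightarrow> (real^2 \<Rightarrow> complex) \<Rightarrow> (real^2 \<Rightarrow> complex)" where
  "exp_Cn n t = op_exp circle (\<lambda>\<phi> v. - complex_of_real t * Cn n \<phi> v)"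

text \<open>\<open>R + J\<^sub>n R J\<^sub>n\<^sup>* \<ge> \<kappa> I\<close> and \<open>R + C\<^sub>n\<^sup>* R C\<^sub>n \<ge> \<kappa> I\<close> for all nonzero \<open>n\<close>.\<close>

definition coercive_J :: "real \<Rightarrow> bool" where
  "coercive_J \<kappa> \<longleftrightarrow> (\<forall>n. n \<noteq> 0 \<longrightarrow> op_ge_on circle (L2 circle)
     (hc_sum (graph_of circle (Jn n)) (graph_of circle Rv) (adj circle (graph_of circle (Jn n))) 1) \<kappa>)"

definition coercive_C :: "real \<Rightarrow> bool" where
  "coercive_C \<kappa> \<longleftrightarrow> (\<forall>n. n \<noteq> 0 \<longrightarrow> op_ge_on circle (L2 circle)
     (hc_sum (adj circle (graph_of circle (Cn n))) (graph_of circle Rv) (graph_of circle (Cn n)) 1) \<kappa>)"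

definition cubic_lower_bound :: "real \<Rightarrow> real \<Rightarrow> bool" where
  "cubic_lower_bound \<tau> c \<longleftrightarrow> (\<forall>t\<in>{0..\<tau>}. 1 - c * t ^ 3 \<le> op_norm circle (exp_Cn (vector [1, 0]) t))"

end

theory Submission
  imports Defs "HOL-Real_Asymp.Real_Asymp"
begin

text \<open>
  A Fourier expansion in \<open>x\<close> turns \<open>R\<close>, \<open>J\<close> and \<open>C\<close> into the operators \<open>Rv\<close>, \<open>Jn n\<close> and \<open>Cn n\<close> on the
  circle, and the given semigroup into \<open>exp (- Cn n t)\<close>, because \<open>s \<mapsto> P (t - s) (exp (- Cn n s) \<phi>)\<close> has
  derivative zero; this needs that \<open>P\<close> is locally bounded, hence the uniform boundedness principle.
  Part (a) then is a sharp inequality on the circle. For the decay, a multiple of the cross term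
  between density and current is added to the energy of each mode. A constant multiple gives an
  exponential rate larger than \<open>lambda0\<close>; a multiple depending on time that vanishes at the ends of
  \<open>[0, t]\<close> gives a loss of order \<open>t\<^sup>3\<close>. The constant \<open>c\<close> of part (c) is so small, by
  \<open>\<delta> \<le> 1/10\<close> and \<open>lambda0 \<le> 1/10\<close>, that the latter suffices with room to spare.
\<close>

section \<open>Square-integrable functions\<close>

text \<open>The explicit constants are the main trap. They mix an infimum over the square root of
  \<open>Rv\<close>, solutions of transcendental equations and \<open>lambda0\<close>, but the upper
  bound in (c) survives if \<open>c\<close> is replaced by something larger:
  \<open>c \<le> c\<^sub>2 \<le> 1 / 4000\<close>, whereas each nonzero mode loses at least the
  fraction t^3/960 of its squared norm, up to higher order. So the infimum enters through its sign,
  \<open>r\<close> through existence, uniqueness and the identity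
  \<open>c\<^sub>3 = \<delta> / (12 * r)\<close>. All estimates are uniform in n because the cross
  term is divided by |n| >= 1: its derivative contains -|n|/2 times the density, and the quotient no
  longer depends on n. The value (3 - sqrt 5)/2 comes from one integral: the mean of 1/(b + cos^2)
  is 1/sqrt(b(b + 1)), which equals 1 for b = (sqrt 5 - 1)/2. The lower bound in (c) rests on the
  constant function on the circle: \<open>Rv\<close> kills it, so along its flow the dissipation
  rate starts like s^2 and the energy loss like t^3. Elements of L2 are functions and
  \<open>P\<close> is any semigroup with the given generator, so Fourier coefficients are identified
  only almost everywhere, mostly by pairing with single modes.\<close>

lemma borel_measurable_cnj [measurable (raw)]:
  "f \<in> borel_measurable M \<Longrightarrow> (\<lambda>z. cnj (f z)) \<in> borel_measurable M"
  by (rule borel_measurable_continuous_on[of cnj]) (simp_all add: continuous_on_cnj continuous_on_id)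

lemma L2_measurable [measurable_dest]: "f \<in> L2 M \<Longrightarrow> f \<in> borel_measurable M"
  by (simp add: L2_def)

lemma L2_sq_integrable: "f \<in> L2 M \<Longrightarrow> integrable M (\<lambda>z. (cmod (f z))\<^sup>2)"
  by (simp add: L2_def)

lemma L2_integrable_mult:
  assumes f: "f \<in> L2 M" and g: "g \<in> L2 M"
  shows "integrable M (\<lambda>z. f z * g z)"
proof (rule Bochner_Integration.integrable_bound)
  show "integrable M (\<lambda>z. (cmod (f z))\<^sup>2 + (cmod (g z))\<^sup>2)"
    using L2_sq_integrable[OF f] L2_sq_integrable[OF g] by simp
  show "(\<lambda>z. f z * g z) \<in> borel_measurable M" using f g by measurable
  show "AE z in M. norm (f z * g z) \<le> norm ((cmod (f z))\<^sup>2 + (cmod (g z))\<^sup>2)"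
  proof (rule AE_I2)
    fix z
    have "2 * (cmod (f z) * cmod (g z)) \<le> (cmod (f z))\<^sup>2 + (cmod (g z))\<^sup>2"
      using sum_squares_bound[of "cmod (f z)" "cmod (g z)"] by (simp add: mult.assoc)
    moreover have "0 \<le> cmod (f z) * cmod (g z)" by simp
    ultimately have "cmod (f z) * cmod (g z) \<le> (cmod (f z))\<^sup>2 + (cmod (g z))\<^sup>2"
      by linarith
    then show "norm (f z * g z) \<le> norm ((cmod (f z))\<^sup>2 + (cmod (g z))\<^sup>2)"
      by (simp add: norm_mult)
  qed
qed

lemma L2_bounded_mult:
  assumes f: "f \<in> L2 M" and g: "g \<in> borel_measurable M"
    and B: "\<And>z. z \<in> space M \<Longrightarrow> cmod (g z) \<le> B"
  shows "(\<lambda>z. g z * f z) \<in> L2 M"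
proof -
  have "integrable M (\<lambda>z. (cmod (g z * f z))\<^sup>2)"
  proof (rule Bochner_Integration.integrable_bound)
    show "integrable M (\<lambda>z. B\<^sup>2 * (cmod (f z))\<^sup>2)"
      using L2_sq_integrable[OF f] by simp
    show "(\<lambda>z. (cmod (g z * f z))\<^sup>2) \<in> borel_measurable M" using f g by measurable
    show "AE z in M. norm ((cmod (g z * f z))\<^sup>2) \<le> norm (B\<^sup>2 * (cmod (f z))\<^sup>2)"
      using B by (auto intro!: AE_I2 mult_right_mono power_mono simp: norm_mult power_mult_distrib)
  qed
  moreover have "(\<lambda>z. g z * f z) \<in> borel_measurable M" using f g by measurable
  ultimately show ?thesis by (simp add: L2_def)
qed

lemma L2_scale: "f \<in> L2 M \<Longrightarrow> (\<lambda>z. c * f z) \<in> L2 M"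
  by (rule L2_bounded_mult[where B = "cmod c"]) auto

lemma L2_cnj: "f \<in> L2 M \<Longrightarrow> (\<lambda>z. cnj (f z)) \<in> L2 M"
  by (auto simp: L2_def)

lemma L2_zero: "(\<lambda>z. 0) \<in> L2 M"
  by (simp add: L2_def)

lemma L2_add:
  assumes f: "f \<in> L2 M" and g: "g \<in> L2 M"
  shows "(\<lambda>z. f z + g z) \<in> L2 M"
proof -
  have "integrable M (\<lambda>z. (cmod (f z + g z))\<^sup>2)"
  proof (rule Bochner_Integration.integrable_bound)
    show "integrable M (\<lambda>z. 2 * (cmod (f z))\<^sup>2 + 2 * (cmod (g z))\<^sup>2)"
      using L2_sq_integrable[OF f] L2_sq_integrable[OF g] by simp
    show "(\<lambda>z. (cmod (f z + g z))\<^sup>2) \<in> borel_measurable M" using f g by measurable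
    show "AE z in M. norm ((cmod (f z + g z))\<^sup>2) \<le> norm (2 * (cmod (f z))\<^sup>2 + 2 * (cmod (g z))\<^sup>2)"
    proof (rule AE_I2)
      fix z
      have "(cmod (f z + g z))\<^sup>2 \<le> (cmod (f z) + cmod (g z))\<^sup>2"
        by (rule power_mono[OF norm_triangle_ineq]) simp
      also have "\<dots> \<le> 2 * (cmod (f z))\<^sup>2 + 2 * (cmod (g z))\<^sup>2"
        using sum_squares_bound[of "cmod (f z)" "cmod (g z)"] by (simp add: power2_sum)
      finally show "norm ((cmod (f z + g z))\<^sup>2) \<le> norm (2 * (cmod (f z))\<^sup>2 + 2 * (cmod (g z))\<^sup>2)"
        by simp
    qed
  qed
  moreover have "(\<lambda>z. f z + g z) \<in> borel_measurable M" using f g by measurable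
  ultimately show ?thesis by (simp add: L2_def)
qed

lemma L2_uminus: "f \<in> L2 M \<Longrightarrow> (\<lambda>z. - f z) \<in> L2 M"
  using L2_scale[of f M "-1"] by simp

lemma L2_diff: "f \<in> L2 M \<Longrightarrow> g \<in> L2 M \<Longrightarrow> (\<lambda>z. f z - g z) \<in> L2 M"
  using L2_add[OF _ L2_uminus, of f M g] by simp

lemma L2_sum: "(\<And>i. i \<in> I \<Longrightarrow> f i \<in> L2 M) \<Longrightarrow> (\<lambda>z. \<Sum>i\<in>I. f i z) \<in> L2 M"
  by (induction I rule: infinite_finite_induct) (auto intro: L2_zero L2_add)

lemma (in finite_measure) L2_bounded:
  assumes "f \<in> borel_measurable M" "\<And>z. z \<in> space M \<Longrightarrow> cmod (f z) \<le> B"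
  shows "f \<in> L2 M"
proof -
  have "(\<lambda>z. 1) \<in> L2 M" by (simp add: L2_def)
  from L2_bounded_mult[OF this assms] show ?thesis by simp
qed

lemma (in finite_measure) L2_integrable: "f \<in> L2 M \<Longrightarrow> integrable M f"
  using L2_integrable_mult[of f M "\<lambda>z. 1"] by (simp add: L2_def)

lemma l2_inner_integrable:
  "f \<in> L2 M \<Longrightarrow> g \<in> L2 M \<Longrightarrow> integrable M (\<lambda>z. f z * cnj (g z))"
  by (intro L2_integrable_mult L2_cnj)

lemma l2_inner_add_left:
  "f \<in> L2 M \<Longrightarrow> g \<in> L2 M \<Longrightarrow> h \<in> L2 M \<Longrightarrow>
    l2_inner M (\<lambda>z. f z + g z) h = l2_inner M f h + l2_inner M g h"
  by (simp add: l2_inner_def distrib_right l2_inner_integrable)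

lemma l2_inner_diff_left:
  "f \<in> L2 M \<Longrightarrow> g \<in> L2 M \<Longrightarrow> h \<in> L2 M \<Longrightarrow>
    l2_inner M (\<lambda>z. f z - g z) h = l2_inner M f h - l2_inner M g h"
  by (simp add: l2_inner_def left_diff_distrib l2_inner_integrable)

lemma l2_inner_scale_left: "l2_inner M (\<lambda>z. c * f z) h = c * l2_inner M f h"
  by (simp add: l2_inner_def mult.assoc)

lemma l2_inner_commute: "l2_inner M f g = cnj (l2_inner M g f)"
  unfolding l2_inner_def Bochner_Integration.integral_cnj[symmetric] by (simp add: mult.commute)

lemma l2_inner_add_right:
  "f \<in> L2 M \<Longrightarrow> g \<in> L2 M \<Longrightarrow> h \<in> L2 M \<Longrightarrow>
    l2_inner M h (\<lambda>z. f z + g z) = l2_inner M h f + l2_inner M h g"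
  by (simp add: l2_inner_def distrib_left l2_inner_integrable)

lemma l2_inner_diff_right:
  "f \<in> L2 M \<Longrightarrow> g \<in> L2 M \<Longrightarrow> h \<in> L2 M \<Longrightarrow>
    l2_inner M h (\<lambda>z. f z - g z) = l2_inner M h f - l2_inner M h g"
  by (simp add: l2_inner_def right_diff_distrib l2_inner_integrable)

lemma l2_inner_scale_right: "l2_inner M h (\<lambda>z. c * f z) = cnj c * l2_inner M h f"
  unfolding l2_inner_def by (simp add: mult.left_commute[of _ "cnj c"])

lemma l2_inner_sum_left:
  assumes "\<And>i. i \<in> I \<Longrightarrow> f i \<in> L2 M" "h \<in> L2 M"
  shows "l2_inner M (\<lambda>z. \<Sum>i\<in>I. f i z) h = (\<Sum>i\<in>I. l2_inner M (f i) h)"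
  unfolding l2_inner_def sum_distrib_right
  by (rule Bochner_Integration.integral_sum) (use assms in \<open>auto intro: l2_inner_integrable\<close>)

lemma l2_norm_nonneg [simp]: "0 \<le> l2_norm M f"
  by (simp add: l2_norm_def)

lemma l2_norm_power2: "(l2_norm M f)\<^sup>2 = (LINT z|M. (cmod (f z))\<^sup>2)"
  by (simp add: l2_norm_def)

lemma l2_inner_self: "l2_inner M f f = of_real ((l2_norm M f)\<^sup>2)"
  by (simp add: l2_norm_power2 l2_inner_def complex_norm_square[symmetric] flip: integral_complex_of_real)

lemma l2_norm_cong_AE:
  assumes "f \<in> borel_measurable M" "g \<in> borel_measurable M" "AE z in M. f z = g z"
  shows "l2_norm M f = l2_norm M g"
  unfolding l2_norm_def by (rule arg_cong[where f = sqrt], rule integral_cong_AE) (use assms in auto)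

lemma l2_inner_cong_AE:
  assumes "f \<in> borel_measurable M" "f' \<in> borel_measurable M" "AE z in M. f z = f' z"
    "g \<in> borel_measurable M" "g' \<in> borel_measurable M" "AE z in M. g z = g' z"
  shows "l2_inner M f g = l2_inner M f' g'"
  unfolding l2_inner_def by (rule integral_cong_AE) (use assms in auto)

lemma l2_norm_scale: "l2_norm M (\<lambda>z. c * f z) = cmod c * l2_norm M f"
  by (simp add: l2_norm_def norm_mult power_mult_distrib real_sqrt_mult)

lemma l2_norm_uminus: "l2_norm M (\<lambda>z. - f z) = l2_norm M f"
  by (simp add: l2_norm_def)

lemma l2_norm_minus_commute: "l2_norm M (\<lambda>z. f z - g z) = l2_norm M (\<lambda>z. g z - f z)"
  by (simp add: l2_norm_def norm_minus_commute)

lemma l2_norm_zero [simp]: "l2_norm M (\<lambda>z. 0) = 0"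
  by (simp add: l2_norm_def)

lemma l2_norm_eq_0:
  assumes "f \<in> L2 M"
  shows "l2_norm M f = 0 \<longleftrightarrow> (AE z in M. f z = 0)"
  using integral_nonneg_eq_0_iff_AE[OF L2_sq_integrable[OF assms]]
  by (simp add: l2_norm_def)

lemma nn_integral_L2:
  "f \<in> L2 M \<Longrightarrow> (\<integral>\<^sup>+z. ennreal (cmod (f z)) ^ 2 \<partial>M) = ennreal ((l2_norm M f)\<^sup>2)"
  by (simp add: ennreal_power l2_norm_power2 nn_integral_eq_integral L2_sq_integrable)

text \<open>Transferred from the inequality for integrals of nonnegative extended functions.\<close>

lemma l2_cauchy_schwarz_norm:
  assumes f: "f \<in> L2 M" and g: "g \<in> L2 M"
  shows "(LINT z|M. cmod (f z) * cmod (g z)) \<le> l2_norm M f * l2_norm M g"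
proof -
  have int: "integrable M (\<lambda>z. cmod (f z) * cmod (g z))"
    using integrable_norm[OF L2_integrable_mult[OF f g]] by (simp add: norm_mult)
  have [measurable]: "f \<in> borel_measurable M" "g \<in> borel_measurable M"
    using f g by (auto dest: L2_measurable)
  have "ennreal ((LINT z|M. cmod (f z) * cmod (g z))\<^sup>2)
      = (\<integral>\<^sup>+z. ennreal (cmod (f z)) * ennreal (cmod (g z)) \<partial>M)\<^sup>2"
    using int by (simp add: nn_integral_eq_integral integral_nonneg ennreal_power flip: ennreal_mult)
  also have "\<dots> \<le> ennreal ((l2_norm M f)\<^sup>2) * ennreal ((l2_norm M g)\<^sup>2)"
    using Cauchy_Schwarz_nn_integral[of "\<lambda>z. ennreal (cmod (f z))" M "\<lambda>z. ennreal (cmod (g z))"]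
    by (simp add: nn_integral_L2 f g)
  also have "\<dots> = ennreal ((l2_norm M f * l2_norm M g)\<^sup>2)"
    by (simp add: power_mult_distrib ennreal_mult)
  finally have "(LINT z|M. cmod (f z) * cmod (g z))\<^sup>2 \<le> (l2_norm M f * l2_norm M g)\<^sup>2"
    by (simp add: ennreal_le_iff)
  then show ?thesis by (rule power2_le_imp_le) simp
qed

lemma l2_cauchy_schwarz:
  assumes f: "f \<in> L2 M" and g: "g \<in> L2 M"
  shows "cmod (l2_inner M f g) \<le> l2_norm M f * l2_norm M g"
proof -
  have "cmod (l2_inner M f g) \<le> (LINT z|M. cmod (f z * cnj (g z)))"
    unfolding l2_inner_def by (rule integral_norm_bound)
  also have "\<dots> = (LINT z|M. cmod (f z) * cmod (g z))" by (simp add: norm_mult)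
  finally show ?thesis using l2_cauchy_schwarz_norm[OF f g] by linarith
qed

lemma l2_norm_add_power2:
  assumes "f \<in> L2 M" "g \<in> L2 M"
  shows "(l2_norm M (\<lambda>z. f z + g z))\<^sup>2 = (l2_norm M f)\<^sup>2 + 2 * Re (l2_inner M f g) + (l2_norm M g)\<^sup>2"
proof -
  have "complex_of_real ((l2_norm M (\<lambda>z. f z + g z))\<^sup>2)
      = l2_inner M f f + (l2_inner M f g + l2_inner M g f) + l2_inner M g g"
    unfolding l2_inner_self[symmetric]
    using assms by (simp add: l2_inner_add_left l2_inner_add_right L2_add)
  also have "l2_inner M f g + l2_inner M g f = of_real (2 * Re (l2_inner M f g))"
    by (subst l2_inner_commute[of M g f]) (simp add: complex_add_cnj)
  finally show ?thesis
    unfolding l2_inner_self by (simp flip: of_real_add of_real_mult add: of_real_eq_iff del: of_real_power)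
qed

lemma l2_norm_triangle:
  assumes "f \<in> L2 M" "g \<in> L2 M"
  shows "l2_norm M (\<lambda>z. f z + g z) \<le> l2_norm M f + l2_norm M g"
proof (rule power2_le_imp_le)
  have "Re (l2_inner M f g) \<le> l2_norm M f * l2_norm M g"
    using l2_cauchy_schwarz[OF assms] complex_Re_le_cmod[of "l2_inner M f g"] by linarith
  then show "(l2_norm M (\<lambda>z. f z + g z))\<^sup>2 \<le> (l2_norm M f + l2_norm M g)\<^sup>2"
    unfolding l2_norm_add_power2[OF assms] by (simp add: power2_sum)
qed simp

lemma l2_norm_triangle_diff:
  assumes "f \<in> L2 M" "g \<in> L2 M"
  shows "l2_norm M (\<lambda>z. f z - g z) \<le> l2_norm M f + l2_norm M g"
  using l2_norm_triangle[OF assms(1) L2_uminus[OF assms(2)]] by (simp add: l2_norm_uminus)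

lemma l2_dist_triangle:
  assumes "f \<in> L2 M" "g \<in> L2 M" "h \<in> L2 M"
  shows "l2_norm M (\<lambda>z. f z - h z) \<le> l2_norm M (\<lambda>z. f z - g z) + l2_norm M (\<lambda>z. g z - h z)"
  using l2_norm_triangle[OF L2_diff[OF assms(1,2)] L2_diff[OF assms(2,3)]] by simp

lemma l2_norm_diff_ineq:
  assumes "f \<in> L2 M" "g \<in> L2 M"
  shows "\<bar>l2_norm M f - l2_norm M g\<bar> \<le> l2_norm M (\<lambda>z. f z - g z)"
  using l2_norm_triangle[OF L2_diff[OF assms] assms(2)]
    l2_norm_triangle[OF L2_diff[OF assms(2,1)] assms(1)] l2_norm_minus_commute[of M f g]
  by simp

lemma l2_norm_sum_le:
  assumes "\<And>i. i \<in> I \<Longrightarrow> f i \<in> L2 M"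
  shows "l2_norm M (\<lambda>z. \<Sum>i\<in>I. f i z) \<le> (\<Sum>i\<in>I. l2_norm M (f i))"
  using assms
proof (induction I rule: infinite_finite_induct)
  case (insert x F)
  have "l2_norm M (\<lambda>z. f x z + (\<Sum>i\<in>F. f i z)) \<le> l2_norm M (f x) + l2_norm M (\<lambda>z. \<Sum>i\<in>F. f i z)"
    using insert by (intro l2_norm_triangle L2_sum) auto
  then show ?case using insert by fastforce
qed auto

lemma l2_norm_mono:
  assumes "f \<in> borel_measurable M" "g \<in> L2 M" "AE z in M. cmod (f z) \<le> cmod (g z)"
  shows "f \<in> L2 M \<and> l2_norm M f \<le> l2_norm M g"
proof -
  have f: "integrable M (\<lambda>z. (cmod (f z))\<^sup>2)"
    using L2_sq_integrable[OF assms(2)] by (rule Bochner_Integration.integrable_bound)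
      (use assms in \<open>auto intro: power_mono\<close>)
  have "(LINT z|M. (cmod (f z))\<^sup>2) \<le> (LINT z|M. (cmod (g z))\<^sup>2)"
    using f L2_sq_integrable[OF assms(2)] by (rule integral_mono_AE) (use assms in \<open>auto intro: power_mono\<close>)
  with f assms show ?thesis by (simp add: L2_def l2_norm_def)
qed

lemma tendsto_l2_inner:
  assumes "\<And>k. F k \<in> L2 M" "f \<in> L2 M" "g \<in> L2 M" "(\<lambda>k. l2_norm M (\<lambda>z. F k z - f z)) \<longlonglongrightarrow> 0"
  shows "(\<lambda>k. l2_inner M (F k) g) \<longlonglongrightarrow> l2_inner M f g"
proof (rule LIM_zero_cancel, rule Lim_null_comparison)
  show "\<forall>\<^sub>F k in sequentially. norm (l2_inner M (F k) g - l2_inner M f g)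
      \<le> l2_norm M (\<lambda>z. F k z - f z) * l2_norm M g"
    using l2_cauchy_schwarz[OF L2_diff[OF assms(1,2)] assms(3)] assms
    by (simp add: l2_inner_diff_left)
  show "(\<lambda>k. l2_norm M (\<lambda>z. F k z - f z) * l2_norm M g) \<longlonglongrightarrow> 0"
    using tendsto_mult_left_zero[OF assms(4)] .
qed

lemma tendsto_l2_norm:
  assumes "\<And>k. F k \<in> L2 M" "f \<in> L2 M" "(\<lambda>k. l2_norm M (\<lambda>z. F k z - f z)) \<longlonglongrightarrow> 0"
  shows "(\<lambda>k. l2_norm M (F k)) \<longlonglongrightarrow> l2_norm M f"
proof (rule LIM_zero_cancel, rule Lim_null_comparison[OF _ assms(3)])
  show "\<forall>\<^sub>F k in sequentially. norm (l2_norm M (F k) - l2_norm M f) \<le> l2_norm M (\<lambda>z. F k z - f z)"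
    using l2_norm_diff_ineq[OF assms(1,2)] by simp
qed

lemma l2_limit_unique:
  assumes "\<And>k. F k \<in> L2 M" "f \<in> L2 M" "g \<in> L2 M"
    "(\<lambda>k. l2_norm M (\<lambda>z. F k z - f z)) \<longlonglongrightarrow> 0" "(\<lambda>k. l2_norm M (\<lambda>z. F k z - g z)) \<longlonglongrightarrow> 0"
  shows "AE z in M. f z = g z"
proof -
  have "(\<lambda>k. l2_norm M (\<lambda>z. F k z - f z) + l2_norm M (\<lambda>z. F k z - g z)) \<longlonglongrightarrow> 0"
    using tendsto_add[OF assms(4,5)] by simp
  moreover have "l2_norm M (\<lambda>z. f z - g z) \<le> l2_norm M (\<lambda>z. F k z - f z) + l2_norm M (\<lambda>z. F k z - g z)" for k
    using l2_dist_triangle[OF assms(2) assms(1) assms(3), of k] l2_norm_minus_commute[of M "F k" f] by simp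
  ultimately have "l2_norm M (\<lambda>z. f z - g z) \<le> 0"
    by (intro LIMSEQ_le_const) auto
  then have "l2_norm M (\<lambda>z. f z - g z) = 0" by (simp add: order_antisym)
  then show ?thesis using l2_norm_eq_0[OF L2_diff[OF assms(2,3)]] by simp
qed

text \<open>The usual proof of completeness: along a subsequence with increments below 2^-k the sum
  of the absolute increments has finite L2 norm, hence is finite almost everywhere, so the
  subsequence converges pointwise; Fatou then turns pointwise convergence into convergence in norm,
  and the Cauchy property extends it to the whole sequence.\<close>

lemma l2_complete:
  assumes F: "\<And>k. F k \<in> L2 M"
    and cauchy: "\<And>e. 0 < e \<Longrightarrow> \<exists>N. \<forall>m\<ge>N. \<forall>n\<ge>N. l2_norm M (\<lambda>z. F m z - F n z) < e"
  shows "\<exists>f\<in>L2 M. (\<lambda>k. l2_norm M (\<lambda>z. F k z - f z)) \<longlonglongrightarrow> 0"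
proof -
  have "\<forall>k. \<exists>N. \<forall>m\<ge>N. \<forall>n\<ge>N. l2_norm M (\<lambda>z. F m z - F n z) < (1/2) ^ k"
    by (intro allI cauchy) simp
  then have "\<exists>N. \<forall>k. \<forall>m\<ge>N k. \<forall>n\<ge>N k. l2_norm M (\<lambda>z. F m z - F n z) < (1/2) ^ k"
    by (rule choice)
  then obtain N where N: "\<And>k m n. m \<ge> N k \<Longrightarrow> n \<ge> N k \<Longrightarrow> l2_norm M (\<lambda>z. F m z - F n z) < (1/2) ^ k"
    by blast
  \<comment> \<open>The running maximum of \<open>N\<close> makes the indices of the subsequence
    monotone.\<close>
  define r where "r k = Max (N ` {..k})" for k
  have rN: "N k \<le> r k" for k unfolding r_def by (rule Max_ge) auto
  have rmono: "r k \<le> r l" if "k \<le> l" for k l unfolding r_def using that by (intro Max_mono) auto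
  have near: "l2_norm M (\<lambda>z. F m z - F (r k) z) \<le> (1/2) ^ k" if "m \<ge> r k" for m k
    by (rule less_imp_le[OF N]) (use rN[of k] that in linarith)+
  define g where "g k z = cmod (F (r (Suc k)) z - F (r k) z)" for k z
  have [measurable]: "F k \<in> borel_measurable M" for k using F by (rule L2_measurable)
  have gnn: "0 \<le> g k z" for k z by (simp add: g_def)
  have gm [measurable]: "g k \<in> borel_measurable M" for k unfolding g_def by measurable
  have gL2: "(\<lambda>z. complex_of_real (g k z)) \<in> L2 M" for k
    using L2_diff[OF F F, of "r (Suc k)" "r k"] by (simp add: L2_def g_def)
  have gn: "l2_norm M (\<lambda>z. complex_of_real (g k z)) \<le> (1/2) ^ k" for k
    using near[OF rmono[of k "Suc k"]] by (simp add: l2_norm_def g_def)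
  \<comment> \<open>The increments are bounded by a geometric series with sum 2, which gives 4 after
    squaring, uniformly in \<open>n\<close>.\<close>
  have Gn: "(\<integral>\<^sup>+z. (\<Sum>k<n. ennreal (g k z)) ^ 2 \<partial>M) \<le> 4" for n
  proof -
    have L: "(\<lambda>z. \<Sum>k<n. complex_of_real (g k z)) \<in> L2 M" by (intro L2_sum gL2)
    have "l2_norm M (\<lambda>z. \<Sum>k<n. complex_of_real (g k z)) \<le> (\<Sum>k<n. (1/2) ^ k)"
      by (rule order_trans[OF l2_norm_sum_le sum_mono]) (use gL2 gn in auto)
    also have "\<dots> \<le> 2" by (subst geometric_sum) (auto simp: power_one_over)
    finally have "(l2_norm M (\<lambda>z. \<Sum>k<n. complex_of_real (g k z)))\<^sup>2 \<le> 2\<^sup>2"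
      by (intro power_mono) auto
    moreover have "(\<integral>\<^sup>+z. (\<Sum>k<n. ennreal (g k z)) ^ 2 \<partial>M)
        = (\<integral>\<^sup>+z. ennreal (cmod (\<Sum>k<n. complex_of_real (g k z))) ^ 2 \<partial>M)"
    proof (rule nn_integral_cong)
      fix z
      have "cmod (\<Sum>k<n. complex_of_real (g k z)) = (\<Sum>k<n. g k z)"
        unfolding of_real_sum[symmetric] norm_of_real by (rule abs_of_nonneg) (simp add: sum_nonneg g_def)
      then show "(\<Sum>k<n. ennreal (g k z)) ^ 2 = ennreal (cmod (\<Sum>k<n. complex_of_real (g k z))) ^ 2"
        by (simp add: g_def)
    qed
    ultimately have "(\<integral>\<^sup>+z. (\<Sum>k<n. ennreal (g k z)) ^ 2 \<partial>M) \<le> ennreal (2\<^sup>2)"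
      by (metis nn_integral_L2[OF L] ennreal_leI)
    then show ?thesis by simp
  qed
  have "(\<integral>\<^sup>+z. (SUP n. (\<Sum>k<n. ennreal (g k z)) ^ 2) \<partial>M) = (SUP n. (\<integral>\<^sup>+z. (\<Sum>k<n. ennreal (g k z)) ^ 2 \<partial>M))"
  proof (rule nn_integral_monotone_convergence_SUP)
    have "(\<Sum>k<m. ennreal (g k z)) \<le> (\<Sum>k<n. ennreal (g k z))" if "m \<le> n" for m n z
      using that by (intro sum_mono2) auto
    then show "incseq (\<lambda>n z. (\<Sum>k<n. ennreal (g k z)) ^ 2)"
      by (simp add: incseq_def le_fun_def power_mono)
    show "\<And>n. (\<lambda>z. (\<Sum>k<n. ennreal (g k z)) ^ 2) \<in> borel_measurable M" by measurable
  qed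
  also have "\<dots> \<le> 4" using Gn by (rule SUP_least)
  also have "(4::ennreal) < \<infinity>" by simp
  finally have "AE z in M. (SUP n. (\<Sum>k<n. ennreal (g k z)) ^ 2) \<noteq> \<infinity>"
    by (intro nn_integral_noteq_infinite) auto
  then have conv: "AE z in M. convergent (\<lambda>k. F (r k) z)"
  proof eventually_elim
    fix z assume fin: "(SUP n. (\<Sum>k<n. ennreal (g k z)) ^ 2) \<noteq> \<infinity>"
    have "\<exists>b\<ge>0. s = ennreal b" if "s \<noteq> \<infinity>" for s :: ennreal
      using that by (cases s) auto
    from this[OF fin] obtain b where b: "(SUP n. (\<Sum>k<n. ennreal (g k z)) ^ 2) = ennreal b" "0 \<le> b"
      by blast
    have "(\<Sum>k<n. g k z) \<le> sqrt b" for n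
    proof -
      have "(\<Sum>k<n. ennreal (g k z)) ^ 2 \<le> ennreal b" unfolding b(1)[symmetric] by (rule SUP_upper) simp
      moreover have "(\<Sum>k<n. ennreal (g k z)) = ennreal (\<Sum>k<n. g k z)" by (simp add: gnn)
      ultimately have "ennreal ((\<Sum>k<n. g k z)\<^sup>2) \<le> ennreal b"
        by (simp only: ennreal_power sum_nonneg gnn)
      then have "(\<Sum>k<n. g k z)\<^sup>2 \<le> b"
        using b(2) by (simp only: ennreal_le_iff)
      then show ?thesis by (rule real_le_rsqrt)
    qed
    then have "summable (\<lambda>k. g k z)"
      by (intro summableI_nonneg_bounded[where x = "sqrt b"]) (auto simp: g_def)
    then have "summable (\<lambda>k. F (r (Suc k)) z - F (r k) z)"
      unfolding g_def by (rule summable_norm_cancel)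
    then have "(\<lambda>n. \<Sum>k<n. F (r (Suc k)) z - F (r k) z) \<longlonglongrightarrow> (\<Sum>k. F (r (Suc k)) z - F (r k) z)"
      by (rule summable_LIMSEQ)
    then have "(\<lambda>n. F (r n) z - F (r 0) z) \<longlonglongrightarrow> (\<Sum>k. F (r (Suc k)) z - F (r k) z)"
      unfolding sum_lessThan_telescope[where f = "\<lambda>k. F (r k) z"] .
    from tendsto_add[OF this tendsto_const[of "F (r 0) z"]]
    show "convergent (\<lambda>k. F (r k) z)" by (simp only: diff_add_cancel convergentI)
  qed
  \<comment> \<open>Off the set of convergence \<open>lim\<close> takes some default value; this set
    has measure zero and measurability is not affected.\<close>
  define f where "f z = lim (\<lambda>k. F (r k) z)" for z
  have [measurable]: "f \<in> borel_measurable M"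
    unfolding f_def by measurable
  have fl: "AE z in M. (\<lambda>k. F (r k) z) \<longlonglongrightarrow> f z"
    using conv by eventually_elim (simp add: f_def convergent_LIMSEQ_iff)
  \<comment> \<open>Fatou: the distance of \<open>F (r m)\<close> to the pointwise limit is at most
    the limes inferior of its distances to later members of the subsequence.\<close>
  have bound: "(\<integral>\<^sup>+z. ennreal (cmod (F (r m) z - f z)) ^ 2 \<partial>M) \<le> ennreal (((1/2) ^ m)\<^sup>2)" for m
  proof -
    have "(\<integral>\<^sup>+z. ennreal (cmod (F (r m) z - f z)) ^ 2 \<partial>M)
        = (\<integral>\<^sup>+z. liminf (\<lambda>n. ennreal (cmod (F (r m) z - F (r n) z)) ^ 2) \<partial>M)"
    proof (rule nn_integral_cong_AE, use fl in eventually_elim)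
      fix z assume "(\<lambda>k. F (r k) z) \<longlonglongrightarrow> f z"
      then have L: "(\<lambda>n. ennreal ((cmod (F (r m) z - F (r n) z))\<^sup>2)) \<longlonglongrightarrow> ennreal ((cmod (F (r m) z - f z))\<^sup>2)"
        by (intro tendsto_ennrealI tendsto_intros)
      show "ennreal (cmod (F (r m) z - f z)) ^ 2 = liminf (\<lambda>n. ennreal (cmod (F (r m) z - F (r n) z)) ^ 2)"
        using lim_imp_Liminf[OF sequentially_bot L] by (simp only: ennreal_power norm_ge_zero)
    qed
    also have "\<dots> \<le> liminf (\<lambda>n. \<integral>\<^sup>+z. ennreal (cmod (F (r m) z - F (r n) z)) ^ 2 \<partial>M)"
      by (rule nn_integral_liminf) measurable
    also have "\<dots> \<le> ennreal (((1/2) ^ m)\<^sup>2)"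
    proof (rule Liminf_le)
      show "\<forall>\<^sub>F n in sequentially. (\<integral>\<^sup>+z. ennreal (cmod (F (r m) z - F (r n) z)) ^ 2 \<partial>M) \<le> ennreal (((1/2) ^ m)\<^sup>2)"
        unfolding eventually_sequentially
      proof (intro exI[of _ m] allI impI)
        fix n assume "m \<le> n"
        then have "l2_norm M (\<lambda>z. F (r m) z - F (r n) z) \<le> (1/2) ^ m"
          using near[OF rmono[of m n]] by (subst l2_norm_minus_commute)
        then show "(\<integral>\<^sup>+z. ennreal (cmod (F (r m) z - F (r n) z)) ^ 2 \<partial>M) \<le> ennreal (((1/2) ^ m)\<^sup>2)"
          unfolding nn_integral_L2[OF L2_diff[OF F F, of "r m" "r n"]]
          by (intro ennreal_leI power_mono) auto
      qed
    qed simp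
    finally show ?thesis .
  qed
  have dL2: "(\<lambda>z. F (r m) z - f z) \<in> L2 M" for m
  proof -
    have "(\<integral>\<^sup>+z. ennreal (cmod (F (r m) z - f z)) ^ 2 \<partial>M) < \<infinity>"
      by (rule le_less_trans[OF bound]) simp
    then have "integrable M (\<lambda>z. (cmod (F (r m) z - f z))\<^sup>2)"
      by (simp add: integrable_iff_bounded ennreal_power)
    then show ?thesis by (simp add: L2_def)
  qed
  have dn: "l2_norm M (\<lambda>z. F (r m) z - f z) \<le> (1/2) ^ m" for m
  proof (rule power2_le_imp_le)
    show "(l2_norm M (\<lambda>z. F (r m) z - f z))\<^sup>2 \<le> ((1/2) ^ m)\<^sup>2"
      using bound[of m] unfolding nn_integral_L2[OF dL2] by (subst (asm) ennreal_le_iff) simp_all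
  qed simp
  have fL2: "f \<in> L2 M" using L2_diff[OF F[of "r 0"] dL2[of 0]] by simp
  have "(\<lambda>k. l2_norm M (\<lambda>z. F k z - f z)) \<longlonglongrightarrow> 0"
  proof (rule LIMSEQ_I)
    fix e :: real assume e: "0 < e"
    then obtain m where m: "(1/2) ^ m < e / 2" using real_arch_pow_inv[of "e/2" "1/2"] by auto
    have "l2_norm M (\<lambda>z. F k z - f z) < e" if "k \<ge> r m" for k
      using l2_dist_triangle[OF F F fL2, of k "r m"] near[OF that] dn[of m] m by linarith
    then show "\<exists>N. \<forall>k\<ge>N. norm (l2_norm M (\<lambda>z. F k z - f z) - 0) < e" by auto
  qed
  with fL2 show ?thesis by blast
qed

section \<open>Planar vectors and integration over one period\<close>

abbreviation period :: "real measure" where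
  "period \<equiv> restrict_space lborel {0..<2 * pi}"

abbreviation vec2 :: "real \<Rightarrow> real \<Rightarrow> real^2" where
  "vec2 a b \<equiv> vector [a, b]"

lemma inner_vec2: "(x :: real^2) \<bullet> y = x $ 1 * y $ 1 + x $ 2 * y $ 2"
  by (simp add: inner_vec_def sum_2)

lemma continuous_on_vec2 [continuous_intros]:
  "continuous_on S f \<Longrightarrow> continuous_on S g \<Longrightarrow> continuous_on S (\<lambda>z. vec2 (f z) (g z))"
proof -
  assume "continuous_on S f" "continuous_on S g"
  then have "continuous_on S (\<lambda>z. \<chi> i. if i = (1::2) then f z else g z)"
  proof (intro continuous_on_vec_lambda)
    fix i :: 2
    show "continuous_on S (\<lambda>z. if i = 1 then f z else g z)"
      by (cases "i = 1") (use \<open>continuous_on S f\<close> \<open>continuous_on S g\<close> in simp_all)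
  qed
  moreover have "(\<chi> i. if i = (1::2) then f z else g z) = vec2 (f z) (g z)" for z
    by (simp add: vec_eq_iff forall_2)
  ultimately show ?thesis by simp
qed

lemma borel_measurable_vec2 [measurable (raw)]:
  assumes "f \<in> borel_measurable M" "g \<in> borel_measurable M"
  shows "(\<lambda>z. vec2 (f z) (g z)) \<in> borel_measurable M"
proof -
  have "continuous_on UNIV (\<lambda>p :: real \<times> real. vec2 (fst p) (snd p))"
    by (intro continuous_intros)
  from borel_measurable_continuous_onI[OF this]
  have [measurable]: "(\<lambda>p :: real \<times> real. vec2 (fst p) (snd p)) \<in> borel_measurable borel" .
  have "(\<lambda>z. (f z, g z)) \<in> M \<rightarrow>\<^sub>M borel" using assms by measurable
  then have "(\<lambda>z. (\<lambda>p. vec2 (fst p) (snd p)) (f z, g z)) \<in> borel_measurable M"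
    by measurable
  then show ?thesis by simp
qed

lemma finite_measure_period: "finite_measure period"
  by (rule finite_measureI) (simp add: emeasure_restrict_space space_restrict_space)

lemma measure_period: "emeasure period (space period) = ennreal (2 * pi)"
  by (simp add: emeasure_restrict_space space_restrict_space)

text \<open>The half-open period differs from a closed interval by a single point, a null set, so
  the fundamental theorem of calculus applies.\<close>

lemma integral_period_FTC:
  fixes f F :: "real \<Rightarrow> complex"
  assumes "\<And>\<theta>. (F has_vector_derivative f \<theta>) (at \<theta>)" "continuous_on UNIV f"
  shows "(LINT \<theta>|period. f \<theta>) = F (2 * pi) - F 0"
proof -
  have "(LINT \<theta>|period. f \<theta>) = (LINT \<theta>|lborel. indicator {0..<2 * pi} \<theta> *\<^sub>R f \<theta>)"
    by (subst integral_restrict_space) auto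
  also have "\<dots> = (LINT \<theta>|lborel. indicator {0..2 * pi} \<theta> *\<^sub>R f \<theta>)"
  proof (rule integral_cong_AE)
    have [measurable]: "f \<in> borel_measurable borel"
      using assms(2) by (rule borel_measurable_continuous_onI)
    show "(\<lambda>\<theta>. indicat_real {0..<2 * pi} \<theta> *\<^sub>R f \<theta>) \<in> borel_measurable lborel"
      "(\<lambda>\<theta>. indicat_real {0..2 * pi} \<theta> *\<^sub>R f \<theta>) \<in> borel_measurable lborel"
      by measurable
    show "AE \<theta> in lborel. indicat_real {0..<2 * pi} \<theta> *\<^sub>R f \<theta> = indicat_real {0..2 * pi} \<theta> *\<^sub>R f \<theta>"
      using AE_lborel_singleton[of "2 * pi"] by eventually_elim (auto simp: indicator_def)
  qed
  also have "\<dots> = F (2 * pi) - F 0"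
    by (rule integral_FTC_atLeastAtMost)
      (use assms in \<open>auto intro: has_vector_derivative_at_within continuous_on_subset\<close>)
  finally show ?thesis .
qed

section \<open>The circle\<close>

abbreviation dir :: "real \<Rightarrow> real^2" where
  "dir \<theta> \<equiv> vec2 (cos \<theta>) (sin \<theta>)"

lemma dir_in_sphere: "dir \<theta> \<in> sphere 0 1"
  by (simp add: norm_eq_sqrt_inner inner_vec2 power2_eq_square[symmetric])

lemma measurable_dir: "dir \<in> period \<rightarrow>\<^sub>M restrict_space borel (sphere 0 1)"
proof (rule measurable_restrict_space2)
  show "dir \<in> space period \<rightarrow> sphere 0 1" using dir_in_sphere by blast
  have "continuous_on UNIV dir" by (intro continuous_intros)
  from borel_measurable_continuous_onI[OF this] show "dir \<in> borel_measurable period"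
    by (simp add: measurable_restrict_space1)
qed

lemma space_circle: "space circle = sphere 0 1"
  by (simp add: circle_def space_restrict_space)

lemma sets_circle: "sets circle = sets (restrict_space borel (sphere 0 1))"
  by (simp add: circle_def)

lemma measurable_circle_iff: "borel_measurable circle = borel_measurable (restrict_space borel (sphere 0 1))"
  by (rule measurable_cong_sets) (simp_all add: sets_circle)

lemma finite_measure_circle: "finite_measure circle"
  unfolding circle_def by (rule finite_measure.finite_measure_distr[OF finite_measure_period measurable_dir])

interpretation circle: finite_measure circle by (rule finite_measure_circle)

lemma borel_measurable_circle: "f \<in> borel_measurable borel \<Longrightarrow> f \<in> borel_measurable circle"
  unfolding measurable_circle_iff by (rule measurable_restrict_space1)

lemma measurable_circle_continuous: "continuous_on UNIV f \<Longrightarrow> f \<in> borel_measurable circle"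
  by (intro borel_measurable_circle borel_measurable_continuous_onI)

lemma emeasure_circle: "emeasure circle (space circle) = ennreal (2 * pi)"
proof -
  have "emeasure circle (space circle) = emeasure period (dir -` sphere 0 1 \<inter> space period)"
    unfolding space_circle unfolding circle_def
    by (rule emeasure_distr[OF measurable_dir]) (auto simp: sets_restrict_space)
  also have "dir -` sphere 0 1 \<inter> space period = space period"
    using dir_in_sphere by auto
  finally show ?thesis using measure_period by (simp only:)
qed

lemma measure_circle: "measure circle (space circle) = 2 * pi"
  by (simp add: measure_def emeasure_circle)

lemma integral_circle:
  fixes f :: "real^2 \<Rightarrow> complex"
  assumes "f \<in> borel_measurable circle"
  shows "(LINT v|circle. f v) = (LINT \<theta>|period. f (dir \<theta>))"
  unfolding circle_def by (rule integral_distr[OF measurable_dir]) (use assms measurable_circle_iff in auto)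

lemma integral_circle_FTC:
  fixes f :: "real^2 \<Rightarrow> complex"
  assumes "\<And>\<theta>. (F has_vector_derivative f (dir \<theta>)) (at \<theta>)" "f \<in> borel_measurable circle"
    "continuous_on UNIV (\<lambda>\<theta>. f (dir \<theta>))"
  shows "(LINT v|circle. f v) = F (2 * pi) - F 0"
  unfolding integral_circle[OF assms(2)] by (rule integral_period_FTC[OF assms(1,3)])

section \<open>The torus\<close>

text \<open>This makes Fubini available in \<open>real^2\<close>: Lebesgue measure is determined by
  its values on boxes, and there it factorizes over the two coordinates.\<close>

lemma lborel_real2: "(lborel :: (real^2) measure) = distr (lborel \<Otimes>\<^sub>M lborel) borel (\<lambda>p. vec2 (fst p) (snd p))"
proof (rule lborel_eqI)
  fix l u :: "real^2"
  assume le: "\<And>b. b \<in> Basis \<Longrightarrow> l \<bullet> b \<le> u \<bullet> b"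
  have B: "axis i 1 \<in> (Basis :: (real^2) set)" for i :: 2 by simp
  have le': "l $ i \<le> u $ i" for i using le[OF B[of i]] by (simp add: inner_axis)
  have "(\<lambda>p. vec2 (fst p) (snd p)) -` box l u \<inter> space (lborel \<Otimes>\<^sub>M lborel) = {l $ 1<..<u $ 1} \<times> {l $ 2<..<u $ 2}"
    by (auto simp: mem_box_cart forall_2 space_pair_measure)
  moreover have "(\<lambda>p. vec2 (fst p) (snd p)) \<in> borel_measurable (lborel \<Otimes>\<^sub>M lborel)"
    by measurable
  ultimately have "emeasure (distr (lborel \<Otimes>\<^sub>M lborel) borel (\<lambda>p. vec2 (fst p) (snd p))) (box l u)
      = emeasure (lborel \<Otimes>\<^sub>M lborel) ({l $ 1<..<u $ 1} \<times> {l $ 2<..<u $ 2})"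
    by (simp add: emeasure_distr)
  also have "\<dots> = ennreal (u $ 1 - l $ 1) * ennreal (u $ 2 - l $ 2)"
    using le' by (simp add: lborel.emeasure_pair_measure_Times)
  also have "\<dots> = (\<Prod>b\<in>Basis. ennreal ((u - l) \<bullet> b))"
  proof -
    have B2: "(Basis :: (real^2) set) = {axis 1 1, axis 2 1}"
      by (auto simp: Basis_vec_def UNIV_2)
    have "axis 1 (1::real) \<noteq> (axis 2 1 :: real^2)" by (simp add: axis_eq_axis)
    then show ?thesis unfolding B2 by (simp add: inner_axis)
  qed
  finally show "emeasure (distr (lborel \<Otimes>\<^sub>M lborel) borel (\<lambda>p. vec2 (fst p) (snd p))) (box l u)
      = (\<Prod>b\<in>Basis. (u - l) \<bullet> b)"
    using le by (simp add: prod_ennreal inner_diff_left)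
qed simp

abbreviation torus_box :: "(real^2) set" where
  "torus_box \<equiv> {x. \<forall>i. 0 \<le> x $ i \<and> x $ i < 2 * pi}"

lemma torus_box_borel [measurable]: "torus_box \<in> sets borel"
proof -
  have "torus_box = {x. 0 \<le> x $ 1 \<and> x $ 1 < 2 * pi \<and> 0 \<le> x $ 2 \<and> x $ 2 < 2 * pi}"
    by (auto simp: forall_2)
  also have "\<dots> \<in> sets borel" by measurable
  finally show ?thesis .
qed

lemma space_torus: "space torus = torus_box"
  by (simp add: torus_def space_restrict_space)

lemma sets_torus: "sets torus = sets (restrict_space borel torus_box)"
  by (simp add: torus_def sets_restrict_space)

text \<open>Both orders are stated because a character integrates to zero only in a coordinate where
  its frequency is nonzero, and that coordinate has to be the inner variable.\<close>

lemma torus_Fubini: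
  fixes f :: "real^2 \<Rightarrow> complex"
  assumes "integrable torus f"
  shows "(LINT x|torus. f x) = (LINT a|period. LINT b|period. f (vec2 a b))"
    and "(LINT x|torus. f x) = (LINT b|period. LINT a|period. f (vec2 a b))"
proof -
  let ?g = "\<lambda>a b. indicator {0..<2 * pi} a *\<^sub>R indicator {0..<2 * pi} b *\<^sub>R f (vec2 a b)"
  let ?h = "\<lambda>x. indicator torus_box x *\<^sub>R f x"
  have h: "integrable lborel ?h"
    using assms unfolding torus_def by (subst (asm) integrable_restrict_space) auto
  have m: "(\<lambda>p. vec2 (fst p) (snd p)) \<in> lborel \<Otimes>\<^sub>M lborel \<rightarrow>\<^sub>M borel"
    by measurable
  have hm: "?h \<in> borel_measurable borel" using h by (auto dest: borel_measurable_integrable)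
  have gh: "?h (vec2 (fst p) (snd p)) = case_prod ?g p" for p
    by (auto simp: indicator_def forall_2 split: prod.splits)
  have "integrable (lborel \<Otimes>\<^sub>M lborel) (\<lambda>p. ?h (vec2 (fst p) (snd p)))"
    by (rule integrable_distr[OF m]) (use h lborel_real2 in simp)
  then have int: "integrable (lborel \<Otimes>\<^sub>M lborel) (case_prod ?g)"
    unfolding gh by (simp add: case_prod_unfold)
  have "(LINT x|torus. f x) = (LINT x|lborel. ?h x)"
    unfolding torus_def by (subst integral_restrict_space) auto
  also have "\<dots> = (LINT p|(lborel \<Otimes>\<^sub>M lborel). ?h (vec2 (fst p) (snd p)))"
    unfolding lborel_real2 by (rule integral_distr[OF m hm])
  also have "\<dots> = (LINT p|(lborel \<Otimes>\<^sub>M lborel). case_prod ?g p)"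
    unfolding gh ..
  finally have eq: "(LINT x|torus. f x) = (LINT p|(lborel \<Otimes>\<^sub>M lborel). case_prod ?g p)" .
  have "(LINT p|(lborel \<Otimes>\<^sub>M lborel). case_prod ?g p) = (LINT a|lborel. LINT b|lborel. ?g a b)"
    by (rule lborel_pair.integral_fst[symmetric, OF int])
  also have "\<dots> = (LINT a|period. LINT b|period. f (vec2 a b))"
    by (simp add: integral_restrict_space del: scaleR_scaleR)
  finally show "(LINT x|torus. f x) = (LINT a|period. LINT b|period. f (vec2 a b))"
    using eq by simp
  have "(LINT p|(lborel \<Otimes>\<^sub>M lborel). case_prod ?g p) = (LINT b|lborel. LINT a|lborel. ?g a b)"
    by (rule lborel_pair.integral_snd[symmetric, OF int])
  also have "\<dots> = (LINT b|period. LINT a|period. f (vec2 a b))"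
    unfolding scaleR_left_commute[of "indicat_real {0..<2 * pi} a" "indicat_real {0..<2 * pi} b" for a b]
    by (simp add: integral_restrict_space del: scaleR_scaleR)
  finally show "(LINT x|torus. f x) = (LINT b|period. LINT a|period. f (vec2 a b))"
    using eq by simp
qed

lemma finite_measure_torus: "finite_measure torus"
proof -
  have "torus_box \<subseteq> cbox (vec2 0 0) (vec2 (2 * pi) (2 * pi))"
    by (auto simp: mem_box_cart forall_2)
  then have "emeasure lborel torus_box \<le> emeasure lborel (cbox (vec2 0 0) (vec2 (2 * pi) (2 * pi)))"
    by (rule emeasure_mono) simp
  also have "\<dots> < \<infinity>" by (rule emeasure_lborel_cbox_finite)
  finally show ?thesis
    by (intro finite_measureI) (simp add: torus_def emeasure_restrict_space space_restrict_space less_top)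
qed

interpretation torus: finite_measure torus by (rule finite_measure_torus)

interpretation torus_circle: pair_sigma_finite torus circle ..

interpretation phase: finite_measure phase
  unfolding phase_def by (rule finite_measure_pair_measure) unfold_locales

lemma borel_measurable_torus: "f \<in> borel_measurable borel \<Longrightarrow> f \<in> borel_measurable torus"
  unfolding torus_def by (rule measurable_restrict_space1) simp

lemma space_phase: "space phase = torus_box \<times> sphere 0 1"
  by (simp add: phase_def space_pair_measure space_torus space_circle)

lemma measurable_fst_phase: "fst \<in> phase \<rightarrow>\<^sub>M borel"
proof -
  have "(\<lambda>x. x) \<in> torus \<rightarrow>\<^sub>M borel" by (rule borel_measurable_torus) simp
  from measurable_compose[OF measurable_fst this, of circle] show ?thesis unfolding phase_def by simp
qed

lemma measurable_snd_phase: "snd \<in> phase \<rightarrow>\<^sub>M borel"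
proof -
  have "(\<lambda>x. x) \<in> circle \<rightarrow>\<^sub>M borel" by (rule borel_measurable_circle) simp
  from measurable_compose[OF measurable_snd this, of torus] show ?thesis unfolding phase_def by simp
qed

lemma borel_measurable_phase:
  assumes "f \<in> borel_measurable borel" shows "f \<in> borel_measurable phase"
proof -
  have "(\<lambda>z. (fst z, snd z)) \<in> phase \<rightarrow>\<^sub>M borel \<Otimes>\<^sub>M borel"
    by (rule measurable_Pair[OF measurable_fst_phase measurable_snd_phase])
  then have "(\<lambda>z. z) \<in> phase \<rightarrow>\<^sub>M borel" by (simp add: borel_prod)
  from measurable_compose[OF this assms] show ?thesis .
qed

lemma measurable_phase_continuous: "continuous_on UNIV f \<Longrightarrow> f \<in> borel_measurable phase"
  by (intro borel_measurable_phase borel_measurable_continuous_onI)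

lemma measure_torus: "measure torus (space torus) = (2 * pi)\<^sup>2"
proof -
  have "complex_of_real (measure torus (space torus)) = (LINT x|torus. 1)" by (simp add: scaleR_conv_of_real)
  also have "\<dots> = (LINT a|period. LINT b|period. 1)"
    by (rule torus_Fubini) simp
  also have "\<dots> = complex_of_real ((2 * pi)\<^sup>2)"
    using measure_period by (simp add: measure_def power2_eq_square scaleR_conv_of_real)
  finally show ?thesis by (simp only: of_real_eq_iff)
qed

section \<open>Functions with vanishing polynomial moments\<close>

text \<open>Polynomials are uniformly dense in the continuous functions on the compact set
  \<open>K\<close> by Stone-Weierstrass, and \<open>f\<close> is integrable. The map
  \<open>T\<close> lets the same lemma serve the circle, where it is the identity, and phase space,
  where it wraps the position coordinates onto circles.\<close>

lemma (in finite_measure) integral_continuous_eq_0: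
  fixes f :: "'a \<Rightarrow> complex" and T :: "'a \<Rightarrow> 'e::euclidean_space"
  assumes f: "integrable M f" and T [measurable]: "T \<in> borel_measurable M"
    and K: "compact K" "\<And>z. z \<in> space M \<Longrightarrow> T z \<in> K"
    and mom: "\<And>p. real_polynomial_function p \<Longrightarrow> (LINT z|M. f z * of_real (p (T z))) = 0"
    and g: "continuous_on UNIV g"
  shows "integrable M (\<lambda>z. f z * of_real (g (T z)))" and "(LINT z|M. f z * of_real (g (T z))) = 0"
proof -
  have int: "integrable M (\<lambda>z. f z * of_real (h (T z)))" if h: "continuous_on UNIV h" for h
  proof -
    obtain B where B: "\<And>y. y \<in> K \<Longrightarrow> \<bar>h y\<bar> \<le> B"
      using compact_imp_bounded[OF compact_continuous_image[OF continuous_on_subset[OF h] K(1)]]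
      by (auto simp: bounded_iff)
    have [measurable]: "h \<in> borel_measurable borel" using h by (rule borel_measurable_continuous_onI)
    have [measurable]: "f \<in> borel_measurable M" using f by (rule borel_measurable_integrable)
    show ?thesis
    proof (rule Bochner_Integration.integrable_bound)
      show "integrable M (\<lambda>z. B * norm (f z))" using f by simp
      show "(\<lambda>z. f z * of_real (h (T z))) \<in> borel_measurable M" by measurable
      show "AE z in M. norm (f z * of_real (h (T z))) \<le> norm (B * norm (f z))"
      proof (rule AE_I2)
        fix z assume "z \<in> space M"
        then have "\<bar>h (T z)\<bar> \<le> \<bar>B\<bar>" using B[OF K(2)] by fastforce
        then show "norm (f z * of_real (h (T z))) \<le> norm (B * norm (f z))"
          by (simp add: norm_mult abs_mult mult.commute[of "cmod (f z)"] mult_right_mono)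
      qed
    qed
  qed
  show "integrable M (\<lambda>z. f z * of_real (g (T z)))" by (rule int[OF g])
  have "cmod (LINT z|M. f z * of_real (g (T z))) \<le> e * (LINT z|M. cmod (f z))" if e: "e > 0" for e
  proof -
    obtain p where p: "real_polynomial_function p" "\<And>y. y \<in> K \<Longrightarrow> \<bar>g y - p y\<bar> < e"
      using Stone_Weierstrass_real_polynomial_function[OF K(1) continuous_on_subset[OF g] e] by blast
    have pc: "continuous_on UNIV p"
      using continuous_real_polymonial_function[OF p(1)] continuous_at_imp_continuous_on by blast
    have "(LINT z|M. f z * of_real (g (T z)))
        = (LINT z|M. f z * of_real (g (T z))) - (LINT z|M. f z * of_real (p (T z)))"
      using mom[OF p(1)] by simp
    also have "\<dots> = (LINT z|M. f z * of_real (g (T z)) - f z * of_real (p (T z)))"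
      using int[OF g] int[OF pc] by simp
    also have "cmod \<dots> \<le> (LINT z|M. cmod (f z * of_real (g (T z)) - f z * of_real (p (T z))))"
      by (rule integral_norm_bound)
    also have "\<dots> \<le> (LINT z|M. e * cmod (f z))"
    proof (rule integral_mono)
      show "integrable M (\<lambda>z. cmod (f z * of_real (g (T z)) - f z * of_real (p (T z))))"
        using int[OF g] int[OF pc] by simp
      fix z assume "z \<in> space M"
      then have "\<bar>g (T z) - p (T z)\<bar> \<le> e" using p(2)[OF K(2)] by (simp add: less_imp_le)
      then show "cmod (f z * of_real (g (T z)) - f z * of_real (p (T z))) \<le> e * cmod (f z)"
        unfolding right_diff_distrib[symmetric] of_real_diff[symmetric] norm_mult norm_of_real
        by (subst mult.commute) (rule mult_right_mono, simp_all)
    qed (use f in simp)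
    finally show ?thesis by simp
  qed
  \<comment> \<open>The summand 1 keeps the factor positive also when \<open>f\<close> vanishes
    almost everywhere, so that one can divide by it.\<close>
  then have le: "cmod (LINT z|M. f z * of_real (g (T z))) \<le> e * ((LINT z|M. cmod (f z)) + 1)" if "e > 0" for e
    using that by (fastforce simp: distrib_left)
  have pos: "(LINT z|M. cmod (f z)) + 1 > 0"
    by (simp add: add_nonneg_pos)
  have "cmod (LINT z|M. f z * of_real (g (T z))) \<le> 0 + e" if "e > 0" for e
    using le[of "e / ((LINT z|M. cmod (f z)) + 1)"] pos that by simp
  then have "cmod (LINT z|M. f z * of_real (g (T z))) \<le> 0" by (rule field_le_epsilon)
  then show "(LINT z|M. f z * of_real (g (T z))) = 0" by simp
qed

text \<open>Vanishing moments give vanishing integrals against continuous functions of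
  \<open>T\<close>, then over preimages of closed sets, and by Dynkin's argument over all measurable
  sets, which forces \<open>f\<close> to vanish almost everywhere. The generator \<open>G\<close> is
  a parameter because the suitable preimages of closed sets differ between the two
  applications.\<close>

lemma (in finite_measure) AE_zero_polynomial_moments:
  fixes f :: "'a \<Rightarrow> complex" and T :: "'a \<Rightarrow> 'e::euclidean_space"
  assumes f: "integrable M f" and T [measurable]: "T \<in> borel_measurable M"
    and K: "compact K" "\<And>z. z \<in> space M \<Longrightarrow> T z \<in> K"
    and mom: "\<And>p. real_polynomial_function p \<Longrightarrow> (LINT z|M. f z * of_real (p (T z))) = 0"
    and G: "sets M = sigma_sets (space M) G" "Int_stable G"
    and GF: "\<And>A. A \<in> G \<Longrightarrow> \<exists>F. closed F \<and> A = {z \<in> space M. T z \<in> F}"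
  shows "AE z in M. f z = 0"
proof -
  have cont: "(LINT z|M. f z * of_real (g (T z))) = 0" if "continuous_on UNIV g" for g
    using integral_continuous_eq_0(2)[of f T K g] f T K mom that by blast
  have [measurable]: "f \<in> borel_measurable M" using f by (rule borel_measurable_integrable)
  have clo: "(LINT z:{z \<in> space M. T z \<in> F}|M. f z) = 0" if F: "closed F" "F \<noteq> {}" for F
  proof -
    \<comment> \<open>A bounded sequence of continuous functions tending pointwise to the indicator
      of the closed set \<open>F\<close>: the base is 1 on \<open>F\<close> and smaller than 1 off
      it.\<close>
    define g where "g k y = (1 / (1 + infdist y F)) ^ k" for k y
    have gc: "continuous_on UNIV (g k)" for k
      unfolding g_def by (intro continuous_intros) (simp add: add_nonneg_eq_0_iff infdist_nonneg)
    have g01: "0 \<le> g k y" "g k y \<le> 1" for k y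
      unfolding g_def using infdist_nonneg[of y F] by (auto intro!: power_le_one simp: divide_le_eq_1)
    have gl: "(\<lambda>k. g k y) \<longlonglongrightarrow> indicator F y" for y
    proof (cases "y \<in> F")
      case True
      then show ?thesis by (simp add: g_def)
    next
      case False
      then have "infdist y F \<noteq> 0" using in_closed_iff_infdist_zero[OF F] by simp
      then have "infdist y F > 0" using infdist_nonneg[of y F] by linarith
      then show ?thesis unfolding g_def using False by (simp add: LIMSEQ_realpow_zero)
    qed
    have [measurable]: "g k \<in> borel_measurable borel" for k
      using gc by (rule borel_measurable_continuous_onI)
    have [measurable]: "F \<in> sets borel" using F(1) by simp
    have "(\<lambda>k. LINT z|M. f z * of_real (g k (T z))) \<longlonglongrightarrow> (LINT z|M. f z * of_real (indicator F (T z)))"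
    proof (rule integral_dominated_convergence[where w = "\<lambda>z. cmod (f z)"])
      show "AE z in M. (\<lambda>k. f z * of_real (g k (T z))) \<longlonglongrightarrow> f z * of_real (indicator F (T z))"
        by (intro AE_I2 tendsto_intros gl)
      show "\<And>k. AE z in M. norm (f z * of_real (g k (T z))) \<le> cmod (f z)"
        using g01 by (auto simp: norm_mult mult_left_le)
    qed (use f in \<open>auto\<close>)
    then have "(LINT z|M. f z * of_real (indicator F (T z))) = 0"
      unfolding cont[OF gc] by (simp add: LIMSEQ_const_iff)
    moreover have "(LINT z:{z \<in> space M. T z \<in> F}|M. f z) = (LINT z|M. f z * of_real (indicator F (T z)))"
      unfolding set_lebesgue_integral_def by (rule Bochner_Integration.integral_cong) (auto simp: indicator_def)
    ultimately show ?thesis by simp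
  qed
  have sI: "set_integrable M A f" if "A \<in> sets M" for A
    unfolding set_integrable_def using integrable_mult_indicator[OF that f] .
  have "G \<subseteq> Pow (space M)" using GF by blast
  have all: "(LINT z:A|M. f z) = 0" if "A \<in> sets M" for A
    using \<open>Int_stable G\<close> \<open>G \<subseteq> Pow (space M)\<close> that[unfolded G(1)]
  proof (induction rule: sigma_sets_induct_disjoint)
    case (basic A)
    then obtain F where "closed F" "A = {z \<in> space M. T z \<in> F}" using GF by blast
    then show ?case using clo[of F] by (cases "F = {}") (auto simp: set_lebesgue_integral_def)
  next
    case empty
    then show ?case by (simp add: set_lebesgue_integral_def)
  next
    case (compl A)
    have A: "A \<in> sets M" using compl(1) G(1) by simp
    \<comment> \<open>Complements need the integral over the whole space, which vanishes since
      \<open>UNIV\<close> is closed.\<close>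
    have "{z \<in> space M. T z \<in> UNIV} = space M" by simp
    then have "0 = (LINT z:space M|M. f z)" using clo[of UNIV] by simp
    also have "space M = A \<union> (space M - A)" using A sets.sets_into_space by blast
    then have "(LINT z:space M|M. f z) = (LINT z:A \<union> (space M - A)|M. f z)" by simp
    also have "\<dots> = (LINT z:A|M. f z) + (LINT z:space M - A|M. f z)"
      by (rule set_integral_Un) (use A sI in auto)
    finally show ?case using compl by simp
  next
    case (union A)
    have A: "A i \<in> sets M" for i using union(2) G(1) by auto
    have "(LINT z:(\<Union>i. A i)|M. f z) = (\<Sum>i. (LINT z:(A i)|M. f z))"
      by (rule lebesgue_integral_countable_add) (use A union(1) sI in \<open>auto simp: disjoint_family_on_def\<close>)
    then show ?case using union(3) by simp
  qed
  show ?thesis by (rule density_zero[OF f all])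
qed

section \<open>Completeness of the trigonometric polynomials\<close>

abbreviation rvec :: "int^2 \<Rightarrow> real^2" where
  "rvec n \<equiv> (\<chi> i. real_of_int (n $ i))"

lemma sets_circle_closed: "sets circle = sigma_sets (sphere 0 1) ((\<inter>) (sphere 0 1) ` Collect closed)"
proof -
  have "sphere (0 :: real^2) 1 \<in> sigma_sets UNIV (Collect closed)"
    by (rule sigma_sets.Basic) simp
  from sigma_sets_Int[OF this] show ?thesis
    by (simp add: sets_circle sets_restrict_space borel_eq_closed)
qed

lemma AE_circle_zero:
  assumes "f \<in> L2 circle"
    and "\<And>q. real_polynomial_function q \<Longrightarrow> (LINT v|circle. f v * of_real (q v)) = 0"
  shows "AE v in circle. f v = 0"
proof (rule circle.AE_zero_polynomial_moments[where T = "\<lambda>v. v" and K = "sphere 0 1"])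
  show "sets circle = sigma_sets (space circle) ((\<inter>) (sphere 0 1) ` Collect closed)"
    by (simp add: sets_circle_closed space_circle)
  show "Int_stable ((\<inter>) (sphere (0::real^2) 1) ` Collect closed)"
  proof (rule Int_stableI)
    fix A B assume "A \<in> (\<inter>) (sphere (0::real^2) 1) ` Collect closed" "B \<in> (\<inter>) (sphere (0::real^2) 1) ` Collect closed"
    then obtain a b where "closed a" "closed b" "A = sphere 0 1 \<inter> a" "B = sphere 0 1 \<inter> b" by blast
    then have "A \<inter> B = sphere 0 1 \<inter> (a \<inter> b)" "closed (a \<inter> b)" by auto
    then show "A \<inter> B \<in> (\<inter>) (sphere 0 1) ` Collect closed" by blast
  qed
  fix A assume "A \<in> (\<inter>) (sphere (0::real^2) 1) ` Collect closed"
  then obtain F where "closed F" "A = sphere 0 1 \<inter> F" by blast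
  then have "closed F \<and> A = {z \<in> space circle. z \<in> F}" by (simp add: space_circle Int_def)
  then show "\<exists>F. closed F \<and> A = {z \<in> space circle. z \<in> F}" ..
next
  show "integrable circle f" using assms(1) by (rule circle.L2_integrable)
  show "(\<lambda>v. v) \<in> borel_measurable circle" by (rule borel_measurable_circle) simp
qed (simp_all add: space_circle assms(2) del: mem_sphere)

text \<open>Lower quadrants are chosen as generators because inside the box they are preimages of
  closed arcs under \<open>cis\<close>. An arbitrary relatively closed subset of the half-open box
  need not be such a preimage, since \<open>cis\<close> glues the two ends of the period
  together.\<close>

lemma sets_torus_le: "sets torus = sigma_sets torus_box ((\<inter>) torus_box ` range (\<lambda>b. {..b}))"
proof -
  have "torus_box \<in> sigma_sets UNIV (range (\<lambda>b::real^2. {..b}))"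
    using torus_box_borel by (simp add: borel_eq_atMost)
  from sigma_sets_Int[OF this] show ?thesis
    by (simp add: sets_torus sets_restrict_space borel_eq_atMost)
qed

text \<open>The minimum stops the arc after one full turn. An integer number of turns separates
  points with equal image, and starting from the half-open period this number cannot be
  positive.\<close>

lemma cis_arc:
  assumes "0 \<le> x" "x < 2 * pi"
  shows "cis x \<in> cis ` {0..min b (2 * pi)} \<longleftrightarrow> x \<le> b"
proof
  assume "cis x \<in> cis ` {0..min b (2 * pi)}"
  then obtain y where y: "0 \<le> y" "y \<le> b" "y \<le> 2 * pi" "cis x = cis y" by auto
  from y(4) have "sin x = sin y \<and> cos x = cos y" by (simp add: complex_eq_iff)
  then obtain k :: int where k: "x = y + 2 * pi * k"
    unfolding sin_cos_eq_iff by blast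
  have "2 * pi * k < 2 * pi * 1" using k assms y(1) by linarith
  then have "real_of_int k < 1" using pi_gt_zero by (subst (asm) mult_less_cancel_left_pos) auto
  then have "k \<le> 0" by simp
  then have "2 * pi * k \<le> 0" by (simp add: mult_nonneg_nonpos)
  then show "x \<le> b" using k y by linarith
qed (use assms in auto)

text \<open>The hypothesis says that \<open>f\<close> is orthogonal to trigonometric monomials in
  position times polynomials in velocity. Cosine and sine of a coordinate are combinations of two
  characters, so this extends to every polynomial in the image of \<open>?T\<close>, and the
  criterion on polynomial moments applies.\<close>

lemma AE_phase_zero:
  assumes f: "f \<in> L2 phase"
    and mom: "\<And>n q. real_polynomial_function q \<Longrightarrow>
      (LINT z|phase. f z * (cis (fst z \<bullet> rvec n) * of_real (q (snd z)))) = 0"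
  shows "AE z in phase. f z = 0"
proof -
  let ?T = "\<lambda>z :: (real^2) \<times> (real^2). (cis (fst z $ 1), cis (fst z $ 2), snd z)"
  let ?K = "sphere 0 1 \<times> sphere 0 1 \<times> sphere 0 1 :: (complex \<times> complex \<times> (real^2)) set"
  let ?Ea = "(\<inter>) torus_box ` range (\<lambda>b. {..b})"
  let ?Eb = "(\<inter>) (sphere (0::real^2) 1) ` Collect closed"
  let ?G = "{a \<times> b |a b. a \<in> ?Ea \<and> b \<in> ?Eb}"
  have Tc: "continuous_on UNIV ?T" by (intro continuous_intros)
  \<comment> \<open>The functions \<open>g\<close> for which the product \<open>f g\<close> has the
    orthogonality of \<open>f\<close>. Demanding it against all \<open>n\<close> and
    \<open>q\<close> at once makes the class stable under multiplication by characters and by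
    polynomials in the velocity, which the induction over polynomials needs.\<close>
  define V where "V g \<longleftrightarrow> g \<in> borel_measurable phase \<and> (\<exists>B. \<forall>z\<in>space phase. cmod (g z) \<le> B) \<and>
    (\<forall>n q. real_polynomial_function q \<longrightarrow>
      (LINT z|phase. f z * (g z * (cis (fst z \<bullet> rvec n) * of_real (q (snd z))))) = 0)" for g
  have qm: "(\<lambda>z. cis (fst z \<bullet> rvec n) * complex_of_real (q (snd z))) \<in> borel_measurable phase"
    and qb: "\<exists>B. \<forall>z\<in>space phase. cmod (cis (fst z \<bullet> rvec n) * complex_of_real (q (snd z))) \<le> B"
    if q: "real_polynomial_function q" for n q
  proof -
    have qc: "continuous_on UNIV q"
      using continuous_real_polymonial_function[OF q] continuous_at_imp_continuous_on by blast
    have "continuous_on UNIV (\<lambda>z :: (real^2) \<times> (real^2). q (snd z))"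
      by (rule continuous_on_compose2[OF qc]) (auto intro: continuous_on_snd continuous_on_id)
    then show "(\<lambda>z. cis (fst z \<bullet> rvec n) * complex_of_real (q (snd z))) \<in> borel_measurable phase"
      by (intro measurable_phase_continuous continuous_intros)
    have "bounded (q ` sphere 0 1)"
      by (intro compact_imp_bounded compact_continuous_image continuous_on_subset[OF qc]) auto
    then obtain B where "\<And>y. y \<in> sphere 0 1 \<Longrightarrow> \<bar>q y\<bar> \<le> B"
      unfolding bounded_iff real_norm_def by blast
    then show "\<exists>B. \<forall>z\<in>space phase. cmod (cis (fst z \<bullet> rvec n) * complex_of_real (q (snd z))) \<le> B"
      by (intro exI[of _ B] ballI) (simp add: norm_mult space_phase mem_Times_iff)
  qed
  have VI: "V g" if "g \<in> borel_measurable phase" "\<And>z. z \<in> space phase \<Longrightarrow> cmod (g z) \<le> B"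
    "\<And>n q. real_polynomial_function q \<Longrightarrow>
      (LINT z|phase. f z * (g z * (cis (fst z \<bullet> rvec n) * of_real (q (snd z))))) = 0" for g B
    unfolding V_def using that by blast
  have Vm: "g \<in> borel_measurable phase" if "V g" for g using that unfolding V_def by blast
  have Vb: "\<exists>B. \<forall>z\<in>space phase. cmod (g z) \<le> B" if "V g" for g using that unfolding V_def by blast
  have Vmom: "(LINT z|phase. f z * (g z * (cis (fst z \<bullet> rvec n) * of_real (q (snd z))))) = 0"
    if "V g" "real_polynomial_function q" for g n q
    using that unfolding V_def by blast
  have Vint: "integrable phase (\<lambda>z. f z * (g z * (cis (fst z \<bullet> rvec n) * of_real (q (snd z)))))"
    if g: "V g" and q: "real_polynomial_function q" for g n q
  proof -
    obtain B where B: "\<And>z. z \<in> space phase \<Longrightarrow> cmod (g z) \<le> B" using Vb[OF g] by blast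
    obtain C where C: "\<And>z. z \<in> space phase \<Longrightarrow> cmod (cis (fst z \<bullet> rvec n) * complex_of_real (q (snd z))) \<le> C"
      using qb[OF q] by blast
    have "(\<lambda>z. cis (fst z \<bullet> rvec n) * complex_of_real (q (snd z))) \<in> L2 phase"
      by (rule phase.L2_bounded[OF qm[OF q] C])
    then have "(\<lambda>z. g z * (cis (fst z \<bullet> rvec n) * complex_of_real (q (snd z)))) \<in> L2 phase"
      by (rule L2_bounded_mult[OF _ Vm[OF g] B])
    with f show ?thesis by (rule L2_integrable_mult)
  qed
  have Vadd: "V (\<lambda>z. g z + h z)" if g: "V g" and h: "V h" for g h
  proof -
    obtain B C where B: "\<And>z. z \<in> space phase \<Longrightarrow> cmod (g z) \<le> B"
      and C: "\<And>z. z \<in> space phase \<Longrightarrow> cmod (h z) \<le> C"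
      using Vb[OF g] Vb[OF h] by blast
    show ?thesis
    proof (rule VI)
      show "(\<lambda>z. g z + h z) \<in> borel_measurable phase"
        by (rule borel_measurable_add[OF Vm[OF g] Vm[OF h]])
      show "cmod (g z + h z) \<le> B + C" if "z \<in> space phase" for z
        by (rule norm_triangle_mono[OF B[OF that] C[OF that]])
      show "(LINT z|phase. f z * ((g z + h z) * (cis (fst z \<bullet> rvec n) * of_real (q (snd z))))) = 0"
        if "real_polynomial_function q" for n q
        unfolding distrib_left distrib_right
        using Bochner_Integration.integral_add[OF Vint[OF g that, of n] Vint[OF h that, of n]]
        by (simp only: Vmom[OF g that] Vmom[OF h that] add_0_right)
    qed
  qed
  have Vscale: "V (\<lambda>z. c * g z)" if g: "V g" for g c
  proof -
    obtain B where B: "\<And>z. z \<in> space phase \<Longrightarrow> cmod (g z) \<le> B" using Vb[OF g] by blast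
    show ?thesis
    proof (rule VI)
      show "(\<lambda>z. c * g z) \<in> borel_measurable phase"
        by (rule borel_measurable_times[OF borel_measurable_const Vm[OF g]])
      show "cmod (c * g z) \<le> cmod c * B" if "z \<in> space phase" for z
        unfolding norm_mult by (rule mult_left_mono[OF B[OF that]]) simp
      show "(LINT z|phase. f z * (c * g z * (cis (fst z \<bullet> rvec n) * of_real (q (snd z))))) = 0"
        if "real_polynomial_function q" for n q
        unfolding mult.assoc[of c] mult.left_commute[of "f _" c]
        by (simp only: integral_mult_right_zero Vmom[OF g that] mult_zero_right)
    qed
  qed
  have Vcis: "V (\<lambda>z. cis (fst z \<bullet> rvec m) * g z)" if g: "V g" for g m
  proof -
    obtain B where B: "\<And>z. z \<in> space phase \<Longrightarrow> cmod (g z) \<le> B" using Vb[OF g] by blast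
    have "continuous_on UNIV (\<lambda>z::(real^2)\<times>(real^2). cis (fst z \<bullet> rvec m))"
      by (intro continuous_intros)
    note m = measurable_phase_continuous[OF this]
    have "rvec (m + n) = rvec m + rvec n" for n by (simp add: vec_eq_iff)
    then have eq: "(cis (fst z \<bullet> rvec m) * g z) * (cis (fst z \<bullet> rvec n) * w)
        = g z * (cis (fst z \<bullet> rvec (m + n)) * w)" for z n w
      by (simp add: inner_add_right cis_mult[symmetric])
    show ?thesis
    proof (rule VI)
      show "(\<lambda>z. cis (fst z \<bullet> rvec m) * g z) \<in> borel_measurable phase"
        by (rule borel_measurable_times[OF m Vm[OF g]])
      show "cmod (cis (fst z \<bullet> rvec m) * g z) \<le> B" if "z \<in> space phase" for z
        using B[OF that] by (simp add: norm_mult)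
      show "(LINT z|phase. f z * (cis (fst z \<bullet> rvec m) * g z * (cis (fst z \<bullet> rvec n) * of_real (q (snd z))))) = 0"
        if "real_polynomial_function q" for n q
        unfolding eq by (rule Vmom[OF g that])
    qed
  qed
  have Vq: "V (\<lambda>z. of_real (q (snd z)) * g z)" if g: "V g" and q: "real_polynomial_function q" for g q
  proof -
    obtain B where B: "\<And>z. z \<in> space phase \<Longrightarrow> cmod (g z) \<le> B" using Vb[OF g] by blast
    obtain C where C: "\<And>z. z \<in> space phase \<Longrightarrow> cmod (cis (fst z \<bullet> rvec 0) * complex_of_real (q (snd z))) \<le> C"
      using qb[OF q] by blast
    have r0: "rvec 0 = 0" by (simp add: vec_eq_iff)
    have C': "cmod (complex_of_real (q (snd z))) \<le> C" if "z \<in> space phase" for z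
      using C[OF that] by (simp only: r0 inner_zero_right cis_zero mult_1_left)
    have m: "(\<lambda>z. complex_of_real (q (snd z))) \<in> borel_measurable phase"
      using qm[OF q, of 0] by (simp only: r0 inner_zero_right cis_zero mult_1_left)
    have eq: "(of_real (q (snd z)) * g z) * (w * of_real (r (snd z)))
        = g z * (w * complex_of_real (q (snd z) * r (snd z)))" for z w and r :: "real^2 \<Rightarrow> real" by simp
    show ?thesis
    proof (rule VI)
      show "(\<lambda>z. of_real (q (snd z)) * g z) \<in> borel_measurable phase"
        by (rule borel_measurable_times[OF m Vm[OF g]])
      show "cmod (of_real (q (snd z)) * g z) \<le> C * B" if "z \<in> space phase" for z
        unfolding norm_mult using order_trans[OF norm_ge_zero C'[OF that]]
        by (intro mult_mono C'[OF that] B[OF that]) simp_all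
      show "(LINT z|phase. f z * (of_real (q (snd z)) * g z * (cis (fst z \<bullet> rvec n) * of_real (r (snd z))))) = 0"
        if "real_polynomial_function r" for n r
        unfolding eq by (rule Vmom[OF g real_polynomial_function.intros(4)[OF q that]])
    qed
  qed
  have VT: "V (\<lambda>z. of_real (p (?T z)) * g z)" if "real_polynomial_function p" "V g" for p g
    using that
  proof (induction p arbitrary: g rule: real_polynomial_function.induct)
    \<comment> \<open>A linear functional of \<open>?T z\<close> is a combination of the cosines and
      sines of the two position coordinates plus a linear function of the velocity; each of these
      multiplies \<open>V\<close> into itself.\<close>
    case (linear l)
    interpret l: bounded_linear l by fact
    obtain c1 c2 c3 c4 where c: "l (1, 0, 0) = c1" "l (\<i>, 0, 0) = c2" "l (0, 1, 0) = c3" "l (0, \<i>, 0) = c4"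
      by blast
    have dec: "(cis a, cis b, v) = cos a *\<^sub>R (1, 0, 0) + sin a *\<^sub>R (\<i>, 0, 0) + cos b *\<^sub>R (0, 1, 0)
        + sin b *\<^sub>R (0, \<i>, 0) + (0, 0, v)" for a b and v :: "real^2"
      by (simp add: complex_eq_iff)
    have le: "l (cis a, cis b, v) = c1 * cos a + c2 * sin a + c3 * cos b + c4 * sin b + l (0, 0, v)" for a b v
      by (subst dec) (simp only: l.add l.scaleR c real_scaleR_def mult.commute)
    have blin: "bounded_linear (\<lambda>v :: real^2. (0 :: complex, 0 :: complex, v))"
      by (intro bounded_linear_Pair bounded_linear_zero bounded_linear_ident)
    have q: "real_polynomial_function (\<lambda>v. l (0, 0, v))"
      using bounded_linear_compose[OF linear(1) blin] by (rule real_polynomial_function.intros(1))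
    have r: "fst z \<bullet> rvec (vector [1, 0]) = fst z $ 1" "fst z \<bullet> rvec (vector [-1, 0]) = - fst z $ 1"
      "fst z \<bullet> rvec (vector [0, 1]) = fst z $ 2" "fst z \<bullet> rvec (vector [0, -1]) = - fst z $ 2"
      for z :: "(real^2) \<times> (real^2)"
      by (simp_all add: inner_vec2)
    have cosE: "of_real (cos a) * w = (1/2) * (cis a * w) + (1/2) * (cis (- a) * w)"
      and sinE: "of_real (sin a) * w = (-\<i>/2) * (cis a * w) + (\<i>/2) * (cis (- a) * w)" for a w
      by (simp_all add: complex_eq_iff field_simps)
    have Vc: "V (\<lambda>z. of_real (cos (fst z $ 1)) * g z)" "V (\<lambda>z. of_real (cos (fst z $ 2)) * g z)"
      and Vs: "V (\<lambda>z. of_real (sin (fst z $ 1)) * g z)" "V (\<lambda>z. of_real (sin (fst z $ 2)) * g z)"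
      unfolding cosE sinE
      by (intro Vadd Vscale Vcis[OF linear(2), of "vector [1, 0]", unfolded r]
          Vcis[OF linear(2), of "vector [-1, 0]", unfolded r] Vcis[OF linear(2), of "vector [0, 1]", unfolded r]
          Vcis[OF linear(2), of "vector [0, -1]", unfolded r])+
    have eq: "complex_of_real (l (?T z)) * g z =
        (of_real c1 * (of_real (cos (fst z $ 1)) * g z) + of_real c2 * (of_real (sin (fst z $ 1)) * g z))
      + (of_real c3 * (of_real (cos (fst z $ 2)) * g z) + of_real c4 * (of_real (sin (fst z $ 2)) * g z))
      + of_real (l (0, 0, snd z)) * g z" for z
      unfolding le of_real_add of_real_mult by (simp only: distrib_right mult.assoc add.assoc)
    show ?case unfolding eq by (intro Vadd Vscale Vc Vs Vq linear(2) q)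
  next
    case (const c)
    then show ?case by (rule Vscale)
  next
    case (add p q)
    then show ?case using Vadd by (simp add: distrib_right)
  next
    case (mult p q)
    then show ?case using mult(3)[OF mult(4)[OF mult(5)]] by (simp add: mult.assoc)
  qed
  have V1: "V (\<lambda>z. 1)" by (rule VI[where B = 1]) (simp_all add: mom)
  have rvec0: "rvec 0 = 0" by (simp add: vec_eq_iff)
  show ?thesis
  proof (rule phase.AE_zero_polynomial_moments[where T = ?T and K = ?K and G = ?G])
    show "integrable phase f" using f by (rule phase.L2_integrable)
    show "?T \<in> borel_measurable phase" by (rule measurable_phase_continuous[OF Tc])
    show "compact ?K" by (intro compact_Times compact_sphere)
    show "\<And>z. z \<in> space phase \<Longrightarrow> ?T z \<in> ?K" by (simp add: space_phase mem_Times_iff)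
    fix p :: "complex \<times> complex \<times> (real^2) \<Rightarrow> real" assume "real_polynomial_function p"
    from VT[OF this V1] have "V (\<lambda>z. of_real (p (?T z)))" by simp
    then have "(LINT z|phase. f z * (of_real (p (?T z)) * (cis (fst z \<bullet> rvec 0) * of_real 1))) = 0"
      by (rule Vmom) (rule real_polynomial_function.intros(2))
    then show "(LINT z|phase. f z * of_real (p (?T z))) = 0"
      by (simp only: rvec0 inner_zero_right cis_zero mult_1_left of_real_1 mult_1_right)
  next
    have "sets phase = sets (sigma (space torus \<times> space circle) ?G)"
      unfolding phase_def
    proof (rule sets_pair_eq)
      show "?Ea \<subseteq> Pow (space torus)" "?Eb \<subseteq> Pow (space circle)"
        by (auto simp: space_torus space_circle)
      show "sets torus = sigma_sets (space torus) ?Ea" by (simp add: space_torus sets_torus_le)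
      show "sets circle = sigma_sets (space circle) ?Eb" by (simp add: space_circle sets_circle_closed)
      show "countable {torus_box}" "countable {sphere (0 :: real^2) 1}" by auto
      \<comment> \<open>The generator of a product sigma algebra requires that each factor is
        covered by countably many members of its own generator; here the whole factor is
        one.\<close>
      have "torus_box = torus_box \<inter> {..vec2 (2 * pi) (2 * pi)}"
        by (auto simp: less_eq_vec_def forall_2)
      then show "{torus_box} \<subseteq> ?Ea" by blast
      have "sphere (0::real^2) 1 = sphere 0 1 \<inter> UNIV" by simp
      then show "{sphere (0 :: real^2) 1} \<subseteq> ?Eb" by blast
    qed (auto simp: space_torus space_circle)
    also have "\<dots> = sigma_sets (space phase) ?G"
      unfolding space_phase space_torus space_circle by (rule sets_measure_of) auto
    finally show "sets phase = sigma_sets (space phase) ?G" .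
    show "Int_stable ?G"
    proof (rule Int_stableI)
      fix A B assume "A \<in> ?G" "B \<in> ?G"
      then obtain a a' c c' where *: "A = (torus_box \<inter> {..a}) \<times> (sphere 0 1 \<inter> c)" "closed c"
          "B = (torus_box \<inter> {..a'}) \<times> (sphere 0 1 \<inter> c')" "closed c'" by blast
      have "{..a} \<inter> {..a'} = {..(\<chi> i. min (a $ i) (a' $ i))}"
        by (auto simp: less_eq_vec_def)
      then have "A \<inter> B = (torus_box \<inter> {..(\<chi> i. min (a $ i) (a' $ i))}) \<times> (sphere 0 1 \<inter> (c \<inter> c'))"
        using * by blast
      moreover have "closed (c \<inter> c')" using * by auto
      ultimately show "A \<inter> B \<in> ?G" by blast
    qed
    fix A assume "A \<in> ?G"
    then obtain b c where A: "A = (torus_box \<inter> {..b}) \<times> (sphere 0 1 \<inter> c)" "closed c" by blast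
    let ?F = "cis ` {0..min (b $ 1) (2 * pi)} \<times> cis ` {0..min (b $ 2) (2 * pi)} \<times> c"
    have "closed ?F"
      by (intro closed_Times A compact_imp_closed compact_continuous_image continuous_intros compact_Icc)
    moreover have "A = {z \<in> space phase. ?T z \<in> ?F}"
    proof (rule set_eqI)
      fix z :: "(real^2) \<times> (real^2)"
      have arc: "cis (fst z $ i) \<in> cis ` {0..min (b $ i) (2 * pi)} \<longleftrightarrow> fst z $ i \<le> b $ i"
        if "z \<in> space phase" for i
        using that by (intro cis_arc) (auto simp: space_phase)
      have "z \<in> {z \<in> space phase. ?T z \<in> ?F} \<longleftrightarrow> z \<in> space phase \<and> fst z \<le> b \<and> snd z \<in> c"
        using arc[of 1] arc[of 2] by (simp only: mem_Collect_eq mem_Sigma_iff less_eq_vec_def forall_2) blast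
      then show "z \<in> A \<longleftrightarrow> z \<in> {z \<in> space phase. ?T z \<in> ?F}"
        by (simp only: A(1) space_phase mem_Times_iff Int_iff atMost_iff) blast
    qed
    ultimately show "\<exists>F. closed F \<and> A = {z \<in> space phase. ?T z \<in> F}" by blast
  qed
qed

section \<open>Fourier modes\<close>

lemma integral_period_cis:
  assumes "k \<noteq> (0::int)"
  shows "(LINT b|period. cis (c + b * real_of_int k)) = 0"
proof -
  let ?F = "\<lambda>b. cis (c + b * real_of_int k) / (\<i> * of_int k)"
  have "(?F has_vector_derivative cis (c + b * real_of_int k)) (at b)" for b
  proof -
    have "((\<lambda>b. c + b * real_of_int k) has_real_derivative real_of_int k) (at b)"
      by (auto intro!: derivative_eq_intros)
    from field_vector_diff_chain_at[OF has_vector_derivative_mult_right[OF has_vector_derivative_of_real[OF this], of \<i>] DERIV_exp]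
    have "((\<lambda>b. cis (c + b * real_of_int k)) has_vector_derivative
        \<i> * of_int k * cis (c + b * real_of_int k)) (at b)"
      by (simp add: o_def cis_conv_exp)
    from has_vector_derivative_divide[OF this, of "\<i> * of_int k"]
    show ?thesis using assms by (simp add: scaleR_conv_of_real)
  qed
  then have "(LINT b|period. cis (c + b * real_of_int k)) = ?F (2 * pi) - ?F 0"
    by (rule integral_period_FTC) (intro continuous_intros)
  also have "cis (c + 2 * pi * real_of_int k) = cis c"
    by (simp add: cis_mult[symmetric] cis_multiple_2pi)
  then have "?F (2 * pi) - ?F 0 = 0" by simp
  finally show ?thesis .
qed

lemma rvec_minus: "rvec (- n) = - rvec n"
  and rvec_diff: "rvec (m - n) = rvec m - rvec n"
  and rvec_0: "rvec 0 = 0"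
  by (simp_all add: vec_eq_iff)

lemma integral_torus_cis:
  "(LINT x|torus. cis (x \<bullet> rvec n)) = (if n = 0 then of_real ((2 * pi)\<^sup>2) else 0)"
proof (cases "n = 0")
  case True
  then have "(LINT x|torus. cis (x \<bullet> rvec n)) = (LINT x|torus. 1)" by (simp only: rvec_0 inner_zero_right cis_zero)
  also have "\<dots> = of_real ((2 * pi)\<^sup>2)" by (simp add: measure_torus scaleR_conv_of_real)
  finally show ?thesis using True by simp
next
  case False
  have m: "(\<lambda>x. cis (x \<bullet> rvec n)) \<in> borel_measurable torus"
    by (intro borel_measurable_torus borel_measurable_continuous_onI continuous_intros)
  have int: "integrable torus (\<lambda>x. cis (x \<bullet> rvec n))"
    by (rule torus.integrable_const_bound[where B = 1]) (simp_all add: m)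
  have e: "vec2 a b \<bullet> rvec n = a * real_of_int (n $ 1) + b * real_of_int (n $ 2)" for a b
    by (simp add: inner_vec2)
  show ?thesis
  proof (cases "n $ 2 = 0")
    case True
    with False have "n $ 1 \<noteq> 0" by (auto simp: vec_eq_iff forall_2)
    then have "(LINT a|period. cis (vec2 a b \<bullet> rvec n)) = 0" for b
      using integral_period_cis[of "n $ 1" "b * real_of_int (n $ 2)"] unfolding e by (simp add: add.commute)
    then show ?thesis using False by (simp add: torus_Fubini(2)[OF int])
  next
    case n2: False
    then have "(LINT b|period. cis (vec2 a b \<bullet> rvec n)) = 0" for a
      unfolding e by (rule integral_period_cis)
    then show ?thesis using False by (simp add: torus_Fubini(1)[OF int])
  qed
qed

text \<open>The characters are not normalized, so \<open>lift n\<close> is 2 pi times an isometry,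
  and the division by (2 pi)^2 in \<open>fcoef n\<close> makes the latter its left inverse.\<close>

definition lift :: "int^2 \<Rightarrow> (real^2 \<Rightarrow> complex) \<Rightarrow> (real^2) \<times> (real^2) \<Rightarrow> complex" where
  "lift n \<phi> = (\<lambda>z. cis (fst z \<bullet> rvec n) * \<phi> (snd z))"

definition fcoef :: "int^2 \<Rightarrow> ((real^2) \<times> (real^2) \<Rightarrow> complex) \<Rightarrow> real^2 \<Rightarrow> complex" where
  "fcoef n f v = (LINT x|torus. f (x, v) * cis (- (x \<bullet> rvec n))) / of_real ((2 * pi)\<^sup>2)"

lemma lift_measurable: 
  assumes "\<phi> \<in> borel_measurable circle"
  shows "lift n \<phi> \<in> borel_measurable phase"
proof -
  have 1: "(\<lambda>z::(real^2)\<times>(real^2). cis (fst z \<bullet> rvec n)) \<in> borel_measurable phase"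
    by (intro measurable_phase_continuous continuous_intros)
  have 2: "(\<lambda>z. \<phi> (snd z)) \<in> borel_measurable phase"
    unfolding phase_def by (rule measurable_compose[OF measurable_snd assms])
  show ?thesis unfolding lift_def by (rule borel_measurable_times[OF 1 2])
qed

lemma integrable_snd_phase:
  fixes g :: "real^2 \<Rightarrow> real"
  assumes "integrable circle g"
  shows "integrable phase (\<lambda>z. g (snd z))" and "(LINT z|phase. g (snd z)) = (2 * pi)\<^sup>2 * (LINT v|circle. g v)"
proof -
  have m: "(\<lambda>z. g (snd z)) \<in> borel_measurable (torus \<Otimes>\<^sub>M circle)"
    by (rule measurable_compose[OF measurable_snd]) (use assms in auto)
  show int: "integrable phase (\<lambda>z. g (snd z))"
    unfolding phase_def by (rule torus_circle.Fubini_integrable[OF m]) (use assms in simp_all)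
  have "(LINT z|phase. g (snd z)) = (LINT x|torus. LINT v|circle. g v)"
    using torus_circle.integral_fst'[OF int[unfolded phase_def]] by (simp add: phase_def)
  then show "(LINT z|phase. g (snd z)) = (2 * pi)\<^sup>2 * (LINT v|circle. g v)"
    by (simp add: measure_torus)
qed

lemma lift_L2:
  assumes "\<phi> \<in> L2 circle"
  shows "lift n \<phi> \<in> L2 phase" and "l2_norm phase (lift n \<phi>) = 2 * pi * l2_norm circle \<phi>"
proof -
  have c: "cmod (lift n \<phi> z) = cmod (\<phi> (snd z))" for z by (simp add: lift_def norm_mult)
  show "lift n \<phi> \<in> L2 phase"
    using lift_measurable[OF L2_measurable[OF assms]] integrable_snd_phase(1)[OF L2_sq_integrable[OF assms]]
    by (simp add: L2_def c)
  show "l2_norm phase (lift n \<phi>) = 2 * pi * l2_norm circle \<phi>"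
    unfolding l2_norm_def c integrable_snd_phase(2)[OF L2_sq_integrable[OF assms]]
    by (simp add: real_sqrt_mult)
qed

lemma fcoef_measurable:
  assumes "f \<in> borel_measurable phase"
  shows "fcoef n f \<in> borel_measurable circle"
proof -
  have 1: "(\<lambda>z::(real^2)\<times>(real^2). cis (- (fst z \<bullet> rvec n))) \<in> borel_measurable (torus \<Otimes>\<^sub>M circle)"
    unfolding phase_def[symmetric] by (intro measurable_phase_continuous continuous_intros)
  have 2: "f \<in> borel_measurable (torus \<Otimes>\<^sub>M circle)" using assms by (simp add: phase_def)
  from borel_measurable_times[OF 2 1]
  have "(\<lambda>z. f z * cis (- (fst z \<bullet> rvec n))) \<in> borel_measurable (torus \<Otimes>\<^sub>M circle)" .
  from measurable_compose[OF measurable_pair_swap' this]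
  have "(\<lambda>p. f (snd p, fst p) * cis (- (snd p \<bullet> rvec n))) \<in> borel_measurable (circle \<Otimes>\<^sub>M torus)"
    by (simp add: case_prod_beta)
  then have "(\<lambda>v. LINT x|torus. f (x, v) * cis (- (x \<bullet> rvec n))) \<in> borel_measurable circle"
    by (intro torus.borel_measurable_lebesgue_integral) (simp add: case_prod_beta)
  then show ?thesis unfolding fcoef_def by (intro borel_measurable_divide borel_measurable_const)
qed

text \<open>For almost every velocity Cauchy-Schwarz on the torus bounds the coefficient by the norm
  of the slice; the squares are then integrated by Fubini. The true factor 1/(2 pi) is replaced by
  1.\<close>

lemma fcoef_L2:
  assumes f: "f \<in> L2 phase"
  shows "fcoef n f \<in> L2 circle"
proof -
  let ?g = "\<lambda>v. LINT x|torus. (cmod (f (x, v)))\<^sup>2"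
  have int: "integrable (torus \<Otimes>\<^sub>M circle) (\<lambda>(x, v). (cmod (f (x, v)))\<^sup>2)"
    using L2_sq_integrable[OF f] by (simp add: phase_def case_prod_unfold)
  have fm: "f \<in> borel_measurable (torus \<Otimes>\<^sub>M circle)"
    using L2_measurable[OF f] by (simp add: phase_def)
  have m: "(\<lambda>x. f (x, v)) \<in> borel_measurable torus" if "v \<in> space circle" for v
    by (rule measurable_compose[OF measurable_Pair2'[OF that] fm])
  have bound: "AE v in circle. (cmod (fcoef n f v))\<^sup>2 \<le> ?g v"
    using torus_circle.AE_integrable_snd[OF int] AE_space
  proof eventually_elim
    fix v assume i: "integrable torus (\<lambda>x. (cmod (f (x, v)))\<^sup>2)" and v: "v \<in> space circle"
    have L: "(\<lambda>x. f (x, v)) \<in> L2 torus" using i m[OF v] by (simp add: L2_def)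
    have cm: "(\<lambda>x. cis (x \<bullet> rvec n)) \<in> borel_measurable torus"
      by (intro borel_measurable_torus borel_measurable_continuous_onI continuous_intros)
    have C: "(\<lambda>x. cis (x \<bullet> rvec n)) \<in> L2 torus" by (rule torus.L2_bounded[OF cm, of 1]) simp
    have nC: "l2_norm torus (\<lambda>x. cis (x \<bullet> rvec n)) = 2 * pi"
      by (simp add: l2_norm_def measure_torus real_sqrt_mult)
    have "fcoef n f v = l2_inner torus (\<lambda>x. f (x, v)) (\<lambda>x. cis (x \<bullet> rvec n)) / of_real ((2 * pi)\<^sup>2)"
      by (simp add: fcoef_def l2_inner_def cis_cnj)
    then have "cmod (fcoef n f v) = cmod (l2_inner torus (\<lambda>x. f (x, v)) (\<lambda>x. cis (x \<bullet> rvec n))) / (2 * pi)\<^sup>2"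
      by (simp add: norm_divide norm_power norm_mult)
    also have "\<dots> \<le> l2_norm torus (\<lambda>x. f (x, v)) * (2 * pi) / (2 * pi)\<^sup>2"
      using l2_cauchy_schwarz[OF L C] nC by (intro divide_right_mono) simp_all
    also have "\<dots> = l2_norm torus (\<lambda>x. f (x, v)) / (2 * pi)" by (simp add: power2_eq_square)
    also have "\<dots> \<le> l2_norm torus (\<lambda>x. f (x, v)) / 1"
      by (rule divide_left_mono) (use pi_ge_two in simp_all)
    finally have "(cmod (fcoef n f v))\<^sup>2 \<le> (l2_norm torus (\<lambda>x. f (x, v)))\<^sup>2"
      by (intro power_mono) simp_all
    then show "(cmod (fcoef n f v))\<^sup>2 \<le> ?g v" by (simp add: l2_norm_power2)
  qed
  have "integrable circle (\<lambda>v. (cmod (fcoef n f v))\<^sup>2)"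
  proof (rule Bochner_Integration.integrable_bound[OF torus_circle.integrable_snd[OF int]])
    show "(\<lambda>v. (cmod (fcoef n f v))\<^sup>2) \<in> borel_measurable circle"
      using fcoef_measurable[OF L2_measurable[OF f]] by simp
    show "AE v in circle. norm ((cmod (fcoef n f v))\<^sup>2) \<le> norm (?g v)"
      using bound by eventually_elim simp
  qed
  then show ?thesis using fcoef_measurable[OF L2_measurable[OF f]] by (simp add: L2_def)
qed

lemma inner_lift:
  assumes f: "f \<in> L2 phase" and \<phi>: "\<phi> \<in> L2 circle"
  shows "l2_inner phase f (lift n \<phi>) = of_real ((2 * pi)\<^sup>2) * l2_inner circle (fcoef n f) \<phi>"
proof -
  have eq: "f z * cnj (lift n \<phi> z) = (f z * cis (- (fst z \<bullet> rvec n))) * cnj (\<phi> (snd z))" for z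
    by (simp add: lift_def cis_cnj)
  have "integrable (torus \<Otimes>\<^sub>M circle) (\<lambda>(x, v). (f (x, v) * cis (- (x \<bullet> rvec n))) * cnj (\<phi> v))"
    using l2_inner_integrable[OF f lift_L2(1)[OF \<phi>, of n]] unfolding eq by (simp add: phase_def case_prod_unfold)
  from torus_circle.integral_snd[OF this]
  have "l2_inner phase f (lift n \<phi>) = (LINT v|circle. LINT x|torus. (f (x, v) * cis (- (x \<bullet> rvec n))) * cnj (\<phi> v))"
    unfolding l2_inner_def eq by (simp add: phase_def case_prod_unfold)
  also have "\<dots> = (LINT v|circle. of_real ((2 * pi)\<^sup>2) * (fcoef n f v * cnj (\<phi> v)))"
    by (simp add: fcoef_def)
  also have "\<dots> = of_real ((2 * pi)\<^sup>2) * l2_inner circle (fcoef n f) \<phi>"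
    unfolding l2_inner_def by (rule integral_mult_right_zero)
  finally show ?thesis .
qed

text \<open>The means by which coefficients are computed: an identity of pairings with single modes
  avoids arguing about individual slices, where the defining integral need not behave well.\<close>

lemma fcoef_unique:
  assumes f: "f \<in> L2 phase" and g: "g \<in> L2 circle"
    and eq: "\<And>\<phi>. \<phi> \<in> L2 circle \<Longrightarrow> l2_inner phase f (lift n \<phi>) = of_real ((2 * pi)\<^sup>2) * l2_inner circle g \<phi>"
  shows "AE v in circle. fcoef n f v = g v"
proof -
  let ?d = "\<lambda>v. fcoef n f v - g v"
  have d: "?d \<in> L2 circle" by (rule L2_diff[OF fcoef_L2[OF f] g])
  have "l2_inner circle (fcoef n f) ?d = l2_inner circle g ?d"
    using inner_lift[OF f d] eq[OF d] by simp
  then have "l2_inner circle ?d ?d = 0" by (simp add: l2_inner_diff_left fcoef_L2 f g d)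
  then have "l2_norm circle ?d = 0" by (simp add: l2_inner_self)
  then show ?thesis using l2_norm_eq_0[OF d] by simp
qed

lemma fcoef_lift: "fcoef n (lift m \<phi>) = (if n = m then \<phi> else (\<lambda>v. 0))"
proof
  fix v
  have "cis (x \<bullet> rvec m) * cis (- (x \<bullet> rvec n)) = cis (x \<bullet> rvec (m - n))" for x
    unfolding rvec_diff inner_diff_right cis_mult by simp
  then have "lift m \<phi> (x, v) * cis (- (x \<bullet> rvec n)) = cis (x \<bullet> rvec (m - n)) * \<phi> v" for x
    by (simp only: lift_def fst_conv snd_conv mult.assoc mult.left_commute[of "\<phi> v"] mult.commute[of "\<phi> v"]
        flip: \<open>\<And>x. cis (x \<bullet> rvec m) * cis (- (x \<bullet> rvec n)) = cis (x \<bullet> rvec (m - n))\<close>)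
  then have "fcoef n (lift m \<phi>) v = (LINT x|torus. cis (x \<bullet> rvec (m - n))) * \<phi> v / of_real ((2 * pi)\<^sup>2)"
    by (simp only: fcoef_def integral_mult_left_zero)
  also have "\<dots> = (if n = m then \<phi> else (\<lambda>v. 0)) v"
    unfolding integral_torus_cis by auto
  finally show "fcoef n (lift m \<phi>) v = (if n = m then \<phi> else (\<lambda>v. 0)) v" .
qed

lemma inner_lift_lift:
  assumes "\<phi> \<in> L2 circle" "\<psi> \<in> L2 circle"
  shows "l2_inner phase (lift n \<phi>) (lift m \<psi>) =
    (if n = m then of_real ((2 * pi)\<^sup>2) * l2_inner circle \<phi> \<psi> else 0)"
  unfolding inner_lift[OF lift_L2(1)[OF assms(1)] assms(2)] fcoef_lift by (simp add: l2_inner_def)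

lemma fcoef_cong_AE:
  assumes f: "f \<in> L2 phase" "g \<in> L2 phase" and "AE z in phase. f z = g z"
  shows "AE v in circle. fcoef n f v = fcoef n g v"
proof (rule fcoef_unique[OF f(1) fcoef_L2[OF f(2)]])
  fix \<phi> assume \<phi>: "\<phi> \<in> L2 circle"
  have "l2_inner phase f (lift n \<phi>) = l2_inner phase g (lift n \<phi>)"
    by (rule l2_inner_cong_AE) (use assms lift_L2[OF \<phi>] in \<open>auto dest: L2_measurable\<close>)
  then show "l2_inner phase f (lift n \<phi>) = of_real ((2 * pi)\<^sup>2) * l2_inner circle (fcoef n g) \<phi>"
    by (simp only: inner_lift[OF f(2) \<phi>])
qed

text \<open>Only almost everywhere: on a slice that is not integrable the integral has the default
  value 0 and additivity can fail.\<close>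

lemma fcoef_linear:
  assumes f: "f \<in> L2 phase" "g \<in> L2 phase"
  shows "AE v in circle. fcoef n (\<lambda>z. a * f z + b * g z) v = a * fcoef n f v + b * fcoef n g v"
proof (rule fcoef_unique)
  show "(\<lambda>z. a * f z + b * g z) \<in> L2 phase" by (intro L2_add L2_scale f)
  show "(\<lambda>v. a * fcoef n f v + b * fcoef n g v) \<in> L2 circle" by (intro L2_add L2_scale fcoef_L2 f)
  fix \<phi> assume \<phi>: "\<phi> \<in> L2 circle"
  show "l2_inner phase (\<lambda>z. a * f z + b * g z) (lift n \<phi>)
    = of_real ((2 * pi)\<^sup>2) * l2_inner circle (\<lambda>v. a * fcoef n f v + b * fcoef n g v) \<phi>"
    by (simp add: l2_inner_add_left l2_inner_scale_left L2_scale f fcoef_L2 lift_L2 \<phi> inner_lift distrib_left mult.left_commute)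
qed

lemma AE_phase_zero_fcoef:
  assumes f: "f \<in> L2 phase" and z: "\<And>n. AE v in circle. fcoef n f v = 0"
  shows "AE z in phase. f z = 0"
proof (rule AE_phase_zero[OF f])
  fix n :: "int^2" and q :: "real^2 \<Rightarrow> real" assume q: "real_polynomial_function q"
  have qc: "continuous_on S q" for S
    using continuous_real_polymonial_function[OF q] continuous_at_imp_continuous_on by blast
  have "bounded (q ` sphere 0 1)" by (intro compact_imp_bounded compact_continuous_image qc) simp
  then obtain B where B: "\<And>y. y \<in> sphere 0 1 \<Longrightarrow> \<bar>q y\<bar> \<le> B"
    unfolding bounded_iff real_norm_def by blast
  have qL: "(\<lambda>v. complex_of_real (q v)) \<in> L2 circle"
    by (rule circle.L2_bounded[where B = B])
      (use B in \<open>auto simp: space_circle intro!: measurable_circle_continuous continuous_on_of_real qc\<close>)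
  have "(LINT z|phase. f z * (cis (fst z \<bullet> rvec n) * of_real (q (snd z)))) = l2_inner phase f (lift (- n) (\<lambda>v. of_real (q v)))"
    by (simp only: l2_inner_def lift_def rvec_minus inner_minus_right complex_cnj_mult cis_cnj minus_minus complex_cnj_complex_of_real)
  also have "\<dots> = of_real ((2 * pi)\<^sup>2) * l2_inner circle (fcoef (- n) f) (\<lambda>v. of_real (q v))"
    by (rule inner_lift[OF f qL])
  also have "l2_inner circle (fcoef (- n) f) (\<lambda>v. of_real (q v)) = l2_inner circle (\<lambda>v. 0) (\<lambda>v. of_real (q v))"
    by (rule l2_inner_cong_AE) (use z fcoef_L2[OF f] qL in \<open>auto dest: L2_measurable\<close>)
  finally show "(LINT z|phase. f z * (cis (fst z \<bullet> rvec n) * of_real (q (snd z)))) = 0"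
    by (simp add: l2_inner_def)
qed

section \<open>Partial Fourier sums: Bessel, Riesz-Fischer, Parseval\<close>

definition modes :: "nat \<Rightarrow> (int^2) set" where
  "modes K = {n. \<forall>i. \<bar>n $ i\<bar> \<le> int K}"

lemma finite_modes: "finite (modes K)"
proof -
  have "modes K \<subseteq> (\<lambda>(a, b). vector [a, b]) ` ({- int K..int K} \<times> {- int K..int K})"
  proof
    fix n :: "int^2" assume "n \<in> modes K"
    then have "n $ 1 \<in> {- int K..int K}" "n $ 2 \<in> {- int K..int K}"
      unfolding modes_def mem_Collect_eq forall_2 by auto
    moreover have "n = (\<lambda>(a, b). vector [a, b]) (n $ 1, n $ 2)" by (simp add: vec_eq_iff forall_2)
    ultimately show "n \<in> (\<lambda>(a, b). vector [a, b]) ` ({- int K..int K} \<times> {- int K..int K})" by blast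
  qed
  then show ?thesis by (rule finite_subset) simp
qed

lemma modes_mono: "K \<le> L \<Longrightarrow> modes K \<subseteq> modes L"
  unfolding modes_def by (auto intro: order_trans)

lemma in_modes: "\<exists>K. n \<in> modes K"
proof -
  have "\<bar>n $ i\<bar> \<le> int (nat \<bar>n $ 1\<bar> + nat \<bar>n $ 2\<bar>)" for i
    using exhaust_2[of i] by auto
  then show ?thesis unfolding modes_def by blast
qed

definition lsum :: "(int^2) set \<Rightarrow> (int^2 \<Rightarrow> real^2 \<Rightarrow> complex) \<Rightarrow> (real^2) \<times> (real^2) \<Rightarrow> complex" where
  "lsum I \<phi> = (\<lambda>z. \<Sum>n\<in>I. lift n (\<phi> n) z)"

lemma lsum_L2: "(\<And>n. \<phi> n \<in> L2 circle) \<Longrightarrow> lsum I \<phi> \<in> L2 phase"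
  unfolding lsum_def by (intro L2_sum lift_L2)

lemma inner_lsum:
  assumes "f \<in> L2 phase" "\<And>n. \<phi> n \<in> L2 circle"
  shows "l2_inner phase f (lsum I \<phi>) = of_real ((2 * pi)\<^sup>2) * (\<Sum>n\<in>I. l2_inner circle (fcoef n f) (\<phi> n))"
proof -
  have "l2_inner phase (lsum I \<phi>) f = (\<Sum>n\<in>I. l2_inner phase (lift n (\<phi> n)) f)"
    unfolding lsum_def by (rule l2_inner_sum_left) (use assms lift_L2 in auto)
  then have "l2_inner phase f (lsum I \<phi>) = cnj (\<Sum>n\<in>I. l2_inner phase (lift n (\<phi> n)) f)"
    by (subst l2_inner_commute) simp
  also have "\<dots> = (\<Sum>n\<in>I. l2_inner phase f (lift n (\<phi> n)))"
    unfolding cnj_sum by (intro sum.cong refl l2_inner_commute[symmetric])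
  finally show ?thesis by (simp add: inner_lift assms sum_distrib_left)
qed

lemma inner_lsum_lift:
  assumes "\<And>n. \<phi> n \<in> L2 circle" "\<psi> \<in> L2 circle" "finite I"
  shows "l2_inner phase (lsum I \<phi>) (lift m \<psi>) =
    (if m \<in> I then of_real ((2 * pi)\<^sup>2) * l2_inner circle (\<phi> m) \<psi> else 0)"
proof -
  have "l2_inner phase (lsum I \<phi>) (lift m \<psi>) = (\<Sum>n\<in>I. l2_inner phase (lift n (\<phi> n)) (lift m \<psi>))"
    unfolding lsum_def by (rule l2_inner_sum_left) (use assms lift_L2 in auto)
  also have "\<dots> = (\<Sum>n\<in>I. if n = m then of_real ((2 * pi)\<^sup>2) * l2_inner circle (\<phi> n) \<psi> else 0)"
    by (intro sum.cong refl inner_lift_lift assms)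
  also have "\<dots> = (if m \<in> I then of_real ((2 * pi)\<^sup>2) * l2_inner circle (\<phi> m) \<psi> else 0)"
    using assms(3) by (simp add: sum.delta)
  finally show ?thesis .
qed

lemma norm_lsum:
  assumes "\<And>n. \<phi> n \<in> L2 circle" "finite I"
  shows "(l2_norm phase (lsum I \<phi>))\<^sup>2 = (2 * pi)\<^sup>2 * (\<Sum>n\<in>I. (l2_norm circle (\<phi> n))\<^sup>2)"
proof -
  have "complex_of_real ((l2_norm phase (lsum I \<phi>))\<^sup>2) = l2_inner phase (lsum I \<phi>) (lsum I \<phi>)"
    by (rule l2_inner_self[symmetric])
  also have "\<dots> = (\<Sum>n\<in>I. cnj (l2_inner phase (lsum I \<phi>) (lift n (\<phi> n))))"
  proof -
    have "l2_inner phase (lsum I \<phi>) (lsum I \<phi>) = (\<Sum>n\<in>I. l2_inner phase (lift n (\<phi> n)) (lsum I \<phi>))"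
      by (subst lsum_def, rule l2_inner_sum_left) (use assms lift_L2 lsum_L2 in auto)
    then show ?thesis by (subst (asm) l2_inner_commute) simp
  qed
  also have "\<dots> = (\<Sum>n\<in>I. of_real ((2 * pi)\<^sup>2 * (l2_norm circle (\<phi> n))\<^sup>2))"
    by (intro sum.cong refl) (simp add: inner_lsum_lift assms l2_inner_self)
  also have "\<dots> = complex_of_real ((2 * pi)\<^sup>2 * (\<Sum>n\<in>I. (l2_norm circle (\<phi> n))\<^sup>2))"
    by (simp add: sum_distrib_left)
  finally show ?thesis by (simp only: of_real_eq_iff)
qed

lemma lsum_diff:
  assumes "I \<subseteq> J" "finite J"
  shows "lsum J \<phi> z - lsum I \<phi> z = lsum (J - I) \<phi> z"
  unfolding lsum_def by (simp add: sum_diff assms)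

lemma bessel:
  assumes f: "f \<in> L2 phase" and I: "finite I"
  shows "(2 * pi)\<^sup>2 * (\<Sum>n\<in>I. (l2_norm circle (fcoef n f))\<^sup>2) \<le> (l2_norm phase f)\<^sup>2"
proof -
  let ?g = "lsum I (\<lambda>n. fcoef n f)" and ?S = "(2 * pi)\<^sup>2 * (\<Sum>n\<in>I. (l2_norm circle (fcoef n f))\<^sup>2)"
  have g: "?g \<in> L2 phase" by (rule lsum_L2) (rule fcoef_L2[OF f])
  have n: "(l2_norm phase ?g)\<^sup>2 = ?S" by (rule norm_lsum[OF fcoef_L2[OF f] I])
  have "l2_inner phase f ?g = of_real ?S"
    by (simp add: inner_lsum f fcoef_L2 l2_inner_self)
  then have "?S \<le> cmod (l2_inner phase f ?g)" by (simp add: norm_mult norm_power sum_nonneg del: of_real_mult of_real_power of_real_sum)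
  also have "\<dots> \<le> l2_norm phase f * l2_norm phase ?g" by (rule l2_cauchy_schwarz[OF f g])
  finally have "(l2_norm phase ?g)\<^sup>2 \<le> l2_norm phase f * l2_norm phase ?g" using n by simp
  then have "l2_norm phase ?g \<le> l2_norm phase f"
    using l2_norm_nonneg[of phase ?g] l2_norm_nonneg[of phase f]
    by (cases "l2_norm phase ?g = 0") (auto simp: power2_eq_square mult_le_cancel_right)
  then show ?thesis unfolding n[symmetric] by (rule power_mono) simp
qed

text \<open>Orthogonality turns norms of differences of partial sums into differences of the bounded
  increasing real sequence \<open>S\<close>, so the partial sums form a Cauchy sequence. This is the
  source of all functions with prescribed coefficients.\<close>

lemma riesz_fischer:
  assumes \<phi>: "\<And>n. \<phi> n \<in> L2 circle"
    and bd: "\<And>I. finite I \<Longrightarrow> (\<Sum>n\<in>I. (l2_norm circle (\<phi> n))\<^sup>2) \<le> B"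
  shows "\<exists>f\<in>L2 phase. (\<lambda>K. l2_norm phase (\<lambda>z. lsum (modes K) \<phi> z - f z)) \<longlonglongrightarrow> 0 \<and>
    (\<forall>n. AE v in circle. fcoef n f v = \<phi> n v)"
proof -
  define S where "S K = (\<Sum>n\<in>modes K. (l2_norm circle (\<phi> n))\<^sup>2)" for K
  have "convergent S"
  proof (rule Bseq_mono_convergent)
    show "Bseq S" by (rule BseqI'[where K = B]) (use bd[OF finite_modes] in \<open>simp add: S_def sum_nonneg\<close>)
    show "\<forall>m n. m \<le> n \<longrightarrow> S m \<le> S n"
      unfolding S_def by (intro allI impI sum_mono2 finite_modes modes_mono) simp_all
  qed
  then have cau: "Cauchy S" by (rule convergent_Cauchy)
  have diff: "(l2_norm phase (\<lambda>z. lsum (modes L) \<phi> z - lsum (modes K) \<phi> z))\<^sup>2 = (2 * pi)\<^sup>2 * (S L - S K)" if "K \<le> L" for K L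
  proof -
    have "(l2_norm phase (\<lambda>z. lsum (modes L) \<phi> z - lsum (modes K) \<phi> z))\<^sup>2
        = (l2_norm phase (lsum (modes L - modes K) \<phi>))\<^sup>2"
      by (simp add: lsum_diff[OF modes_mono[OF that] finite_modes])
    also have "\<dots> = (2 * pi)\<^sup>2 * (\<Sum>n\<in>modes L - modes K. (l2_norm circle (\<phi> n))\<^sup>2)"
      by (rule norm_lsum[OF \<phi>]) (simp add: finite_modes)
    also have "(\<Sum>n\<in>modes L - modes K. (l2_norm circle (\<phi> n))\<^sup>2) = S L - S K"
      unfolding S_def by (rule sum_diff[OF finite_modes modes_mono[OF that]])
    finally show ?thesis .
  qed
  have abs: "(l2_norm phase (\<lambda>z. lsum (modes L) \<phi> z - lsum (modes K) \<phi> z))\<^sup>2 \<le> (2 * pi)\<^sup>2 * \<bar>S L - S K\<bar>" for K L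
  proof (cases "K \<le> L")
    case True
    then show ?thesis using diff[OF True] by (simp add: mult_left_mono)
  next
    case False
    then have "L \<le> K" by simp
    from diff[OF this] show ?thesis
      by (subst l2_norm_minus_commute) (simp add: mult_left_mono)
  qed
  have "\<exists>f\<in>L2 phase. (\<lambda>K. l2_norm phase (\<lambda>z. lsum (modes K) \<phi> z - f z)) \<longlonglongrightarrow> 0"
  proof (rule l2_complete[OF lsum_L2[OF \<phi>]])
    fix e :: real assume e: "0 < e"
    then have "(e / (2 * pi))\<^sup>2 > 0" using pi_gt_zero by simp
    from CauchyD[OF cau this] obtain N where N: "\<And>m n. N \<le> m \<Longrightarrow> N \<le> n \<Longrightarrow> \<bar>S m - S n\<bar> < (e / (2 * pi))\<^sup>2"
      unfolding real_norm_def by blast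
    have "l2_norm phase (\<lambda>z. lsum (modes m) \<phi> z - lsum (modes n) \<phi> z) < e" if "m \<ge> N" "n \<ge> N" for m n
    proof (rule power2_less_imp_less)
      have "(2 * pi)\<^sup>2 * \<bar>S m - S n\<bar> < (2 * pi)\<^sup>2 * (e / (2 * pi))\<^sup>2"
        by (rule mult_strict_left_mono[OF N[OF that]]) simp
      also have "\<dots> = e\<^sup>2" by (simp add: power_divide)
      finally show "(l2_norm phase (\<lambda>z. lsum (modes m) \<phi> z - lsum (modes n) \<phi> z))\<^sup>2 < e\<^sup>2"
        using abs[of m n] by linarith
    qed (use e in simp)
    then show "\<exists>N. \<forall>m\<ge>N. \<forall>n\<ge>N. l2_norm phase (\<lambda>z. lsum (modes m) \<phi> z - lsum (modes n) \<phi> z) < e" by blast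
  qed
  then obtain f where f: "f \<in> L2 phase" and lim: "(\<lambda>K. l2_norm phase (\<lambda>z. lsum (modes K) \<phi> z - f z)) \<longlonglongrightarrow> 0"
    by blast
  have "AE v in circle. fcoef n f v = \<phi> n v" for n
  proof (rule fcoef_unique[OF f \<phi>])
    fix \<psi> assume \<psi>: "\<psi> \<in> L2 circle"
    have 1: "(\<lambda>K. l2_inner phase (lsum (modes K) \<phi>) (lift n \<psi>)) \<longlonglongrightarrow> l2_inner phase f (lift n \<psi>)"
      by (rule tendsto_l2_inner[OF lsum_L2[OF \<phi>] f lift_L2(1)[OF \<psi>] lim])
    obtain K0 where K0: "n \<in> modes K0" using in_modes by blast
    have "\<forall>\<^sub>F K in sequentially. l2_inner phase (lsum (modes K) \<phi>) (lift n \<psi>) = of_real ((2 * pi)\<^sup>2) * l2_inner circle (\<phi> n) \<psi>"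
      using eventually_ge_at_top[of K0]
    proof eventually_elim
      fix K assume "K0 \<le> K"
      then have "n \<in> modes K" using K0 modes_mono by blast
      then show "l2_inner phase (lsum (modes K) \<phi>) (lift n \<psi>) = of_real ((2 * pi)\<^sup>2) * l2_inner circle (\<phi> n) \<psi>"
        using inner_lsum_lift[of \<phi>, OF \<phi> \<psi> finite_modes, of K n] by simp
    qed
    from tendsto_cong[THEN iffD1, OF this 1]
    show "l2_inner phase f (lift n \<psi>) = of_real ((2 * pi)\<^sup>2) * l2_inner circle (\<phi> n) \<psi>"
      by (rule LIMSEQ_unique[OF _ tendsto_const])
  qed
  with f lim show ?thesis by blast
qed

text \<open>By Bessel the coefficients of \<open>f\<close> are square summable, so their Fourier
  sums converge to some \<open>g\<close> with the same coefficients, and completeness of the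
  trigonometric system identifies \<open>g\<close> with \<open>f\<close>.\<close>

lemma fourier_expansion:
  assumes f: "f \<in> L2 phase"
  shows "(\<lambda>K. l2_norm phase (\<lambda>z. lsum (modes K) (\<lambda>n. fcoef n f) z - f z)) \<longlonglongrightarrow> 0"
proof -
  let ?\<phi> = "\<lambda>n. fcoef n f"
  have c: "\<And>n. ?\<phi> n \<in> L2 circle" by (rule fcoef_L2[OF f])
  have "(\<Sum>n\<in>I. (l2_norm circle (?\<phi> n))\<^sup>2) \<le> (l2_norm phase f)\<^sup>2 / (2 * pi)\<^sup>2" if "finite I" for I
    using bessel[OF f that] by (simp add: pos_le_divide_eq mult.commute)
  from riesz_fischer[of ?\<phi>, OF c this] obtain g where g: "g \<in> L2 phase"
    and lim: "(\<lambda>K. l2_norm phase (\<lambda>z. lsum (modes K) ?\<phi> z - g z)) \<longlonglongrightarrow> 0"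
    and gn: "\<And>n. AE v in circle. fcoef n g v = fcoef n f v" by blast
  have "AE v in circle. fcoef n (\<lambda>z. 1 * g z + (-1) * f z) v = 0" for n
    using fcoef_linear[OF g f, of n 1 "-1"] gn[of n] by eventually_elim simp
  then have "AE z in phase. 1 * g z + (-1) * f z = 0"
    by (intro AE_phase_zero_fcoef L2_add L2_scale f g)
  then have fg: "AE z in phase. g z = f z" by eventually_elim simp
  have "l2_norm phase (\<lambda>z. lsum (modes K) ?\<phi> z - g z) = l2_norm phase (\<lambda>z. lsum (modes K) ?\<phi> z - f z)" for K
  proof (rule l2_norm_cong_AE)
    show "(\<lambda>z. lsum (modes K) ?\<phi> z - g z) \<in> borel_measurable phase"
      "(\<lambda>z. lsum (modes K) ?\<phi> z - f z) \<in> borel_measurable phase"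
      by (intro L2_measurable L2_diff lsum_L2 c f g)+
    show "AE z in phase. lsum (modes K) ?\<phi> z - g z = lsum (modes K) ?\<phi> z - f z"
      using fg by eventually_elim simp
  qed
  then show ?thesis using lim by simp
qed

lemma parseval:
  assumes f: "f \<in> L2 phase"
  shows "(\<lambda>K. (2 * pi)\<^sup>2 * (\<Sum>n\<in>modes K. (l2_norm circle (fcoef n f))\<^sup>2)) \<longlonglongrightarrow> (l2_norm phase f)\<^sup>2"
proof -
  have c: "\<And>n. fcoef n f \<in> L2 circle" by (rule fcoef_L2[OF f])
  have "(\<lambda>K. (l2_norm phase (lsum (modes K) (\<lambda>n. fcoef n f)))\<^sup>2) \<longlonglongrightarrow> (l2_norm phase f)\<^sup>2"
    by (intro tendsto_power tendsto_l2_norm[OF lsum_L2[OF c] f fourier_expansion[OF f]])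
  then show ?thesis by (simp only: norm_lsum[OF c finite_modes])
qed

lemma norm_le_by_modes:
  assumes f: "f \<in> L2 phase" and g: "g \<in> L2 phase" and c: "0 \<le> c"
    and le: "\<And>n. l2_norm circle (fcoef n f) \<le> c * l2_norm circle (fcoef n g)"
  shows "l2_norm phase f \<le> c * l2_norm phase g"
proof -
  have "(l2_norm phase f)\<^sup>2 \<le> c\<^sup>2 * (l2_norm phase g)\<^sup>2"
  proof (rule LIMSEQ_le[OF parseval[OF f] tendsto_mult_left[OF parseval[OF g]]])
    have "(\<Sum>n\<in>modes K. (l2_norm circle (fcoef n f))\<^sup>2) \<le> c\<^sup>2 * (\<Sum>n\<in>modes K. (l2_norm circle (fcoef n g))\<^sup>2)" for K
      unfolding sum_distrib_left power_mult_distrib[symmetric] by (intro sum_mono power_mono le) simp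
    then have "(2 * pi)\<^sup>2 * (\<Sum>n\<in>modes K. (l2_norm circle (fcoef n f))\<^sup>2)
        \<le> (2 * pi)\<^sup>2 * (c\<^sup>2 * (\<Sum>n\<in>modes K. (l2_norm circle (fcoef n g))\<^sup>2))" for K
      by (intro mult_left_mono) simp_all
    then show "\<exists>N. \<forall>K\<ge>N. (2 * pi)\<^sup>2 * (\<Sum>n\<in>modes K. (l2_norm circle (fcoef n f))\<^sup>2)
        \<le> c\<^sup>2 * ((2 * pi)\<^sup>2 * (\<Sum>n\<in>modes K. (l2_norm circle (fcoef n g))\<^sup>2))"
      by (simp add: mult.left_commute)
  qed
  then have "(l2_norm phase f)\<^sup>2 \<le> (c * l2_norm phase g)\<^sup>2" by (simp add: power_mult_distrib)
  then show ?thesis by (rule power2_le_imp_le) (simp add: c)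
qed

lemma norm_sq_le_by_modes:
  assumes f: "f \<in> L2 phase" and g: "g \<in> L2 phase" and h: "h \<in> L2 phase"
    and le: "\<And>n. c * (l2_norm circle (fcoef n f))\<^sup>2 \<le> (l2_norm circle (fcoef n g))\<^sup>2 + (l2_norm circle (fcoef n h))\<^sup>2"
  shows "c * (l2_norm phase f)\<^sup>2 \<le> (l2_norm phase g)\<^sup>2 + (l2_norm phase h)\<^sup>2"
proof (rule LIMSEQ_le[OF tendsto_mult_left[OF parseval[OF f]] tendsto_add[OF parseval[OF g] parseval[OF h]]])
  have "c * (\<Sum>n\<in>modes K. (l2_norm circle (fcoef n f))\<^sup>2)
    \<le> (\<Sum>n\<in>modes K. (l2_norm circle (fcoef n g))\<^sup>2) + (\<Sum>n\<in>modes K. (l2_norm circle (fcoef n h))\<^sup>2)" for K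
    unfolding sum_distrib_left sum.distrib[symmetric] by (intro sum_mono le)
  then have "(2 * pi)\<^sup>2 * (c * (\<Sum>n\<in>modes K. (l2_norm circle (fcoef n f))\<^sup>2))
    \<le> (2 * pi)\<^sup>2 * ((\<Sum>n\<in>modes K. (l2_norm circle (fcoef n g))\<^sup>2) + (\<Sum>n\<in>modes K. (l2_norm circle (fcoef n h))\<^sup>2))" for K
    by (intro mult_left_mono) simp_all
  then show "\<exists>N. \<forall>K\<ge>N. c * ((2 * pi)\<^sup>2 * (\<Sum>n\<in>modes K. (l2_norm circle (fcoef n f))\<^sup>2))
    \<le> (2 * pi)\<^sup>2 * (\<Sum>n\<in>modes K. (l2_norm circle (fcoef n g))\<^sup>2) + (2 * pi)\<^sup>2 * (\<Sum>n\<in>modes K. (l2_norm circle (fcoef n h))\<^sup>2)"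
    by (simp only: mult.left_commute[of c] distrib_left) blast
qed

section \<open>Test functions\<close>

text \<open>A class that contains the functions used for testing and is closed under directional
  derivatives, so that smoothness of every order follows by induction on the order.\<close>

inductive elem :: "('a::euclidean_space \<Rightarrow> complex) \<Rightarrow> bool" where
  elem_const: "elem (\<lambda>z. c)"
| elem_linear: "bounded_linear l \<Longrightarrow> elem (\<lambda>z. of_real (l z))"
| elem_cis: "bounded_linear l \<Longrightarrow> elem (\<lambda>z. cis (l z))"
| elem_add: "elem f \<Longrightarrow> elem g \<Longrightarrow> elem (\<lambda>z. f z + g z)"
| elem_mult: "elem f \<Longrightarrow> elem g \<Longrightarrow> elem (\<lambda>z. f z * g z)"

lemma elem_has_derivative:
  "elem f \<Longrightarrow> \<exists>f'. (\<forall>z. (f has_derivative f' z) (at z)) \<and> (\<forall>w. elem (\<lambda>z. f' z w))"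
proof (induction rule: elem.induct)
  case (elem_const c)
  show ?case by (intro exI[of _ "\<lambda>z w. 0"]) (simp add: elem.elem_const)
next
  case (elem_linear l)
  then have "((\<lambda>z. complex_of_real (l z)) has_derivative (\<lambda>w. of_real (l w))) (at z)" for z
    by (intro has_derivative_of_real bounded_linear_imp_has_derivative)
  then show ?case by (intro exI[of _ "\<lambda>z w. complex_of_real (l w)"]) (simp add: elem.elem_const)
next
  case (elem_cis l)
  then have "((\<lambda>z. cis (l z)) has_derivative (\<lambda>w. l w *\<^sub>R (\<i> * cis (l z)))) (at z)" for z
    by (intro has_derivative_cis bounded_linear_imp_has_derivative)
  moreover have "elem (\<lambda>z. l w *\<^sub>R (\<i> * cis (l z)))" for w
    unfolding scaleR_conv_of_real by (intro elem.elem_mult elem.elem_const elem.elem_cis elem_cis)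
  ultimately show ?case by (intro exI[of _ "\<lambda>z w. l w *\<^sub>R (\<i> * cis (l z))"]) simp
next
  case (elem_add f g)
  then obtain f' g' where "\<And>z. (f has_derivative f' z) (at z)" "\<And>w. elem (\<lambda>z. f' z w)"
    "\<And>z. (g has_derivative g' z) (at z)" "\<And>w. elem (\<lambda>z. g' z w)" by blast
  then show ?case
    by (intro exI[of _ "\<lambda>z w. f' z w + g' z w"] conjI allI has_derivative_add elem.elem_add) simp_all
next
  case (elem_mult f g)
  then obtain f' g' where *: "\<And>z. (f has_derivative f' z) (at z)" "\<And>w. elem (\<lambda>z. f' z w)"
    "\<And>z. (g has_derivative g' z) (at z)" "\<And>w. elem (\<lambda>z. g' z w)" by blast
  have "elem (\<lambda>z. f z * g' z w + f' z w * g z)" for w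
    by (intro elem.elem_add elem.elem_mult elem_mult *)
  then show ?case
    using has_derivative_mult[OF *(1) *(3)] by (intro exI[of _ "\<lambda>z w. f z * g' z w + f' z w * g z"]) simp
qed

lemma elem_Ck: "elem f \<Longrightarrow> Ck k f"
proof (induction k arbitrary: f)
  case 0
  obtain f' where "\<And>z. (f has_derivative f' z) (at z)" using elem_has_derivative[OF 0] by blast
  then have "isCont f z" for z using has_derivative_continuous by blast
  then show ?case by (simp add: continuous_at_imp_continuous_on)
next
  case (Suc k)
  obtain f' where f': "\<And>z. (f has_derivative f' z) (at z)" and e: "\<And>w. elem (\<lambda>z. f' z w)"
    using elem_has_derivative[OF Suc.prems] by blast
  have "f differentiable_on UNIV"
    using f' by (auto simp: differentiable_on_def differentiable_def intro: has_derivative_at_withinI)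
  moreover have "frechet_derivative f (at z) = f' z" for z
    using frechet_derivative_at[OF f'] by simp
  ultimately show ?case using Suc.IH[OF e] by simp
qed

lemma elem_polynomial:
  assumes "real_polynomial_function q" "bounded_linear L"
  shows "elem (\<lambda>z. of_real (q (L z)))"
  using assms(1)
proof (induction rule: real_polynomial_function.induct)
  case (linear l)
  show ?case by (rule elem_linear) (rule bounded_linear_compose[OF linear assms(2)])
next
  case (const c)
  show ?case by (rule elem_const)
next
  case (add f g)
  then show ?case unfolding of_real_add by (intro elem_add)
next
  case (mult f g)
  then show ?case unfolding of_real_mult by (intro elem_mult)
qed

text \<open>The weak derivatives pair functions without complex conjugation; the sign in the
  exponent makes pairing with \<open>mono_test n q\<close> pick out the coefficient with index
  \<open>n\<close>.\<close>

definition mono_test :: "int^2 \<Rightarrow> (real^2 \<Rightarrow> real) \<Rightarrow> (real^2) \<times> (real^2) \<Rightarrow> complex" where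
  "mono_test n q = (\<lambda>z. cis (- (fst z \<bullet> rvec n)) * of_real (q (snd z)))"

lemma test_fun_mono:
  assumes q: "real_polynomial_function q"
  shows "test_fun (mono_test n q)"
proof -
  have "bounded_linear (\<lambda>z :: (real^2) \<times> (real^2). - (fst z \<bullet> rvec n))"
    by (intro bounded_linear_minus bounded_linear_compose[OF bounded_linear_inner_left bounded_linear_fst])
  then have "elem (mono_test n q)"
    unfolding mono_test_def by (intro elem_mult elem_cis elem_polynomial[OF q bounded_linear_snd])
  moreover have "mono_test n q (x + axis i (2 * pi), v) = mono_test n q (x, v)" for x v i
  proof -
    have "cis (- ((x + axis i (2 * pi)) \<bullet> rvec n)) = cis (- (x \<bullet> rvec n)) * cis (2 * pi * of_int (- (n $ i)))"
      by (simp add: cis_mult inner_add_left inner_axis' algebra_simps)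
    also have "cis (2 * pi * real_of_int (- (n $ i))) = 1" by (rule cis_multiple_2pi) simp
    finally show ?thesis by (simp add: mono_test_def)
  qed
  ultimately show ?thesis unfolding test_fun_def by (auto intro: elem_Ck)
qed

lemma mono_test_frechet:
  assumes q: "real_polynomial_function q"
  shows "frechet_derivative (\<lambda>z. c * mono_test n q z) (at z) (w, 0) = c * (- \<i> * of_real (w \<bullet> rvec n)) * mono_test n q z"
proof -
  obtain q' where q': "(q has_derivative q') (at (snd z))"
    using differentiable_at_real_polynomial_function[OF q] by (auto simp: differentiable_def)
  have 1: "((\<lambda>z. of_real (q (snd z))) has_derivative (\<lambda>h. complex_of_real (q' (snd h)))) (at z)"
    using has_derivative_compose[OF has_derivative_snd[OF has_derivative_ident] q']
    by (intro has_derivative_of_real) simp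
  have "bounded_linear (\<lambda>z :: (real^2) \<times> (real^2). - (fst z \<bullet> rvec n))"
    by (intro bounded_linear_minus bounded_linear_compose[OF bounded_linear_inner_left bounded_linear_fst])
  then have 2: "((\<lambda>z. cis (- (fst z \<bullet> rvec n))) has_derivative
      (\<lambda>h. (- (fst h \<bullet> rvec n)) *\<^sub>R (\<i> * cis (- (fst z \<bullet> rvec n))))) (at z)"
    by (intro has_derivative_cis bounded_linear_imp_has_derivative)
  have 3: "((\<lambda>z. c * mono_test n q z) has_derivative (\<lambda>h. c * (cis (- (fst z \<bullet> rvec n)) * of_real (q' (snd h))
      + (- (fst h \<bullet> rvec n)) *\<^sub>R (\<i> * cis (- (fst z \<bullet> rvec n))) * of_real (q (snd z))))) (at z)"
    unfolding mono_test_def by (intro has_derivative_mult_right has_derivative_mult 1 2)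
  have "q' 0 = 0" using has_derivative_bounded_linear[OF q'] by (rule linear_simps(3))
  then show ?thesis unfolding frechet_derivative_at[OF 3, symmetric]
    by (simp add: mono_test_def scaleR_conv_of_real)
qed

section \<open>Integration by parts on the torus\<close>

lemma bounded_continuous_cbox:
  fixes f :: "real^2 \<Rightarrow> complex"
  assumes "continuous_on UNIV f"
  shows "integrable torus f"
proof -
  have "bounded (f ` cbox (vec2 0 0) (vec2 (2 * pi) (2 * pi)))"
    by (intro compact_imp_bounded compact_continuous_image continuous_on_subset[OF assms] compact_cbox subset_UNIV)
  then obtain B where B: "\<And>x. x \<in> cbox (vec2 0 0) (vec2 (2 * pi) (2 * pi)) \<Longrightarrow> cmod (f x) \<le> B"
    unfolding bounded_iff by blast
  show ?thesis
  proof (rule torus.integrable_const_bound[where B = B])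
    show "AE x in torus. cmod (f x) \<le> B"
      by (rule AE_I2, rule B) (auto simp: space_torus mem_box_cart forall_2 less_imp_le)
    show "f \<in> borel_measurable torus"
      by (intro borel_measurable_torus borel_measurable_continuous_onI assms)
  qed
qed

lemma L2_phase_continuous:
  fixes f :: "(real^2) \<times> (real^2) \<Rightarrow> complex"
  assumes "continuous_on UNIV f"
  shows "f \<in> L2 phase"
proof -
  let ?K = "cbox (vec2 0 0) (vec2 (2 * pi) (2 * pi)) \<times> sphere (0::real^2) 1"
  have "bounded (f ` ?K)"
    by (intro compact_imp_bounded compact_continuous_image continuous_on_subset[OF assms]
        compact_Times compact_cbox compact_sphere subset_UNIV)
  then obtain B where B: "\<And>x. x \<in> ?K \<Longrightarrow> cmod (f x) \<le> B"
    unfolding bounded_iff by blast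
  show ?thesis
    by (rule phase.L2_bounded[OF measurable_phase_continuous[OF assms], of B], rule B)
      (auto simp: space_phase mem_box_cart forall_2 less_imp_le)
qed

text \<open>Along a coordinate line the integral of the derivative is the difference of two values
  one period apart, hence zero; a general direction follows by linearity.\<close>

lemma integral_torus_derivative:
  fixes \<Psi> :: "real^2 \<Rightarrow> complex"
  assumes D: "\<And>x. (\<Psi> has_derivative D x) (at x)" and cont: "\<And>w. continuous_on UNIV (\<lambda>x. D x w)"
    and per: "\<And>x i. \<Psi> (x + axis i (2 * pi)) = \<Psi> x"
  shows "(LINT x|torus. D x w) = 0"
proof -
  have lin: "linear (D x)" for x
    using has_derivative_bounded_linear[OF D] by (rule bounded_linear.linear)
  have line: "((\<lambda>t. \<Psi> (p + t *\<^sub>R e)) has_vector_derivative D (p + t *\<^sub>R e) e) (at t)" for p e t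
  proof -
    have "((\<lambda>t. p + t *\<^sub>R e) has_derivative (\<lambda>h. h *\<^sub>R e)) (at t)"
      by (auto intro!: derivative_eq_intros)
    from has_derivative_compose[OF this D]
    show ?thesis by (simp add: has_vector_derivative_def linear_scale[OF lin])
  qed
  have int: "integrable torus (\<lambda>x. D x e)" for e by (rule bounded_continuous_cbox[OF cont])
  have ax1: "vec2 a b = vec2 0 b + a *\<^sub>R axis 1 1" and ax2: "vec2 a b = vec2 a 0 + b *\<^sub>R axis 2 1" for a b
    by (simp_all add: vec_eq_iff forall_2 axis_def)
  have pw: "p + (2 * pi) *\<^sub>R axis i 1 = p + axis i (2 * pi)" for p :: "real^2" and i
    by (simp add: vec_eq_iff axis_def)
  have c1: "continuous_on UNIV (\<lambda>t. D (p + t *\<^sub>R e) e)" for p e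
    by (rule continuous_on_compose2[OF cont]) (auto intro!: continuous_intros)
  have z: "(LINT t|period. D (p + t *\<^sub>R axis i 1) (axis i 1)) = 0" for p i
  proof -
    have "(LINT t|period. D (p + t *\<^sub>R axis i 1) (axis i 1)) = \<Psi> (p + (2 * pi) *\<^sub>R axis i 1) - \<Psi> (p + 0 *\<^sub>R axis i 1)"
      by (rule integral_period_FTC[OF line c1])
    then show ?thesis by (simp add: pw per)
  qed
  have "(LINT x|torus. D x (axis 1 1)) = (LINT b|period. LINT a|period. D (vec2 0 b + a *\<^sub>R axis 1 1) (axis 1 1))"
    unfolding torus_Fubini(2)[OF int] by (subst ax1) (rule refl)
  then have z1: "(LINT x|torus. D x (axis 1 1)) = 0" by (simp only: z) simp
  have "(LINT x|torus. D x (axis 2 1)) = (LINT a|period. LINT b|period. D (vec2 a 0 + b *\<^sub>R axis 2 1) (axis 2 1))"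
    unfolding torus_Fubini(1)[OF int] by (subst ax2) (rule refl)
  then have z2: "(LINT x|torus. D x (axis 2 1)) = 0" by (simp only: z) simp
  have w: "w = w $ 1 *\<^sub>R axis 1 1 + w $ 2 *\<^sub>R axis 2 1" by (simp add: vec_eq_iff forall_2 axis_def)
  have "D x w = w $ 1 *\<^sub>R D x (axis 1 1) + w $ 2 *\<^sub>R D x (axis 2 1)" for x
    by (subst w) (simp only: linear_add[OF lin] linear_scale[OF lin])
  then show ?thesis using int z1 z2 by simp
qed

lemma Ck_continuous_frechet: "Ck (Suc k) \<psi> \<Longrightarrow> continuous_on UNIV (\<lambda>z. frechet_derivative \<psi> (at z) w)"
  by (cases k) (auto simp: differentiable_imp_continuous_on)

lemma Ck_has_derivative: "Ck (Suc k) \<psi> \<Longrightarrow> (\<psi> has_derivative frechet_derivative \<psi> (at z)) (at z)"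
  by (auto simp: differentiable_on_def frechet_derivative_works)

text \<open>Integration by parts against the character. The direction \<open>w\<close> may depend on
  the velocity, so one statement covers both the partial derivatives and
  \<open>v_grad\<close>.\<close>

lemma fcoef_derivative:
  assumes C: "Ck (Suc 0) \<psi>" and per: "\<And>x v i. \<psi> (x + axis i (2 * pi), v) = \<psi> (x, v)"
  shows "fcoef n (\<lambda>z. frechet_derivative \<psi> (at z) (w (snd z), 0)) v = \<i> * of_real (w v \<bullet> rvec n) * fcoef n \<psi> v"
proof -
  let ?E = "\<lambda>x. cis (- (x \<bullet> rvec n))"
  let ?D = "\<lambda>x h. \<psi> (x, v) * ((- (h \<bullet> rvec n)) *\<^sub>R (\<i> * ?E x)) + frechet_derivative \<psi> (at (x, v)) (h, 0) * ?E x"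
  note d = Ck_has_derivative[OF C] and fc = Ck_continuous_frechet[OF C]
  have \<psi>c: "continuous_on UNIV (\<lambda>x. \<psi> (x, v))"
  proof (rule continuous_on_compose2[where g = \<psi> and f = "\<lambda>x. (x, v)" and t = UNIV])
    show "continuous_on UNIV \<psi>" using C by (simp add: differentiable_imp_continuous_on)
  qed (auto intro!: continuous_intros)
  have fc': "continuous_on UNIV (\<lambda>x. frechet_derivative \<psi> (at (x, v)) h)" for h
    by (rule continuous_on_compose2[OF fc]) (auto intro!: continuous_intros)
  have Ec: "continuous_on UNIV ?E" by (intro continuous_intros)
  have pd: "((\<lambda>x. (x, v)) has_derivative (\<lambda>h. (h, 0))) (at x)" for x
    by (auto intro!: derivative_eq_intros)
  have "bounded_linear (\<lambda>x :: real^2. - (x \<bullet> rvec n))"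
    by (intro bounded_linear_minus bounded_linear_inner_left)
  then have Ed: "(?E has_derivative (\<lambda>h. (- (h \<bullet> rvec n)) *\<^sub>R (\<i> * ?E x))) (at x)" for x
    by (intro has_derivative_cis bounded_linear_imp_has_derivative)
  have z0: "(LINT x|torus. ?D x (w v)) = 0"
  proof (rule integral_torus_derivative[where D = ?D and w = "w v" and \<Psi> = "\<lambda>x. \<psi> (x, v) * ?E x"])
    show "((\<lambda>x. \<psi> (x, v) * ?E x) has_derivative ?D x) (at x)" for x
      by (rule has_derivative_mult[OF has_derivative_compose[OF pd d] Ed])
    show "continuous_on UNIV (\<lambda>x. ?D x h)" for h by (intro continuous_intros \<psi>c fc')
    fix x i
    have "?E (x + axis i (2 * pi)) = ?E x * cis (2 * pi * of_int (- (n $ i)))"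
      by (simp add: cis_mult inner_add_left inner_axis' algebra_simps)
    also have "cis (2 * pi * real_of_int (- (n $ i))) = 1" by (rule cis_multiple_2pi) simp
    finally show "\<psi> (x + axis i (2 * pi), v) * ?E (x + axis i (2 * pi)) = \<psi> (x, v) * ?E x"
      by (simp add: per)
  qed
  have eqD: "?D x (w v) = (- \<i> * of_real (w v \<bullet> rvec n)) * (\<psi> (x, v) * ?E x) + frechet_derivative \<psi> (at (x, v)) (w v, 0) * ?E x" for x
    by (simp add: scaleR_conv_of_real)
  have sp: "(LINT x|torus. (- \<i> * of_real (w v \<bullet> rvec n)) * (\<psi> (x, v) * ?E x) + frechet_derivative \<psi> (at (x, v)) (w v, 0) * ?E x)
     = (- \<i> * of_real (w v \<bullet> rvec n)) * (LINT x|torus. \<psi> (x, v) * ?E x) + (LINT x|torus. frechet_derivative \<psi> (at (x, v)) (w v, 0) * ?E x)"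
  proof (subst Bochner_Integration.integral_add)
    show "integrable torus (\<lambda>x. (- \<i> * of_real (w v \<bullet> rvec n)) * (\<psi> (x, v) * ?E x))"
      by (intro bounded_continuous_cbox continuous_on_mult continuous_on_const \<psi>c Ec)
    show "integrable torus (\<lambda>x. frechet_derivative \<psi> (at (x, v)) (w v, 0) * ?E x)"
      by (intro bounded_continuous_cbox continuous_on_mult fc' Ec)
  qed (simp only: integral_mult_right_zero)
  have "(- \<i> * of_real (w v \<bullet> rvec n)) * (LINT x|torus. \<psi> (x, v) * ?E x)
      + (LINT x|torus. frechet_derivative \<psi> (at (x, v)) (w v, 0) * ?E x) = 0"
    using z0 unfolding eqD sp .
  then have "(LINT x|torus. frechet_derivative \<psi> (at (x, v)) (w v, 0) * ?E x)
      = \<i> * of_real (w v \<bullet> rvec n) * (LINT x|torus. \<psi> (x, v) * ?E x)"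
    by (simp add: eq_neg_iff_add_eq_0[symmetric] add.commute)
  then show ?thesis by (simp add: fcoef_def)
qed

lemma fcoef_cnj: "fcoef n (\<lambda>z. cnj (f z)) v = cnj (fcoef (- n) f v)"
proof -
  have "(LINT x|torus. cnj (f (x, v)) * cis (- (x \<bullet> rvec n))) = (LINT x|torus. cnj (f (x, v) * cis (- (x \<bullet> rvec (- n)))))"
    unfolding rvec_minus by (simp add: cis_cnj)
  then show ?thesis unfolding fcoef_def Bochner_Integration.integral_cnj by simp
qed

lemma v_grad_continuous:
  assumes "Ck (Suc k) \<psi>" shows "continuous_on UNIV (v_grad \<psi>)"
proof -
  have "v_grad \<psi> z = snd z $ 1 *\<^sub>R frechet_derivative \<psi> (at z) (axis 1 1, 0)
      + snd z $ 2 *\<^sub>R frechet_derivative \<psi> (at z) (axis 2 1, 0)" for z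
  proof -
    have lin: "linear (frechet_derivative \<psi> (at z))"
      using has_derivative_bounded_linear[OF Ck_has_derivative[OF assms]] by (rule bounded_linear.linear)
    have w: "(snd z, 0) = snd z $ 1 *\<^sub>R (axis 1 1, 0) + snd z $ 2 *\<^sub>R (axis 2 1, 0 :: real^2)"
      by (simp add: vec_eq_iff forall_2 axis_def)
    have "v_grad \<psi> z = frechet_derivative \<psi> (at z) (snd z, 0)" by (simp add: v_grad_def case_prod_unfold)
    then show ?thesis by (subst (asm) w) (simp only: linear_add[OF lin] linear_scale[OF lin])
  qed
  then have "v_grad \<psi> = (\<lambda>z. snd z $ 1 *\<^sub>R frechet_derivative \<psi> (at z) (axis 1 1, 0)
      + snd z $ 2 *\<^sub>R frechet_derivative \<psi> (at z) (axis 2 1, 0))" by blast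
  then show ?thesis by (simp only:) (intro continuous_intros Ck_continuous_frechet[OF assms])
qed

lemma test_fun_dx:
  assumes "test_fun \<psi>" shows "test_fun (dx i \<psi>)"
  unfolding test_fun_def
proof (intro conjI allI)
  fix k
  have "Ck (Suc k) \<psi>" using assms unfolding test_fun_def by blast
  then show "Ck k (dx i \<psi>)" by (simp add: dx_def)
next
  fix x v j
  have C: "Ck (Suc 0) \<psi>" using assms unfolding test_fun_def by blast
  have "((\<lambda>z. \<psi> (z + (axis j (2 * pi), 0))) has_derivative frechet_derivative \<psi> (at ((x, v) + (axis j (2 * pi), 0)))) (at (x, v))"
  proof (rule has_derivative_compose[OF _ Ck_has_derivative[OF C]])
    show "((\<lambda>z. z + (axis j (2 * pi), 0)) has_derivative (\<lambda>h. h)) (at (x, v))"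
      by (auto intro!: derivative_eq_intros)
  qed
  moreover have "(\<lambda>z. \<psi> (z + (axis j (2 * pi), 0))) = \<psi>"
    using assms by (auto simp: test_fun_def)
  ultimately have "(\<psi> has_derivative frechet_derivative \<psi> (at (x + axis j (2 * pi), v))) (at (x, v))" by simp
  from frechet_derivative_at[OF this] show "dx i \<psi> (x + axis j (2 * pi), v) = dx i \<psi> (x, v)"
    by (simp add: dx_def)
qed

section \<open>Weak transport derivative as a Fourier multiplier\<close>

lemma inner_lsum_limit:
  assumes f: "f \<in> L2 phase" and h: "h \<in> L2 phase"
  shows "(\<lambda>K. of_real ((2 * pi)\<^sup>2) * (\<Sum>n\<in>modes K. l2_inner circle (fcoef n f) (fcoef n h))) \<longlonglongrightarrow> l2_inner phase f h"
proof -
  have c: "\<And>n. fcoef n f \<in> L2 circle" by (rule fcoef_L2[OF f])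
  have "l2_inner phase (lsum (modes K) (\<lambda>n. fcoef n f)) h
      = of_real ((2 * pi)\<^sup>2) * (\<Sum>n\<in>modes K. l2_inner circle (fcoef n f) (fcoef n h))" for K
    by (subst l2_inner_commute, subst inner_lsum[OF h c], subst (2) l2_inner_commute) simp
  then show ?thesis
    using tendsto_l2_inner[OF lsum_L2[OF c] f h fourier_expansion[OF f]] by simp
qed

definition v_dot :: "int^2 \<Rightarrow> real^2 \<Rightarrow> complex" where
  "v_dot n v = of_real (v \<bullet> rvec n)"

lemma v_dot_measurable: "v_dot n \<in> borel_measurable circle"
  unfolding v_dot_def by (intro measurable_circle_continuous continuous_intros)

lemma v_dot_bound: "v \<in> sphere 0 1 \<Longrightarrow> cmod (v_dot n v) \<le> norm (rvec n)"
  using Cauchy_Schwarz_ineq2[of v "rvec n"] by (simp add: v_dot_def)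

lemma v_dot_L2: "\<phi> \<in> L2 circle \<Longrightarrow> (\<lambda>v. v_dot n v * \<phi> v) \<in> L2 circle"
  by (rule L2_bounded_mult[OF _ v_dot_measurable v_dot_bound]) (simp_all add: space_circle)

lemma inner_v_dot:
  "l2_inner circle (\<lambda>v. v_dot n v * \<phi> v) \<psi> = l2_inner circle \<phi> (\<lambda>v. v_dot n v * \<psi> v)"
  unfolding l2_inner_def by (rule Bochner_Integration.integral_cong) (simp_all add: v_dot_def)

text \<open>In every mode transport is multiplication by i times a real function, which is skew; the
  modes are summed by Parseval in its inner product form. It yields the adjoint of
  \<open>J_op\<close> and one half of the description of the weak derivative.\<close>

lemma inner_skew:
  assumes f: "f \<in> L2 phase" and g: "g \<in> L2 phase" and h: "h \<in> L2 phase" and k: "k \<in> L2 phase"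
    and gf: "\<And>n. AE v in circle. fcoef n g v = \<i> * (v_dot n v * fcoef n f v)"
    and hk: "\<And>n. AE v in circle. fcoef n h v = \<i> * (v_dot n v * fcoef n k v)"
  shows "l2_inner phase f h = - l2_inner phase g k"
proof -
  have "l2_inner circle (fcoef n f) (fcoef n h) = - l2_inner circle (fcoef n g) (fcoef n k)" for n
  proof -
    have fL: "(\<lambda>v. \<i> * (v_dot n v * fcoef n f v)) \<in> L2 circle" and kL: "(\<lambda>v. \<i> * (v_dot n v * fcoef n k v)) \<in> L2 circle"
      by (intro L2_scale v_dot_L2 fcoef_L2 f k)+
    have "l2_inner circle (fcoef n f) (fcoef n h) = l2_inner circle (fcoef n f) (\<lambda>v. \<i> * (v_dot n v * fcoef n k v))"
      by (rule l2_inner_cong_AE[OF _ _ _ _ _ hk])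
        (simp_all add: L2_measurable[OF fcoef_L2[OF f]] L2_measurable[OF fcoef_L2[OF h]] L2_measurable[OF kL])
    also have "\<dots> = - l2_inner circle (\<lambda>v. \<i> * (v_dot n v * fcoef n f v)) (fcoef n k)"
      by (simp add: l2_inner_scale_right l2_inner_scale_left inner_v_dot)
    also have "l2_inner circle (\<lambda>v. \<i> * (v_dot n v * fcoef n f v)) (fcoef n k) = l2_inner circle (fcoef n g) (fcoef n k)"
      by (rule l2_inner_cong_AE[symmetric, OF _ _ gf])
        (simp_all add: L2_measurable[OF fcoef_L2[OF g]] L2_measurable[OF fcoef_L2[OF k]] L2_measurable[OF fL])
    finally show ?thesis .
  qed
  then have "(\<lambda>K. - (of_real ((2 * pi)\<^sup>2) * (\<Sum>n\<in>modes K. l2_inner circle (fcoef n g) (fcoef n k)))) \<longlonglongrightarrow> l2_inner phase f h"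
    using inner_lsum_limit[OF f h] by (simp add: sum_negf)
  from LIMSEQ_unique[OF this tendsto_minus[OF inner_lsum_limit[OF g k]]] show ?thesis .
qed

lemma polynomial_L2_circle:
  assumes "real_polynomial_function q" shows "(\<lambda>v. complex_of_real (q v)) \<in> L2 circle"
proof -
  have qc: "continuous_on S q" for S
    using continuous_real_polymonial_function[OF assms] continuous_at_imp_continuous_on by blast
  have "bounded (q ` sphere 0 1)" by (intro compact_imp_bounded compact_continuous_image qc) simp
  then obtain B where B: "\<And>y. y \<in> sphere 0 1 \<Longrightarrow> \<bar>q y\<bar> \<le> B"
    unfolding bounded_iff real_norm_def by blast
  show ?thesis
    by (rule circle.L2_bounded[where B = B])
      (use B in \<open>auto simp: space_circle intro!: measurable_circle_continuous continuous_on_of_real qc\<close>)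
qed

lemma integral_mono_test:
  assumes f: "f \<in> L2 phase" and q: "real_polynomial_function q"
  shows "(LINT z|phase. f z * mono_test n q z) = of_real ((2 * pi)\<^sup>2) * (LINT v|circle. fcoef n f v * of_real (q v))"
proof -
  have "(LINT z|phase. f z * mono_test n q z) = l2_inner phase f (lift n (\<lambda>v. of_real (q v)))"
    by (simp add: l2_inner_def lift_def mono_test_def cis_cnj)
  also have "\<dots> = of_real ((2 * pi)\<^sup>2) * (LINT v|circle. fcoef n f v * of_real (q v))"
    unfolding inner_lift[OF f polynomial_L2_circle[OF q]] by (simp add: l2_inner_def)
  finally show ?thesis .
qed

text \<open>From left to right, test with a character times a polynomial in the velocity and use
  that polynomials separate functions on the circle. From right to left, the coefficients of a
  smooth test function are multiplied by the same symbol, and skewness passes the derivative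
  over.\<close>

lemma weak_v_grad_iff:
  assumes f: "f \<in> L2 phase" and g: "g \<in> L2 phase"
  shows "weak_v_grad f g \<longleftrightarrow> (\<forall>n. AE v in circle. fcoef n g v = \<i> * (v_dot n v * fcoef n f v))"
proof
  assume w: "weak_v_grad f g"
  show "\<forall>n. AE v in circle. fcoef n g v = \<i> * (v_dot n v * fcoef n f v)"
  proof
    fix n
    let ?d = "\<lambda>v. fcoef n g v - \<i> * (v_dot n v * fcoef n f v)"
    have d: "?d \<in> L2 circle" by (intro L2_diff L2_scale v_dot_L2 fcoef_L2 f g)
    have "AE v in circle. ?d v = 0"
    proof (rule AE_circle_zero[OF d])
      fix q :: "real^2 \<Rightarrow> real" assume q: "real_polynomial_function q"
      have pos: "complex_of_real ((2 * pi)\<^sup>2) \<noteq> 0" by simp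
      have qL: "(\<lambda>v. complex_of_real (q v)) \<in> L2 circle" by (rule polynomial_L2_circle[OF q])
      have vg: "v_grad (mono_test n q) z = - \<i> * (v_dot n (snd z) * mono_test n q z)" for z
        using mono_test_frechet[OF q, of 1 n z "snd z"]
        by (simp add: v_grad_def case_prod_unfold v_dot_def)
      have "(LINT z|phase. f z * v_grad (mono_test n q) z)
          = l2_inner phase f (lift n (\<lambda>v. \<i> * (v_dot n v * of_real (q v))))"
        unfolding vg by (simp add: l2_inner_def lift_def mono_test_def cis_cnj v_dot_def mult_ac)
      also have "\<dots> = of_real ((2 * pi)\<^sup>2) * l2_inner circle (fcoef n f) (\<lambda>v. \<i> * (v_dot n v * of_real (q v)))"
        by (intro inner_lift f L2_scale v_dot_L2 qL)
      also have "l2_inner circle (fcoef n f) (\<lambda>v. \<i> * (v_dot n v * of_real (q v)))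
          = - (LINT v|circle. (\<i> * (v_dot n v * fcoef n f v)) * of_real (q v))"
        unfolding l2_inner_def Bochner_Integration.integral_minus[symmetric]
        by (rule Bochner_Integration.integral_cong) (simp_all add: v_dot_def)
      finally have "(LINT v|circle. fcoef n g v * of_real (q v)) = (LINT v|circle. (\<i> * (v_dot n v * fcoef n f v)) * of_real (q v))"
        using w[unfolded weak_v_grad_def, rule_format, OF test_fun_mono[OF q, of n]] integral_mono_test[OF g q, of n] pos
        by simp
      then show "(LINT v|circle. ?d v * of_real (q v)) = 0"
        unfolding left_diff_distrib
        using L2_integrable_mult[OF fcoef_L2[OF g, of n] qL]
          L2_integrable_mult[OF L2_scale[OF v_dot_L2[OF fcoef_L2[OF f, of n], of n], of \<i>] qL]
        by simp
    qed
    then show "AE v in circle. fcoef n g v = \<i> * (v_dot n v * fcoef n f v)" by simp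
  qed
next
  assume gf: "\<forall>n. AE v in circle. fcoef n g v = \<i> * (v_dot n v * fcoef n f v)"
  show "weak_v_grad f g"
    unfolding weak_v_grad_def
  proof (intro allI impI)
    fix \<psi> assume \<psi>: "test_fun \<psi>"
    then have C: "Ck (Suc 0) \<psi>" and C0: "Ck 0 \<psi>" unfolding test_fun_def by blast+
    \<comment> \<open>The weak pairing is bilinear while \<open>l2_inner\<close> conjugates its
      second argument, hence the conjugated test function.\<close>
    have vgL: "(\<lambda>z. cnj (v_grad \<psi> z)) \<in> L2 phase" by (intro L2_cnj L2_phase_continuous v_grad_continuous[OF C])
    have \<psi>L: "(\<lambda>z. cnj (\<psi> z)) \<in> L2 phase" using C0 by (intro L2_cnj L2_phase_continuous) simp
    have vg: "fcoef m (v_grad \<psi>) v = \<i> * of_real (v \<bullet> rvec m) * fcoef m \<psi> v" for m v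
      using fcoef_derivative[OF C, of m "\<lambda>v. v" v] \<psi>
      by (simp add: v_grad_def[abs_def] case_prod_unfold test_fun_def)
    have "fcoef n (\<lambda>z. cnj (v_grad \<psi> z)) v = \<i> * (v_dot n v * fcoef n (\<lambda>z. cnj (\<psi> z)) v)" for n v
      unfolding fcoef_cnj v_dot_def vg rvec_minus inner_minus_right by simp
    then have "l2_inner phase f (\<lambda>z. cnj (v_grad \<psi> z)) = - l2_inner phase g (\<lambda>z. cnj (\<psi> z))"
      by (intro inner_skew[OF f g vgL \<psi>L]) (use gf in simp_all)
    then show "(LINT z|phase. f z * v_grad \<psi> z) = - (LINT z|phase. g z * \<psi> z)"
      by (simp add: l2_inner_def)
  qed
qed

section \<open>The operators in Fourier variables\<close>

lemma const_L2_circle: "(\<lambda>v. c) \<in> L2 circle"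
  by (rule circle.L2_bounded[of _ "cmod c"]) simp_all

lemma v_mean_inner: "v_mean \<phi> = l2_inner circle \<phi> (\<lambda>v. 1) / of_real (2 * pi)"
  by (simp add: v_mean_def l2_inner_def)

lemma v_mean_cong_AE:
  assumes "\<phi> \<in> borel_measurable circle" "\<psi> \<in> borel_measurable circle" "AE v in circle. \<phi> v = \<psi> v"
  shows "v_mean \<phi> = v_mean \<psi>"
  unfolding v_mean_def by (rule arg_cong[where f = "\<lambda>c. c / _"], rule integral_cong_AE) (use assms in auto)

lemma v_mean_const [simp]: "v_mean (\<lambda>v. c) = c"
  by (simp add: v_mean_def measure_circle scaleR_conv_of_real)

lemma v_mean_add: "\<phi> \<in> L2 circle \<Longrightarrow> \<psi> \<in> L2 circle \<Longrightarrow> v_mean (\<lambda>v. \<phi> v + \<psi> v) = v_mean \<phi> + v_mean \<psi>"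
  by (simp add: v_mean_inner l2_inner_add_left const_L2_circle add_divide_distrib)

lemma v_mean_diff: "\<phi> \<in> L2 circle \<Longrightarrow> \<psi> \<in> L2 circle \<Longrightarrow> v_mean (\<lambda>v. \<phi> v - \<psi> v) = v_mean \<phi> - v_mean \<psi>"
  by (simp add: v_mean_inner l2_inner_diff_left const_L2_circle diff_divide_distrib)

lemma v_mean_scale: "v_mean (\<lambda>v. c * \<phi> v) = c * v_mean \<phi>"
  by (simp add: v_mean_def)

lemma Rv_L2: "\<phi> \<in> L2 circle \<Longrightarrow> Rv \<phi> \<in> L2 circle"
  unfolding Rv_def by (intro L2_diff const_L2_circle)

lemma v_mean_Rv: "\<phi> \<in> L2 circle \<Longrightarrow> v_mean (Rv \<phi>) = 0"
  unfolding Rv_def by (simp add: v_mean_diff const_L2_circle)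

lemma inner_const_right: "l2_inner circle \<phi> (\<lambda>v. c) = of_real (2 * pi) * cnj c * v_mean \<phi>"
  by (simp add: l2_inner_def v_mean_def)

lemma inner_Rv: assumes "\<phi> \<in> L2 circle" shows "l2_inner circle (Rv \<phi>) \<phi> = l2_inner circle (Rv \<phi>) (Rv \<phi>)"
proof -
  have "l2_inner circle (Rv \<phi>) (\<lambda>v. \<phi> v - v_mean \<phi>) = l2_inner circle (Rv \<phi>) \<phi> - l2_inner circle (Rv \<phi>) (\<lambda>v. v_mean \<phi>)"
    by (intro l2_inner_diff_right assms Rv_L2 const_L2_circle)
  then show ?thesis by (simp add: Rv_def[symmetric] inner_const_right v_mean_Rv assms)
qed

lemma norm_Rv_power2:
  assumes "\<phi> \<in> L2 circle"
  shows "(l2_norm circle \<phi>)\<^sup>2 = (l2_norm circle (Rv \<phi>))\<^sup>2 + 2 * pi * (cmod (v_mean \<phi>))\<^sup>2"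
proof -
  have "\<phi> = (\<lambda>v. Rv \<phi> v + v_mean \<phi>)" by (simp add: Rv_def)
  then have "(l2_norm circle \<phi>)\<^sup>2 = (l2_norm circle (\<lambda>v. Rv \<phi> v + v_mean \<phi>))\<^sup>2" by simp
  also have "\<dots> = (l2_norm circle (Rv \<phi>))\<^sup>2 + 2 * Re (l2_inner circle (Rv \<phi>) (\<lambda>v. v_mean \<phi>))
      + (l2_norm circle (\<lambda>v. v_mean \<phi>))\<^sup>2"
    by (rule l2_norm_add_power2[OF Rv_L2[OF assms] const_L2_circle])
  also have "(l2_norm circle (\<lambda>v. v_mean \<phi>))\<^sup>2 = 2 * pi * (cmod (v_mean \<phi>))\<^sup>2"
    by (simp add: l2_norm_power2 measure_circle)
  finally show ?thesis by (simp add: inner_const_right v_mean_Rv assms)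
qed

lemma norm_Rv_le: "\<phi> \<in> L2 circle \<Longrightarrow> l2_norm circle (Rv \<phi>) \<le> l2_norm circle \<phi>"
  by (rule power2_le_imp_le) (simp_all add: norm_Rv_power2[of \<phi>])

lemma Rv_cong_AE:
  assumes "\<phi> \<in> borel_measurable circle" "\<psi> \<in> borel_measurable circle" "AE v in circle. \<phi> v = \<psi> v"
  shows "AE v in circle. Rv \<phi> v = Rv \<psi> v"
  using assms(3) unfolding Rv_def v_mean_cong_AE[OF assms] by eventually_elim simp

lemma norm_v_dot_le:
  assumes "\<phi> \<in> L2 circle"
  shows "l2_norm circle (\<lambda>v. v_dot n v * \<phi> v) \<le> norm (rvec n) * l2_norm circle \<phi>"
proof -
  have "(\<lambda>v. v_dot n v * \<phi> v) \<in> L2 circle \<and>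
      l2_norm circle (\<lambda>v. v_dot n v * \<phi> v) \<le> l2_norm circle (\<lambda>v. of_real (norm (rvec n)) * \<phi> v)"
  proof (rule l2_norm_mono)
    show "AE v in circle. cmod (v_dot n v * \<phi> v) \<le> cmod (of_real (norm (rvec n)) * \<phi> v)"
      by (rule AE_I2) (auto simp: norm_mult space_circle intro!: mult_right_mono v_dot_bound)
  qed (intro L2_measurable v_dot_L2 L2_scale assms)+
  then show ?thesis by (simp add: l2_norm_scale)
qed

lemma AE_eq_fcoef:
  assumes f: "f \<in> L2 phase" and g: "g \<in> L2 phase" and eq: "\<And>n. AE v in circle. fcoef n f v = fcoef n g v"
  shows "AE z in phase. f z = g z"
proof -
  have "AE v in circle. fcoef n (\<lambda>z. 1 * f z + (-1) * g z) v = 0" for n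
    using fcoef_linear[OF f g, of n 1 "-1"] eq[of n] by eventually_elim simp
  then have "AE z in phase. 1 * f z + (-1) * g z = 0"
    by (intro AE_phase_zero_fcoef L2_add L2_scale f g)
  then show ?thesis by eventually_elim simp
qed

text \<open>Averaging in velocity commutes with taking Fourier coefficients in position. Both facts
  reduce to Fubini; square integrability uses that a mean over the circle is controlled by the norm
  of the slice.\<close>

lemma v_average_L2:
  assumes f: "f \<in> L2 phase"
  shows "(\<lambda>z. v_mean (\<lambda>w. f (fst z, w))) \<in> L2 phase"
    and "AE v in circle. fcoef n (\<lambda>z. v_mean (\<lambda>w. f (fst z, w))) v = v_mean (fcoef n f)"
proof -
  let ?m = "\<lambda>x. v_mean (\<lambda>w. f (x, w))"
  let ?g = "\<lambda>x. LINT v|circle. (cmod (f (x, v)))\<^sup>2"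
  have fm: "f \<in> borel_measurable (torus \<Otimes>\<^sub>M circle)"
    using L2_measurable[OF f] by (simp add: phase_def)
  have int: "integrable (torus \<Otimes>\<^sub>M circle) (\<lambda>p. (cmod (f p))\<^sup>2)"
    using L2_sq_integrable[OF f] by (simp add: phase_def)
  have "(\<lambda>x. LINT w|circle. f (x, w)) \<in> borel_measurable torus"
    by (intro circle.borel_measurable_lebesgue_integral) (simp add: case_prod_unfold fm)
  then have mm: "?m \<in> borel_measurable torus"
    unfolding v_mean_def by (intro borel_measurable_divide borel_measurable_const)
  have bound: "AE x in torus. (cmod (?m x))\<^sup>2 \<le> ?g x"
    using torus_circle.AE_integrable_fst'[OF int] AE_space
  proof eventually_elim
    fix x assume i: "integrable circle (\<lambda>v. (cmod (f (x, v)))\<^sup>2)" and x: "x \<in> space torus"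
    have L: "(\<lambda>v. f (x, v)) \<in> L2 circle"
      using i measurable_compose[OF measurable_Pair1'[OF x] fm] by (simp add: L2_def)
    have "(l2_norm circle (\<lambda>v. f (x, v)))\<^sup>2 \<ge> 2 * pi * (cmod (?m x))\<^sup>2"
      using norm_Rv_power2[OF L] by simp
    moreover have "1 * (cmod (?m x))\<^sup>2 \<le> 2 * pi * (cmod (?m x))\<^sup>2"
      by (rule mult_right_mono) (use pi_ge_two in simp_all)
    ultimately show "(cmod (?m x))\<^sup>2 \<le> ?g x" by (simp add: l2_norm_power2)
  qed
  have mi: "integrable torus (\<lambda>x. (cmod (?m x))\<^sup>2)"
  proof (rule Bochner_Integration.integrable_bound[OF torus_circle.integrable_fst'[OF int]])
    show "(\<lambda>x. (cmod (?m x))\<^sup>2) \<in> borel_measurable torus" using mm by simp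
    show "AE x in torus. norm ((cmod (?m x))\<^sup>2) \<le> norm (?g x)"
      using bound by eventually_elim simp
  qed
  have Mm: "(\<lambda>z. ?m (fst z)) \<in> borel_measurable (torus \<Otimes>\<^sub>M circle)"
    by (rule measurable_compose[OF measurable_fst mm])
  have "integrable (torus \<Otimes>\<^sub>M circle) (\<lambda>z. (cmod (?m (fst z)))\<^sup>2)"
    by (rule torus_circle.Fubini_integrable) (use Mm mi in simp_all)
  then show M: "(\<lambda>z. ?m (fst z)) \<in> L2 phase" using Mm by (simp add: L2_def phase_def)
  define I where "I = (LINT x|torus. ?m x * cis (- (x \<bullet> rvec n)))"
  have mlift: "l2_inner phase (\<lambda>z. ?m (fst z)) (lift n \<phi>) = I * (LINT v|circle. cnj (\<phi> v))" if \<phi>: "\<phi> \<in> L2 circle" for \<phi>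
  proof -
    have "l2_inner phase (\<lambda>z. ?m (fst z)) (lift n \<phi>) = (LINT x|torus. LINT v|circle. ?m x * cnj (lift n \<phi> (x, v)))"
      unfolding l2_inner_def
      using torus_circle.integral_fst'[OF l2_inner_integrable[OF M lift_L2(1)[OF \<phi>, of n], unfolded phase_def]]
      by (simp add: phase_def)
    also have "\<dots> = (LINT x|torus. (?m x * cis (- (x \<bullet> rvec n))) * (LINT v|circle. cnj (\<phi> v)))"
      by (simp add: lift_def cis_cnj mult.assoc[symmetric])
    finally show ?thesis by (simp only: I_def integral_mult_left_zero)
  qed
  \<comment> \<open>Pairing \<open>f\<close> itself with the mode that is constant in velocity
    evaluates the integral \<open>I\<close> in terms of the coefficient of \<open>f\<close>.\<close>
  have "l2_inner phase f (lift n (\<lambda>v. 1)) = (LINT x|torus. LINT v|circle. f (x, v) * cnj (lift n (\<lambda>v. 1) (x, v)))"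
    unfolding l2_inner_def
    using torus_circle.integral_fst'[OF l2_inner_integrable[OF f lift_L2(1)[OF const_L2_circle, of n], unfolded phase_def]]
    by (simp add: phase_def)
  also have "\<dots> = (LINT x|torus. of_real (2 * pi) * (?m x * cis (- (x \<bullet> rvec n))))"
    by (simp add: lift_def cis_cnj v_mean_def)
  also have "\<dots> = of_real (2 * pi) * I" by (simp only: I_def integral_mult_right_zero)
  finally have "of_real (2 * pi) * I = of_real ((2 * pi)\<^sup>2) * (of_real (2 * pi) * v_mean (fcoef n f))"
    unfolding inner_lift[OF f const_L2_circle] inner_const_right by simp
  then have I: "I = of_real ((2 * pi)\<^sup>2) * v_mean (fcoef n f)" by simp
  show "AE v in circle. fcoef n (\<lambda>z. ?m (fst z)) v = v_mean (fcoef n f)"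
  proof (rule fcoef_unique[OF M const_L2_circle])
    fix \<phi> assume "\<phi> \<in> L2 circle"
    from mlift[OF this] show "l2_inner phase (\<lambda>z. ?m (fst z)) (lift n \<phi>) = of_real ((2 * pi)\<^sup>2) * l2_inner circle (\<lambda>v. v_mean (fcoef n f)) \<phi>"
      by (simp only: mlift I) (simp add: l2_inner_def)
  qed
qed

text \<open>One representative among all the almost everywhere equal functions that
  \<open>R_op\<close> relates to \<open>f\<close>.\<close>

definition Rx :: "((real^2) \<times> (real^2) \<Rightarrow> complex) \<Rightarrow> (real^2) \<times> (real^2) \<Rightarrow> complex" where
  "Rx f z = f z - v_mean (\<lambda>w. f (fst z, w))"

lemma Rx_L2: "f \<in> L2 phase \<Longrightarrow> Rx f \<in> L2 phase"
  unfolding Rx_def by (intro L2_diff v_average_L2)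

lemma fcoef_Rx:
  assumes f: "f \<in> L2 phase"
  shows "AE v in circle. fcoef n (Rx f) v = Rv (fcoef n f) v"
proof -
  have "Rx f = (\<lambda>z. 1 * f z + (-1) * v_mean (\<lambda>w. f (fst z, w)))" by (simp add: Rx_def fun_eq_iff)
  then show ?thesis
    using fcoef_linear[OF f v_average_L2(1)[OF f], of n 1 "-1"] v_average_L2(2)[OF f, of n]
    by (auto simp: Rv_def)
qed

lemma R_op_Rx: "(f, r) \<in> R_op \<longleftrightarrow> f \<in> L2 phase \<and> r \<in> L2 phase \<and> (AE z in phase. r z = Rx f z)"
  by (simp add: R_op_def graph_of_def Rx_def case_prod_unfold)

lemma R_op_iff:
  "(f, r) \<in> R_op \<longleftrightarrow> f \<in> L2 phase \<and> r \<in> L2 phase \<and> (\<forall>n. AE v in circle. fcoef n r v = Rv (fcoef n f) v)"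
proof (cases "f \<in> L2 phase \<and> r \<in> L2 phase")
  case True
  then have f: "f \<in> L2 phase" and r: "r \<in> L2 phase" by auto
  have "(AE z in phase. r z = Rx f z) \<longleftrightarrow> (\<forall>n. AE v in circle. fcoef n r v = Rv (fcoef n f) v)"
  proof
    assume "AE z in phase. r z = Rx f z"
    note eq = fcoef_cong_AE[OF r Rx_L2[OF f] this]
    show "\<forall>n. AE v in circle. fcoef n r v = Rv (fcoef n f) v"
    proof
      fix n show "AE v in circle. fcoef n r v = Rv (fcoef n f) v"
        using eq[of n] fcoef_Rx[OF f, of n] by eventually_elim simp
    qed
  next
    assume eq: "\<forall>n. AE v in circle. fcoef n r v = Rv (fcoef n f) v"
    show "AE z in phase. r z = Rx f z"
    proof (rule AE_eq_fcoef[OF r Rx_L2[OF f]])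
      fix n show "AE v in circle. fcoef n r v = fcoef n (Rx f) v"
        using eq[rule_format, of n] fcoef_Rx[OF f, of n] by eventually_elim simp
    qed
  qed
  with True show ?thesis by (simp add: R_op_Rx)
qed (auto simp: R_op_Rx)

lemma R_op_exists: "f \<in> L2 phase \<Longrightarrow> (f, Rx f) \<in> R_op"
  by (simp add: R_op_Rx Rx_L2)

lemma R_op_inner:
  assumes "(f, r) \<in> R_op" shows "l2_inner phase r f = of_real ((l2_norm phase r)\<^sup>2)"
proof -
  have f: "f \<in> L2 phase" and r: "r \<in> L2 phase" and rn: "\<And>n. AE v in circle. fcoef n r v = Rv (fcoef n f) v"
    using assms unfolding R_op_iff by auto
  have "l2_inner circle (fcoef n r) (fcoef n f) = l2_inner circle (fcoef n r) (fcoef n r)" for n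
  proof -
    note m = L2_measurable[OF fcoef_L2[OF f]] L2_measurable[OF fcoef_L2[OF r]] L2_measurable[OF Rv_L2[OF fcoef_L2[OF f]]]
    have "l2_inner circle (fcoef n r) (fcoef n f) = l2_inner circle (Rv (fcoef n f)) (fcoef n f)"
      by (rule l2_inner_cong_AE[OF _ _ rn]) (simp_all add: m)
    also have "\<dots> = l2_inner circle (Rv (fcoef n f)) (Rv (fcoef n f))" by (rule inner_Rv[OF fcoef_L2[OF f]])
    also have "\<dots> = l2_inner circle (fcoef n r) (fcoef n r)"
      by (rule l2_inner_cong_AE[symmetric, OF _ _ rn _ _ rn]) (simp_all add: m)
    finally show ?thesis .
  qed
  then have "(\<lambda>K. of_real ((2 * pi)\<^sup>2) * (\<Sum>n\<in>modes K. l2_inner circle (fcoef n r) (fcoef n r))) \<longlonglongrightarrow> l2_inner phase r f"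
    using inner_lsum_limit[OF r f] by simp
  from LIMSEQ_unique[OF this inner_lsum_limit[OF r r]] show ?thesis by (simp add: l2_inner_self)
qed

lemma fcoef_uminus: "fcoef n (\<lambda>z. - g z) v = - fcoef n g v"
  by (simp add: fcoef_def)

lemma J_op_iff:
  "(f, j) \<in> J_op \<longleftrightarrow> f \<in> L2 phase \<and> j \<in> L2 phase \<and>
    (\<forall>n. AE v in circle. fcoef n j v = - \<i> * (v_dot n v * fcoef n f v))"
proof
  assume "(f, j) \<in> J_op"
  then obtain g where g: "j = (\<lambda>z. - g z)" "f \<in> L2 phase" "g \<in> L2 phase" "weak_v_grad f g"
    unfolding J_op_def by blast
  from g(4) have "AE v in circle. fcoef n g v = \<i> * (v_dot n v * fcoef n f v)" for n
    unfolding weak_v_grad_iff[OF g(2,3)] by blast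
  then have "AE v in circle. fcoef n j v = - \<i> * (v_dot n v * fcoef n f v)" for n
    unfolding g(1) fcoef_uminus by simp
  then show "f \<in> L2 phase \<and> j \<in> L2 phase \<and> (\<forall>n. AE v in circle. fcoef n j v = - \<i> * (v_dot n v * fcoef n f v))"
    using g L2_uminus by blast
next
  assume *: "f \<in> L2 phase \<and> j \<in> L2 phase \<and> (\<forall>n. AE v in circle. fcoef n j v = - \<i> * (v_dot n v * fcoef n f v))"
  then have L: "(\<lambda>z. - j z) \<in> L2 phase" by (intro L2_uminus) simp
  have "AE v in circle. fcoef n (\<lambda>z. - j z) v = \<i> * (v_dot n v * fcoef n f v)" for n
    using *[THEN conjunct2, THEN conjunct2, rule_format, of n] unfolding fcoef_uminus by eventually_elim simp
  then have "weak_v_grad f (\<lambda>z. - j z)" using weak_v_grad_iff[of f "\<lambda>z. - j z"] L * by blast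
  moreover have "j = (\<lambda>z. - (- j z))" by simp
  ultimately show "(f, j) \<in> J_op"
    unfolding J_op_def mem_Collect_eq using L *
    by (intro exI[of _ f] exI[of _ "\<lambda>z. - j z"] conjI) simp_all
qed

lemma J_op_lift:
  assumes "\<phi> \<in> L2 circle"
  shows "(lift n \<phi>, lift n (\<lambda>v. - \<i> * (v_dot n v * \<phi> v))) \<in> J_op"
  unfolding J_op_iff
proof (intro conjI allI)
  show "lift n \<phi> \<in> L2 phase" "lift n (\<lambda>v. - \<i> * (v_dot n v * \<phi> v)) \<in> L2 phase"
    by (intro lift_L2 L2_scale v_dot_L2 assms)+
  show "AE v in circle. fcoef m (lift n (\<lambda>v. - \<i> * (v_dot n v * \<phi> v))) v = - \<i> * (v_dot m v * fcoef m (lift n \<phi>) v)" for m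
    by (simp add: fcoef_lift)
qed

text \<open>Compared with \<open>J_op_iff\<close> the sign is reversed and the domain is the same,
  which is skew-adjointness. Single modes lie in the domain of \<open>J_op\<close>, and pairing with
  them determines every coefficient of the adjoint; the converse is
  \<open>inner_skew\<close>.\<close>

lemma adj_J_op_iff:
  "(f, h) \<in> adj phase J_op \<longleftrightarrow> f \<in> L2 phase \<and> h \<in> L2 phase \<and>
    (\<forall>n. AE v in circle. fcoef n h v = \<i> * (v_dot n v * fcoef n f v))"
proof
  assume "(f, h) \<in> adj phase J_op"
  then have f: "f \<in> L2 phase" and h: "h \<in> L2 phase"
    and eq: "\<And>u u'. (u, u') \<in> J_op \<Longrightarrow> l2_inner phase u' f = l2_inner phase u h"
    unfolding adj_def by auto
  have "AE v in circle. fcoef n h v = \<i> * (v_dot n v * fcoef n f v)" for n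
  proof (rule fcoef_unique[OF h])
    show "(\<lambda>v. \<i> * (v_dot n v * fcoef n f v)) \<in> L2 circle" by (intro L2_scale v_dot_L2 fcoef_L2 f)
    fix \<phi> assume \<phi>: "\<phi> \<in> L2 circle"
    then have \<phi>': "(\<lambda>v. - \<i> * (v_dot n v * \<phi> v)) \<in> L2 circle" by (intro L2_scale v_dot_L2)
    have "l2_inner phase h (lift n \<phi>) = l2_inner phase f (lift n (\<lambda>v. - \<i> * (v_dot n v * \<phi> v)))"
      using arg_cong[OF eq[OF J_op_lift[OF \<phi>]], of cnj] by (simp add: l2_inner_commute[symmetric])
    also have "\<dots> = of_real ((2 * pi)\<^sup>2) * l2_inner circle (fcoef n f) (\<lambda>v. - \<i> * (v_dot n v * \<phi> v))"
      by (rule inner_lift[OF f \<phi>'])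
    also have "\<dots> = of_real ((2 * pi)\<^sup>2) * l2_inner circle (\<lambda>v. \<i> * (v_dot n v * fcoef n f v)) \<phi>"
      unfolding l2_inner_scale_right l2_inner_scale_left inner_v_dot by simp
    finally show "l2_inner phase h (lift n \<phi>) = of_real ((2 * pi)\<^sup>2) * l2_inner circle (\<lambda>v. \<i> * (v_dot n v * fcoef n f v)) \<phi>" .
  qed
  with f h show "f \<in> L2 phase \<and> h \<in> L2 phase \<and> (\<forall>n. AE v in circle. fcoef n h v = \<i> * (v_dot n v * fcoef n f v))"
    by blast
next
  assume *: "f \<in> L2 phase \<and> h \<in> L2 phase \<and> (\<forall>n. AE v in circle. fcoef n h v = \<i> * (v_dot n v * fcoef n f v))"
  have "l2_inner phase u' f = l2_inner phase u h" if "(u, u') \<in> J_op" for u u'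
  proof -
    from that have u: "u \<in> L2 phase" and u': "u' \<in> L2 phase"
      and un: "\<And>n. AE v in circle. fcoef n u' v = - \<i> * (v_dot n v * fcoef n u v)"
      unfolding J_op_iff by auto
    have "AE v in circle. fcoef n (\<lambda>z. - u' z) v = \<i> * (v_dot n v * fcoef n u v)" for n
      using un[of n] unfolding fcoef_uminus by eventually_elim simp
    then have "l2_inner phase u h = - l2_inner phase (\<lambda>z. - u' z) f"
      using * by (intro inner_skew[OF u L2_uminus[OF u']]) auto
    then show ?thesis by (simp add: l2_inner_def)
  qed
  then show "(f, h) \<in> adj phase J_op" using * unfolding adj_def by blast
qed

lemma Jn_eq: "Jn n \<phi> = (\<lambda>v. - \<i> * (v_dot n v * \<phi> v))"
  by (simp add: Jn_def v_dot_def fun_eq_iff)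

lemma Cn_eq: "Cn n \<phi> = (\<lambda>v. Rv \<phi> v + \<i> * (v_dot n v * \<phi> v))"
  by (simp add: Cn_def Jn_eq fun_eq_iff)

lemma Cn_L2: "\<phi> \<in> L2 circle \<Longrightarrow> Cn n \<phi> \<in> L2 circle"
  unfolding Cn_eq by (intro L2_add Rv_L2 L2_scale v_dot_L2)

lemma C_op_iff:
  "(f, c) \<in> C_op \<longleftrightarrow> f \<in> L2 phase \<and> c \<in> L2 phase \<and> (\<forall>n. AE v in circle. fcoef n c v = Cn n (fcoef n f) v)"
proof
  assume "(f, c) \<in> C_op"
  then obtain r j where c: "c = (\<lambda>z. r z - j z)" and R: "(f, r) \<in> R_op" and J: "(f, j) \<in> J_op"
    unfolding C_op_def op_minus_def by blast
  from R J have f: "f \<in> L2 phase" and r: "r \<in> L2 phase" and j: "j \<in> L2 phase" unfolding R_op_iff J_op_iff by auto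
  have "AE v in circle. fcoef n c v = Cn n (fcoef n f) v" for n
  proof -
    have "AE v in circle. fcoef n (\<lambda>z. 1 * r z + (-1) * j z) v = 1 * fcoef n r v + (-1) * fcoef n j v"
      by (rule fcoef_linear[OF r j])
    moreover have "AE v in circle. fcoef n r v = Rv (fcoef n f) v"
      "AE v in circle. fcoef n j v = - \<i> * (v_dot n v * fcoef n f v)"
      using R J unfolding R_op_iff J_op_iff by auto
    ultimately show ?thesis unfolding c Cn_eq by eventually_elim simp
  qed
  with c f r j show "f \<in> L2 phase \<and> c \<in> L2 phase \<and> (\<forall>n. AE v in circle. fcoef n c v = Cn n (fcoef n f) v)"
    by (auto intro: L2_diff)
next
  assume *: "f \<in> L2 phase \<and> c \<in> L2 phase \<and> (\<forall>n. AE v in circle. fcoef n c v = Cn n (fcoef n f) v)"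
  then have f: "f \<in> L2 phase" and c: "c \<in> L2 phase" by auto
  \<comment> \<open>The transport part is recovered by subtraction; its coefficients are then those
    that membership in \<open>J_op\<close> requires.\<close>
  let ?j = "\<lambda>z. Rx f z - c z"
  have j: "?j \<in> L2 phase" by (intro L2_diff Rx_L2 f c)
  have "AE v in circle. fcoef n ?j v = - \<i> * (v_dot n v * fcoef n f v)" for n
  proof -
    have "AE v in circle. fcoef n (\<lambda>z. 1 * Rx f z + (-1) * c z) v = 1 * fcoef n (Rx f) v + (-1) * fcoef n c v"
      by (rule fcoef_linear[OF Rx_L2[OF f] c])
    moreover have "AE v in circle. fcoef n c v = Cn n (fcoef n f) v" using * by blast
    ultimately show ?thesis using fcoef_Rx[OF f, of n] unfolding Cn_eq by eventually_elim simp
  qed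
  then have "(f, ?j) \<in> J_op" unfolding J_op_iff using f j by blast
  then show "(f, c) \<in> C_op"
    unfolding C_op_def op_minus_def mem_Collect_eq using R_op_exists[OF f]
    by (intro exI[of _ f] exI[of _ "Rx f"] exI[of _ ?j] conjI) simp_all
qed

lemma C_op_lift:
  assumes "\<phi> \<in> L2 circle" shows "(lift n \<phi>, lift n (Cn n \<phi>)) \<in> C_op"
  unfolding C_op_iff
proof (intro conjI allI)
  show "lift n \<phi> \<in> L2 phase" "lift n (Cn n \<phi>) \<in> L2 phase" by (intro lift_L2 Cn_L2 assms)+
  show "AE v in circle. fcoef m (lift n (Cn n \<phi>)) v = Cn m (fcoef m (lift n \<phi>)) v" for m
    by (simp add: fcoef_lift Cn_eq Rv_def)
qed

section \<open>The domain \<open>D_circ\<close> in Fourier variables\<close>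

lemma exists_from_modes:
  assumes w: "w \<in> L2 phase" and \<phi>: "\<And>n. \<phi> n \<in> L2 circle"
    and le: "\<And>n. l2_norm circle (\<phi> n) \<le> l2_norm circle (fcoef n w)"
  shows "\<exists>f\<in>L2 phase. \<forall>n. AE v in circle. fcoef n f v = \<phi> n v"
proof -
  have "(\<Sum>n\<in>I. (l2_norm circle (\<phi> n))\<^sup>2) \<le> (l2_norm phase w)\<^sup>2 / (2 * pi)\<^sup>2" if I: "finite I" for I
  proof -
    have "(\<Sum>n\<in>I. (l2_norm circle (\<phi> n))\<^sup>2) \<le> (\<Sum>n\<in>I. (l2_norm circle (fcoef n w))\<^sup>2)"
      by (intro sum_mono power_mono le) simp
    also have "\<dots> \<le> (l2_norm phase w)\<^sup>2 / (2 * pi)\<^sup>2"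
      using bessel[OF w I] by (simp add: pos_le_divide_eq mult.commute)
    finally show ?thesis .
  qed
  from riesz_fischer[of \<phi>, OF \<phi> this] show ?thesis by blast
qed

lemma integral_scale_inner:
  fixes f g :: "'a \<Rightarrow> complex"
  shows "(LINT z|M. f z * (c * g z)) = c * (LINT z|M. f z * g z)"
proof -
  have "f z * (c * g z) = c * (f z * g z)" for z by simp
  then show ?thesis by (simp only: integral_mult_right_zero)
qed

lemma weak_dxdx_mono:
  assumes f: "f \<in> L2 phase" and g: "g \<in> L2 phase" and w: "weak_dxdx i j f g"
  shows "AE v in circle. fcoef n g v = - of_int (n $ i * n $ j) * fcoef n f v"
proof -
  let ?d = "\<lambda>v. fcoef n g v - (- of_int (n $ i * n $ j)) * fcoef n f v"
  have d: "?d \<in> L2 circle" by (intro L2_diff L2_scale fcoef_L2 f g)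
  have "AE v in circle. ?d v = 0"
  proof (rule AE_circle_zero[OF d])
    fix q :: "real^2 \<Rightarrow> real" assume q: "real_polynomial_function q"
    have dj: "dx j (mono_test n q) = (\<lambda>z. (- \<i> * of_int (n $ j)) * mono_test n q z)"
      using mono_test_frechet[OF q, of 1 n _ "axis j 1"] by (simp add: dx_def fun_eq_iff inner_axis')
    have "dx i (dx j (mono_test n q)) z = - of_int (n $ i * n $ j) * mono_test n q z" for z
      unfolding dj using mono_test_frechet[OF q, of "- \<i> * of_int (n $ j)" n z "axis i 1"]
      by (simp add: dx_def inner_axis' algebra_simps)
    then have "- of_int (n $ i * n $ j) * (LINT z|phase. f z * mono_test n q z) = (LINT z|phase. g z * mono_test n q z)"
      using w[unfolded weak_dxdx_def, rule_format, OF test_fun_mono[OF q, of n]]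
      by (simp only: integral_scale_inner)
    then have "of_real ((2 * pi)\<^sup>2) * (- of_int (n $ i * n $ j) * (LINT v|circle. fcoef n f v * of_real (q v)))
        = of_real ((2 * pi)\<^sup>2) * (LINT v|circle. fcoef n g v * of_real (q v))"
      unfolding integral_mono_test[OF f q] integral_mono_test[OF g q] by (simp only: mult.left_commute)
    then have eq: "- of_int (n $ i * n $ j) * (LINT v|circle. fcoef n f v * of_real (q v))
        = (LINT v|circle. fcoef n g v * of_real (q v))"
      by (rule mult_left_cancel[THEN iffD1, rotated]) simp
    have qL: "(\<lambda>v. complex_of_real (q v)) \<in> L2 circle" by (rule polynomial_L2_circle[OF q])
    have "(LINT v|circle. ?d v * of_real (q v)) = (LINT v|circle. fcoef n g v * of_real (q v))
        - (LINT v|circle. - of_int (n $ i * n $ j) * fcoef n f v * of_real (q v))"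
      unfolding left_diff_distrib
      by (intro Bochner_Integration.integral_diff L2_integrable_mult L2_scale fcoef_L2 f g qL)
    also have "(LINT v|circle. - of_int (n $ i * n $ j) * fcoef n f v * of_real (q v))
        = - of_int (n $ i * n $ j) * (LINT v|circle. fcoef n f v * of_real (q v))"
      by (simp only: mult.assoc integral_mult_right_zero)
    finally show "(LINT v|circle. ?d v * of_real (q v)) = 0"
      unfolding eq by simp
  qed
  then show ?thesis by eventually_elim (simp only: right_minus_eq)
qed

lemma D_circ_L2: "f \<in> D_circ \<Longrightarrow> f \<in> L2 phase"
  by (simp add: D_circ_def)

lemma norm_rvec_power2: "(norm (rvec n))\<^sup>2 = of_int (n $ 1 * n $ 1 + n $ 2 * n $ 2)"
  by (simp add: power2_norm_eq_inner inner_vec2)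

text \<open>The function \<open>w\<close> is the Laplacian of \<open>f\<close> in position, with
  symbol -|n|^2. It serves as a dominating function for the modes produced by \<open>J_op\<close>,
  \<open>R_op\<close> and the adjoint.\<close>

lemma D_circ_modes:
  assumes "f \<in> D_circ"
  shows "\<exists>w\<in>L2 phase. \<forall>n. l2_norm circle (fcoef n w) = (norm (rvec n))\<^sup>2 * l2_norm circle (fcoef n f)"
proof -
  have f: "f \<in> L2 phase" using assms by (rule D_circ_L2)
  from assms obtain g1 g2 where g: "g1 \<in> L2 phase" "weak_dxdx 1 1 f g1" "g2 \<in> L2 phase" "weak_dxdx 2 2 f g2"
    unfolding D_circ_def by blast
  let ?w = "\<lambda>z. 1 * g1 z + 1 * g2 z"
  have w: "?w \<in> L2 phase" by (intro L2_add L2_scale g)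
  have "l2_norm circle (fcoef n ?w) = (norm (rvec n))\<^sup>2 * l2_norm circle (fcoef n f)" for n
  proof -
    have "AE v in circle. fcoef n ?w v = - of_real ((norm (rvec n))\<^sup>2) * fcoef n f v"
      using fcoef_linear[OF g(1,3), of n 1 1] weak_dxdx_mono[OF f g(1,2), of n] weak_dxdx_mono[OF f g(3,4), of n]
      unfolding norm_rvec_power2 by eventually_elim (simp add: algebra_simps)
    then have "l2_norm circle (fcoef n ?w) = l2_norm circle (\<lambda>v. - of_real ((norm (rvec n))\<^sup>2) * fcoef n f v)"
      by (intro l2_norm_cong_AE L2_measurable L2_scale fcoef_L2 f w)
    then show ?thesis unfolding l2_norm_scale by (simp add: norm_power)
  qed
  with w show ?thesis by blast
qed

lemma norm_rvec_ge_1: assumes "n \<noteq> 0" shows "1 \<le> norm (rvec n)"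
proof -
  have "n $ 1 \<noteq> 0 \<or> n $ 2 \<noteq> 0" using assms by (auto simp: vec_eq_iff forall_2)
  then have "0 < n $ 1 * n $ 1 + n $ 2 * n $ 2"
    by (simp only: sum_squares_gt_zero_iff)
  then have "1 \<le> n $ 1 * n $ 1 + n $ 2 * n $ 2" by simp
  then have "1\<^sup>2 \<le> (norm (rvec n))\<^sup>2" unfolding norm_rvec_power2 by (simp only: one_power2 of_int_1_le_iff)
  then show ?thesis by (rule power2_le_imp_le) simp
qed

text \<open>This shows that \<open>D_circ\<close> lies in the domain of J R J*. On the integer
  lattice |n| <= |n|^2, so both the first application of the multiplier and the second are dominated
  mode by mode by the Laplacian, and square-summable coefficients come from a function.\<close>

lemma D_circ_chain:
  assumes "f \<in> D_circ"
  shows "\<exists>h k l. (f, h) \<in> adj phase J_op \<and> (h, k) \<in> R_op \<and> (k, l) \<in> J_op"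
proof -
  have f: "f \<in> L2 phase" using assms by (rule D_circ_L2)
  obtain w where w: "w \<in> L2 phase" and wn: "\<And>n. l2_norm circle (fcoef n w) = (norm (rvec n))\<^sup>2 * l2_norm circle (fcoef n f)"
    using D_circ_modes[OF assms] by blast
  have le1: "norm (rvec n) \<le> (norm (rvec n))\<^sup>2" for n
  proof (cases "n = 0")
    case True
    show ?thesis unfolding True rvec_0 by simp
  next
    case False
    show ?thesis by (rule self_le_power[OF norm_rvec_ge_1[OF False]]) simp
  qed
  let ?h = "\<lambda>n v. \<i> * (v_dot n v * fcoef n f v)"
  have hL: "?h n \<in> L2 circle" for n by (intro L2_scale v_dot_L2 fcoef_L2 f)
  have hn: "l2_norm circle (?h n) \<le> norm (rvec n) * l2_norm circle (fcoef n f)" for n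
    using norm_v_dot_le[OF fcoef_L2[OF f]] by (simp add: l2_norm_scale)
  have "l2_norm circle (?h n) \<le> l2_norm circle (fcoef n w)" for n
    unfolding wn by (rule order_trans[OF hn mult_right_mono[OF le1]]) simp
  from exists_from_modes[of w ?h, OF w hL this] obtain h where h: "h \<in> L2 phase"
    and hc: "\<And>n. AE v in circle. fcoef n h v = ?h n v" by blast
  let ?k = "Rx h"
  have k: "?k \<in> L2 phase" by (rule Rx_L2[OF h])
  let ?l = "\<lambda>n v. - \<i> * (v_dot n v * fcoef n ?k v)"
  have lL: "?l n \<in> L2 circle" for n by (intro L2_scale v_dot_L2 fcoef_L2 k)
  have "l2_norm circle (?l n) \<le> l2_norm circle (fcoef n w)" for n
  proof -
    have "l2_norm circle (?l n) \<le> norm (rvec n) * l2_norm circle (fcoef n ?k)"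
      unfolding l2_norm_scale using norm_v_dot_le[OF fcoef_L2[OF k]] by simp
    also have "l2_norm circle (fcoef n ?k) = l2_norm circle (Rv (fcoef n h))"
      by (intro l2_norm_cong_AE L2_measurable fcoef_L2 k Rv_L2 h fcoef_Rx)
    also have "\<dots> \<le> l2_norm circle (fcoef n h)" by (rule norm_Rv_le[OF fcoef_L2[OF h]])
    also have "\<dots> = l2_norm circle (?h n)"
      by (intro l2_norm_cong_AE L2_measurable[OF fcoef_L2[OF h]] L2_measurable[OF hL] hc)
    also have "\<dots> \<le> norm (rvec n) * l2_norm circle (fcoef n f)" by (rule hn)
    finally show ?thesis unfolding wn power2_eq_square by (simp add: mult_left_mono mult.assoc)
  qed
  from exists_from_modes[of w ?l, OF w lL this] obtain l where l: "l \<in> L2 phase"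
    and lc: "\<And>n. AE v in circle. fcoef n l v = ?l n v" by blast
  have "(f, h) \<in> adj phase J_op" unfolding adj_J_op_iff using f h hc by blast
  moreover have "(h, ?k) \<in> R_op" by (rule R_op_exists[OF h])
  moreover have "(?k, l) \<in> J_op" unfolding J_op_iff using k l lc by blast
  ultimately show ?thesis by blast
qed

text \<open>Provides the element of the domain on which coercivity with index 0 fails.\<close>

lemma lift_D_circ:
  assumes "\<phi> \<in> L2 circle" shows "lift n \<phi> \<in> D_circ"
proof -
  have L: "lift n \<phi> \<in> L2 phase" by (rule lift_L2[OF assms])
  have "weak_dxdx i j (lift n \<phi>) (\<lambda>z. - of_int (n $ i * n $ j) * lift n \<phi> z)" for i j
    unfolding weak_dxdx_def
  proof (intro allI impI)
    fix \<psi> assume \<psi>: "test_fun \<psi>"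
    have pair: "(LINT z|phase. lift n \<phi> z * u z) = of_real ((2 * pi)\<^sup>2) * (LINT v|circle. \<phi> v * fcoef (- n) u v)"
      if u: "u \<in> L2 phase" for u
    proof -
      have "(LINT z|phase. lift n \<phi> z * u z) = l2_inner phase u (\<lambda>z. cnj (lift n \<phi> z))"
        by (simp add: l2_inner_def mult.commute)
      also have "(\<lambda>z. cnj (lift n \<phi> z)) = lift (- n) (\<lambda>v. cnj (\<phi> v))"
        unfolding lift_def rvec_minus by (simp add: cis_cnj fun_eq_iff)
      finally show ?thesis
        unfolding inner_lift[OF u L2_cnj[OF assms]] by (simp add: l2_inner_def mult.commute)
    qed
    have dL: "u \<in> L2 phase" if "test_fun u" for u
    proof -
      have "Ck 0 u" using that unfolding test_fun_def by blast
      then show ?thesis by (intro L2_phase_continuous) simp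
    qed
    have dc: "fcoef m (dx l u) v = \<i> * of_int (m $ l) * fcoef m u v" if "test_fun u" for m l u v
    proof -
      have "Ck (Suc 0) u" "\<And>x v i. u (x + axis i (2 * pi), v) = u (x, v)"
        using that unfolding test_fun_def by blast+
      from fcoef_derivative[OF this, where w = "\<lambda>v. axis l 1" and v = v and n = m]
      show ?thesis by (simp add: dx_def[abs_def] inner_axis')
    qed
    have "fcoef (- n) (dx i (dx j \<psi>)) v = - of_int (n $ i * n $ j) * fcoef (- n) \<psi> v" for v
      unfolding dc[OF test_fun_dx[OF \<psi>]] dc[OF \<psi>] by (simp add: algebra_simps)
    then have "(LINT z|phase. lift n \<phi> z * dx i (dx j \<psi>) z)
        = of_real ((2 * pi)\<^sup>2) * (- of_int (n $ i * n $ j) * (LINT v|circle. \<phi> v * fcoef (- n) \<psi> v))"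
      unfolding pair[OF dL[OF test_fun_dx[OF test_fun_dx[OF \<psi>]]]] by (simp only: integral_scale_inner)
    also have "\<dots> = - of_int (n $ i * n $ j) * (LINT z|phase. lift n \<phi> z * \<psi> z)"
      unfolding pair[OF dL[OF \<psi>]] by (rule mult.left_commute)
    also have "\<dots> = (LINT z|phase. - of_int (n $ i * n $ j) * lift n \<phi> z * \<psi> z)"
      by (simp only: mult.assoc integral_mult_right_zero)
    finally show "(LINT z|phase. lift n \<phi> z * dx i (dx j \<psi>) z) = (LINT z|phase. - of_int (n $ i * n $ j) * lift n \<phi> z * \<psi> z)" .
  qed
  moreover have "(\<lambda>z. - of_int (n $ i * n $ j) * lift n \<phi> z) \<in> L2 phase" for i j by (rule L2_scale[OF L])
  ultimately show ?thesis unfolding D_circ_def using L by blast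
qed

section \<open>Coercivity on the circle\<close>

lemma rvec_polar:
  assumes "n \<noteq> 0"
  shows "\<exists>\<alpha>. \<forall>\<theta>. dir \<theta> \<bullet> rvec n = norm (rvec n) * cos (\<theta> - \<alpha>)"
proof -
  have N: "norm (rvec n) > 0" using norm_rvec_ge_1[OF assms] by linarith
  define a b where "a = rvec n $ 1 / norm (rvec n)" and "b = rvec n $ 2 / norm (rvec n)"
  have "(rvec n $ 1)\<^sup>2 + (rvec n $ 2)\<^sup>2 = (norm (rvec n))\<^sup>2"
    unfolding norm_rvec_power2 by (simp add: power2_eq_square)
  then have "a\<^sup>2 + b\<^sup>2 = 1"
    unfolding a_def b_def power_divide add_divide_distrib[symmetric] using N by simp
  from sincos_total_2pi_le[OF this] obtain \<alpha> where "a = cos \<alpha>" "b = sin \<alpha>" by blast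
  then have "rvec n $ 1 = norm (rvec n) * cos \<alpha>" "rvec n $ 2 = norm (rvec n) * sin \<alpha>"
    unfolding a_def b_def using N by (simp_all add: field_simps)
  then have "dir \<theta> \<bullet> rvec n = norm (rvec n) * cos (\<theta> - \<alpha>)" for \<theta>
    unfolding inner_vec2 cos_diff by (simp add: algebra_simps)
  then show ?thesis by blast
qed

text \<open>Velocity means are evaluated through explicit antiderivatives in the angle; a periodic
  antiderivative gives mean zero.\<close>

lemma v_mean_via_antiderivative:
  assumes "\<And>\<theta>. (F has_real_derivative f (dir \<theta>)) (at \<theta>)" "continuous_on UNIV f"
  shows "v_mean (\<lambda>v. of_real (f v)) = of_real ((F (2 * pi) - F 0) / (2 * pi))"
proof -
  have c: "continuous_on UNIV (\<lambda>\<theta>. f (dir \<theta>))"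
    by (rule continuous_on_compose2[OF assms(2)]) (auto intro!: continuous_intros)
  have "(LINT v|circle. complex_of_real (f v)) = of_real (F (2 * pi)) - of_real (F 0)"
  proof (rule integral_circle_FTC[where F = "\<lambda>\<theta>. of_real (F \<theta>)"])
    show "((\<lambda>\<theta>. complex_of_real (F \<theta>)) has_vector_derivative of_real (f (dir \<theta>))) (at \<theta>)" for \<theta>
      by (rule has_vector_derivative_of_real[OF assms(1)])
    show "(\<lambda>v. complex_of_real (f v)) \<in> borel_measurable circle"
      by (intro measurable_circle_continuous continuous_on_of_real assms)
    show "continuous_on UNIV (\<lambda>\<theta>. complex_of_real (f (dir \<theta>)))"
      by (intro continuous_on_of_real c)
  qed
  then show ?thesis by (simp add: v_mean_def)
qed

lemma inner_Rv_symmetric: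
  assumes "\<phi> \<in> L2 circle" "\<psi> \<in> L2 circle"
  shows "l2_inner circle (Rv \<phi>) (Rv \<psi>) = l2_inner circle \<phi> (Rv \<psi>)"
proof -
  have "l2_inner circle (Rv \<phi>) (Rv \<psi>) = l2_inner circle \<phi> (Rv \<psi>) - l2_inner circle (\<lambda>v. v_mean \<phi>) (Rv \<psi>)"
    by (subst (1) Rv_def, rule l2_inner_diff_left) (intro assms const_L2_circle Rv_L2)+
  moreover have "l2_inner circle (\<lambda>v. v_mean \<phi>) (Rv \<psi>) = 0"
    by (subst l2_inner_commute) (simp add: inner_const_right v_mean_Rv assms)
  ultimately show ?thesis by simp
qed

lemma l2_norm_diff_scale:
  assumes "f \<in> L2 M" "g \<in> L2 M"
  shows "(l2_norm M (\<lambda>z. f z - c * g z))\<^sup>2 = (l2_norm M f)\<^sup>2 - 2 * Re (cnj c * l2_inner M f g) + (cmod c)\<^sup>2 * (l2_norm M g)\<^sup>2"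
  using l2_norm_add_power2[OF assms(1) L2_scale[OF assms(2)], of "- c"]
  unfolding l2_inner_scale_right l2_norm_scale by (simp add: power_mult_distrib)

context
  fixes n :: "int^2" and e :: "real^2"
  assumes n0: "n \<noteq> 0" and e_def: "e = rvec n /\<^sub>R norm (rvec n)"
begin

lemma unit_polar: "\<exists>\<alpha>. \<forall>\<theta>. dir \<theta> \<bullet> e = cos (\<theta> - \<alpha>)"
proof -
  obtain \<alpha> where "\<And>\<theta>. dir \<theta> \<bullet> rvec n = norm (rvec n) * cos (\<theta> - \<alpha>)" using rvec_polar[OF n0] by blast
  moreover have "norm (rvec n) > 0" using norm_rvec_ge_1[OF n0] by linarith
  ultimately have "dir \<theta> \<bullet> e = cos (\<theta> - \<alpha>)" for \<theta> unfolding e_def by simp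
  then show ?thesis by blast
qed

lemma v_dot_unit: "v_dot n v = of_real (norm (rvec n)) * of_real (v \<bullet> e)"
proof -
  have "norm (rvec n) > 0" using norm_rvec_ge_1[OF n0] by linarith
  then have "v \<bullet> rvec n = norm (rvec n) * (v \<bullet> e)" unfolding e_def by simp
  then show ?thesis unfolding v_dot_def by (simp only: of_real_mult)
qed

lemma v_mean_unit: "v_mean (\<lambda>v. of_real (v \<bullet> e)) = 0"
proof -
  obtain \<alpha> where a: "\<And>\<theta>. dir \<theta> \<bullet> e = cos (\<theta> - \<alpha>)" using unit_polar by blast
  have "v_mean (\<lambda>v. of_real (v \<bullet> e)) = of_real ((sin (2 * pi - \<alpha>) - sin (0 - \<alpha>)) / (2 * pi))"
  proof (rule v_mean_via_antiderivative[where F = "\<lambda>\<theta>. sin (\<theta> - \<alpha>)"])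
    show "((\<lambda>\<theta>. sin (\<theta> - \<alpha>)) has_real_derivative dir \<theta> \<bullet> e) (at \<theta>)" for \<theta>
      unfolding a by (auto intro!: derivative_eq_intros)
  qed (intro continuous_intros)
  then show ?thesis by (simp add: sin_diff)
qed

lemma v_mean_unit_sq: "v_mean (\<lambda>v. of_real ((v \<bullet> e)\<^sup>2)) = 1 / 2"
proof -
  obtain \<alpha> where a: "\<And>\<theta>. dir \<theta> \<bullet> e = cos (\<theta> - \<alpha>)" using unit_polar by blast
  let ?F = "\<lambda>\<theta>. \<theta> / 2 + sin (\<theta> - \<alpha>) * cos (\<theta> - \<alpha>) / 2"
  have "v_mean (\<lambda>v. of_real ((v \<bullet> e)\<^sup>2)) = of_real ((?F (2 * pi) - ?F 0) / (2 * pi))"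
  proof (rule v_mean_via_antiderivative)
    show "(?F has_real_derivative (dir \<theta> \<bullet> e)\<^sup>2) (at \<theta>)" for \<theta>
    proof -
      have "(?F has_real_derivative 1 / 2 + (cos (\<theta> - \<alpha>) * cos (\<theta> - \<alpha>) - sin (\<theta> - \<alpha>) * sin (\<theta> - \<alpha>)) / 2) (at \<theta>)"
        by (auto intro!: derivative_eq_intros)
      moreover have "1 / 2 + (cos (\<theta> - \<alpha>) * cos (\<theta> - \<alpha>) - sin (\<theta> - \<alpha>) * sin (\<theta> - \<alpha>)) / 2 = (cos (\<theta> - \<alpha>))\<^sup>2"
        using sin_cos_squared_add[of "\<theta> - \<alpha>"] unfolding power2_eq_square by argo
      ultimately show ?thesis unfolding a by simp
    qed
  qed (intro continuous_intros)
  then show ?thesis by (simp add: sin_diff cos_diff)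
qed

text \<open>
  With \<open>w v = v \<bullet> e\<close>, the function \<open>eigfun\<close> has mean one and solves
  \<open>beta * R g + w * R (w * g) = 1 - beta\<close>, that is, it minimizes \<open>\<parallel>R g\<parallel>\<^sup>2 + \<parallel>R (w g)\<parallel>\<^sup>2\<close> for given norm.
  Testing this equation with \<open>\<phi>\<close> and completing squares gives the bound with \<open>1 - beta = (3 - sqrt 5) / 2\<close>.
\<close>

definition beta :: real where "beta = (sqrt 5 - 1) / 2"

definition eigfun :: "real^2 \<Rightarrow> real" where "eigfun v = 1 / (beta + (v \<bullet> e)\<^sup>2)"

lemma beta_pos: "0 < beta" unfolding beta_def by simp

lemma eigfun_pos: "0 < beta + (v \<bullet> e)\<^sup>2"
  using beta_pos by (simp add: add_pos_nonneg)

lemma eigfun_continuous: "continuous_on UNIV eigfun"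
  unfolding eigfun_def[abs_def] using eigfun_pos by (intro continuous_intros) (simp add: less_imp_neq[THEN not_sym])

lemma eigfun_L2: "(\<lambda>v. complex_of_real (eigfun v)) \<in> L2 circle"
proof (rule circle.L2_bounded[where B = "1 / beta"])
  show "(\<lambda>v. complex_of_real (eigfun v)) \<in> borel_measurable circle"
    by (intro measurable_circle_continuous continuous_on_of_real eigfun_continuous)
  fix v
  have "\<bar>eigfun v\<bar> = 1 / (beta + (v \<bullet> e)\<^sup>2)"
    unfolding eigfun_def using eigfun_pos[of v] by simp
  also have "\<dots> \<le> 1 / beta" using beta_pos by (intro divide_left_mono mult_pos_pos eigfun_pos) simp_all
  finally show "cmod (complex_of_real (eigfun v)) \<le> 1 / beta" by simp
qed

text \<open>With the doubled angle x the function is 2/(sqrt 5 + cos x), which is a Poisson kernel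
  (1 - q^2)/(1 + 2 q cos x + q^2) and therefore has mean one. The antiderivative \<open>?F\<close>
  is smooth on the whole line because its arctangent has a denominator without zeros, and the
  arctangent term is periodic, so \<open>?F\<close> grows by exactly one period.\<close>

lemma v_mean_eigfun: "v_mean (\<lambda>v. of_real (eigfun v)) = 1"
proof -
  obtain \<alpha> where a: "\<And>\<theta>. dir \<theta> \<bullet> e = cos (\<theta> - \<alpha>)" using unit_polar by blast
  \<comment> \<open>The parameter of the Poisson kernel: the root below 1 of (1 + q^2)/(2 q) = sqrt
    5. It also satisfies (1 - q^2)/(2 q) = 2, which is the numerator.\<close>
  define \<rho> where "\<rho> = sqrt 5 - 2"
  have s5: "2 < sqrt 5" "sqrt 5 < 3" by (simp_all add: real_less_rsqrt real_less_lsqrt)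
  then have \<rho>: "0 < \<rho>" "\<rho> < 1" by (simp_all add: \<rho>_def)
  have s55: "sqrt 5 * sqrt 5 = 5" by simp
  let ?u = "\<lambda>\<theta>. \<rho> * sin (2 * (\<theta> - \<alpha>)) / (1 + \<rho> * cos (2 * (\<theta> - \<alpha>)))"
  let ?F = "\<lambda>\<theta>. \<theta> - arctan (?u \<theta>)"
  have d1: "1 + \<rho> * cos x > 0" for x
  proof -
    have "\<rho> * cos x \<ge> \<rho> * (-1)" using \<rho> by (intro mult_left_mono) simp_all
    then show ?thesis using \<rho> by linarith
  qed
  have "v_mean (\<lambda>v. of_real (eigfun v)) = of_real ((?F (2 * pi) - ?F 0) / (2 * pi))"
  proof (rule v_mean_via_antiderivative[OF _ eigfun_continuous])
    fix \<theta>
    define s c where "s = sin (2 * (\<theta> - \<alpha>))" and "c = cos (2 * (\<theta> - \<alpha>))"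
    have sc: "s * s = 1 - c * c" unfolding s_def c_def using sin_cos_squared_add[of "2 * (\<theta> - \<alpha>)"]
      by (simp add: power2_eq_square algebra_simps)
    have dp: "1 + \<rho> * c > 0" unfolding c_def by (rule d1)
    have "(?u has_real_derivative ((\<rho> * (c * 2)) * (1 + \<rho> * c) - (\<rho> * s) * (\<rho> * (- s * 2))) / ((1 + \<rho> * c) * (1 + \<rho> * c))) (at \<theta>)"
      unfolding s_def c_def by (rule derivative_eq_intros refl | use d1[of "2 * (\<theta> - \<alpha>)"] in simp)+
    then have "(?F has_real_derivative 1 - inverse (1 + (?u \<theta>)\<^sup>2) * (((\<rho> * (c * 2)) * (1 + \<rho> * c) - (\<rho> * s) * (\<rho> * (- s * 2))) / ((1 + \<rho> * c) * (1 + \<rho> * c)))) (at \<theta>)"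
      by (rule DERIV_diff[OF DERIV_ident DERIV_chain2[OF DERIV_arctan]])
    moreover have "1 - inverse (1 + (?u \<theta>)\<^sup>2) * (((\<rho> * (c * 2)) * (1 + \<rho> * c) - (\<rho> * s) * (\<rho> * (- s * 2))) / ((1 + \<rho> * c) * (1 + \<rho> * c)))
        = eigfun (dir \<theta>)"
    proof -
      have num: "(\<rho> * (c * 2)) * (1 + \<rho> * c) - (\<rho> * s) * (\<rho> * (- s * 2)) = 2 * \<rho> * (c + \<rho>)"
      proof -
        have "(\<rho> * (c * 2)) * (1 + \<rho> * c) - (\<rho> * s) * (\<rho> * (- s * 2)) = 2 * \<rho> * c + 2 * \<rho> * \<rho> * (c * c) + 2 * \<rho> * \<rho> * (s * s)"
          by (simp add: algebra_simps)
        then show ?thesis unfolding sc by (simp add: algebra_simps)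
      qed
      define q where "q = 1 + 2 * \<rho> * c + \<rho> * \<rho>"
      have q: "(1 + \<rho> * c) * (1 + \<rho> * c) + (\<rho> * s) * (\<rho> * s) = q"
      proof -
        have "(1 + \<rho> * c) * (1 + \<rho> * c) + (\<rho> * s) * (\<rho> * s) = 1 + 2 * \<rho> * c + \<rho> * \<rho> * (c * c) + \<rho> * \<rho> * (s * s)"
          by (simp add: algebra_simps)
        then show ?thesis unfolding sc q_def by (simp add: algebra_simps)
      qed
      have qp: "q > 0" unfolding q[symmetric] using mult_pos_pos[OF dp dp] zero_le_square[of "\<rho> * s"] by linarith
      have "1 + (?u \<theta>)\<^sup>2 = q / ((1 + \<rho> * c) * (1 + \<rho> * c))"
        unfolding q[symmetric] s_def[symmetric] c_def[symmetric] power2_eq_square using dp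
        by (simp add: add_divide_distrib)
      then have "inverse (1 + (?u \<theta>)\<^sup>2) = ((1 + \<rho> * c) * (1 + \<rho> * c)) / q" by simp
      then have "1 - inverse (1 + (?u \<theta>)\<^sup>2) * (((\<rho> * (c * 2)) * (1 + \<rho> * c) - (\<rho> * s) * (\<rho> * (- s * 2))) / ((1 + \<rho> * c) * (1 + \<rho> * c)))
          = 1 - 2 * \<rho> * (c + \<rho>) / q"
        unfolding num using dp by simp
      also have "\<dots> = (1 - \<rho> * \<rho>) / q" using qp unfolding q_def by (simp add: field_simps)
      also have "\<dots> = (4 * \<rho>) / (2 * \<rho> * (sqrt 5 + c))"
      proof -
        have "1 - \<rho> * \<rho> = 4 * \<rho>" unfolding \<rho>_def using s55 by (simp add: algebra_simps)
        moreover have "q = 2 * \<rho> * (sqrt 5 + c)" unfolding q_def \<rho>_def using s55 by (simp add: algebra_simps)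
        ultimately show ?thesis by simp
      qed
      also have "\<dots> = 2 / (sqrt 5 + c)"
      proof -
        have "4 * \<rho> = 2 * \<rho> * 2" by simp
        then show ?thesis using \<rho> by (simp only:) (rule mult_divide_mult_cancel_left, simp)
      qed
      also have "\<dots> = 1 / (beta + (cos (\<theta> - \<alpha>))\<^sup>2)"
      proof -
        have "c = 2 * (cos (\<theta> - \<alpha>))\<^sup>2 - 1" unfolding c_def by (rule cos_double_cos)
        then have "sqrt 5 + c = 2 * (beta + (cos (\<theta> - \<alpha>))\<^sup>2)" unfolding beta_def by (simp add: field_simps)
        then show ?thesis using mult_divide_mult_cancel_left[of "2::real" 1 "beta + (cos (\<theta> - \<alpha>))\<^sup>2"]
          by (simp only: mult_1_right)
      qed
      finally show ?thesis unfolding eigfun_def a .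
    qed
    ultimately show "(?F has_real_derivative eigfun (dir \<theta>)) (at \<theta>)" by simp
  qed
  also have "?F (2 * pi) - ?F 0 = 2 * pi"
  proof -
    have p: "2 * (2 * pi - \<alpha>) = - (2 * \<alpha>) + 2 * (2 * pi)" "2 * (0 - \<alpha>) = - (2 * \<alpha>)" by simp_all
    have "sin (2 * (2 * pi - \<alpha>)) = sin (2 * (0 - \<alpha>))" "cos (2 * (2 * pi - \<alpha>)) = cos (2 * (0 - \<alpha>))"
      unfolding p using sin_periodic[of "- (2 * \<alpha>) + 2 * pi"] sin_periodic[of "- (2 * \<alpha>)"]
        cos_periodic[of "- (2 * \<alpha>) + 2 * pi"] cos_periodic[of "- (2 * \<alpha>)"] by (simp_all add: algebra_simps)
    then show ?thesis by simp
  qed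
  finally show ?thesis by simp
qed

text \<open>Since beta + cos^2 = s^2 - sin^2 with s^2 = beta + 1, partial fractions give a periodic
  logarithmic antiderivative. The vanishing mean is what lets \<open>Rv\<close> be dropped on the
  product of w and g in the minimization problem.\<close>

lemma v_mean_unit_eigfun: "v_mean (\<lambda>v. of_real ((v \<bullet> e) * eigfun v)) = 0"
proof -
  obtain \<alpha> where a: "\<And>\<theta>. dir \<theta> \<bullet> e = cos (\<theta> - \<alpha>)" using unit_polar by blast
  define s where "s = sqrt (beta + 1)"
  have ss: "s * s = beta + 1" unfolding s_def using beta_pos by simp
  have s1: "s > 1" unfolding s_def using beta_pos by simp
  let ?F = "\<lambda>\<theta>. (ln (s + sin (\<theta> - \<alpha>)) - ln (s - sin (\<theta> - \<alpha>))) / (2 * s)"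
  have "v_mean (\<lambda>v. of_real ((v \<bullet> e) * eigfun v)) = of_real ((?F (2 * pi) - ?F 0) / (2 * pi))"
  proof (rule v_mean_via_antiderivative)
    show "continuous_on UNIV (\<lambda>v. (v \<bullet> e) * eigfun v)" by (intro continuous_intros eigfun_continuous)
    fix \<theta>
    define t c where "t = sin (\<theta> - \<alpha>)" and "c = cos (\<theta> - \<alpha>)"
    have b: "s + t > 0" "s - t > 0" unfolding t_def using s1 sin_ge_minus_one[of "\<theta> - \<alpha>"] sin_le_one[of "\<theta> - \<alpha>"] by linarith+
    have ds: "((\<lambda>\<theta>. sin (\<theta> - \<alpha>)) has_real_derivative c) (at \<theta>)"
      unfolding c_def by (auto intro!: derivative_eq_intros)
    have "((\<lambda>\<theta>. ln (s + sin (\<theta> - \<alpha>))) has_real_derivative 1 / (s + t) * (0 + c)) (at \<theta>)"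
      unfolding t_def by (rule DERIV_chain2[OF DERIV_ln_divide DERIV_add[OF DERIV_const ds]]) (use b(1) t_def in simp)
    moreover have "((\<lambda>\<theta>. ln (s - sin (\<theta> - \<alpha>))) has_real_derivative 1 / (s - t) * (0 - c)) (at \<theta>)"
      unfolding t_def by (rule DERIV_chain2[OF DERIV_ln_divide DERIV_diff[OF DERIV_const ds]]) (use b(2) t_def in simp)
    ultimately have "(?F has_real_derivative (1 / (s + t) * (0 + c) - 1 / (s - t) * (0 - c)) / (2 * s)) (at \<theta>)"
      by (intro DERIV_cdivide DERIV_diff)
    moreover have "(1 / (s + t) * (0 + c) - 1 / (s - t) * (0 - c)) / (2 * s) = c / ((s + t) * (s - t))"
    proof -
      have "1 / (s + t) * (0 + c) - 1 / (s - t) * (0 - c) = c / (s + t) + c / (s - t)" by simp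
      also have "\<dots> = (c * (s - t) + c * (s + t)) / ((s + t) * (s - t))"
        by (rule add_frac_eq) (use b in simp_all)
      also have "c * (s - t) + c * (s + t) = c * (2 * s)" by (simp add: algebra_simps)
      finally show ?thesis using s1 by simp
    qed
    moreover have "(s + t) * (s - t) = beta + c\<^sup>2"
    proof -
      have "t * t = 1 - c\<^sup>2" unfolding t_def c_def using sin_cos_squared_add[of "\<theta> - \<alpha>"]
        by (simp add: power2_eq_square algebra_simps)
      then show ?thesis using ss by (simp add: algebra_simps)
    qed
    ultimately show "(?F has_real_derivative (dir \<theta> \<bullet> e) * eigfun (dir \<theta>)) (at \<theta>)"
      unfolding eigfun_def a c_def by simp
  qed
  moreover have "sin (2 * pi - \<alpha>) = sin (0 - \<alpha>)" by (simp add: sin_diff)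
  ultimately show ?thesis by simp
qed

text \<open>The minimizer \<open>g\<close> satisfies a linear equation, so the quadratic form of
  \<open>\<phi>\<close> against \<open>g\<close> depends on the mean of \<open>\<phi>\<close> only;
  this is \<open>Q\<close>. Equality holds at \<open>g\<close>, so the constant is the best one for
  a unit direction.\<close>

lemma coercive_unit:
  assumes \<phi>: "\<phi> \<in> L2 circle"
  shows "(1 - beta) * (l2_norm circle \<phi>)\<^sup>2
    \<le> (l2_norm circle (Rv \<phi>))\<^sup>2 + (l2_norm circle (Rv (\<lambda>v. of_real (v \<bullet> e) * \<phi> v)))\<^sup>2"
proof -
  define g where "g v = complex_of_real (eigfun v)" for v
  define w where "w v = complex_of_real (v \<bullet> e)" for v
  define c where "c = v_mean \<phi>"
  have g: "g \<in> L2 circle" unfolding g_def[abs_def] by (rule eigfun_L2)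
  have wm: "w \<in> borel_measurable circle"
    unfolding w_def[abs_def] by (intro measurable_circle_continuous continuous_intros)
  have wb: "cmod (w v) \<le> norm e" if "v \<in> space circle" for v
    using that Cauchy_Schwarz_ineq2[of v e] by (simp add: w_def space_circle)
  have wL: "(\<lambda>v. w v * \<psi> v) \<in> L2 circle" if "\<psi> \<in> L2 circle" for \<psi>
    by (rule L2_bounded_mult[OF that wm wb])
  have ws: "l2_inner circle (\<lambda>v. w v * \<psi> v) \<chi>' = l2_inner circle \<psi> (\<lambda>v. w v * \<chi>' v)" for \<psi> \<chi>'
    unfolding l2_inner_def w_def by (rule Bochner_Integration.integral_cong) simp_all
  have mg: "v_mean g = 1" unfolding g_def[abs_def] by (rule v_mean_eigfun)
  have "v_mean (\<lambda>v. w v * g v) = 0"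
    using v_mean_unit_eigfun unfolding w_def g_def by simp
  then have Rwg: "Rv (\<lambda>v. w v * g v) = (\<lambda>v. w v * g v)" by (simp add: Rv_def)
  have eig: "of_real beta * Rv g v + w v * (w v * g v) = of_real (1 - beta)" for v
  proof -
    have "of_real beta * Rv g v + w v * (w v * g v) = of_real ((beta + (v \<bullet> e)\<^sup>2) * eigfun v - beta)"
      unfolding Rv_def mg by (simp add: g_def w_def power2_eq_square algebra_simps)
    also have "(beta + (v \<bullet> e)\<^sup>2) * eigfun v = 1"
      unfolding eigfun_def using eigfun_pos[of v] by simp
    finally show ?thesis .
  qed
  have Q: "of_real beta * l2_inner circle (Rv \<psi>) (Rv g) + l2_inner circle (Rv (\<lambda>v. w v * \<psi> v)) (Rv (\<lambda>v. w v * g v))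
      = of_real (2 * pi * (1 - beta)) * v_mean \<psi>" if \<psi>: "\<psi> \<in> L2 circle" for \<psi>
  proof -
    have "l2_inner circle (Rv (\<lambda>v. w v * \<psi> v)) (Rv (\<lambda>v. w v * g v)) = l2_inner circle (\<lambda>v. w v * \<psi> v) (Rv (\<lambda>v. w v * g v))"
      by (rule inner_Rv_symmetric[OF wL[OF \<psi>] wL[OF g]])
    also have "\<dots> = l2_inner circle \<psi> (\<lambda>v. w v * (w v * g v))" unfolding Rwg ws ..
    finally have "of_real beta * l2_inner circle (Rv \<psi>) (Rv g) + l2_inner circle (Rv (\<lambda>v. w v * \<psi> v)) (Rv (\<lambda>v. w v * g v))
        = l2_inner circle \<psi> (\<lambda>v. of_real beta * Rv g v) + l2_inner circle \<psi> (\<lambda>v. w v * (w v * g v))"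
      by (simp add: inner_Rv_symmetric[OF \<psi> g] l2_inner_scale_right)
    also have "\<dots> = l2_inner circle \<psi> (\<lambda>v. of_real beta * Rv g v + w v * (w v * g v))"
      by (intro l2_inner_add_right[symmetric] L2_scale Rv_L2 g wL \<psi>)
    also have "\<dots> = of_real (2 * pi * (1 - beta)) * v_mean \<psi>"
      unfolding eig inner_const_right by simp
    finally show ?thesis .
  qed
  define A B where "A = l2_inner circle (Rv \<phi>) (Rv g)" and "B = l2_inner circle (Rv (\<lambda>v. w v * \<phi> v)) (Rv (\<lambda>v. w v * g v))"
  define a b where "a = (l2_norm circle (Rv g))\<^sup>2" and "b = (l2_norm circle (Rv (\<lambda>v. w v * g v)))\<^sup>2"
  have QA: "of_real beta * A + B = of_real (2 * pi * (1 - beta)) * c" unfolding A_def B_def c_def by (rule Q[OF \<phi>])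
  have Qa: "beta * a + b = 2 * pi * (1 - beta)"
  proof -
    have "complex_of_real (beta * a + b) = of_real (2 * pi * (1 - beta))"
      using Q[OF g] by (simp add: l2_inner_self mg a_def b_def)
    then show ?thesis by (simp only: of_real_eq_iff)
  qed
  \<comment> \<open>Completing squares: 1 and 2 express that \<open>\<phi>\<close> minus its mean
    times \<open>g\<close> has nonnegative values of the two forms. Adding beta times 1 to 2 and
    inserting \<open>Q\<close> removes all cross terms; the remaining part (1 - beta) of the norm of
    \<open>Rv \<phi>\<close> is put back at the end.\<close>
  have 1: "(l2_norm circle (Rv \<phi>))\<^sup>2 - 2 * Re (cnj c * A) + (cmod c)\<^sup>2 * a \<ge> 0"
    unfolding A_def a_def using l2_norm_diff_scale[OF Rv_L2[OF \<phi>] Rv_L2[OF g], of c]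
      zero_le_power2[of "l2_norm circle (\<lambda>z. Rv \<phi> z - c * Rv g z)"] by linarith
  have 2: "(l2_norm circle (Rv (\<lambda>v. w v * \<phi> v)))\<^sup>2 - 2 * Re (cnj c * B) + (cmod c)\<^sup>2 * b \<ge> 0"
    unfolding B_def b_def using l2_norm_diff_scale[OF Rv_L2[OF wL[OF \<phi>]] Rv_L2[OF wL[OF g]], of c]
      zero_le_power2[of "l2_norm circle (\<lambda>z. Rv (\<lambda>v. w v * \<phi> v) z - c * Rv (\<lambda>v. w v * g v) z)"] by linarith
  have "beta * Re (cnj c * A) + Re (cnj c * B) = Re (cnj c * (of_real beta * A + B))"
    by (simp add: algebra_simps)
  also have "cnj c * (of_real beta * A + B) = of_real (2 * pi * (1 - beta) * (cmod c)\<^sup>2)"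
    unfolding QA of_real_mult complex_norm_square by (simp add: mult_ac)
  finally have 3: "beta * Re (cnj c * A) + Re (cnj c * B) = 2 * pi * (1 - beta) * (cmod c)\<^sup>2" by simp
  have 4: "beta * ((cmod c)\<^sup>2 * a) + (cmod c)\<^sup>2 * b = 2 * pi * (1 - beta) * (cmod c)\<^sup>2"
  proof -
    have "beta * ((cmod c)\<^sup>2 * a) + (cmod c)\<^sup>2 * b = (beta * a + b) * (cmod c)\<^sup>2" by (simp add: algebra_simps)
    then show ?thesis unfolding Qa .
  qed
  have "0 \<le> beta * ((l2_norm circle (Rv \<phi>))\<^sup>2 - 2 * Re (cnj c * A) + (cmod c)\<^sup>2 * a)"
    using 1 beta_pos by (intro mult_nonneg_nonneg) simp_all
  then have 5: "0 \<le> beta * (l2_norm circle (Rv \<phi>))\<^sup>2 + (l2_norm circle (Rv (\<lambda>v. w v * \<phi> v)))\<^sup>2 - 2 * pi * (1 - beta) * (cmod c)\<^sup>2"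
    using 2 3 4 unfolding right_diff_distrib distrib_left by linarith
  have "(1 - beta) * (l2_norm circle \<phi>)\<^sup>2 = (1 - beta) * (l2_norm circle (Rv \<phi>))\<^sup>2 + 2 * pi * (1 - beta) * (cmod c)\<^sup>2"
    unfolding norm_Rv_power2[OF \<phi>] c_def by (simp add: algebra_simps)
  then show ?thesis using 5 unfolding w_def left_diff_distrib by linarith
qed

text \<open>The second term scales with |n| >= 1, so unit length is the worst case and the constant
  does not depend on \<open>n\<close>.\<close>

lemma coercive_mode:
  assumes \<phi>: "\<phi> \<in> L2 circle"
  shows "(3 - sqrt 5) / 2 * (l2_norm circle \<phi>)\<^sup>2
    \<le> (l2_norm circle (Rv \<phi>))\<^sup>2 + (l2_norm circle (Rv (\<lambda>v. v_dot n v * \<phi> v)))\<^sup>2"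
proof -
  let ?N = "norm (rvec n)"
  have "Rv (\<lambda>v. v_dot n v * \<phi> v) = (\<lambda>v. of_real ?N * Rv (\<lambda>v. of_real (v \<bullet> e) * \<phi> v) v)"
    unfolding Rv_def v_dot_unit mult.assoc v_mean_scale by (simp add: right_diff_distrib)
  then have "l2_norm circle (Rv (\<lambda>v. v_dot n v * \<phi> v)) = ?N * l2_norm circle (Rv (\<lambda>v. of_real (v \<bullet> e) * \<phi> v))"
    by (simp add: l2_norm_scale)
  moreover have "1 * l2_norm circle (Rv (\<lambda>v. of_real (v \<bullet> e) * \<phi> v)) \<le> ?N * l2_norm circle (Rv (\<lambda>v. of_real (v \<bullet> e) * \<phi> v))"
    by (rule mult_right_mono[OF norm_rvec_ge_1[OF n0]]) simp
  ultimately have "(l2_norm circle (Rv (\<lambda>v. of_real (v \<bullet> e) * \<phi> v)))\<^sup>2 \<le> (l2_norm circle (Rv (\<lambda>v. v_dot n v * \<phi> v)))\<^sup>2"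
    by (intro power_mono) simp_all
  moreover have b: "(3 - sqrt 5) / 2 = 1 - beta" by (simp add: beta_def field_simps)
  ultimately show ?thesis unfolding b using coercive_unit[OF \<phi>] by linarith
qed

end

lemma v_mean_v_dot: "v_mean (v_dot n) = 0"
proof (cases "n = 0")
  case True
  have "v_dot n = (\<lambda>v. 0)" unfolding v_dot_def[abs_def] True rvec_0 by simp
  then show ?thesis by simp
next
  case False
  show ?thesis
    unfolding v_dot_unit[OF False refl, abs_def] v_mean_scale v_mean_unit[OF False refl] by simp
qed

lemma v_mean_v_dot_sq: "v_mean (\<lambda>v. v_dot n v * v_dot n v) = of_real ((norm (rvec n))\<^sup>2 / 2)"
proof (cases "n = 0")
  case True
  have "v_dot n = (\<lambda>v. 0)" unfolding v_dot_def[abs_def] True rvec_0 by simp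
  then show ?thesis unfolding True rvec_0 by simp
next
  case False
  have "v_dot n v * v_dot n v = of_real ((norm (rvec n))\<^sup>2) * of_real ((v \<bullet> (rvec n /\<^sub>R norm (rvec n)))\<^sup>2)" for v
    unfolding v_dot_unit[OF False refl] by (simp add: power2_eq_square mult_ac)
  then show ?thesis by (simp only: v_mean_scale v_mean_unit_sq[OF False refl]) simp
qed

section \<open>Hypocoercivity inequalities\<close>

lemma hc_sum_0: "(f, g) \<in> hc_sum A R B 0 \<longleftrightarrow> (f, g) \<in> R"
proof
  assume "(f, g) \<in> hc_sum A R B 0"
  then obtain h where h: "g = (\<lambda>z. \<Sum>j\<le>0. h j z)" "\<forall>j\<le>0. (f, h j) \<in> (B ^^ j) O R O (A ^^ j)"
    unfolding hc_sum_def mem_Collect_eq by (elim exE conjE) simp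
  have "g = h 0" unfolding h(1) by simp
  with h(2)[rule_format, of 0] show "(f, g) \<in> R" by simp
next
  assume "(f, g) \<in> R"
  then show "(f, g) \<in> hc_sum A R B 0"
    unfolding hc_sum_def mem_Collect_eq by (intro exI[of _ f] exI[of _ "\<lambda>_. g"]) simp
qed

lemma hc_sum_1:
  "(f, g) \<in> hc_sum A R B 1 \<longleftrightarrow>
    (\<exists>r h k l. g = (\<lambda>z. r z + l z) \<and> (f, r) \<in> R \<and> (f, h) \<in> B \<and> (h, k) \<in> R \<and> (k, l) \<in> A)"
proof
  assume "(f, g) \<in> hc_sum A R B 1"
  then obtain u where u: "g = (\<lambda>z. \<Sum>j\<le>1. u j z)" "\<forall>j\<le>1. (f, u j) \<in> (B ^^ j) O R O (A ^^ j)"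
    unfolding hc_sum_def mem_Collect_eq by (elim exE conjE) simp
  have "(f, u 0) \<in> R" using u(2)[rule_format, of 0] by simp
  moreover have "(f, u 1) \<in> B O R O A" using u(2)[rule_format, of 1] by simp
  then obtain h k where "(f, h) \<in> B" "(h, k) \<in> R" "(k, u 1) \<in> A"
    by (elim relcompE Pair_inject) simp
  moreover have "g = (\<lambda>z. u 0 z + u 1 z)" unfolding u(1) by simp
  ultimately show "\<exists>r h k l. g = (\<lambda>z. r z + l z) \<and> (f, r) \<in> R \<and> (f, h) \<in> B \<and> (h, k) \<in> R \<and> (k, l) \<in> A"
    by (intro exI[of _ "u 0"] exI[of _ h] exI[of _ k] exI[of _ "u 1"] conjI)
next
  assume "\<exists>r h k l. g = (\<lambda>z. r z + l z) \<and> (f, r) \<in> R \<and> (f, h) \<in> B \<and> (h, k) \<in> R \<and> (k, l) \<in> A"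
  then obtain r h k l where *: "g = (\<lambda>z. r z + l z)" "(f, r) \<in> R" "(f, h) \<in> B" "(h, k) \<in> R" "(k, l) \<in> A"
    by (elim exE conjE) simp
  let ?u = "\<lambda>j :: nat. if j = 0 then r else l"
  have "(f, ?u j) \<in> (B ^^ j) O R O (A ^^ j)" if "j \<le> 1" for j
  proof -
    have l: "(f, l) \<in> B O R O A" using *(3,4,5) by (intro relcompI)
    from that consider "j = 0" | "j = 1" by linarith
    then show ?thesis by cases (use *(2) l in simp_all)
  qed
  moreover have "g = (\<lambda>z. \<Sum>j\<le>1. ?u j z)" using *(1) by simp
  ultimately show "(f, g) \<in> hc_sum A R B 1"
    unfolding hc_sum_def mem_Collect_eq by (intro exI[of _ f] exI[of _ ?u]) simp
qed

lemma op_ge_on_iff: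
  "op_ge_on M D T \<kappa> \<longleftrightarrow> D \<subseteq> Domain T \<and> (\<forall>f g. (f, g) \<in> T \<longrightarrow> f \<in> D \<longrightarrow>
    Im (l2_inner M g f) = 0 \<and> \<kappa> * (l2_norm M f)\<^sup>2 \<le> Re (l2_inner M g f))"
  by (simp only: op_ge_on_def Ball_def split_paired_All prod.case)

text \<open>One frame for transport on the circle, for \<open>Cn n\<close> on the circle and for
  transport on phase space. \<open>R_inner\<close> expresses that R is an orthogonal projection and
  \<open>AB\<close> that A and B are formally adjoint; together they turn the quadratic form into a
  sum of two squared norms.\<close>

locale hc_operators =
  fixes M :: "'a measure" and A R B :: "'a op_graph"
  assumes R_L2: "(f, r) \<in> R \<Longrightarrow> f \<in> L2 M \<and> r \<in> L2 M"
    and R_inner: "(f, r) \<in> R \<Longrightarrow> l2_inner M r f = of_real ((l2_norm M r)\<^sup>2)"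
    and A_L2: "(k, l) \<in> A \<Longrightarrow> l \<in> L2 M"
    and AB: "(k, l) \<in> A \<Longrightarrow> (f, h) \<in> B \<Longrightarrow> l2_inner M l f = l2_inner M k h"
begin

lemma inner_sum:
  assumes "(f, r) \<in> R" "(f, h) \<in> B" "(h, k) \<in> R" "(k, l) \<in> A"
  shows "l2_inner M (\<lambda>z. r z + l z) f = of_real ((l2_norm M r)\<^sup>2 + (l2_norm M k)\<^sup>2)"
proof -
  have "l2_inner M (\<lambda>z. r z + l z) f = l2_inner M r f + l2_inner M l f"
    by (rule l2_inner_add_left) (use assms R_L2 A_L2 in blast)+
  also have "l2_inner M l f = l2_inner M k h" by (rule AB[OF assms(4,2)])
  finally show ?thesis by (simp add: R_inner[OF assms(1)] R_inner[OF assms(3)])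
qed

lemma op_ge_onI:
  assumes dom: "\<And>f. f \<in> D \<Longrightarrow> \<exists>r h k l. (f, r) \<in> R \<and> (f, h) \<in> B \<and> (h, k) \<in> R \<and> (k, l) \<in> A"
    and coer: "\<And>f r h k. f \<in> D \<Longrightarrow> (f, r) \<in> R \<Longrightarrow> (f, h) \<in> B \<Longrightarrow> (h, k) \<in> R \<Longrightarrow>
      \<kappa> * (l2_norm M f)\<^sup>2 \<le> (l2_norm M r)\<^sup>2 + (l2_norm M k)\<^sup>2"
  shows "op_ge_on M D (hc_sum A R B 1) \<kappa>"
  unfolding op_ge_on_iff
proof (intro conjI subsetI allI impI)
  fix f assume "f \<in> D"
  from dom[OF this] obtain r h k l where "(f, r) \<in> R" "(f, h) \<in> B" "(h, k) \<in> R" "(k, l) \<in> A" by blast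
  then have "(f, \<lambda>z. r z + l z) \<in> hc_sum A R B 1" unfolding hc_sum_1 by blast
  then show "f \<in> Domain (hc_sum A R B 1)" by blast
next
  fix f g assume "(f, g) \<in> hc_sum A R B 1" and f: "f \<in> D"
  then obtain r h k l where *: "g = (\<lambda>z. r z + l z)" "(f, r) \<in> R" "(f, h) \<in> B" "(h, k) \<in> R" "(k, l) \<in> A"
    unfolding hc_sum_1 by blast
  show "Im (l2_inner M g f) = 0" "\<kappa> * (l2_norm M f)\<^sup>2 \<le> Re (l2_inner M g f)"
    unfolding *(1) inner_sum[OF *(2-)] using coer[OF f *(2-4)] by simp_all
qed

lemma op_ge_onD:
  assumes "op_ge_on M D (hc_sum A R B 1) \<kappa>" "f \<in> D" "(f, r) \<in> R" "(f, h) \<in> B" "(h, k) \<in> R" "(k, l) \<in> A"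
  shows "\<kappa> * (l2_norm M f)\<^sup>2 \<le> (l2_norm M r)\<^sup>2 + (l2_norm M k)\<^sup>2"
proof -
  have "(f, \<lambda>z. r z + l z) \<in> hc_sum A R B 1" unfolding hc_sum_1 using assms by blast
  then have "\<kappa> * (l2_norm M f)\<^sup>2 \<le> Re (l2_inner M (\<lambda>z. r z + l z) f)"
    using assms(1,2) unfolding op_ge_on_iff by blast
  then show ?thesis unfolding inner_sum[OF assms(3-6)] by simp
qed

end

text \<open>For index 0 the operator is R alone, and a single nonzero function annihilated by its
  form rules out coercivity.\<close>

lemma not_op_ge_on_0:
  assumes "f \<in> D" "(f, r) \<in> R" "l2_inner M r f = 0" "0 < l2_norm M f"
  shows "\<not> (\<exists>\<kappa>>0. op_ge_on M D (hc_sum A R B 0) \<kappa>)"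
proof
  assume "\<exists>\<kappa>>0. op_ge_on M D (hc_sum A R B 0) \<kappa>"
  then obtain \<kappa> where \<kappa>: "0 < \<kappa>" "op_ge_on M D (hc_sum A R B 0) \<kappa>" by blast
  have "(f, r) \<in> hc_sum A R B 0" unfolding hc_sum_0 by fact
  then have "\<kappa> * (l2_norm M f)\<^sup>2 \<le> Re (l2_inner M r f)"
    using \<kappa>(2) assms(1) unfolding op_ge_on_iff by blast
  then have "\<kappa> * (l2_norm M f)\<^sup>2 \<le> 0" using assms(3) by simp
  moreover have "0 < \<kappa> * (l2_norm M f)\<^sup>2" using \<kappa> assms by simp
  ultimately show False by linarith
qed

lemma hypocoercivity_index_1I:
  assumes "0 < \<kappa>" "op_ge_on M D (hc_sum A R B 1) \<kappa>" "\<not> (\<exists>\<kappa>>0. op_ge_on M D (hc_sum A R B 0) \<kappa>)"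
  shows "hypocoercivity_index M D A R B 1"
  unfolding hypocoercivity_index_def
proof (intro conjI allI impI)
  show "\<exists>\<kappa>>0. op_ge_on M D (hc_sum A R B 1) \<kappa>" using assms(1,2) by blast
  fix k :: nat assume "k < 1"
  then have "k = 0" by simp
  then show "\<not> (\<exists>\<kappa>>0. op_ge_on M D (hc_sum A R B k) \<kappa>)" using assms(3) by simp
qed

subsection \<open>On the circle\<close>

lemma adj_iff:
  "(g, h) \<in> adj M T \<longleftrightarrow> g \<in> L2 M \<and> h \<in> L2 M \<and>
    (\<forall>f f'. (f, f') \<in> T \<longrightarrow> l2_inner M f' g = l2_inner M f h)"
  by (simp only: adj_def mem_Collect_eq prod.case Ball_def split_paired_All)

lemma graph_of_L2: "(f, g) \<in> graph_of M T \<Longrightarrow> f \<in> L2 M \<and> g \<in> L2 M \<and> (AE z in M. g z = T f z)"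
  by (simp add: graph_of_def)

lemma graph_ofI: "f \<in> L2 M \<Longrightarrow> T f \<in> L2 M \<Longrightarrow> (f, T f) \<in> graph_of M T"
  by (simp add: graph_of_def)

lemma adj_graph_pair:
  assumes "(k, l) \<in> adj M (graph_of M T)" "(f, h) \<in> graph_of M T"
  shows "l2_inner M l f = l2_inner M k h"
proof -
  have "l2_inner M h k = l2_inner M f l" using assms unfolding adj_iff by blast
  from arg_cong[OF this, of cnj] show ?thesis by (simp only: l2_inner_commute[symmetric])
qed

lemma adj_graphI:
  assumes g: "g \<in> L2 M" "S \<in> L2 M" and T: "\<And>f. f \<in> L2 M \<Longrightarrow> T f \<in> L2 M"
    and eq: "\<And>f. f \<in> L2 M \<Longrightarrow> l2_inner M (T f) g = l2_inner M f S"
  shows "(g, S) \<in> adj M (graph_of M T)"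
proof -
  have "l2_inner M f' g = l2_inner M f S" if "(f, f') \<in> graph_of M T" for f f'
  proof -
    note * = graph_of_L2[OF that]
    have "l2_inner M f' g = l2_inner M (T f) g"
      by (rule l2_inner_cong_AE) (use * T g in \<open>simp_all add: L2_measurable\<close>)
    then show ?thesis using eq * by simp
  qed
  then show ?thesis unfolding adj_iff using g by blast
qed

lemma graph_Rv_iff: "(f, r) \<in> graph_of circle Rv \<longleftrightarrow> f \<in> L2 circle \<and> r \<in> L2 circle \<and> (AE v in circle. r v = Rv f v)"
  by (simp add: graph_of_def)

lemma graph_Rv_inner:
  assumes "(f, r) \<in> graph_of circle Rv" shows "l2_inner circle r f = of_real ((l2_norm circle r)\<^sup>2)"
proof -
  note * = assms[unfolded graph_Rv_iff]
  note m = L2_measurable[of r circle] L2_measurable[of f circle] L2_measurable[OF Rv_L2, of f]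
  have "l2_inner circle r f = l2_inner circle (Rv f) f"
    by (rule l2_inner_cong_AE) (use * m in auto)
  also have "\<dots> = of_real ((l2_norm circle (Rv f))\<^sup>2)" using * by (simp add: inner_Rv l2_inner_self)
  also have "l2_norm circle (Rv f) = l2_norm circle r"
    by (rule l2_norm_cong_AE[symmetric]) (use * m in auto)
  finally show ?thesis .
qed

lemma norm_graph_Rv:
  assumes "(f, r) \<in> graph_of circle Rv" "g \<in> L2 circle" "AE v in circle. f v = g v"
  shows "l2_norm circle r = l2_norm circle (Rv g)"
proof (rule l2_norm_cong_AE)
  note * = assms(1)[unfolded graph_Rv_iff]
  show "r \<in> borel_measurable circle" "Rv g \<in> borel_measurable circle"
    using * by (auto intro: L2_measurable Rv_L2 assms)
  have "AE v in circle. Rv f v = Rv g v"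
    by (rule Rv_cong_AE) (use * assms in \<open>auto intro: L2_measurable\<close>)
  then show "AE v in circle. r v = Rv g v" using *[THEN conjunct2, THEN conjunct2] by eventually_elim simp
qed

lemma Jn_L2: "\<phi> \<in> L2 circle \<Longrightarrow> Jn n \<phi> \<in> L2 circle"
  unfolding Jn_eq by (intro L2_scale v_dot_L2)

lemma Jn_inner: "l2_inner circle (Jn n f) g = l2_inner circle f (\<lambda>v. \<i> * (v_dot n v * g v))"
  unfolding Jn_eq l2_inner_scale_left l2_inner_scale_right inner_v_dot by simp

text \<open>From left to right, test the adjoint relation with the difference between
  \<open>h\<close> and the expected value: its norm is then zero.\<close>

lemma adj_Jn_iff:
  "(g, h) \<in> adj circle (graph_of circle (Jn n)) \<longleftrightarrow>
    g \<in> L2 circle \<and> h \<in> L2 circle \<and> (AE v in circle. h v = \<i> * (v_dot n v * g v))"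
proof
  assume a: "(g, h) \<in> adj circle (graph_of circle (Jn n))"
  then have g: "g \<in> L2 circle" and h: "h \<in> L2 circle" unfolding adj_iff by auto
  let ?S = "\<lambda>v. \<i> * (v_dot n v * g v)"
  let ?d = "\<lambda>v. h v - ?S v"
  have S: "?S \<in> L2 circle" by (intro L2_scale v_dot_L2 g)
  have d: "?d \<in> L2 circle" by (rule L2_diff[OF h S])
  have "(?d, Jn n ?d) \<in> graph_of circle (Jn n)" by (rule graph_ofI) (rule d, rule Jn_L2[OF d])
  from adj_graph_pair[OF a this] have "l2_inner circle h ?d = l2_inner circle g (Jn n ?d)" .
  also have "\<dots> = l2_inner circle ?S ?d"
    by (subst l2_inner_commute, subst Jn_inner) (rule l2_inner_commute[symmetric])
  finally have "l2_inner circle ?d ?d = 0" by (simp add: l2_inner_diff_left[OF h S d])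
  then have "l2_norm circle ?d = 0" by (simp add: l2_inner_self)
  then have "AE v in circle. ?d v = 0" using l2_norm_eq_0[OF d] by simp
  then have "AE v in circle. h v = ?S v" by eventually_elim (simp only: right_minus_eq)
  with g h show "g \<in> L2 circle \<and> h \<in> L2 circle \<and> (AE v in circle. h v = \<i> * (v_dot n v * g v))" by blast
next
  assume *: "g \<in> L2 circle \<and> h \<in> L2 circle \<and> (AE v in circle. h v = \<i> * (v_dot n v * g v))"
  then have S: "(\<lambda>v. \<i> * (v_dot n v * g v)) \<in> L2 circle" by (intro L2_scale v_dot_L2) simp
  show "(g, h) \<in> adj circle (graph_of circle (Jn n))"
  proof (rule adj_graphI)
    fix f assume f: "f \<in> L2 circle"
    show "l2_inner circle (Jn n f) g = l2_inner circle f h"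
      unfolding Jn_inner by (rule l2_inner_cong_AE) (use * f S in \<open>auto intro: L2_measurable\<close>)
  qed (use * Jn_L2 in auto)
qed

interpretation J_ops: hc_operators circle "graph_of circle (Jn n)" "graph_of circle Rv" "adj circle (graph_of circle (Jn n))" for n
proof
  fix f h k l assume kl: "(k, l) \<in> graph_of circle (Jn n)"
  from graph_of_L2[OF kl] show "l \<in> L2 circle" by blast
  assume fh: "(f, h) \<in> adj circle (graph_of circle (Jn n))"
  from arg_cong[OF adj_graph_pair[OF fh kl], of cnj] show "l2_inner circle l f = l2_inner circle k h"
    by (simp only: l2_inner_commute[symmetric])
next
  fix f r assume r: "(f, r) \<in> graph_of circle Rv"
  from graph_of_L2[OF r] show "f \<in> L2 circle \<and> r \<in> L2 circle" by blast
  show "l2_inner circle r f = of_real ((l2_norm circle r)\<^sup>2)" by (rule graph_Rv_inner[OF r])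
qed

interpretation C_ops: hc_operators circle "adj circle (graph_of circle (Cn n))" "graph_of circle Rv" "graph_of circle (Cn n)" for n
proof
  fix f h k l assume kl: "(k, l) \<in> adj circle (graph_of circle (Cn n))"
  then show "l \<in> L2 circle" unfolding adj_iff by blast
  assume fh: "(f, h) \<in> graph_of circle (Cn n)"
  show "l2_inner circle l f = l2_inner circle k h" by (rule adj_graph_pair[OF kl fh])
qed (fact J_ops.R_L2 J_ops.R_inner)+

lemma J_chain:
  assumes f: "f \<in> L2 circle"
  shows "(f, Rv f) \<in> graph_of circle Rv" "(f, \<lambda>v. \<i> * (v_dot n v * f v)) \<in> adj circle (graph_of circle (Jn n))"
    "((\<lambda>v. \<i> * (v_dot n v * f v)), Rv (\<lambda>v. \<i> * (v_dot n v * f v))) \<in> graph_of circle Rv"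
    "(Rv (\<lambda>v. \<i> * (v_dot n v * f v)), Jn n (Rv (\<lambda>v. \<i> * (v_dot n v * f v)))) \<in> graph_of circle (Jn n)"
proof -
  have h: "(\<lambda>v. \<i> * (v_dot n v * f v)) \<in> L2 circle" by (intro L2_scale v_dot_L2 f)
  show "(f, Rv f) \<in> graph_of circle Rv" by (rule graph_ofI) (rule f, rule Rv_L2[OF f])
  show "((\<lambda>v. \<i> * (v_dot n v * f v)), Rv (\<lambda>v. \<i> * (v_dot n v * f v))) \<in> graph_of circle Rv"
    by (rule graph_ofI) (rule h, rule Rv_L2[OF h])
  show "(Rv (\<lambda>v. \<i> * (v_dot n v * f v)), Jn n (Rv (\<lambda>v. \<i> * (v_dot n v * f v)))) \<in> graph_of circle (Jn n)"
    by (rule graph_ofI) (rule Rv_L2[OF h], rule Jn_L2[OF Rv_L2[OF h]])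
  show "(f, \<lambda>v. \<i> * (v_dot n v * f v)) \<in> adj circle (graph_of circle (Jn n))"
    unfolding adj_Jn_iff using f h by simp
qed

lemma norm_Rv_v_dot_scale: "l2_norm circle (Rv (\<lambda>v. \<i> * (v_dot n v * f v))) = l2_norm circle (Rv (\<lambda>v. v_dot n v * f v))"
proof -
  have "Rv (\<lambda>v. \<i> * (v_dot n v * f v)) = (\<lambda>v. \<i> * Rv (\<lambda>v. v_dot n v * f v) v)"
    unfolding Rv_def v_mean_scale by (simp add: right_diff_distrib)
  then show ?thesis by (simp add: l2_norm_scale)
qed

lemma coercive_J_kappa: "coercive_J ((3 - sqrt 5) / 2)"
  unfolding coercive_J_def
proof (intro allI impI J_ops.op_ge_onI)
  fix n :: "int^2" and f assume n: "n \<noteq> 0" and f: "f \<in> L2 circle"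
  then show "\<exists>r h k l. (f, r) \<in> graph_of circle Rv \<and> (f, h) \<in> adj circle (graph_of circle (Jn n)) \<and>
      (h, k) \<in> graph_of circle Rv \<and> (k, l) \<in> graph_of circle (Jn n)"
    using J_chain[OF f] by blast
  fix r h k
  assume r: "(f, r) \<in> graph_of circle Rv" and h: "(f, h) \<in> adj circle (graph_of circle (Jn n))" and k: "(h, k) \<in> graph_of circle Rv"
  have "l2_norm circle r = l2_norm circle (Rv f)" by (rule norm_graph_Rv[OF r f]) simp
  moreover have "l2_norm circle k = l2_norm circle (Rv (\<lambda>v. \<i> * (v_dot n v * f v)))"
    by (rule norm_graph_Rv[OF k]) (use h f in \<open>auto simp: adj_Jn_iff intro: L2_scale v_dot_L2\<close>)
  ultimately show "(3 - sqrt 5) / 2 * (l2_norm circle f)\<^sup>2 \<le> (l2_norm circle r)\<^sup>2 + (l2_norm circle k)\<^sup>2"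
    using coercive_mode[OF n refl f] by (simp only: norm_Rv_v_dot_scale)
qed

lemma kappa_pos: "0 < (3 - sqrt 5) / 2" and kappa_le_1: "(3 - sqrt 5) / 2 \<le> 1"
  by (simp_all add: real_less_lsqrt real_le_rsqrt)

lemma norm_one_circle: "(l2_norm circle (\<lambda>v. 1))\<^sup>2 = 2 * pi"
  by (simp add: l2_norm_power2 measure_circle)

lemma norm_v_dot: "(l2_norm circle (v_dot n))\<^sup>2 = pi * (norm (rvec n))\<^sup>2"
proof -
  have L: "v_dot n \<in> L2 circle" using v_dot_L2[OF const_L2_circle[of 1], of n] by simp
  have "complex_of_real ((l2_norm circle (v_dot n))\<^sup>2) = l2_inner circle (v_dot n) (v_dot n)"
    by (rule l2_inner_self[symmetric])
  also have "\<dots> = l2_inner circle (\<lambda>v. v_dot n v * v_dot n v) (\<lambda>v. 1)"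
    by (simp add: l2_inner_def v_dot_def)
  also have "\<dots> = of_real (pi * (norm (rvec n))\<^sup>2)"
    unfolding inner_const_right v_mean_v_dot_sq by simp
  finally show ?thesis by (simp only: of_real_eq_iff)
qed

lemma Rv_v_dot: "Rv (v_dot n) = v_dot n"
  by (simp add: Rv_def v_mean_v_dot)

lemma Rv_one: "Rv (\<lambda>v. c) = (\<lambda>v. 0)"
  by (simp add: Rv_def)

text \<open>Test with the constant 1 and n = (1, 0): \<open>Rv\<close> kills the constant, and the
  first velocity coordinate has squared norm pi against 2 pi. This bounds \<open>\<delta>\<close> by
  1/10 and thereby keeps \<open>c\<close> small.\<close>

lemma coercive_J_le_half:
  assumes "coercive_J \<kappa>" shows "\<kappa> \<le> 1 / 2"
proof -
  let ?n = "vector [1, 0] :: int^2" and ?f = "\<lambda>v :: real^2. 1 :: complex"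
  have n: "?n \<noteq> 0" by (auto simp: vec_eq_iff exI[of _ 1])
  have N: "(norm (rvec ?n))\<^sup>2 = 1" unfolding norm_rvec_power2 by simp
  have "op_ge_on circle (L2 circle)
     (hc_sum (graph_of circle (Jn ?n)) (graph_of circle Rv) (adj circle (graph_of circle (Jn ?n))) 1) \<kappa>"
    using assms n unfolding coercive_J_def by blast
  from J_ops.op_ge_onD[OF this const_L2_circle[of 1] J_chain[OF const_L2_circle[of 1]]]
  have "\<kappa> * (2 * pi) \<le> pi"
    unfolding norm_Rv_v_dot_scale norm_one_circle Rv_one using norm_v_dot[of ?n] N by (simp add: Rv_v_dot)
  then have "(2 * \<kappa>) * pi \<le> 1 * pi" by simp
  then have "2 * \<kappa> \<le> 1" using pi_gt_zero by (subst (asm) mult_le_cancel_right_pos) auto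
  then show ?thesis by simp
qed

lemma Cn_inner:
  assumes f: "f \<in> L2 circle" and g: "g \<in> L2 circle"
  shows "l2_inner circle (Cn n f) g = l2_inner circle f (\<lambda>v. Rv g v - \<i> * (v_dot n v * g v))"
proof -
  have s: "l2_inner circle (Rv f) g = l2_inner circle f (Rv g)"
    using inner_Rv_symmetric[OF f g] arg_cong[OF inner_Rv_symmetric[OF g f], of cnj]
    by (simp only: l2_inner_commute[symmetric])
  have "l2_inner circle (Cn n f) g = l2_inner circle (Rv f) g + l2_inner circle (\<lambda>v. \<i> * (v_dot n v * f v)) g"
    unfolding Cn_eq by (intro l2_inner_add_left Rv_L2 L2_scale v_dot_L2 f g)
  also have "l2_inner circle (\<lambda>v. \<i> * (v_dot n v * f v)) g = - l2_inner circle f (\<lambda>v. \<i> * (v_dot n v * g v))"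
    unfolding l2_inner_scale_left l2_inner_scale_right inner_v_dot by simp
  also have "l2_inner circle (Rv f) g + - l2_inner circle f (\<lambda>v. \<i> * (v_dot n v * g v))
      = l2_inner circle f (\<lambda>v. Rv g v - \<i> * (v_dot n v * g v))"
    unfolding s using l2_inner_diff_right[OF Rv_L2[OF g] L2_scale[OF v_dot_L2[OF g]] f, of \<i> n] by simp
  finally show ?thesis .
qed

lemma C_chain:
  assumes f: "f \<in> L2 circle"
  shows "\<exists>r h k l. (f, r) \<in> graph_of circle Rv \<and> (f, h) \<in> graph_of circle (Cn n) \<and>
    (h, k) \<in> graph_of circle Rv \<and> (k, l) \<in> adj circle (graph_of circle (Cn n))"
proof -
  let ?k = "Rv (Cn n f)"
  have k: "?k \<in> L2 circle" by (intro Rv_L2 Cn_L2 f)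
  have "(?k, \<lambda>v. Rv ?k v - \<i> * (v_dot n v * ?k v)) \<in> adj circle (graph_of circle (Cn n))"
    by (rule adj_graphI[OF k _ Cn_L2 Cn_inner]) (intro L2_diff Rv_L2 L2_scale v_dot_L2 k | assumption)+
  moreover have "(f, Rv f) \<in> graph_of circle Rv" "(f, Cn n f) \<in> graph_of circle (Cn n)"
    "(Cn n f, ?k) \<in> graph_of circle Rv"
    by (intro graph_ofI f Rv_L2 Cn_L2)+
  ultimately show ?thesis by blast
qed

text \<open>Because \<open>Rv\<close> is a projection, R C f = R f + R(i v.n f), so the triangle
  inequality bounds the transport term by the two terms available here. Squaring costs a factor 2
  and the additional term makes it 3.\<close>

lemma coercive_C_kappa: "coercive_C ((3 - sqrt 5) / 2 / 3)"
  unfolding coercive_C_def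
proof (intro allI impI C_ops.op_ge_onI C_chain)
  fix n :: "int^2" and f r h k assume n: "n \<noteq> 0" and f: "f \<in> L2 circle"
  assume r: "(f, r) \<in> graph_of circle Rv" and h: "(f, h) \<in> graph_of circle (Cn n)" and k: "(h, k) \<in> graph_of circle Rv"
  define x y z where "x = l2_norm circle (Rv f)" and "y = l2_norm circle (Rv (Cn n f))"
    and "z = l2_norm circle (Rv (\<lambda>v. v_dot n v * f v))"
  have r': "l2_norm circle r = x" unfolding x_def by (rule norm_graph_Rv[OF r f]) simp
  have k': "l2_norm circle k = y" unfolding y_def
    by (rule norm_graph_Rv[OF k Cn_L2[OF f]]) (use h graph_of_L2 in blast)
  have "Rv (\<lambda>v. \<i> * (v_dot n v * f v)) = (\<lambda>v. Rv (Cn n f) v - Rv f v)"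
  proof -
    have "v_mean (Cn n f) = v_mean (\<lambda>v. \<i> * (v_dot n v * f v))"
      unfolding Cn_eq by (subst v_mean_add) (simp_all add: v_mean_Rv f Rv_L2 L2_scale v_dot_L2)
    then show ?thesis unfolding Rv_def[of "Cn n f"] Rv_def[of "\<lambda>v. \<i> * (v_dot n v * f v)"] by (simp add: Cn_eq)
  qed
  then have "z = l2_norm circle (\<lambda>v. Rv (Cn n f) v - Rv f v)"
    unfolding z_def norm_Rv_v_dot_scale[symmetric] by simp
  also have "\<dots> \<le> y + x" unfolding x_def y_def by (intro l2_norm_triangle_diff Rv_L2 Cn_L2 f)
  finally have "z\<^sup>2 \<le> (y + x)\<^sup>2" by (rule power_mono) (simp add: z_def)
  also have "\<dots> \<le> 2 * y\<^sup>2 + 2 * x\<^sup>2" using sum_squares_bound[of y x] by (simp add: power2_sum)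
  finally have "x\<^sup>2 + z\<^sup>2 \<le> x\<^sup>2 + (2 * y\<^sup>2 + 2 * x\<^sup>2)" by (rule add_left_mono)
  also have "\<dots> \<le> x\<^sup>2 + (2 * y\<^sup>2 + 2 * x\<^sup>2) + y\<^sup>2" by simp
  also have "\<dots> = 3 * (x\<^sup>2 + y\<^sup>2)" by (simp add: algebra_simps)
  finally have "x\<^sup>2 + z\<^sup>2 \<le> 3 * (x\<^sup>2 + y\<^sup>2)" .
  moreover have "(3 - sqrt 5) / 2 * (l2_norm circle f)\<^sup>2 \<le> x\<^sup>2 + z\<^sup>2"
    unfolding x_def z_def by (rule coercive_mode[OF n refl f])
  ultimately show "(3 - sqrt 5) / 2 / 3 * (l2_norm circle f)\<^sup>2 \<le> (l2_norm circle r)\<^sup>2 + (l2_norm circle k)\<^sup>2"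
    unfolding r' k' by simp
qed

lemma hypocoercivity_index_C:
  assumes "n \<noteq> 0"
  shows "hypocoercivity_index circle (L2 circle) (adj circle (graph_of circle (Cn n))) (graph_of circle Rv) (graph_of circle (Cn n)) 1"
proof (rule hypocoercivity_index_1I)
  show "0 < (3 - sqrt 5) / 2 / 3" using kappa_pos by simp
  show "op_ge_on circle (L2 circle)
     (hc_sum (adj circle (graph_of circle (Cn n))) (graph_of circle Rv) (graph_of circle (Cn n)) 1) ((3 - sqrt 5) / 2 / 3)"
    using coercive_C_kappa assms unfolding coercive_C_def by blast
  show "\<not> (\<exists>\<kappa>>0. op_ge_on circle (L2 circle)
     (hc_sum (adj circle (graph_of circle (Cn n))) (graph_of circle Rv) (graph_of circle (Cn n)) 0) \<kappa>)"
  proof (rule not_op_ge_on_0[OF const_L2_circle[of 1]])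
    show "((\<lambda>v. 1), Rv (\<lambda>v. 1)) \<in> graph_of circle Rv" by (intro graph_ofI Rv_L2 const_L2_circle)
    show "l2_inner circle (Rv (\<lambda>v. 1)) (\<lambda>v. 1) = 0" unfolding Rv_one by (simp add: l2_inner_def)
    show "0 < l2_norm circle (\<lambda>v. 1)" using norm_one_circle by (simp add: l2_norm_def measure_circle)
  qed
qed

subsection \<open>On phase space\<close>

interpretation phase_ops: hc_operators phase J_op R_op "adj phase J_op"
proof
  fix f r assume "(f, r) \<in> R_op"
  then show "f \<in> L2 phase \<and> r \<in> L2 phase" "l2_inner phase r f = of_real ((l2_norm phase r)\<^sup>2)"
    by (simp_all add: R_op_iff R_op_inner)
next
  fix k l f h assume "(k, l) \<in> J_op" "(f, h) \<in> adj phase J_op"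
  then show "l2_inner phase l f = l2_inner phase k h" unfolding adj_iff by blast
qed (simp add: J_op_iff)

lemma integral_phase_eq_mode_0:
  assumes "f \<in> L2 phase"
  shows "(LINT z|phase. f z) = of_real ((2 * pi) ^ 3) * v_mean (fcoef 0 f)"
proof -
  have "lift 0 (\<lambda>v. 1) = (\<lambda>z. 1)" unfolding lift_def rvec_0 by simp
  then have "(LINT z|phase. f z) = l2_inner phase f (lift 0 (\<lambda>v. 1))" by (simp add: l2_inner_def)
  then show ?thesis unfolding inner_lift[OF assms const_L2_circle] inner_const_right
    by (simp add: power3_eq_cube power2_eq_square)
qed

text \<open>Summed over the modes. The mode 0 is not covered by the inequality on the circle; there
  the vanishing integral makes \<open>Rv\<close> act as the identity, and the constant is at most
  1.\<close>

lemma op_ge_on_phase: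
  "op_ge_on phase (D_circ \<inter> {f. (LINT z|phase. f z) = 0}) (hc_sum J_op R_op (adj phase J_op) 1) ((3 - sqrt 5) / 2)"
proof (rule phase_ops.op_ge_onI)
  fix f assume f: "f \<in> D_circ \<inter> {f. (LINT z|phase. f z) = 0}"
  then have fL: "f \<in> L2 phase" using D_circ_L2 by blast
  show "\<exists>r h k l. (f, r) \<in> R_op \<and> (f, h) \<in> adj phase J_op \<and> (h, k) \<in> R_op \<and> (k, l) \<in> J_op"
    using D_circ_chain[of f] R_op_exists[OF fL] f by blast
  fix r h k assume r: "(f, r) \<in> R_op" and h: "(f, h) \<in> adj phase J_op" and k: "(h, k) \<in> R_op"
  have rL: "r \<in> L2 phase" and hL: "h \<in> L2 phase" and kL: "k \<in> L2 phase" using r k by (auto simp: R_op_iff)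
  show "(3 - sqrt 5) / 2 * (l2_norm phase f)\<^sup>2 \<le> (l2_norm phase r)\<^sup>2 + (l2_norm phase k)\<^sup>2"
  proof (rule norm_sq_le_by_modes[OF fL rL kL])
    fix n
    have F: "fcoef n f \<in> L2 circle" by (rule fcoef_L2[OF fL])
    have rn: "l2_norm circle (fcoef n r) = l2_norm circle (Rv (fcoef n f))"
      by (intro l2_norm_cong_AE L2_measurable[OF fcoef_L2[OF rL]] L2_measurable[OF Rv_L2[OF F]])
        (use r in \<open>simp add: R_op_iff\<close>)
    show "(3 - sqrt 5) / 2 * (l2_norm circle (fcoef n f))\<^sup>2 \<le> (l2_norm circle (fcoef n r))\<^sup>2 + (l2_norm circle (fcoef n k))\<^sup>2"
    proof (cases "n = 0")
      case True
      have "v_mean (fcoef n f) = 0" using integral_phase_eq_mode_0[OF fL] f True by simp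
      then have "(l2_norm circle (fcoef n f))\<^sup>2 = (l2_norm circle (fcoef n r))\<^sup>2"
        unfolding rn using norm_Rv_power2[OF F] by simp
      moreover have "(3 - sqrt 5) / 2 * (l2_norm circle (fcoef n f))\<^sup>2 \<le> 1 * (l2_norm circle (fcoef n f))\<^sup>2"
        by (rule mult_right_mono[OF kappa_le_1]) simp
      ultimately show ?thesis using zero_le_power2[of "l2_norm circle (fcoef n k)"] by linarith
    next
      case False
      let ?h = "\<lambda>v. \<i> * (v_dot n v * fcoef n f v)"
      have hh: "?h \<in> L2 circle" by (intro L2_scale v_dot_L2 F)
      have "AE v in circle. fcoef n k v = Rv ?h v"
      proof -
        have "AE v in circle. Rv (fcoef n h) v = Rv ?h v"
          by (rule Rv_cong_AE[OF L2_measurable[OF fcoef_L2[OF hL]] L2_measurable[OF hh]])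
            (use h in \<open>simp add: adj_J_op_iff\<close>)
        moreover have "AE v in circle. fcoef n k v = Rv (fcoef n h) v" using k unfolding R_op_iff by blast
        ultimately show ?thesis by eventually_elim simp
      qed
      then have "l2_norm circle (fcoef n k) = l2_norm circle (Rv ?h)"
        by (intro l2_norm_cong_AE L2_measurable[OF fcoef_L2[OF kL]] L2_measurable[OF Rv_L2[OF hh]])
      then show ?thesis using coercive_mode[OF False refl F] rn by (simp only: norm_Rv_v_dot_scale)
    qed
  qed
qed

text \<open>Index 0 is excluded by a character in the first position coordinate: it has integral
  zero, lies in \<open>D_circ\<close> and does not depend on the velocity, so R annihilates
  it.\<close>

lemma hypocoercivity_index_phase:
  "hypocoercivity_index phase (D_circ \<inter> {f. (LINT z|phase. f z) = 0}) J_op R_op (adj phase J_op) 1"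
proof (rule hypocoercivity_index_1I[OF kappa_pos op_ge_on_phase])
  let ?n = "vector [1, 0] :: int^2"
  let ?f = "lift ?n (\<lambda>v. 1)"
  have n: "0 \<noteq> ?n" by (auto simp: vec_eq_iff exI[of _ 1])
  have f: "?f \<in> L2 phase" by (rule lift_L2[OF const_L2_circle])
  show "\<not> (\<exists>\<kappa>>0. op_ge_on phase (D_circ \<inter> {f. (LINT z|phase. f z) = 0}) (hc_sum J_op R_op (adj phase J_op) 0) \<kappa>)"
  proof (rule not_op_ge_on_0)
    have "(LINT z|phase. ?f z) = 0" unfolding integral_phase_eq_mode_0[OF f] fcoef_lift using n by simp
    then show "?f \<in> D_circ \<inter> {f. (LINT z|phase. f z) = 0}" using lift_D_circ[OF const_L2_circle] by simp
    have "fcoef n (\<lambda>z. 0) = (\<lambda>v. 0)" for n by (simp add: fcoef_def fun_eq_iff)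
    then show "(?f, (\<lambda>z. 0)) \<in> R_op" unfolding R_op_iff using f by (simp add: L2_zero fcoef_lift Rv_one)
    show "l2_inner phase (\<lambda>z. 0) ?f = 0" by (simp add: l2_inner_def)
    have "0 < l2_norm circle (\<lambda>v. 1)" by (simp add: l2_norm_def measure_circle)
    then show "0 < l2_norm phase ?f" using lift_L2(2)[OF const_L2_circle, of ?n 1] by simp
  qed
qed

subsection \<open>Equilibria\<close>

lemma lift_0_const: "lift 0 (\<lambda>v. c) = (\<lambda>z. c)"
  unfolding lift_def rvec_0 by simp

lemma const_C_op: "((\<lambda>z. c), (\<lambda>z. 0)) \<in> C_op"
proof -
  have "Cn 0 (\<lambda>v. c) = (\<lambda>v. 0)" unfolding Cn_eq Rv_one v_dot_def rvec_0 by simp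
  then show ?thesis using C_op_lift[OF const_L2_circle, of 0 c] by (simp add: lift_0_const)
qed

lemma const_L2_phase: "(\<lambda>z. c) \<in> L2 phase"
  using lift_L2(1)[OF const_L2_circle, of 0 c] by (simp add: lift_0_const)

lemma inner_Cn_self: 
  assumes f: "f \<in> L2 circle"
  shows "Re (l2_inner circle (Cn n f) f) = (l2_norm circle (Rv f))\<^sup>2"
proof -
  have "l2_inner circle (Cn n f) f = l2_inner circle (Rv f) f + \<i> * l2_inner circle (\<lambda>v. v_dot n v * f v) f"
    unfolding Cn_eq by (simp add: l2_inner_add_left l2_inner_scale_left Rv_L2 L2_scale v_dot_L2 f)
  moreover have "Im (l2_inner circle (\<lambda>v. v_dot n v * f v) f) = 0"
  proof -
    have "cnj (l2_inner circle (\<lambda>v. v_dot n v * f v) f) = l2_inner circle (\<lambda>v. v_dot n v * f v) f"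
      by (subst l2_inner_commute[symmetric]) (simp only: inner_v_dot)
    from arg_cong[OF this, of Im] show ?thesis by simp
  qed
  ultimately show ?thesis by (simp add: inner_Rv[OF f] l2_inner_self)
qed

text \<open>The real part of the form of \<open>Cn n\<close> is the squared norm of
  \<open>Rv f\<close>, so a function in the kernel is constant in velocity; on constants
  \<open>Cn n\<close> acts as multiplication by i v.n, which is nonzero unless n = 0.\<close>

lemma kernel_Cn:
  assumes f: "f \<in> L2 circle" and z: "AE v in circle. Cn n f v = 0"
  shows "AE v in circle. f v = (if n = 0 then v_mean f else 0)"
proof -
  have "l2_inner circle (Cn n f) f = l2_inner circle (\<lambda>v. 0) f"
    by (rule l2_inner_cong_AE) (use z f in \<open>auto intro: L2_measurable Cn_L2\<close>)
  then have "(l2_norm circle (Rv f))\<^sup>2 = 0" using inner_Cn_self[OF f, of n] by (simp add: l2_inner_def)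
  then have R: "AE v in circle. Rv f v = 0" using l2_norm_eq_0[OF Rv_L2[OF f]] by simp
  then have fm: "AE v in circle. f v = v_mean f" unfolding Rv_def by eventually_elim (simp only: right_minus_eq)
  show ?thesis
  proof (cases "n = 0")
    case True
    then show ?thesis using fm by simp
  next
    case False
    have "AE v in circle. v_mean f * v_dot n v = 0"
      using z R fm unfolding Cn_eq by eventually_elim (simp add: mult.commute)
    then have "l2_norm circle (\<lambda>v. v_mean f * v_dot n v) = 0"
      using l2_norm_eq_0[OF L2_scale[OF v_dot_L2[OF const_L2_circle[of 1]]], of "v_mean f" n] by simp
    moreover have "(l2_norm circle (v_dot n))\<^sup>2 > 0"
      unfolding norm_v_dot
      by (intro mult_pos_pos zero_less_power pi_gt_zero less_le_trans[OF zero_less_one norm_rvec_ge_1[OF False]])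
    ultimately have "v_mean f = 0" unfolding l2_norm_scale by auto
    with fm False show ?thesis by simp
  qed
qed

lemma equilibrium_unique:
  assumes g: "(g, (\<lambda>z. 0)) \<in> C_op"
  shows "AE z in phase. g z = (LINT z|phase. g z) / of_real ((2 * pi) ^ 3)"
proof -
  have gL: "g \<in> L2 phase" using g by (simp add: C_op_iff)
  have m: "(LINT z|phase. g z) / of_real ((2 * pi) ^ 3) = v_mean (fcoef 0 g)"
    unfolding integral_phase_eq_mode_0[OF gL] by simp
  show ?thesis unfolding m
  proof (rule AE_eq_fcoef[OF gL const_L2_phase])
    fix n
    have "AE v in circle. Cn n (fcoef n g) v = 0"
      using g unfolding C_op_iff by (auto simp: fcoef_def)
    from kernel_Cn[OF fcoef_L2[OF gL] this]
    show "AE v in circle. fcoef n g v = fcoef n (\<lambda>z. v_mean (fcoef 0 g)) v"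
      unfolding lift_0_const[symmetric] fcoef_lift by (cases "n = 0") simp_all
  qed
qed

section \<open>The flow on a Fourier mode\<close>

text \<open>Exponential generating function of the sequence \<open>d\<close>: differentiation shifts
  the sequence. It is used at a fixed velocity with the values of the powers of \<open>Cn n\<close>
  as the sequence.\<close>

definition expseries :: "(nat \<Rightarrow> complex) \<Rightarrow> complex \<Rightarrow> complex" where
  "expseries d z = (\<Sum>k. d k / fact k * z ^ k)"

context
  fixes d :: "nat \<Rightarrow> complex" and D b :: real
  assumes bound: "\<And>k. cmod (d k) \<le> D * b ^ k" and b0: "0 \<le> b"
begin

lemma expseries_term_le: "cmod (d k / fact k * z ^ k) \<le> D * ((b * cmod z) ^ k /\<^sub>R fact k)"
proof -
  have "cmod (d k / fact k * z ^ k) = cmod (d k) * (cmod z ^ k / fact k)"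
    by (simp add: norm_mult norm_divide norm_power)
  also have "\<dots> \<le> (D * b ^ k) * (cmod z ^ k / fact k)" by (rule mult_right_mono[OF bound]) simp
  finally show ?thesis by (simp add: power_mult_distrib divide_inverse mult_ac)
qed

lemma expseries_summable_norm: "summable (\<lambda>k. cmod (d k / fact k * z ^ k))"
proof (rule summable_comparison_test'[where N = 0])
  show "summable (\<lambda>k. D * ((b * cmod z) ^ k /\<^sub>R fact k))"
    by (intro summable_mult summable_exp_generic)
qed (use expseries_term_le in simp)

lemma expseries_summable: "summable (\<lambda>k. d k / fact k * z ^ k)"
  by (rule summable_norm_cancel[OF expseries_summable_norm])

lemma expseries_partial_le: "cmod (\<Sum>k<N. d k / fact k * z ^ k) \<le> D * exp (b * cmod z)"
proof -
  have "cmod (\<Sum>k<N. d k / fact k * z ^ k) \<le> (\<Sum>k<N. D * ((b * cmod z) ^ k /\<^sub>R fact k))"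
    by (rule order_trans[OF norm_sum sum_mono[OF expseries_term_le]])
  also have "\<dots> \<le> (\<Sum>k. D * ((b * cmod z) ^ k /\<^sub>R fact k))"
  proof (rule sum_le_suminf)
    show "summable (\<lambda>k. D * ((b * cmod z) ^ k /\<^sub>R fact k))"
      by (intro summable_mult summable_exp_generic)
    fix k
    show "0 \<le> D * ((b * cmod z) ^ k /\<^sub>R fact k)"
      by (rule order_trans[OF norm_ge_zero expseries_term_le])
  qed simp
  also have "\<dots> = D * exp (b * cmod z)"
    unfolding exp_def by (rule suminf_mult[OF summable_exp_generic])
  finally show ?thesis .
qed

lemma expseries_lim: "(\<lambda>N. \<Sum>k<N. d k / fact k * z ^ k) \<longlonglongrightarrow> expseries d z"
  unfolding expseries_def by (rule summable_LIMSEQ[OF expseries_summable])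

lemma expseries_le: "cmod (expseries d z) \<le> D * exp (b * cmod z)"
  by (rule LIMSEQ_le_const2[OF tendsto_norm[OF expseries_lim]]) (use expseries_partial_le in blast)

lemma expseries_deriv: "(expseries d has_field_derivative expseries (\<lambda>k. d (Suc k)) z) (at z)"
proof -
  have "((\<lambda>z. \<Sum>k. d k / fact k * z ^ k) has_field_derivative (\<Sum>k. diffs (\<lambda>k. d k / fact k) k * z ^ k)) (at z)"
    by (rule termdiffs_strong_converges_everywhere[OF expseries_summable])
  moreover have "diffs (\<lambda>k. d k / fact k) k = d (Suc k) / fact k" for k
    unfolding diffs_def fact_Suc by (simp add: field_simps del: of_nat_Suc)
  ultimately show ?thesis unfolding expseries_def[abs_def] by simp
qed

lemma shift_bound: "cmod (d (Suc k)) \<le> (D * b) * b ^ k"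
  using bound[of "Suc k"] by (simp add: mult_ac)

end

text \<open>The mean value inequality along the segment is applied twice, first to the derivative
  and then to the remainder. Base point and increment vary independently in a ball, which gives
  estimates uniform in time.\<close>

lemma expseries_taylor:
  assumes bound: "\<And>k. cmod (d k) \<le> D * b ^ k" and b0: "0 \<le> b" and r: "cmod s \<le> r" "cmod t \<le> r"
  shows "cmod (expseries d s - expseries d t - (s - t) * expseries (\<lambda>k. d (Suc k)) t)
    \<le> D * b\<^sup>2 * exp (b * r) * (cmod (s - t))\<^sup>2"
proof -
  let ?d1 = "\<lambda>k. d (Suc k)" and ?d2 = "\<lambda>k. d (Suc (Suc k))"
  let ?S = "closed_segment s t"
  have b1: "cmod (?d1 k) \<le> (D * b) * b ^ k" for k by (rule shift_bound[OF bound b0])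
  have b2: "cmod (?d2 k) \<le> ((D * b) * b) * b ^ k" for k by (rule shift_bound[OF b1 b0])
  define B where "B = D * b\<^sup>2 * exp (b * r)"
  have D0: "0 \<le> D" using order_trans[OF norm_ge_zero bound[of 0]] by simp
  have in_r: "cmod z \<le> r" if "z \<in> ?S" for z
  proof -
    have "?S \<subseteq> cball 0 r" by (rule closed_segment_subset) (use r in auto)
    then show ?thesis using that by auto
  qed
  have E2: "cmod (expseries ?d2 z) \<le> B" if "z \<in> ?S" for z
  proof -
    have "cmod (expseries ?d2 z) \<le> ((D * b) * b) * exp (b * cmod z)" by (rule expseries_le[OF b2 b0])
    also have "\<dots> \<le> ((D * b) * b) * exp (b * r)"
      using in_r[OF that] b0 D0 by (intro mult_left_mono) (auto intro: mult_left_mono)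
    finally show ?thesis by (simp add: B_def power2_eq_square mult.assoc)
  qed
  have E1: "cmod (expseries ?d1 z - expseries ?d1 t) \<le> B * cmod (s - t)" if z: "z \<in> ?S" for z
  proof -
    have "cmod (expseries ?d1 z - expseries ?d1 t) \<le> B * cmod (z - t)"
    proof (rule field_differentiable_bound[OF convex_closed_segment[of s t]])
      show "(expseries ?d1 has_field_derivative expseries ?d2 w) (at w within ?S)" for w
        by (rule has_field_derivative_at_within[OF expseries_deriv[OF b1 b0]])
    qed (use z E2 in auto)
    also have "\<dots> \<le> B * cmod (s - t)"
    proof (rule mult_left_mono)
      show "cmod (z - t) \<le> cmod (s - t)"
        using segment_bound[OF z] by (simp add: norm_minus_commute)
      show "0 \<le> B" unfolding B_def using D0 by simp
    qed
    finally show ?thesis .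
  qed
  define g where "g z = expseries d z - (z - t) * expseries ?d1 t" for z
  have "cmod (g s - g t) \<le> (B * cmod (s - t)) * cmod (s - t)"
  proof (rule field_differentiable_bound[OF convex_closed_segment[of s t]])
    fix w assume "w \<in> ?S"
    show "(g has_field_derivative (expseries ?d1 w - expseries ?d1 t)) (at w within ?S)"
      unfolding g_def[abs_def]
      by (auto intro!: derivative_eq_intros has_field_derivative_at_within[OF expseries_deriv[OF bound b0]])
  qed (use E1 in auto)
  then show ?thesis unfolding g_def B_def by (simp add: power2_eq_square mult.assoc algebra_simps)
qed

lemma l2_dominated:
  assumes F: "\<And>k. F k \<in> L2 M" and f: "f \<in> L2 M" and G: "G \<in> L2 M"
    and lim: "AE z in M. (\<lambda>k. F k z) \<longlonglongrightarrow> f z" and le: "\<And>k. AE z in M. cmod (F k z - f z) \<le> cmod (G z)"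
  shows "(\<lambda>k. l2_norm M (\<lambda>z. F k z - f z)) \<longlonglongrightarrow> 0"
proof -
  have [measurable]: "F k \<in> borel_measurable M" "f \<in> borel_measurable M" "G \<in> borel_measurable M" for k
    by (intro L2_measurable F f G)+
  have "(\<lambda>k. LINT z|M. (cmod (F k z - f z))\<^sup>2) \<longlonglongrightarrow> (LINT z|M. (0::real))"
  proof (rule integral_dominated_convergence[where w = "\<lambda>z. (cmod (G z))\<^sup>2"])
    show "integrable M (\<lambda>z. (cmod (G z))\<^sup>2)" by (rule L2_sq_integrable[OF G])
    show "AE z in M. (\<lambda>k. (cmod (F k z - f z))\<^sup>2) \<longlonglongrightarrow> 0"
      using lim
    proof eventually_elim
      fix z assume "(\<lambda>k. F k z) \<longlonglongrightarrow> f z"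
      then have "(\<lambda>k. (cmod (F k z - f z))\<^sup>2) \<longlonglongrightarrow> (cmod (f z - f z))\<^sup>2" by (intro tendsto_intros)
      then show "(\<lambda>k. (cmod (F k z - f z))\<^sup>2) \<longlonglongrightarrow> 0" by simp
    qed
    show "AE z in M. norm ((cmod (F k z - f z))\<^sup>2) \<le> (cmod (G z))\<^sup>2" for k
      using le[of k] by eventually_elim (simp add: power_mono)
  qed measurable
  from tendsto_real_sqrt[OF this] show ?thesis by (simp add: l2_norm_def)
qed

section \<open>The bounded operators \<open>Cn n\<close>, their powers and their exponential\<close>

lemma Cn_scale: "Cn n (\<lambda>v. c * \<phi> v) = (\<lambda>v. c * Cn n \<phi> v)"
  unfolding Cn_eq Rv_def v_mean_scale by (simp add: algebra_simps fun_eq_iff)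

lemma Cn_add: "\<phi> \<in> L2 circle \<Longrightarrow> \<psi> \<in> L2 circle \<Longrightarrow> Cn n (\<lambda>v. \<phi> v + \<psi> v) = (\<lambda>v. Cn n \<phi> v + Cn n \<psi> v)"
  unfolding Cn_eq Rv_def by (simp add: v_mean_add algebra_simps fun_eq_iff)

lemma Cn_zero: "Cn n (\<lambda>v. 0) = (\<lambda>v. 0)"
  using Cn_scale[of n 0 "\<lambda>v. 0"] by simp

lemma Cn_sum:
  "(\<And>i. i \<in> I \<Longrightarrow> \<phi> i \<in> L2 circle) \<Longrightarrow> Cn n (\<lambda>v. \<Sum>i\<in>I. \<phi> i v) = (\<lambda>v. \<Sum>i\<in>I. Cn n (\<phi> i) v)"
proof (induction I rule: infinite_finite_induct)
  case (insert i I)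
  then show ?case by (simp add: Cn_add L2_sum)
qed (simp_all add: Cn_zero)

text \<open>The 2 is dictated by the pointwise recursion in \<open>Cpow_pointwise\<close>, where the
  value at \<open>v\<close> and the mean both contribute; for the norm alone 1 would do.\<close>

definition cbd :: "int^2 \<Rightarrow> real" where "cbd n = 2 + norm (rvec n)"

lemma cbd_nonneg: "0 \<le> cbd n"
  unfolding cbd_def by simp

lemma norm_Cn_le:
  assumes "\<phi> \<in> L2 circle" shows "l2_norm circle (Cn n \<phi>) \<le> cbd n * l2_norm circle \<phi>"
proof -
  have "l2_norm circle (Cn n \<phi>) \<le> l2_norm circle (Rv \<phi>) + l2_norm circle (\<lambda>v. \<i> * (v_dot n v * \<phi> v))"
    unfolding Cn_eq by (intro l2_norm_triangle Rv_L2 L2_scale v_dot_L2 assms)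
  also have "\<dots> \<le> l2_norm circle \<phi> + norm (rvec n) * l2_norm circle \<phi>"
    using norm_Rv_le[OF assms] norm_v_dot_le[OF assms, of n] by (simp add: l2_norm_scale)
  also have "\<dots> \<le> cbd n * l2_norm circle \<phi>" by (simp add: cbd_def algebra_simps)
  finally show ?thesis .
qed

lemma norm_v_mean_le:
  assumes "\<phi> \<in> L2 circle" shows "cmod (v_mean \<phi>) \<le> l2_norm circle \<phi>"
proof (rule power2_le_imp_le)
  have "1 * (cmod (v_mean \<phi>))\<^sup>2 \<le> 2 * pi * (cmod (v_mean \<phi>))\<^sup>2"
    by (rule mult_right_mono) (use pi_ge_two in simp_all)
  then show "(cmod (v_mean \<phi>))\<^sup>2 \<le> (l2_norm circle \<phi>)\<^sup>2"
    using norm_Rv_power2[OF assms] zero_le_power2[of "l2_norm circle (Rv \<phi>)"] by linarith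
qed simp

definition Cpow :: "int^2 \<Rightarrow> (real^2 \<Rightarrow> complex) \<Rightarrow> nat \<Rightarrow> real^2 \<Rightarrow> complex" where
  "Cpow n \<phi> k = (Cn n ^^ k) \<phi>"

lemma Cpow_L2: "\<phi> \<in> L2 circle \<Longrightarrow> Cpow n \<phi> k \<in> L2 circle"
  unfolding Cpow_def by (induction k) (simp_all add: Cn_L2)

lemma norm_Cpow_le: "\<phi> \<in> L2 circle \<Longrightarrow> l2_norm circle (Cpow n \<phi> k) \<le> cbd n ^ k * l2_norm circle \<phi>"
proof (induction k)
  case (Suc k)
  have "l2_norm circle (Cpow n \<phi> (Suc k)) \<le> cbd n * l2_norm circle (Cpow n \<phi> k)"
    unfolding Cpow_def funpow.simps o_apply by (rule norm_Cn_le) (use Cpow_L2[OF Suc.prems] Cpow_def in simp)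
  also have "\<dots> \<le> cbd n * (cbd n ^ k * l2_norm circle \<phi>)"
    by (rule mult_left_mono[OF Suc.IH[OF Suc.prems] cbd_nonneg])
  finally show ?case by (simp add: mult.assoc)
qed (simp add: Cpow_def)

text \<open>Apart from subtracting a mean, \<open>Cn n\<close> is a multiplication operator, so the
  values at one velocity obey a scalar recursion. This makes the exponential series converge at
  every point of the circle.\<close>

lemma Cpow_pointwise:
  assumes \<phi>: "\<phi> \<in> L2 circle" and v: "v \<in> sphere 0 1"
  shows "cmod (Cpow n \<phi> k v) \<le> (cmod (\<phi> v) + l2_norm circle \<phi>) * cbd n ^ k"
proof (induction k)
  case 0
  then show ?case by (simp add: Cpow_def)
next
  case (Suc k)
  let ?c = "Cpow n \<phi> k" and ?N = "norm (rvec n)" and ?D = "cmod (\<phi> v) + l2_norm circle \<phi>"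
  have "Cpow n \<phi> (Suc k) v = ?c v - v_mean ?c + \<i> * (v_dot n v * ?c v)"
    unfolding Cpow_def funpow.simps o_apply Cn_eq Rv_def ..
  then have "cmod (Cpow n \<phi> (Suc k) v) \<le> cmod (?c v) + cmod (v_mean ?c) + cmod (v_dot n v) * cmod (?c v)"
    using norm_triangle_ineq[of "?c v - v_mean ?c" "\<i> * (v_dot n v * ?c v)"] norm_triangle_ineq4[of "?c v" "v_mean ?c"]
    by (simp add: norm_mult)
  also have "\<dots> \<le> ?D * cbd n ^ k + ?D * cbd n ^ k + ?N * (?D * cbd n ^ k)"
  proof (intro add_mono mult_mono Suc.IH v_dot_bound[OF v])
    have "cmod (v_mean ?c) \<le> cbd n ^ k * l2_norm circle \<phi>"
      by (rule order_trans[OF norm_v_mean_le[OF Cpow_L2[OF \<phi>]] norm_Cpow_le[OF \<phi>]])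
    also have "\<dots> \<le> cbd n ^ k * ?D" by (intro mult_left_mono) (simp_all add: cbd_nonneg)
    finally show "cmod (v_mean ?c) \<le> ?D * cbd n ^ k" by (simp add: mult.commute)
  qed simp_all
  also have "\<dots> = ?D * cbd n ^ Suc k" by (simp add: cbd_def algebra_simps)
  finally show ?case .
qed

text \<open>The exponential of -t \<open>Cn n\<close>, summed at each velocity separately. This
  fixes a representative with exact value at t = 0 and allows Taylor estimates point by point,
  whereas \<open>exp_Cn\<close> is only some limit in L2.\<close>

definition evol :: "int^2 \<Rightarrow> (real^2 \<Rightarrow> complex) \<Rightarrow> real \<Rightarrow> real^2 \<Rightarrow> complex" where
  "evol n \<phi> t v = expseries (\<lambda>k. Cpow n \<phi> k v) (- of_real t)"

definition evol_partial :: "int^2 \<Rightarrow> (real^2 \<Rightarrow> complex) \<Rightarrow> real \<Rightarrow> nat \<Rightarrow> real^2 \<Rightarrow> complex" where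
  "evol_partial n \<phi> t N v = (\<Sum>k<N. Cpow n \<phi> k v / fact k * (- of_real t) ^ k)"

lemma evol_0: "evol n \<phi> 0 v = \<phi> v"
  unfolding evol_def expseries_def using powser_zero[of "\<lambda>k. Cpow n \<phi> k v / fact k"]
  by (simp add: Cpow_def)

context
  fixes n :: "int^2" and \<phi> :: "real^2 \<Rightarrow> complex"
  assumes \<phi>: "\<phi> \<in> L2 circle"
begin

text \<open>Dominating function for the partial sums and for the Taylor remainder: it collects the
  part of the pointwise bounds that depends on the velocity.\<close>

definition envelope :: "real^2 \<Rightarrow> complex" where
  "envelope v = of_real (cmod (\<phi> v) + l2_norm circle \<phi>)"

lemma envelope_L2: "envelope \<in> L2 circle"
proof -
  have "(\<lambda>v. complex_of_real (cmod (\<phi> v))) \<in> L2 circle" using \<phi> by (auto simp: L2_def)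
  from L2_add[OF this const_L2_circle] show ?thesis
    unfolding envelope_def[abs_def] of_real_add .
qed

lemma cmod_envelope: "cmod (envelope v) = cmod (\<phi> v) + l2_norm circle \<phi>"
  unfolding envelope_def norm_of_real by (simp add: add_nonneg_nonneg)

lemma evol_partial_L2: "evol_partial n \<phi> t N \<in> L2 circle"
proof -
  have "(\<lambda>v. \<Sum>k<N. ((- of_real t) ^ k / fact k) * Cpow n \<phi> k v) \<in> L2 circle"
    by (intro L2_sum L2_scale Cpow_L2 \<phi>)
  then show ?thesis unfolding evol_partial_def[abs_def] by (simp add: mult_ac)
qed

lemma evol_pointwise:
  assumes "v \<in> space circle"
  shows "cmod (evol n \<phi> t v) \<le> exp (cbd n * \<bar>t\<bar>) * cmod (envelope v)"
    and "cmod (evol_partial n \<phi> t N v) \<le> exp (cbd n * \<bar>t\<bar>) * cmod (envelope v)"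
    and "(\<lambda>N. evol_partial n \<phi> t N v) \<longlonglongrightarrow> evol n \<phi> t v"
proof -
  have v: "v \<in> sphere 0 1" using assms by (simp add: space_circle)
  note b = Cpow_pointwise[OF \<phi> v]
  have z: "cmod (- of_real t) = \<bar>t\<bar>" by simp
  show "cmod (evol n \<phi> t v) \<le> exp (cbd n * \<bar>t\<bar>) * cmod (envelope v)"
    using expseries_le[OF b cbd_nonneg, where z = "- of_real t"] unfolding z
    by (simp add: evol_def cmod_envelope mult.commute)
  show "cmod (evol_partial n \<phi> t N v) \<le> exp (cbd n * \<bar>t\<bar>) * cmod (envelope v)"
    using expseries_partial_le[OF b cbd_nonneg, where z = "- of_real t"] unfolding z
    by (simp add: evol_partial_def cmod_envelope mult.commute)
  show "(\<lambda>N. evol_partial n \<phi> t N v) \<longlonglongrightarrow> evol n \<phi> t v"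
    unfolding evol_partial_def evol_def by (rule expseries_lim[OF b cbd_nonneg])
qed

lemma evol_L2: "evol n \<phi> t \<in> L2 circle"
proof -
  have "evol n \<phi> t \<in> borel_measurable circle"
    by (rule borel_measurable_LIMSEQ_metric[OF L2_measurable[OF evol_partial_L2] evol_pointwise(3)])
  then have "evol n \<phi> t \<in> L2 circle \<and> l2_norm circle (evol n \<phi> t) \<le> l2_norm circle (\<lambda>v. of_real (exp (cbd n * \<bar>t\<bar>)) * envelope v)"
  proof (rule l2_norm_mono[OF _ L2_scale[OF envelope_L2]])
    show "AE v in circle. cmod (evol n \<phi> t v) \<le> cmod (of_real (exp (cbd n * \<bar>t\<bar>)) * envelope v)"
      using evol_pointwise(1) by (intro AE_I2) (simp add: norm_mult)
  qed
  then show ?thesis by blast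
qed

lemma evol_lim: "(\<lambda>N. l2_norm circle (\<lambda>v. evol_partial n \<phi> t N v - evol n \<phi> t v)) \<longlonglongrightarrow> 0"
proof (rule l2_dominated[OF evol_partial_L2 evol_L2 L2_scale[OF envelope_L2]])
  show "AE v in circle. (\<lambda>N. evol_partial n \<phi> t N v) \<longlonglongrightarrow> evol n \<phi> t v"
    by (rule AE_I2) (rule evol_pointwise(3))
  show "AE v in circle. cmod (evol_partial n \<phi> t N v - evol n \<phi> t v) \<le> cmod (of_real (2 * exp (cbd n * \<bar>t\<bar>)) * envelope v)" for N
  proof (rule AE_I2)
    fix v assume v: "v \<in> space circle"
    show "cmod (evol_partial n \<phi> t N v - evol n \<phi> t v) \<le> cmod (of_real (2 * exp (cbd n * \<bar>t\<bar>)) * envelope v)"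
      using norm_triangle_ineq4[of "evol_partial n \<phi> t N v" "evol n \<phi> t v"]
        evol_pointwise(1)[OF v, of t] evol_pointwise(2)[OF v, of t N]
      unfolding norm_mult norm_of_real by simp
  qed
qed

end

lemma Cpow_Suc: "Cpow n (Cn n \<phi>) k = Cpow n \<phi> (Suc k)"
  unfolding Cpow_def by (simp add: funpow_swap1)

lemma Cn_evol_partial:
  assumes \<phi>: "\<phi> \<in> L2 circle"
  shows "Cn n (evol_partial n \<phi> t N) = evol_partial n (Cn n \<phi>) t N"
proof -
  have "evol_partial n \<phi> t N = (\<lambda>v. \<Sum>k<N. ((- of_real t) ^ k / fact k) * Cpow n \<phi> k v)"
    unfolding evol_partial_def[abs_def] by (simp add: mult_ac)
  then have "Cn n (evol_partial n \<phi> t N) = (\<lambda>v. \<Sum>k<N. Cn n (\<lambda>v. ((- of_real t) ^ k / fact k) * Cpow n \<phi> k v) v)"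
    by (simp only:) (rule Cn_sum, rule L2_scale[OF Cpow_L2[OF \<phi>]])
  also have "\<dots> = (\<lambda>v. \<Sum>k<N. ((- of_real t) ^ k / fact k) * Cpow n (Cn n \<phi>) k v)"
    unfolding Cn_scale Cpow_Suc by (simp add: Cpow_def)
  finally show ?thesis unfolding evol_partial_def[abs_def] by (simp add: mult_ac)
qed

lemma Cn_diff:
  assumes "\<phi> \<in> L2 circle" "\<psi> \<in> L2 circle"
  shows "Cn n (\<lambda>v. \<phi> v - \<psi> v) = (\<lambda>v. Cn n \<phi> v - Cn n \<psi> v)"
  using Cn_add[OF assms(1) L2_scale[OF assms(2)], of n "-1"] unfolding Cn_scale by simp

text \<open>\<open>Cn n\<close> is bounded, hence commutes with the limit of the partial sums; the
  two sides agree as limits in L2, which leaves a null set.\<close>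

lemma Cn_evol:
  assumes \<phi>: "\<phi> \<in> L2 circle"
  shows "AE v in circle. evol n (Cn n \<phi>) t v = Cn n (evol n \<phi> t) v"
proof (rule l2_limit_unique[OF evol_partial_L2 evol_L2 Cn_L2 evol_lim])
  show "Cn n \<phi> \<in> L2 circle" "Cn n \<phi> \<in> L2 circle" "Cn n \<phi> \<in> L2 circle" by (rule Cn_L2[OF \<phi>])+
  show "evol n \<phi> t \<in> L2 circle" by (rule evol_L2[OF \<phi>])
  show "(\<lambda>N. l2_norm circle (\<lambda>v. evol_partial n (Cn n \<phi>) t N v - Cn n (evol n \<phi> t) v)) \<longlonglongrightarrow> 0"
  proof (rule Lim_null_comparison)
    show "(\<lambda>N. cbd n * l2_norm circle (\<lambda>v. evol_partial n \<phi> t N v - evol n \<phi> t v)) \<longlonglongrightarrow> 0"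
      by (rule tendsto_mult_right_zero[OF evol_lim[OF \<phi>]])
    have "l2_norm circle (Cn n (\<lambda>v. evol_partial n \<phi> t N v - evol n \<phi> t v))
        \<le> cbd n * l2_norm circle (\<lambda>v. evol_partial n \<phi> t N v - evol n \<phi> t v)" for N
      by (rule norm_Cn_le[OF L2_diff[OF evol_partial_L2[OF \<phi>] evol_L2[OF \<phi>]]])
    then show "\<forall>\<^sub>F N in sequentially. norm (l2_norm circle (\<lambda>v. evol_partial n (Cn n \<phi>) t N v - Cn n (evol n \<phi> t) v))
        \<le> cbd n * l2_norm circle (\<lambda>v. evol_partial n \<phi> t N v - evol n \<phi> t v)"
      unfolding Cn_diff[OF evol_partial_L2[OF \<phi>] evol_L2[OF \<phi>]] Cn_evol_partial[OF \<phi>] by simp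
  qed
qed

text \<open>The differential equation in quantitative form: the remainder is quadratic and uniform
  in both times. It gives the derivatives of scalar quantities of the flow as well as the comparison
  with the semigroup.\<close>

lemma evol_taylor:
  assumes \<phi>: "\<phi> \<in> L2 circle"
  shows "\<exists>K\<ge>0. \<forall>s t. \<bar>s\<bar> \<le> r \<longrightarrow> \<bar>t\<bar> \<le> r \<longrightarrow>
    l2_norm circle (\<lambda>v. evol n \<phi> s v - evol n \<phi> t v - of_real (s - t) * (- Cn n (evol n \<phi> t) v)) \<le> K * (s - t)\<^sup>2"
proof -
  let ?K = "(cbd n)\<^sup>2 * exp (cbd n * r)"
  have "l2_norm circle (\<lambda>v. evol n \<phi> s v - evol n \<phi> t v - of_real (s - t) * (- Cn n (evol n \<phi> t) v))
      \<le> (?K * l2_norm circle (envelope \<phi>)) * (s - t)\<^sup>2" if r: "\<bar>s\<bar> \<le> r" "\<bar>t\<bar> \<le> r" for s t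
  proof -
    let ?g = "\<lambda>v. evol n \<phi> s v - evol n \<phi> t v - of_real (s - t) * (- Cn n (evol n \<phi> t) v)"
    have g: "?g \<in> L2 circle"
      by (intro L2_diff L2_scale L2_uminus Cn_L2 evol_L2 \<phi>)
    have "AE v in circle. cmod (?g v) \<le> cmod (of_real (?K * (s - t)\<^sup>2) * envelope \<phi> v)"
      using Cn_evol[OF \<phi>, of n t] AE_space
    proof eventually_elim
      fix v assume e: "evol n (Cn n \<phi>) t v = Cn n (evol n \<phi> t) v" and "v \<in> space circle"
      then have v: "v \<in> sphere 0 1" by (simp add: space_circle)
      have "cmod (expseries (\<lambda>k. Cpow n \<phi> k v) (- of_real s) - expseries (\<lambda>k. Cpow n \<phi> k v) (- of_real t)
          - (- of_real s - - of_real t) * expseries (\<lambda>k. Cpow n \<phi> (Suc k) v) (- of_real t))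
        \<le> (cmod (\<phi> v) + l2_norm circle \<phi>) * (cbd n)\<^sup>2 * exp (cbd n * r) * (cmod (- of_real s - - of_real t))\<^sup>2"
        by (rule expseries_taylor[OF Cpow_pointwise[OF \<phi> v] cbd_nonneg]) (use r in simp_all)
      moreover have "expseries (\<lambda>k. Cpow n \<phi> (Suc k) v) (- of_real t) = Cn n (evol n \<phi> t) v"
        unfolding e[symmetric] evol_def Cpow_Suc ..
      moreover have "cmod (- of_real s - - of_real t) = \<bar>s - t\<bar>"
        unfolding minus_diff_minus norm_minus_cancel of_real_diff[symmetric] norm_of_real ..
      ultimately have *: "cmod (evol n \<phi> s v - evol n \<phi> t v - (- of_real s - - of_real t) * Cn n (evol n \<phi> t) v)
          \<le> (cmod (\<phi> v) + l2_norm circle \<phi>) * (cbd n)\<^sup>2 * exp (cbd n * r) * (\<bar>s - t\<bar>)\<^sup>2"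
        unfolding evol_def[symmetric] by (simp only:)
      have g: "?g v = evol n \<phi> s v - evol n \<phi> t v - (- of_real s - - of_real t) * Cn n (evol n \<phi> t) v"
        by (simp add: algebra_simps)
      have "cmod (of_real (?K * (s - t)\<^sup>2) * envelope \<phi> v)
          = (cmod (\<phi> v) + l2_norm circle \<phi>) * (cbd n)\<^sup>2 * exp (cbd n * r) * (\<bar>s - t\<bar>)\<^sup>2"
        unfolding norm_mult[of "of_real (?K * (s - t)\<^sup>2)"] norm_of_real cmod_envelope[OF \<phi>] by (simp add: abs_mult mult_ac)
      with * show "cmod (?g v) \<le> cmod (of_real (?K * (s - t)\<^sup>2) * envelope \<phi> v)" unfolding g by simp
    qed
    from l2_norm_mono[OF L2_measurable[OF g] L2_scale[OF envelope_L2[OF \<phi>]] this]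
    have "l2_norm circle ?g \<le> cmod (of_real (?K * (s - t)\<^sup>2)) * l2_norm circle (envelope \<phi>)"
      unfolding l2_norm_scale by blast
    also have "cmod (of_real (?K * (s - t)\<^sup>2)) = ?K * (s - t)\<^sup>2"
      unfolding norm_of_real by (rule abs_of_nonneg) simp
    finally show ?thesis by (simp add: mult_ac)
  qed
  then show ?thesis by (intro exI[of _ "?K * l2_norm circle (envelope \<phi>)"]) simp
qed

text \<open>\<open>exp_Cn\<close> is a choice among the L2 limits of the exponential series;
  \<open>evol\<close> is one of them, and such limits agree almost everywhere.\<close>

lemma exp_Cn_evol:
  assumes \<phi>: "\<phi> \<in> L2 circle"
  shows "exp_Cn n t \<phi> \<in> L2 circle" and "AE v in circle. exp_Cn n t \<phi> v = evol n \<phi> t v"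
proof -
  let ?A = "\<lambda>\<phi> v. - complex_of_real t * Cn n \<phi> v"
  have pow: "(?A ^^ k) \<phi> = (\<lambda>v. (- of_real t) ^ k * Cpow n \<phi> k v)" for k
  proof (induction k)
    case (Suc k)
    have "(?A ^^ Suc k) \<phi> = ?A (\<lambda>v. (- of_real t) ^ k * Cpow n \<phi> k v)" using Suc by simp
    also have "\<dots> = (\<lambda>v. (- of_real t) ^ Suc k * Cpow n \<phi> (Suc k) v)"
      unfolding Cn_scale by (simp add: Cpow_def mult.assoc)
    finally show ?case .
  qed (simp add: Cpow_def)
  have part: "(\<Sum>k<N. (?A ^^ k) \<phi> v / fact k) = evol_partial n \<phi> t N v" for N v
    unfolding pow evol_partial_def by (simp add: mult_ac)
  have ex: "exp_Cn n t \<phi> = (SOME g. g \<in> L2 circle \<and> (\<lambda>N. l2_norm circle (\<lambda>v. evol_partial n \<phi> t N v - g v)) \<longlonglongrightarrow> 0)"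
    unfolding exp_Cn_def op_exp_def part ..
  have "exp_Cn n t \<phi> \<in> L2 circle \<and> (\<lambda>N. l2_norm circle (\<lambda>v. evol_partial n \<phi> t N v - exp_Cn n t \<phi> v)) \<longlonglongrightarrow> 0"
    unfolding ex by (rule someI[of _ "evol n \<phi> t"]) (use evol_L2[OF \<phi>] evol_lim[OF \<phi>] in blast)
  then show L: "exp_Cn n t \<phi> \<in> L2 circle" and "AE v in circle. exp_Cn n t \<phi> v = evol n \<phi> t v"
    using l2_limit_unique[OF evol_partial_L2[OF \<phi>] _ evol_L2[OF \<phi>] _ evol_lim[OF \<phi>]] by blast+
qed

section \<open>Energy estimates on a Fourier mode\<close>

lemma has_real_derivative_quadratic:
  fixes f :: "real \<Rightarrow> real"
  assumes d: "0 < d" and q: "\<And>s. \<bar>s - t\<bar> < d \<Longrightarrow> \<bar>f s - f t - (s - t) * D\<bar> \<le> K * (s - t)\<^sup>2"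
  shows "(f has_real_derivative D) (at t)"
  unfolding has_field_derivative_iff
proof (rule LIM_zero_cancel, rule Lim_null_comparison)
  show "((\<lambda>s. K * \<bar>s - t\<bar>) \<longlongrightarrow> 0) (at t)" by (auto intro!: tendsto_eq_intros)
  have "\<forall>\<^sub>F s in at t. \<bar>s - t\<bar> < d" using d unfolding eventually_at dist_real_def by blast
  then show "\<forall>\<^sub>F s in at t. norm ((f s - f t) / (s - t) - D) \<le> K * \<bar>s - t\<bar>"
    using eventually_neq_at_within[of t t UNIV]
  proof eventually_elim
    fix s assume s: "\<bar>s - t\<bar> < d" "s \<noteq> t"
    then have "(f s - f t) / (s - t) - D = (f s - f t - (s - t) * D) / (s - t)"
      by (simp add: diff_divide_distrib)
    then have "norm ((f s - f t) / (s - t) - D) = \<bar>f s - f t - (s - t) * D\<bar> / \<bar>s - t\<bar>"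
      by (simp only: real_norm_def abs_divide)
    also have "\<dots> \<le> K * (s - t)\<^sup>2 / \<bar>s - t\<bar>" by (rule divide_right_mono[OF q[OF s(1)]]) simp
    also have "(s - t)\<^sup>2 = \<bar>s - t\<bar> * \<bar>s - t\<bar>" by (simp add: power2_eq_square)
    also have "K * (\<bar>s - t\<bar> * \<bar>s - t\<bar>) / \<bar>s - t\<bar> = K * \<bar>s - t\<bar>"
      unfolding mult.assoc[symmetric] by (rule nonzero_mult_div_cancel_right) (use s(2) in simp)
    finally show "norm ((f s - f t) / (s - t) - D) \<le> K * \<bar>s - t\<bar>" .
  qed
qed

lemma evol_functional_derivative:
  assumes \<phi>: "\<phi> \<in> L2 circle" and \<zeta>: "\<zeta> \<in> L2 circle"
  shows "((\<lambda>s. Re (l2_inner circle (evol n \<phi> s) \<zeta>)) has_real_derivative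
    - Re (l2_inner circle (Cn n (evol n \<phi> t)) \<zeta>)) (at t)"
proof -
  obtain K where K: "\<And>s t'. \<bar>s\<bar> \<le> \<bar>t\<bar> + 1 \<Longrightarrow> \<bar>t'\<bar> \<le> \<bar>t\<bar> + 1 \<Longrightarrow>
    l2_norm circle (\<lambda>v. evol n \<phi> s v - evol n \<phi> t' v - of_real (s - t') * (- Cn n (evol n \<phi> t') v)) \<le> K * (s - t')\<^sup>2"
    using evol_taylor[OF \<phi>, of "\<bar>t\<bar> + 1" n] by blast
  note L = evol_L2[OF \<phi>, of n]
  show ?thesis
  proof (rule has_real_derivative_quadratic[of 1, where K = "K * l2_norm circle \<zeta>"])
    fix s assume s: "\<bar>s - t\<bar> < 1"
    let ?g = "\<lambda>v. evol n \<phi> s v - evol n \<phi> t v - of_real (s - t) * (- Cn n (evol n \<phi> t) v)"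
    have U: "(\<lambda>v. - Cn n (evol n \<phi> t) v) \<in> L2 circle" by (intro L2_uminus Cn_L2 L)
    have g: "?g \<in> L2 circle" by (intro L2_diff L2_scale U L)
    have "l2_inner circle ?g \<zeta> = l2_inner circle (evol n \<phi> s) \<zeta> - l2_inner circle (evol n \<phi> t) \<zeta>
        - of_real (s - t) * l2_inner circle (\<lambda>v. - Cn n (evol n \<phi> t) v) \<zeta>"
      using l2_inner_diff_left[OF L2_diff[OF L[of s] L[of t]] L2_scale[OF U, of "of_real (s - t)"] \<zeta>]
        l2_inner_diff_left[OF L[of s] L[of t] \<zeta>] by (simp only: l2_inner_scale_left)
    also have "l2_inner circle (\<lambda>v. - Cn n (evol n \<phi> t) v) \<zeta> = - l2_inner circle (Cn n (evol n \<phi> t)) \<zeta>"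
      by (simp add: l2_inner_def)
    finally have "Re (l2_inner circle (evol n \<phi> s) \<zeta>) - Re (l2_inner circle (evol n \<phi> t) \<zeta>)
        - (s - t) * (- Re (l2_inner circle (Cn n (evol n \<phi> t)) \<zeta>)) = Re (l2_inner circle ?g \<zeta>)"
      by simp
    moreover have "\<bar>Re (l2_inner circle ?g \<zeta>)\<bar> \<le> l2_norm circle ?g * l2_norm circle \<zeta>"
      by (rule order_trans[OF abs_Re_le_cmod l2_cauchy_schwarz[OF g \<zeta>]])
    moreover have "l2_norm circle ?g * l2_norm circle \<zeta> \<le> (K * (s - t)\<^sup>2) * l2_norm circle \<zeta>"
      by (rule mult_right_mono[OF K]) (use s in auto)
    ultimately show "\<bar>Re (l2_inner circle (evol n \<phi> s) \<zeta>) - Re (l2_inner circle (evol n \<phi> t) \<zeta>)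
        - (s - t) * (- Re (l2_inner circle (Cn n (evol n \<phi> t)) \<zeta>))\<bar> \<le> K * l2_norm circle \<zeta> * (s - t)\<^sup>2"
      by (simp add: mult_ac)
  qed simp
qed

text \<open>Transport is skew and drops out of the real part, so only the relaxation part
  dissipates. The square of the increment is of second order and joins the remainder.\<close>

lemma evol_energy_derivative:
  assumes \<phi>: "\<phi> \<in> L2 circle"
  shows "((\<lambda>s. (l2_norm circle (evol n \<phi> s))\<^sup>2) has_real_derivative - 2 * (l2_norm circle (Rv (evol n \<phi> t)))\<^sup>2) (at t)"
proof -
  obtain K where K0: "0 \<le> K" and K: "\<And>s t'. \<bar>s\<bar> \<le> \<bar>t\<bar> + 1 \<Longrightarrow> \<bar>t'\<bar> \<le> \<bar>t\<bar> + 1 \<Longrightarrow>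
    l2_norm circle (\<lambda>v. evol n \<phi> s v - evol n \<phi> t' v - of_real (s - t') * (- Cn n (evol n \<phi> t') v)) \<le> K * (s - t')\<^sup>2"
    using evol_taylor[OF \<phi>, of "\<bar>t\<bar> + 1" n] by blast
  note L = evol_L2[OF \<phi>, of n]
  let ?u = "evol n \<phi> t"
  define C where "C = l2_norm circle (Cn n ?u)"
  have C0: "0 \<le> C" by (simp add: C_def)
  show ?thesis
  proof (rule has_real_derivative_quadratic[of 1, where K = "2 * l2_norm circle ?u * K + (C + K)\<^sup>2"])
    fix s assume s: "\<bar>s - t\<bar> < 1"
    define h where "h = s - t"
    let ?U = "\<lambda>v. - Cn n ?u v"
    let ?g = "\<lambda>v. evol n \<phi> s v - ?u v - of_real h * ?U v"
    let ?w = "\<lambda>v. evol n \<phi> s v - ?u v"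
    have U: "?U \<in> L2 circle" by (intro L2_uminus Cn_L2 L)
    have w: "?w \<in> L2 circle" by (intro L2_diff L)
    have g: "?g \<in> L2 circle" by (intro L2_diff L2_scale U L)
    have gK: "l2_norm circle ?g \<le> K * h\<^sup>2" unfolding h_def by (rule K) (use s in auto)
    have h1: "h\<^sup>2 \<le> \<bar>h\<bar>"
    proof -
      have "\<bar>h\<bar> * \<bar>h\<bar> \<le> 1 * \<bar>h\<bar>" by (rule mult_right_mono) (use s in \<open>simp_all add: h_def\<close>)
      then show ?thesis by (simp add: power2_eq_square)
    qed
    have "?w = (\<lambda>v. of_real h * ?U v + ?g v)" by simp
    then have "l2_norm circle ?w \<le> l2_norm circle (\<lambda>v. of_real h * ?U v) + l2_norm circle ?g"
      using l2_norm_triangle[OF L2_scale[OF U, of "of_real h"] g] by (simp only:)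
    also have "\<dots> \<le> \<bar>h\<bar> * C + K * \<bar>h\<bar>"
      using gK mult_left_mono[OF h1 K0] unfolding l2_norm_scale l2_norm_uminus C_def norm_of_real by linarith
    finally have "l2_norm circle ?w \<le> (C + K) * \<bar>h\<bar>" by (simp add: algebra_simps)
    then have w2: "(l2_norm circle ?w)\<^sup>2 \<le> (C + K)\<^sup>2 * h\<^sup>2"
      using power_mono[of "l2_norm circle ?w" "(C + K) * \<bar>h\<bar>" 2] by (simp add: power_mult_distrib)
    have "(l2_norm circle (evol n \<phi> s))\<^sup>2 = (l2_norm circle (\<lambda>v. ?u v + ?w v))\<^sup>2" by simp
    also have "\<dots> = (l2_norm circle ?u)\<^sup>2 + 2 * Re (l2_inner circle ?u ?w) + (l2_norm circle ?w)\<^sup>2"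
      by (rule l2_norm_add_power2[OF L w])
    also have "l2_inner circle ?u ?w = l2_inner circle ?u (\<lambda>v. of_real h * ?U v) + l2_inner circle ?u ?g"
      using l2_inner_add_right[OF L2_scale[OF U, of "of_real h"] g L[of t]] by simp
    also have "l2_inner circle ?u (\<lambda>v. of_real h * ?U v) = - of_real h * l2_inner circle ?u (Cn n ?u)"
      unfolding l2_inner_scale_right by (simp add: l2_inner_def)
    finally have eq: "(l2_norm circle (evol n \<phi> s))\<^sup>2 - (l2_norm circle ?u)\<^sup>2 - h * (- 2 * Re (l2_inner circle ?u (Cn n ?u)))
        = 2 * Re (l2_inner circle ?u ?g) + (l2_norm circle ?w)\<^sup>2"
      by simp
    have "Re (l2_inner circle ?u (Cn n ?u)) = (l2_norm circle (Rv ?u))\<^sup>2"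
      by (subst l2_inner_commute) (simp add: inner_Cn_self[OF L])
    note eq' = eq[unfolded this]
    have "\<bar>Re (l2_inner circle ?u ?g)\<bar> \<le> l2_norm circle ?u * (K * h\<^sup>2)"
      by (rule order_trans[OF abs_Re_le_cmod order_trans[OF l2_cauchy_schwarz[OF L g] mult_left_mono[OF gK]]]) simp
    then have "\<bar>2 * Re (l2_inner circle ?u ?g) + (l2_norm circle ?w)\<^sup>2\<bar> \<le> 2 * (l2_norm circle ?u * (K * h\<^sup>2)) + (C + K)\<^sup>2 * h\<^sup>2"
      using w2 zero_le_power2[of "l2_norm circle ?w"] by linarith
    then show "\<bar>(l2_norm circle (evol n \<phi> s))\<^sup>2 - (l2_norm circle ?u)\<^sup>2 - (s - t) * (- 2 * (l2_norm circle (Rv ?u))\<^sup>2)\<bar>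
        \<le> (2 * l2_norm circle ?u * K + (C + K)\<^sup>2) * (s - t)\<^sup>2"
      unfolding h_def[symmetric] eq' by (simp add: algebra_simps)
  qed simp
qed

lemma evol_energy_mono:
  assumes "\<phi> \<in> L2 circle" "s \<le> t"
  shows "(l2_norm circle (evol n \<phi> t))\<^sup>2 \<le> (l2_norm circle (evol n \<phi> s))\<^sup>2"
  using assms(2)
proof (rule DERIV_nonpos_imp_nonincreasing)
  fix x
  show "\<exists>y. ((\<lambda>s. (l2_norm circle (evol n \<phi> s))\<^sup>2) has_real_derivative y) (at x) \<and> y \<le> 0"
    by (rule exI, rule conjI, rule evol_energy_derivative[OF assms(1)]) simp
qed

lemma evol_contraction:
  assumes "\<phi> \<in> L2 circle" "0 \<le> t"
  shows "l2_norm circle (evol n \<phi> t) \<le> l2_norm circle \<phi>"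
proof (rule power2_le_imp_le)
  have "evol n \<phi> 0 = \<phi>" by (rule ext) (rule evol_0)
  then show "(l2_norm circle (evol n \<phi> t))\<^sup>2 \<le> (l2_norm circle \<phi>)\<^sup>2"
    using evol_energy_mono[OF assms, of n] by simp
qed simp

text \<open>The inequality of arithmetic and geometric means: (aX + bY)^2 is at least 4ab XY. The
  free ratio of a and b decides how a mixed term is charged to X and to Y.\<close>

lemma abs_le_weighted_mean:
  fixes K X Y :: real
  assumes "K\<^sup>2 \<le> c * (X * Y)" "c \<le> 4 * a * b" "0 \<le> X" "0 \<le> Y" "0 \<le> a" "0 \<le> b"
  shows "\<bar>K\<bar> \<le> a * X + b * Y"
proof (rule power2_le_imp_le)
  have "c * (X * Y) \<le> 4 * a * b * (X * Y)" using assms by (intro mult_right_mono) simp_all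
  moreover have "(a * X + b * Y)\<^sup>2 = (a * X - b * Y)\<^sup>2 + 4 * a * b * (X * Y)"
    by (simp add: power2_eq_square algebra_simps)
  ultimately show "\<bar>K\<bar>\<^sup>2 \<le> (a * X + b * Y)\<^sup>2" 
    unfolding power2_abs using assms(1) zero_le_power2[of "a * X - b * Y"] by linarith
qed (use assms in simp)

text \<open>The left side is the time derivative of the energy plus K/N. Dividing by N cancels the
  factor N in the derivative of the cross term, so that the gain -X/2 is the same for all
  modes.\<close>

lemma dissipation_exponential:
  fixes X Y K J P N :: real
  assumes N: "1 \<le> N" and nn: "0 \<le> X" "0 \<le> Y" and K: "K\<^sup>2 \<le> X * Y / 2" and J: "J \<le> Y / 2" and P: "P\<^sup>2 \<le> X * Y / 4"
  shows "- 2 * Y + (- K - N * X / 2 - N * P + N * J) / N \<le> - (1/5) * (X + Y + K / N)"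
proof -
  \<comment> \<open>The weights use up the gain exactly: X receives 1/10 from K, 1/5 from P and 1/5
    from the rate, in total 1/2, while Y keeps a surplus.\<close>
  have "\<bar>K\<bar> \<le> (1/8) * X + 1 * Y" by (rule abs_le_weighted_mean[where c = "1/2"]) (use K nn in simp_all)
  moreover have "\<bar>P\<bar> \<le> (1/5) * X + (5/16) * Y" by (rule abs_le_weighted_mean[where c = "1/4"]) (use P nn in simp_all)
  moreover have "\<bar>K / N\<bar> \<le> \<bar>K\<bar>" using N by (simp add: abs_divide divide_le_eq mult_le_cancel_left1)
  moreover have "(- K - N * X / 2 - N * P + N * J) / N = - (K / N) - X / 2 - P + J"
    using N by (simp add: field_simps)
  ultimately show ?thesis using J nn by argo
qed

text \<open>The weight of the cross term is a square, so that its derivative is of first order in q.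
  The term with this derivative is then charged as q^2 X plus a multiple of Y: the first is a
  fraction of the gain in X, the second is absorbed by the dissipation of Y, which carries no factor
  q.\<close>

lemma dissipation_cubic:
  fixes X Y K J P N q g' :: real
  assumes N: "1 \<le> N" and nn: "0 \<le> X" "0 \<le> Y" and K: "K\<^sup>2 \<le> X * Y / 2" and J: "J \<le> Y / 2" and P: "P\<^sup>2 \<le> X * Y / 4"
    and q: "0 \<le> q" "q \<le> 1" and g': "\<bar>g'\<bar> \<le> q / 4"
  shows "- 2 * Y + (g' * K + q\<^sup>2 / (8 * N) * (- K - N * X / 2 - N * P + N * J)) \<le> - (q\<^sup>2 / 32) * (X + Y)"
proof -
  have qq: "q\<^sup>2 \<le> q" using mult_left_mono[of q 1 q] q by (simp add: power2_eq_square)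
  have q1: "q\<^sup>2 \<le> 1" using qq q by linarith
  have "(q * K)\<^sup>2 \<le> (1/2) * ((q\<^sup>2 * X) * Y)"
    using mult_left_mono[OF K zero_le_power2[of q]] by (simp add: power_mult_distrib mult_ac)
  then have "\<bar>q * K\<bar> \<le> (1/24) * (q\<^sup>2 * X) + 3 * Y"
    by (rule abs_le_weighted_mean) (use nn in simp_all)
  then have qK: "q * \<bar>K\<bar> \<le> q\<^sup>2 * X / 24 + 3 * Y" using q by (simp add: abs_mult)
  have "\<bar>P\<bar> \<le> (1/8) * X + (1/2) * Y" by (rule abs_le_weighted_mean[where c = "1/4"]) (use P nn in simp_all)
  from mult_left_mono[OF this zero_le_power2[of q]]
  have qP: "q\<^sup>2 * \<bar>P\<bar> \<le> q\<^sup>2 * X / 8 + q\<^sup>2 * Y / 2" by (simp add: algebra_simps)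
  have qY: "q\<^sup>2 * Y \<le> Y" using mult_right_mono[OF q1 nn(2)] by simp
  have "g' * K \<le> \<bar>g'\<bar> * \<bar>K\<bar>" unfolding abs_mult[symmetric] by (rule abs_ge_self)
  also have "\<dots> \<le> q / 4 * \<bar>K\<bar>" by (rule mult_right_mono[OF g']) simp
  finally have 1: "g' * K \<le> (q * \<bar>K\<bar>) / 4" by simp
  have 2: "- (q\<^sup>2 / (8 * N)) * K \<le> (q * \<bar>K\<bar>) / 8"
  proof -
    have "- (q\<^sup>2 / (8 * N)) * K \<le> \<bar>q\<^sup>2 / (8 * N)\<bar> * \<bar>K\<bar>"
      using abs_ge_self[of "- (q\<^sup>2 / (8 * N)) * K"] by (simp only: abs_mult abs_minus_cancel)
    also have "\<dots> \<le> (q / 8) * \<bar>K\<bar>"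
    proof (rule mult_right_mono)
      have "\<bar>q\<^sup>2 / (8 * N)\<bar> = q\<^sup>2 / (8 * N)" using N by simp
      also have "\<dots> \<le> q / 8" using N qq q by (intro frac_le) simp_all
      finally show "\<bar>q\<^sup>2 / (8 * N)\<bar> \<le> q / 8" .
    qed simp
    finally show ?thesis by simp
  qed
  have 3: "- (q\<^sup>2 / 8) * P \<le> (q\<^sup>2 * \<bar>P\<bar>) / 8"
    using mult_left_mono[of "- P" "\<bar>P\<bar>" "q\<^sup>2 / 8"] by simp
  have 4: "q\<^sup>2 / 8 * J \<le> Y / 16"
    using mult_left_mono[OF J, of "q\<^sup>2 / 8"] qY by simp
  have eq: "q\<^sup>2 / (8 * N) * (- K - N * X / 2 - N * P + N * J) = - (q\<^sup>2 / (8 * N)) * K - q\<^sup>2 * X / 16 + - (q\<^sup>2 / 8) * P + q\<^sup>2 / 8 * J"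
    using N by (simp add: field_simps)
  have "- 2 * Y + (g' * K + q\<^sup>2 / (8 * N) * (- K - N * X / 2 - N * P + N * J))
      \<le> - 2 * Y + (3/8) * (q * \<bar>K\<bar>) - q\<^sup>2 * X / 16 + (q\<^sup>2 * \<bar>P\<bar>) / 8 + Y / 16"
    unfolding eq using 1 2 3 4 by linarith
  \<comment> \<open>For X the coefficients of q^2 are 1/64 from K, 1/64 from P and -1/16, which sum
    to -1/32; Y has room to spare.\<close>
  also have "\<dots> \<le> - (q\<^sup>2 * X) / 32 - q\<^sup>2 * Y / 32"
    using qK qP qY nn(2) by linarith
  also have "\<dots> = - (q\<^sup>2 / 32) * (X + Y)" by (simp add: field_simps)
  finally show ?thesis .
qed

context
  fixes n :: "int^2" and \<phi> :: "real^2 \<Rightarrow> complex"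
  assumes n0: "n \<noteq> 0" and \<phi>: "\<phi> \<in> L2 circle"
begin

text \<open>
  \<open>a0\<close>, \<open>j0\<close> and \<open>p0\<close> are the density, the current and the trace-free pressure in the direction of
  \<open>n\<close>. The energy \<open>E0 = X0 + Y0\<close> only dissipates \<open>Y0\<close>; the derivative of the cross term \<open>K0\<close> between
  density and current provides the missing dissipation of \<open>X0\<close>.
\<close>

definition "uvec = rvec n /\<^sub>R norm (rvec n)"
definition "modulus = norm (rvec n)"
definition "flow s = evol n \<phi> s"
definition "mom w s = v_mean (\<lambda>v. of_real (w v) * flow s v)" for w :: "real^2 \<Rightarrow> real"
definition "a0 = mom (\<lambda>v. 1)"
definition "j0 = mom (\<lambda>v. v \<bullet> uvec)"
definition "p0 = mom (\<lambda>v. (v \<bullet> uvec)\<^sup>2 - 1/2)"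
definition "X0 s = (cmod (a0 s))\<^sup>2"
definition "Y0 s = (l2_norm circle (Rv (flow s)))\<^sup>2 / (2 * pi)"
definition "K0 s = Im (j0 s) * Re (a0 s) - Re (j0 s) * Im (a0 s)"
definition "P0 s = Re (p0 s) * Re (a0 s) + Im (p0 s) * Im (a0 s)"
definition "E0 s = (l2_norm circle (flow s))\<^sup>2 / (2 * pi)"

lemma modulus_ge_1: "1 \<le> modulus"
  unfolding modulus_def by (rule norm_rvec_ge_1[OF n0])

lemma v_dot_uvec: "v_dot n v = of_real modulus * of_real (v \<bullet> uvec)"
  unfolding modulus_def by (rule v_dot_unit[OF n0 uvec_def])

lemma flow_L2: "flow s \<in> L2 circle"
  unfolding flow_def by (rule evol_L2[OF \<phi>])

lemma weight_L2: "continuous_on UNIV w \<Longrightarrow> (\<lambda>v. complex_of_real (w v)) \<in> L2 circle"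
proof -
  assume w: "continuous_on UNIV w"
  have "bounded (w ` sphere 0 1)" by (intro compact_imp_bounded compact_continuous_image continuous_on_subset[OF w]) simp_all
  then obtain B where B: "\<And>y. y \<in> sphere 0 1 \<Longrightarrow> \<bar>w y\<bar> \<le> B"
    unfolding bounded_iff real_norm_def by blast
  show ?thesis
    by (rule circle.L2_bounded[where B = B])
      (use B in \<open>auto simp: space_circle intro!: measurable_circle_continuous continuous_on_of_real w\<close>)
qed

lemma inner_weight: "l2_inner circle \<psi> (\<lambda>v. of_real (w v)) = of_real (2 * pi) * v_mean (\<lambda>v. of_real (w v) * \<psi> v)"
  by (simp add: l2_inner_def v_mean_def mult.commute)

lemma mom_derivative:
  assumes w: "continuous_on UNIV w"
  shows "((\<lambda>s. Re (mom w s)) has_real_derivative - Re (v_mean (\<lambda>v. of_real (w v) * Cn n (flow t) v))) (at t)"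
    and "((\<lambda>s. Im (mom w s)) has_real_derivative - Im (v_mean (\<lambda>v. of_real (w v) * Cn n (flow t) v))) (at t)"
proof -
  have z: "(\<lambda>v. c * complex_of_real (w v)) \<in> L2 circle" for c by (rule L2_scale[OF weight_L2[OF w]])
  have e: "l2_inner circle \<psi> (\<lambda>v. c * complex_of_real (w v)) = of_real (2 * pi) * (cnj c * v_mean (\<lambda>v. of_real (w v) * \<psi> v))" for \<psi> c
    unfolding l2_inner_scale_right inner_weight by simp
  have r: "Re (of_real (2 * pi) * y) = 2 * pi * Re y" for y by simp
  have "((\<lambda>s. 2 * pi * Re (cnj c * mom w s)) has_real_derivative
      - (2 * pi * Re (cnj c * v_mean (\<lambda>v. of_real (w v) * Cn n (flow t) v)))) (at t)" for c
    using evol_functional_derivative[OF \<phi> z, of n c t] unfolding e r mom_def flow_def .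
  from DERIV_cdivide[OF this, of _ "2 * pi"]
  have d: "((\<lambda>s. Re (cnj c * mom w s)) has_real_derivative
      - Re (cnj c * v_mean (\<lambda>v. of_real (w v) * Cn n (flow t) v))) (at t)" for c
    by simp
  from d[of 1] show "((\<lambda>s. Re (mom w s)) has_real_derivative - Re (v_mean (\<lambda>v. of_real (w v) * Cn n (flow t) v))) (at t)"
    by simp
  from d[of \<i>] show "((\<lambda>s. Im (mom w s)) has_real_derivative - Im (v_mean (\<lambda>v. of_real (w v) * Cn n (flow t) v))) (at t)"
    by simp
qed

lemma weighted_flow_L2: "continuous_on UNIV w \<Longrightarrow> \<psi> \<in> L2 circle \<Longrightarrow> (\<lambda>v. complex_of_real (w v) * \<psi> v) \<in> L2 circle"
proof -
  assume w: "continuous_on UNIV w" and \<psi>: "\<psi> \<in> L2 circle"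
  have "bounded (w ` sphere 0 1)" by (intro compact_imp_bounded compact_continuous_image continuous_on_subset[OF w]) simp_all
  then obtain B where B: "\<And>y. y \<in> sphere 0 1 \<Longrightarrow> \<bar>w y\<bar> \<le> B"
    unfolding bounded_iff real_norm_def by blast
  show ?thesis
    by (rule L2_bounded_mult[OF \<psi>, where B = B])
      (use B in \<open>auto simp: space_circle intro!: measurable_circle_continuous continuous_on_of_real w\<close>)
qed

lemma uvec_continuous: "continuous_on UNIV (\<lambda>v. v \<bullet> uvec)" "continuous_on UNIV (\<lambda>v. (v \<bullet> uvec)\<^sup>2 - 1/2)"
  "continuous_on UNIV (\<lambda>v. (v \<bullet> uvec)\<^sup>2)"
  by (intro continuous_intros)+

text \<open>Conservation of mass: relaxation does not change the density, so only the flux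
  remains.\<close>

lemma mean_Cn_flow:
  "v_mean (\<lambda>v. of_real 1 * Cn n (flow t) v) = \<i> * of_real modulus * j0 t"
proof -
  have "v_mean (Cn n (flow t)) = v_mean (Rv (flow t)) + v_mean (\<lambda>v. \<i> * (v_dot n v * flow t v))"
    unfolding Cn_eq by (intro v_mean_add Rv_L2 L2_scale v_dot_L2 flow_L2)
  also have "v_mean (\<lambda>v. \<i> * (v_dot n v * flow t v)) = \<i> * (of_real modulus * j0 t)"
    unfolding v_mean_scale v_dot_uvec mult.assoc[of "of_real modulus"] j0_def mom_def ..
  finally show ?thesis by (simp add: v_mean_Rv flow_L2)
qed

text \<open>Balance of momentum: the current relaxes at rate 1 and is driven by the second moment,
  which is split into half the density and the trace-free part \<open>p0\<close>.\<close>

lemma mean_uvec_Cn_flow: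
  "v_mean (\<lambda>v. of_real (v \<bullet> uvec) * Cn n (flow t) v) = j0 t + \<i> * of_real modulus * (a0 t / 2 + p0 t)"
proof -
  let ?w = "\<lambda>v. complex_of_real (v \<bullet> uvec)"
  have "(\<lambda>v. ?w v * Cn n (flow t) v)
      = (\<lambda>v. (?w v * flow t v - v_mean (flow t) * ?w v) + \<i> * of_real modulus * (of_real ((v \<bullet> uvec)\<^sup>2) * flow t v))"
    unfolding Cn_eq Rv_def v_dot_uvec by (simp add: fun_eq_iff algebra_simps power2_eq_square)
  then have "v_mean (\<lambda>v. ?w v * Cn n (flow t) v) = v_mean (\<lambda>v. ?w v * flow t v - v_mean (flow t) * ?w v)
      + v_mean (\<lambda>v. \<i> * of_real modulus * (of_real ((v \<bullet> uvec)\<^sup>2) * flow t v))"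
    by (simp only:) (intro v_mean_add L2_diff L2_scale weighted_flow_L2 weight_L2 uvec_continuous flow_L2)
  also have "v_mean (\<lambda>v. ?w v * flow t v - v_mean (flow t) * ?w v) = v_mean (\<lambda>v. ?w v * flow t v) - v_mean (\<lambda>v. v_mean (flow t) * ?w v)"
    by (intro v_mean_diff L2_scale weighted_flow_L2 weight_L2 uvec_continuous flow_L2)
  also have "v_mean (\<lambda>v. v_mean (flow t) * ?w v) = 0"
    unfolding v_mean_scale v_mean_unit[OF n0 uvec_def] by simp
  also have "v_mean (\<lambda>v. \<i> * of_real modulus * (of_real ((v \<bullet> uvec)\<^sup>2) * flow t v))
      = \<i> * of_real modulus * v_mean (\<lambda>v. of_real ((v \<bullet> uvec)\<^sup>2) * flow t v)"
    by (rule v_mean_scale)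
  also have "v_mean (\<lambda>v. of_real ((v \<bullet> uvec)\<^sup>2) * flow t v) = a0 t / 2 + p0 t"
  proof -
    have "(\<lambda>v. of_real ((v \<bullet> uvec)\<^sup>2) * flow t v) = (\<lambda>v. (1/2) * flow t v + of_real ((v \<bullet> uvec)\<^sup>2 - 1/2) * flow t v)"
      by (simp add: fun_eq_iff algebra_simps)
    then have "v_mean (\<lambda>v. of_real ((v \<bullet> uvec)\<^sup>2) * flow t v) = v_mean (\<lambda>v. (1/2) * flow t v) + v_mean (\<lambda>v. of_real ((v \<bullet> uvec)\<^sup>2 - 1/2) * flow t v)"
      by (simp only:) (intro v_mean_add L2_scale weighted_flow_L2 uvec_continuous flow_L2)
    then show ?thesis unfolding v_mean_scale by (simp add: a0_def p0_def mom_def)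
  qed
  finally show ?thesis by (simp add: j0_def mom_def)
qed

lemma K0_derivative:
  "(K0 has_real_derivative - K0 t - modulus * X0 t / 2 - modulus * P0 t + modulus * (cmod (j0 t))\<^sup>2) (at t)"
proof -
  note c = continuous_on_const[of UNIV "1::real"]
  have a: "((\<lambda>s. Re (a0 s)) has_real_derivative modulus * Im (j0 t)) (at t)"
    "((\<lambda>s. Im (a0 s)) has_real_derivative - (modulus * Re (j0 t))) (at t)"
    using mom_derivative[OF c, of t] unfolding mean_Cn_flow a0_def by simp_all
  have j: "((\<lambda>s. Re (j0 s)) has_real_derivative - Re (j0 t) + modulus * (Im (a0 t) / 2 + Im (p0 t))) (at t)"
    "((\<lambda>s. Im (j0 s)) has_real_derivative - Im (j0 t) - modulus * (Re (a0 t) / 2 + Re (p0 t))) (at t)"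
    using mom_derivative[OF uvec_continuous(1), of t] unfolding mean_uvec_Cn_flow j0_def[symmetric] by simp_all
  have "(K0 has_real_derivative ((- Im (j0 t) - modulus * (Re (a0 t) / 2 + Re (p0 t))) * Re (a0 t) + (modulus * Im (j0 t)) * Im (j0 t))
      - ((- Re (j0 t) + modulus * (Im (a0 t) / 2 + Im (p0 t))) * Im (a0 t) + (- (modulus * Re (j0 t))) * Re (j0 t))) (at t)"
    unfolding K0_def[abs_def] by (intro DERIV_diff DERIV_mult a j)
  moreover have "((- Im (j0 t) - modulus * (Re (a0 t) / 2 + Re (p0 t))) * Re (a0 t) + (modulus * Im (j0 t)) * Im (j0 t))
      - ((- Re (j0 t) + modulus * (Im (a0 t) / 2 + Im (p0 t))) * Im (a0 t) + (- (modulus * Re (j0 t))) * Re (j0 t))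
    = - K0 t - modulus * X0 t / 2 - modulus * P0 t + modulus * (cmod (j0 t))\<^sup>2"
    unfolding K0_def P0_def X0_def cmod_power2 by (simp add: power2_eq_square algebra_simps)
  ultimately show ?thesis by simp
qed

lemma E0_derivative: "(E0 has_real_derivative - 2 * Y0 t) (at t)"
  using DERIV_cdivide[OF evol_energy_derivative[OF \<phi>, of n t], of "2 * pi"]
  unfolding E0_def[abs_def] Y0_def flow_def by simp

lemma E0_eq: "E0 s = X0 s + Y0 s"
  unfolding E0_def X0_def Y0_def a0_def mom_def norm_Rv_power2[OF flow_L2] by (simp add: add_divide_distrib)

text \<open>A weight of mean zero does not see the constant part of the flow, so Cauchy-Schwarz
  against \<open>Rv\<close> of the flow suffices.\<close>

lemma mean_zero_bound:
  assumes w: "continuous_on UNIV w" and m: "v_mean (\<lambda>v. of_real (w v)) = 0"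
  shows "(cmod (mom w s))\<^sup>2 \<le> (l2_norm circle (\<lambda>v. of_real (w v)))\<^sup>2 / (2 * pi) * Y0 s"
proof -
  have "(\<lambda>v. of_real (w v) * flow s v) = (\<lambda>v. of_real (w v) * Rv (flow s) v + v_mean (flow s) * of_real (w v))"
    unfolding Rv_def by (simp add: algebra_simps)
  then have "mom w s = v_mean (\<lambda>v. of_real (w v) * Rv (flow s) v) + v_mean (\<lambda>v. v_mean (flow s) * of_real (w v))"
    unfolding mom_def by (simp only:) (intro v_mean_add L2_scale weighted_flow_L2 weight_L2 w Rv_L2 flow_L2)
  then have "of_real (2 * pi) * mom w s = l2_inner circle (Rv (flow s)) (\<lambda>v. of_real (w v))"
    unfolding inner_weight v_mean_scale m by simp
  then have "2 * pi * cmod (mom w s) = cmod (l2_inner circle (Rv (flow s)) (\<lambda>v. of_real (w v)))"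
    by (simp only: norm_mult norm_of_real flip: \<open>of_real (2 * pi) * mom w s = _\<close>) simp
  also have "\<dots> \<le> l2_norm circle (Rv (flow s)) * l2_norm circle (\<lambda>v. of_real (w v))"
    by (rule l2_cauchy_schwarz[OF Rv_L2[OF flow_L2] weight_L2[OF w]])
  finally have "(2 * pi * cmod (mom w s))\<^sup>2 \<le> (l2_norm circle (Rv (flow s)) * l2_norm circle (\<lambda>v. of_real (w v)))\<^sup>2"
    by (intro power_mono) simp_all
  then have "(2 * pi)\<^sup>2 * (cmod (mom w s))\<^sup>2 \<le> (2 * pi)\<^sup>2 * ((l2_norm circle (\<lambda>v. of_real (w v)))\<^sup>2 / (2 * pi) * Y0 s)"
    unfolding Y0_def by (simp add: power_mult_distrib power2_eq_square[of pi] mult_ac)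
  then show ?thesis by (subst (asm) mult_le_cancel_left_pos) simp_all
qed

lemma norm_weight:
  "continuous_on UNIV w \<Longrightarrow> (l2_norm circle (\<lambda>v. of_real (w v)))\<^sup>2 = 2 * pi * Re (v_mean (\<lambda>v. of_real ((w v)\<^sup>2)))"
proof -
  have "complex_of_real ((l2_norm circle (\<lambda>v. of_real (w v)))\<^sup>2) = of_real (2 * pi) * v_mean (\<lambda>v. of_real (w v) * of_real (w v))"
    unfolding l2_inner_self[symmetric] inner_weight ..
  from arg_cong[OF this, of Re] show ?thesis by (simp add: power2_eq_square)
qed

lemma j0_bound: "(cmod (j0 s))\<^sup>2 \<le> Y0 s / 2"
  using mean_zero_bound[OF uvec_continuous(1) v_mean_unit[OF n0 uvec_def], of s]
  unfolding norm_weight[OF uvec_continuous(1)] v_mean_unit_sq[OF n0 uvec_def] j0_def[symmetric] by simp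

lemma Y0_nonneg: "0 \<le> Y0 s" and X0_nonneg: "0 \<le> X0 s"
  by (simp_all add: Y0_def X0_def)

lemma p0_bound: "(cmod (p0 s))\<^sup>2 \<le> Y0 s / 4"
proof -
  let ?w = "\<lambda>v. (v \<bullet> uvec)\<^sup>2 - 1/2"
  have "v_mean (\<lambda>v. of_real (?w v)) = v_mean (\<lambda>v. of_real ((v \<bullet> uvec)\<^sup>2) - 1/2)" by simp
  also have "\<dots> = v_mean (\<lambda>v. of_real ((v \<bullet> uvec)\<^sup>2)) - v_mean (\<lambda>v. 1/2)"
    by (intro v_mean_diff weight_L2 uvec_continuous const_L2_circle)
  finally have m: "v_mean (\<lambda>v. of_real (?w v)) = 0" unfolding v_mean_unit_sq[OF n0 uvec_def] by simp
  have "norm (rvec n) \<noteq> 0" using modulus_ge_1 unfolding modulus_def by linarith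
  then have nu: "norm uvec = 1" unfolding uvec_def norm_scaleR abs_inverse abs_norm_cancel by (rule left_inverse)
  \<comment> \<open>The pointwise bound 1/2 on the unit circle replaces the computation of a fourth
    moment; the resulting factor 1/4 is good enough.\<close>
  have "(\<lambda>v. complex_of_real (?w v)) \<in> L2 circle \<and> l2_norm circle (\<lambda>v. of_real (?w v)) \<le> l2_norm circle (\<lambda>v. (1/2) * 1)"
  proof (rule l2_norm_mono)
    show "(\<lambda>v. complex_of_real (?w v)) \<in> borel_measurable circle"
      by (rule L2_measurable[OF weight_L2[OF uvec_continuous(2)]])
    show "AE v in circle. cmod (of_real (?w v)) \<le> cmod ((1/2) * 1)"
    proof (rule AE_I2)
      fix v assume "v \<in> space circle"
      then have "\<bar>v \<bullet> uvec\<bar> \<le> 1" using Cauchy_Schwarz_ineq2[of v uvec] nu by (simp add: space_circle)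
      then have "\<bar>v \<bullet> uvec\<bar>\<^sup>2 \<le> 1" by (intro power_le_one) simp_all
      then have "\<bar>?w v\<bar> \<le> 1/2" unfolding power2_abs using zero_le_power2[of "v \<bullet> uvec"] by linarith
      then show "cmod (of_real (?w v)) \<le> cmod ((1/2) * 1)" unfolding norm_of_real by simp
    qed
  qed (rule L2_scale[OF const_L2_circle])
  then have "l2_norm circle (\<lambda>v. of_real (?w v)) \<le> (1/2) * l2_norm circle (\<lambda>v. 1)"
    unfolding l2_norm_scale[of circle "1/2" "\<lambda>v. 1"] by simp
  then have "(l2_norm circle (\<lambda>v. of_real (?w v)))\<^sup>2 \<le> ((1/2) * l2_norm circle (\<lambda>v. 1))\<^sup>2" by (rule power_mono) simp
  then have "(l2_norm circle (\<lambda>v. of_real (?w v)))\<^sup>2 / (2 * pi) \<le> 1/4"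
    unfolding power_mult_distrib norm_one_circle by (simp add: power2_eq_square field_simps)
  from order_trans[OF mean_zero_bound[OF uvec_continuous(2) m] mult_right_mono[OF this Y0_nonneg[of s]]]
  show ?thesis unfolding p0_def by simp
qed

lemma K0_bound: "(K0 s)\<^sup>2 \<le> X0 s * Y0 s / 2"
proof -
  have "K0 s = Im (j0 s * cnj (a0 s))" by (simp add: K0_def)
  then have "\<bar>K0 s\<bar> \<le> cmod (j0 s) * cmod (a0 s)" using abs_Im_le_cmod[of "j0 s * cnj (a0 s)"] by (simp add: norm_mult)
  then have "\<bar>K0 s\<bar>\<^sup>2 \<le> (cmod (j0 s) * cmod (a0 s))\<^sup>2" by (rule power_mono) simp
  also have "\<dots> = (cmod (j0 s))\<^sup>2 * X0 s" by (simp add: X0_def power_mult_distrib)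
  also have "\<dots> \<le> Y0 s / 2 * X0 s" by (rule mult_right_mono[OF j0_bound X0_nonneg])
  finally show ?thesis by (simp add: mult.commute)
qed

lemma P0_bound: "(P0 s)\<^sup>2 \<le> X0 s * Y0 s / 4"
proof -
  have "P0 s = Re (p0 s * cnj (a0 s))" by (simp add: P0_def)
  then have "\<bar>P0 s\<bar> \<le> cmod (p0 s) * cmod (a0 s)" using abs_Re_le_cmod[of "p0 s * cnj (a0 s)"] by (simp add: norm_mult)
  then have "\<bar>P0 s\<bar>\<^sup>2 \<le> (cmod (p0 s) * cmod (a0 s))\<^sup>2" by (rule power_mono) simp
  also have "\<dots> = (cmod (p0 s))\<^sup>2 * X0 s" by (simp add: X0_def power_mult_distrib)
  also have "\<dots> \<le> Y0 s / 4 * X0 s" by (rule mult_right_mono[OF p0_bound X0_nonneg])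
  finally show ?thesis by (simp add: mult.commute)
qed

lemma flow_0: "flow 0 = \<phi>"
  unfolding flow_def by (rule ext) (rule evol_0)

lemma mode_exponential_decay:
  assumes t: "0 \<le> t"
  shows "(l2_norm circle (evol n \<phi> t))\<^sup>2 \<le> 3 * exp (- (1/5) * t) * (l2_norm circle \<phi>)\<^sup>2"
proof -
  let ?\<Phi> = "\<lambda>s. E0 s + K0 s / modulus"
  have N: "0 < modulus" using modulus_ge_1 by linarith
  have "exp ((1/5) * t) * ?\<Phi> t \<le> exp ((1/5) * 0) * ?\<Phi> 0"
  proof (rule DERIV_nonpos_imp_nonincreasing[OF t, where f = "\<lambda>s. exp ((1/5) * s) * ?\<Phi> s"])
    fix s assume "0 \<le> s" "s \<le> t"
    let ?D = "- 2 * Y0 s + (- K0 s - modulus * X0 s / 2 - modulus * P0 s + modulus * (cmod (j0 s))\<^sup>2) / modulus"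
    have e: "((\<lambda>s. exp ((1/5) * s)) has_real_derivative exp ((1/5) * s) * (1/5)) (at s)"
      by (auto intro!: derivative_eq_intros)
    have "((\<lambda>s. exp ((1/5) * s) * ?\<Phi> s) has_real_derivative (exp ((1/5) * s) * (1/5)) * ?\<Phi> s + ?D * exp ((1/5) * s)) (at s)"
      by (intro DERIV_mult e DERIV_add DERIV_cdivide E0_derivative K0_derivative)
    moreover have "(exp ((1/5) * s) * (1/5)) * ?\<Phi> s + ?D * exp ((1/5) * s) = exp ((1/5) * s) * ((1/5) * ?\<Phi> s + ?D)"
      by (simp add: algebra_simps)
    moreover have "?D \<le> - (1/5) * (X0 s + Y0 s + K0 s / modulus)"
      by (rule dissipation_exponential[OF modulus_ge_1 X0_nonneg Y0_nonneg K0_bound j0_bound P0_bound])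
    then have "exp ((1/5) * s) * ((1/5) * ?\<Phi> s + ?D) \<le> 0"
      unfolding E0_eq by (intro mult_nonneg_nonpos) simp_all
    ultimately show "\<exists>y. ((\<lambda>s. exp ((1/5) * s) * ?\<Phi> s) has_real_derivative y) (at s) \<and> y \<le> 0" by auto
  qed
  then have mono: "exp ((1/5) * t) * ?\<Phi> t \<le> ?\<Phi> 0" by simp
  \<comment> \<open>Since 4 (36/100)^2 exceeds 1/2, the modified energy lies between 64/100 and
    136/100 of the energy. The quotient 136/64 is below 3, the square of the constant in
    (b).\<close>
  have K: "\<bar>K0 s / modulus\<bar> \<le> (36/100) * E0 s" for s
  proof -
    have "\<bar>K0 s\<bar> \<le> (36/100) * X0 s + (36/100) * Y0 s"
      by (rule abs_le_weighted_mean[where c = "1/2"]) (use K0_bound[of s] X0_nonneg Y0_nonneg in simp_all)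
    moreover have "\<bar>K0 s / modulus\<bar> \<le> \<bar>K0 s\<bar>"
      using modulus_ge_1 N by (simp add: abs_divide divide_le_eq mult_le_cancel_left1)
    ultimately show ?thesis unfolding E0_eq by argo
  qed
  have "(64/100) * E0 t \<le> ?\<Phi> t" using K[of t] by argo
  then have "exp ((1/5) * t) * ((64/100) * E0 t) \<le> exp ((1/5) * t) * ?\<Phi> t" by (rule mult_left_mono) simp
  also note mono
  also have "?\<Phi> 0 \<le> (136/100) * E0 0" using K[of 0] by argo
  finally have "(64/100) * (exp ((1/5) * t) * E0 t) \<le> (136/100) * E0 0" by (simp only: mult.left_commute)
  then have "exp ((1/5) * t) * E0 t \<le> (136/64) * E0 0" by linarith
  moreover have "0 \<le> E0 0" by (simp add: E0_def)
  then have "(136/64) * E0 0 \<le> 3 * E0 0" by linarith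
  ultimately have "exp ((1/5) * t) * E0 t \<le> 3 * E0 0" by linarith
  then have "E0 t \<le> exp (- (1/5) * t) * (3 * E0 0)"
    by (simp add: exp_minus field_simps)
  then have "2 * pi * E0 t \<le> 2 * pi * (exp (- (1/5) * t) * (3 * E0 0))" by (rule mult_left_mono) simp
  then show ?thesis unfolding E0_def flow_0 unfolding flow_def by (simp add: mult_ac)
qed

lemma mode_cubic_decay:
  assumes t: "0 < t" "t \<le> 1"
  shows "(1 + t ^ 3 / 960) * (l2_norm circle (evol n \<phi> t))\<^sup>2 \<le> (l2_norm circle \<phi>)\<^sup>2"
proof -
  text \<open>The weight \<open>g\<close> of the cross term vanishes at both ends of \<open>[0, t]\<close>, and \<open>Z\<close> is the primitive of
    \<open>q\<^sup>2 / 32\<close>, so \<open>Z t = t\<^sup>3 / 960\<close> is the relative loss of energy.\<close>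
  define q where "q s = s * (t - s) / t" for s
  define g where "g s = (q s)\<^sup>2 / (8 * modulus)" for s
  define Z where "Z s = (s ^ 3 * t\<^sup>2 / 3 - s ^ 4 * t / 2 + s ^ 5 / 5) / (32 * t\<^sup>2)" for s
  \<comment> \<open>Energy decreases, so the dissipation at time s, at least (q s)^2/32 times the
    energy at s, is bounded below by the same multiple of the final energy \<open>E0 t\<close>. With
    this constant factor the estimate integrates directly and needs no Gronwall argument; the cross
    term drops out at both ends.\<close>
  let ?\<Psi> = "\<lambda>s. (E0 s + g s * K0 s) + E0 t * Z s"
  have N: "0 < modulus" using modulus_ge_1 by linarith
  have Em: "E0 t \<le> E0 s" if "s \<le> t" for s
    unfolding E0_def flow_def by (rule divide_right_mono[OF evol_energy_mono[OF \<phi> that]]) simp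
  have "?\<Psi> t \<le> ?\<Psi> 0"
  proof (rule DERIV_nonpos_imp_nonincreasing[where f = ?\<Psi>])
    show "0 \<le> t" using t by simp
    fix s assume s: "0 \<le> s" "s \<le> t"
    define g' where "g' = q s * (t - 2 * s) / t / (4 * modulus)"
    have qd: "(q has_real_derivative (t - 2 * s) / t) (at s)"
      unfolding q_def[abs_def] using t by (auto intro!: derivative_eq_intros)
    have gd: "(g has_real_derivative g') (at s)"
    proof -
      have "(g has_real_derivative (2 * (q s * ((t - 2 * s) / t))) / (8 * modulus)) (at s)"
        unfolding g_def[abs_def] using qd by (intro DERIV_cdivide) (auto intro!: derivative_eq_intros)
      moreover have "2 * (q s * ((t - 2 * s) / t)) / (8 * modulus) = g'"
        unfolding g'_def using N t by (simp add: field_simps)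
      ultimately show ?thesis by (simp only:)
    qed
    have Zd: "(Z has_real_derivative (q s)\<^sup>2 / 32) (at s)"
    proof -
      have "(Z has_real_derivative (3 * s\<^sup>2 * t\<^sup>2 / 3 - 4 * s ^ 3 * t / 2 + 5 * s ^ 4 / 5) / (32 * t\<^sup>2)) (at s)"
        unfolding Z_def[abs_def] by (rule DERIV_cdivide) (auto intro!: derivative_eq_intros)
      moreover have "3 * s\<^sup>2 * t\<^sup>2 / 3 - 4 * s ^ 3 * t / 2 + 5 * s ^ 4 / 5 = (s * (t - s))\<^sup>2"
        by (simp add: power2_eq_square power3_eq_cube power4_eq_xxxx algebra_simps)
      moreover have "(q s)\<^sup>2 / 32 = (s * (t - s))\<^sup>2 / (32 * t\<^sup>2)"
        unfolding q_def power_divide by (simp only: divide_divide_eq_left mult.commute)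
      ultimately show ?thesis by (simp only:)
    qed
    let ?D = "- 2 * Y0 s + (g' * K0 s + (q s)\<^sup>2 / (8 * modulus) * (- K0 s - modulus * X0 s / 2 - modulus * P0 s + modulus * (cmod (j0 s))\<^sup>2))"
    have q01: "0 \<le> q s" "q s \<le> 1"
    proof -
      show "0 \<le> q s" unfolding q_def using s t by simp
      have "s * (t - s) \<le> t * 1" using s t by (intro mult_mono) simp_all
      then show "q s \<le> 1" unfolding q_def using t by (simp add: divide_le_eq)
    qed
    have g'b: "\<bar>g'\<bar> \<le> q s / 4"
    proof -
      have "\<bar>g'\<bar> = q s * (\<bar>t - 2 * s\<bar> / t / (4 * modulus))"
        unfolding g'_def using q01 t N by (simp add: abs_mult abs_divide)
      also have "\<dots> \<le> q s * (1 / 4)"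
      proof (rule mult_left_mono[OF _ q01(1)])
        have "\<bar>t - 2 * s\<bar> / t \<le> 1" using s t by (simp add: divide_le_eq abs_le_iff)
        then show "\<bar>t - 2 * s\<bar> / t / (4 * modulus) \<le> 1 / 4"
          using modulus_ge_1 t by (intro frac_le) simp_all
      qed
      finally show ?thesis by simp
    qed
    have "(?\<Psi> has_real_derivative (- 2 * Y0 s + (g' * K0 s + (- K0 s - modulus * X0 s / 2 - modulus * P0 s + modulus * (cmod (j0 s))\<^sup>2) * g s))
        + E0 t * ((q s)\<^sup>2 / 32)) (at s)"
      by (intro DERIV_add DERIV_mult DERIV_cmult E0_derivative gd K0_derivative Zd)
    then have der: "(?\<Psi> has_real_derivative ?D + E0 t * ((q s)\<^sup>2 / 32)) (at s)"
      unfolding g_def by (simp only: mult.commute)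
    have D: "?D \<le> - ((q s)\<^sup>2 / 32) * (X0 s + Y0 s)"
      by (rule dissipation_cubic[OF modulus_ge_1 X0_nonneg Y0_nonneg K0_bound j0_bound P0_bound q01 g'b])
    have E: "E0 t * ((q s)\<^sup>2 / 32) \<le> E0 s * ((q s)\<^sup>2 / 32)"
      by (rule mult_right_mono[OF Em[OF s(2)]]) simp
    have "E0 s * ((q s)\<^sup>2 / 32) = - (- ((q s)\<^sup>2 / 32) * (X0 s + Y0 s))"
      unfolding E0_eq[of s] by (simp only: mult_minus_left minus_minus mult.commute)
    with D E have "?D + E0 t * ((q s)\<^sup>2 / 32) \<le> 0" by linarith
    with der show "\<exists>y. (?\<Psi> has_real_derivative y) (at s) \<and> y \<le> 0" by blast
  qed
  moreover have "g 0 = 0" "g t = 0" unfolding g_def q_def by simp_all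
  moreover have "Z 0 = 0" unfolding Z_def by simp
  moreover have "Z t = t ^ 3 / 960"
  proof -
    have "t ^ 3 * t\<^sup>2 / 3 - t ^ 4 * t / 2 + t ^ 5 / 5 = t\<^sup>2 * (t ^ 3 / 30)"
      by (simp add: power2_eq_square power3_eq_cube power4_eq_xxxx numeral_eq_Suc field_simps)
    then have "Z t = t\<^sup>2 * (t ^ 3 / 30) / (t\<^sup>2 * 32)"
      unfolding Z_def by (simp only: mult.commute)
    also have "\<dots> = t ^ 3 / 30 / 32" using t by (subst mult_divide_mult_cancel_left) simp_all
    finally show ?thesis by simp
  qed
  ultimately have "(1 + t ^ 3 / 960) * E0 t \<le> E0 0" by (simp add: algebra_simps)
  then have "2 * pi * ((1 + t ^ 3 / 960) * E0 t) \<le> 2 * pi * E0 0" by (rule mult_left_mono) simp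
  then show ?thesis unfolding E0_def flow_0 unfolding flow_def by (simp add: mult_ac)
qed

end

text \<open>For n = 0 there is no transport: the mean is conserved, hence stays zero,
  \<open>Rv\<close> acts as the identity and the energy decays exactly at rate 2.\<close>

lemma mode_zero_decay:
  assumes \<phi>: "\<phi> \<in> L2 circle" and m: "v_mean \<phi> = 0"
  shows "(l2_norm circle (evol 0 \<phi> t))\<^sup>2 = exp (- 2 * t) * (l2_norm circle \<phi>)\<^sup>2"
proof -
  have vd: "v_dot 0 = (\<lambda>v. 0)" unfolding v_dot_def[abs_def] rvec_0 by simp
  have C0: "Cn 0 \<psi> = Rv \<psi>" for \<psi> unfolding Cn_eq vd by simp
  have d: "((\<lambda>s. Re (l2_inner circle (evol 0 \<phi> s) (\<lambda>v. c))) has_real_derivative 0) (at s)" for c s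
    using evol_functional_derivative[OF \<phi> const_L2_circle[of c], of 0 s]
    unfolding C0 inner_const_right v_mean_Rv[OF evol_L2[OF \<phi>]] by simp
  have e0: "evol 0 \<phi> 0 = \<phi>" by (rule ext) (rule evol_0)
  have "Re (l2_inner circle (evol 0 \<phi> s) (\<lambda>v. c)) = Re (l2_inner circle (evol 0 \<phi> 0) (\<lambda>v. c))" for c s
    by (rule DERIV_isconst_all) (use d in blast)
  then have z: "Re (of_real (2 * pi) * cnj c * v_mean (evol 0 \<phi> s)) = 0" for c s
    unfolding e0 inner_const_right m by simp
  have mean: "v_mean (evol 0 \<phi> s) = 0" for s
    using z[of 1 s] z[of \<i> s] by (simp add: complex_eq_iff)
  have R: "(l2_norm circle (Rv (evol 0 \<phi> s)))\<^sup>2 = (l2_norm circle (evol 0 \<phi> s))\<^sup>2" for s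
    using norm_Rv_power2[OF evol_L2[OF \<phi>], of 0 s] unfolding mean by simp
  have "((\<lambda>s. exp (2 * s) * (l2_norm circle (evol 0 \<phi> s))\<^sup>2) has_real_derivative 0) (at s)" for s
  proof -
    have "((\<lambda>s. exp (2 * s)) has_real_derivative exp (2 * s) * 2) (at s)"
      by (auto intro!: derivative_eq_intros)
    from DERIV_mult[OF this evol_energy_derivative[OF \<phi>, of 0 s]]
    show ?thesis unfolding R by (simp add: algebra_simps)
  qed
  then have "exp (2 * t) * (l2_norm circle (evol 0 \<phi> t))\<^sup>2 = exp (2 * 0) * (l2_norm circle (evol 0 \<phi> 0))\<^sup>2"
    by (intro DERIV_isconst_all) blast
  then show ?thesis unfolding e0 by (simp add: exp_minus field_simps)
qed

text \<open>The flow starts at a constant, which \<open>Rv\<close> annihilates, so the norm of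
  \<open>Rv\<close> of the flow grows at most linearly. The energy loses twice the square of it per
  unit time, hence at most a multiple of t^3.\<close>

lemma cubic_lower_bound_exists:
  assumes r: "0 < r"
  shows "\<exists>c>0. \<forall>t\<in>{0..r}. 1 - c * t ^ 3 \<le> l2_norm circle (evol n (\<lambda>v. 1) t) / sqrt (2 * pi)"
proof -
  let ?u = "evol n (\<lambda>v. 1)"
  note one = const_L2_circle[of 1]
  obtain K where K0: "0 \<le> K" and K: "\<And>s t. \<bar>s\<bar> \<le> r \<Longrightarrow> \<bar>t\<bar> \<le> r \<Longrightarrow>
    l2_norm circle (\<lambda>v. ?u s v - ?u t v - of_real (s - t) * (- Cn n (?u t) v)) \<le> K * (s - t)\<^sup>2"
    using evol_taylor[OF one, of r n] by blast
  define C where "C = l2_norm circle (Cn n (\<lambda>v. 1))"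
  define L where "L = C + K * r"
  have e0: "?u 0 = (\<lambda>v. 1)" by (rule ext) (rule evol_0)
  have L: "l2_norm circle (Rv (?u s)) \<le> L * s" if s: "0 \<le> s" "s \<le> r" for s
  proof -
    let ?g = "\<lambda>v. ?u s v - 1 - of_real s * (- Cn n (\<lambda>v. 1) v)"
    have U: "(\<lambda>v. - Cn n (\<lambda>v. 1) v) \<in> L2 circle" by (intro L2_uminus Cn_L2 one)
    have g: "?g \<in> L2 circle" by (intro L2_diff evol_L2 L2_scale U one)
    have "l2_norm circle ?g \<le> K * s\<^sup>2" using K[of s 0] s r unfolding e0 by simp
    moreover have "K * s\<^sup>2 \<le> K * (r * s)" using s K0 by (intro mult_left_mono) (simp_all add: power2_eq_square mult_right_mono)
    moreover have "Rv (?u s) = Rv (\<lambda>v. ?u s v - 1)"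
      unfolding Rv_def by (simp add: v_mean_diff evol_L2 one)
    moreover have "l2_norm circle (Rv (\<lambda>v. ?u s v - 1)) \<le> l2_norm circle (\<lambda>v. ?u s v - 1)"
      by (intro norm_Rv_le L2_diff evol_L2 one)
    moreover have "l2_norm circle (\<lambda>v. of_real s * (- Cn n (\<lambda>v. 1) v) + ?g v)
        \<le> l2_norm circle (\<lambda>v. of_real s * (- Cn n (\<lambda>v. 1) v)) + l2_norm circle ?g"
      by (rule l2_norm_triangle[OF L2_scale[OF U] g])
    moreover have "l2_norm circle (\<lambda>v. of_real s * (- Cn n (\<lambda>v. 1) v)) = s * C"
      unfolding l2_norm_scale l2_norm_uminus C_def using s by simp
    moreover have "(\<lambda>v. of_real s * (- Cn n (\<lambda>v. 1) v) + ?g v) = (\<lambda>v. ?u s v - 1)" by simp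
    ultimately show ?thesis unfolding L_def by (simp add: algebra_simps)
  qed
  have low: "2 * pi - (2/3) * L\<^sup>2 * t ^ 3 \<le> (l2_norm circle (?u t))\<^sup>2" if t: "0 \<le> t" "t \<le> r" for t
  proof -
    have "(\<lambda>s. (l2_norm circle (?u s))\<^sup>2 + (2/3) * L\<^sup>2 * s ^ 3) 0 \<le> (\<lambda>s. (l2_norm circle (?u s))\<^sup>2 + (2/3) * L\<^sup>2 * s ^ 3) t"
    proof (rule DERIV_nonneg_imp_nondecreasing[OF t(1)])
      fix s assume s: "0 \<le> s" "s \<le> t"
      have "((\<lambda>s. (2/3) * L\<^sup>2 * s ^ 3) has_real_derivative 2 * L\<^sup>2 * s\<^sup>2) (at s)"
        by (auto intro!: derivative_eq_intros)
      from DERIV_add[OF evol_energy_derivative[OF one] this]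
      have "((\<lambda>s. (l2_norm circle (?u s))\<^sup>2 + (2/3) * L\<^sup>2 * s ^ 3) has_real_derivative
        - 2 * (l2_norm circle (Rv (?u s)))\<^sup>2 + 2 * L\<^sup>2 * s\<^sup>2) (at s)" .
      moreover have "(l2_norm circle (Rv (?u s)))\<^sup>2 \<le> (L * s)\<^sup>2" by (rule power_mono[OF L]) (use s t in simp_all)
      then have "0 \<le> - 2 * (l2_norm circle (Rv (?u s)))\<^sup>2 + 2 * L\<^sup>2 * s\<^sup>2" by (simp add: power_mult_distrib)
      ultimately show "\<exists>y. ((\<lambda>s. (l2_norm circle (?u s))\<^sup>2 + (2/3) * L\<^sup>2 * s ^ 3) has_real_derivative y) (at s) \<and> 0 \<le> y" by blast
    qed
    then show ?thesis unfolding e0 norm_one_circle by simp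
  qed
  \<comment> \<open>The first summand is (2/3) L^2 divided by the initial energy 2 pi; the 1 ensures
    that \<open>c\<close> is positive.\<close>
  define c where "c = L\<^sup>2 / 3 / pi + 1"
  have c: "0 < c" unfolding c_def by (simp add: add_nonneg_pos)
  have "1 - c * t ^ 3 \<le> l2_norm circle (?u t) / sqrt (2 * pi)" if t: "t \<in> {0..r}" for t
  proof (cases "1 - c * t ^ 3 \<le> 0")
    case True
    have "0 \<le> l2_norm circle (?u t) / sqrt (2 * pi)" by simp
    then show ?thesis using True by linarith
  next
    case False
    have t3: "0 \<le> t ^ 3" using t by simp
    show ?thesis
    proof (rule power2_le_imp_le)
      \<comment> \<open>Taking the square root costs nothing: for a number in [0, 1] the square is
        at most the number itself.\<close>
      have "(1 - c * t ^ 3)\<^sup>2 \<le> 1 * (1 - c * t ^ 3)"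
        unfolding power2_eq_square using False c t3 by (intro mult_right_mono) simp_all
      also have "\<dots> \<le> 1 - L\<^sup>2 / 3 / pi * t ^ 3" unfolding c_def using t3 by (simp add: algebra_simps)
      also have "\<dots> = (2 * pi - (2/3) * L\<^sup>2 * t ^ 3) / (2 * pi)" by (simp add: field_simps)
      also have "\<dots> \<le> (l2_norm circle (?u t))\<^sup>2 / (2 * pi)" by (rule divide_right_mono[OF low]) (use t in simp_all)
      also have "\<dots> = (l2_norm circle (?u t) / sqrt (2 * pi))\<^sup>2" by (simp add: power_divide)
      finally show "(1 - c * t ^ 3)\<^sup>2 \<le> (l2_norm circle (?u t) / sqrt (2 * pi))\<^sup>2" .
    qed simp
  qed
  with c show ?thesis by blast
qed

section \<open>Uniform boundedness\<close>

lemma bounded_op_L2: "bounded_op M A \<Longrightarrow> f \<in> L2 M \<Longrightarrow> A f \<in> L2 M"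
  by (simp add: bounded_op_def)

lemma bounded_op_linear:
  "bounded_op M A \<Longrightarrow> f \<in> L2 M \<Longrightarrow> g \<in> L2 M \<Longrightarrow> AE z in M. A (\<lambda>y. a * f y + b * g y) z = a * A f z + b * A g z"
  unfolding bounded_op_def by blast

lemma bounded_op_diff:
  assumes "bounded_op M A" "f \<in> L2 M" "g \<in> L2 M"
  shows "AE z in M. A (\<lambda>y. f y - g y) z = A f z - A g z"
  using bounded_op_linear[OF assms, of 1 "-1"] by simp

lemma bounded_op_add:
  assumes "bounded_op M A" "f \<in> L2 M" "g \<in> L2 M"
  shows "AE z in M. A (\<lambda>y. f y + g y) z = A f z + A g z"
  using bounded_op_linear[OF assms, of 1 1] by simp

lemma bounded_op_scale:
  assumes "bounded_op M A" "f \<in> L2 M"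
  shows "AE z in M. A (\<lambda>y. c * f y) z = c * A f z"
  using bounded_op_linear[OF assms(1,2,2), of c 0] by simp

lemma norm_bounded_op_diff:
  assumes A: "bounded_op M A" and f: "f \<in> L2 M" and g: "g \<in> L2 M"
  shows "l2_norm M (\<lambda>z. A f z - A g z) = l2_norm M (A (\<lambda>z. f z - g z))"
  by (rule l2_norm_cong_AE[symmetric])
    (use bounded_op_diff[OF A f g] in \<open>simp_all add: L2_measurable L2_diff bounded_op_L2[OF A] f g\<close>)

lemma op_norm_bdd:
  assumes A: "bounded_op M A"
  shows "bdd_above ((\<lambda>f. l2_norm M (A f)) ` {f \<in> L2 M. l2_norm M f \<le> 1})"
proof -
  obtain K where K: "\<And>f. f \<in> L2 M \<Longrightarrow> l2_norm M (A f) \<le> K * l2_norm M f"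
    using A unfolding bounded_op_def by blast
  have "l2_norm M (A f) \<le> \<bar>K\<bar>" if "f \<in> L2 M" "l2_norm M f \<le> 1" for f
  proof -
    have "K * l2_norm M f \<le> \<bar>K\<bar> * 1" by (rule mult_mono) (use that in simp_all)
    then show ?thesis using K[OF that(1)] by simp
  qed
  then show ?thesis by (intro bdd_aboveI[of _ "\<bar>K\<bar>"]) blast
qed

lemma op_norm_upper_unit:
  "bounded_op M A \<Longrightarrow> f \<in> L2 M \<Longrightarrow> l2_norm M f \<le> 1 \<Longrightarrow> l2_norm M (A f) \<le> op_norm M A"
  unfolding op_norm_def by (rule cSUP_upper[OF _ op_norm_bdd]) simp_all

lemma op_norm_upper:
  assumes A: "bounded_op M A" and f: "f \<in> L2 M"
  shows "l2_norm M (A f) \<le> op_norm M A * l2_norm M f"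
proof (cases "l2_norm M f = 0")
  case True
  obtain K where "l2_norm M (A f) \<le> K * l2_norm M f" using A f unfolding bounded_op_def by blast
  then show ?thesis using True by simp
next
  case False
  let ?c = "complex_of_real (1 / l2_norm M f)"
  have pos: "0 < l2_norm M f" using False l2_norm_nonneg[of M f] by linarith
  have g: "(\<lambda>z. ?c * f z) \<in> L2 M" by (rule L2_scale[OF f])
  have n: "l2_norm M (\<lambda>z. ?c * f z) = 1" unfolding l2_norm_scale norm_of_real using pos by simp
  have "l2_norm M (A (\<lambda>z. ?c * f z)) = l2_norm M (\<lambda>z. ?c * A f z)"
    by (rule l2_norm_cong_AE[OF L2_measurable[OF bounded_op_L2[OF A g]]
          L2_measurable[OF L2_scale[OF bounded_op_L2[OF A f]]] bounded_op_scale[OF A f]])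
  also have "\<dots> = l2_norm M (A f) / l2_norm M f" unfolding l2_norm_scale norm_of_real using pos by simp
  finally have "l2_norm M (A f) / l2_norm M f \<le> op_norm M A"
    using op_norm_upper_unit[OF A g] n by simp
  then show ?thesis using pos by (simp add: pos_divide_le_eq)
qed

lemma op_norm_approx:
  assumes A: "bounded_op M A" and pos: "0 < op_norm M A"
  shows "\<exists>f\<in>L2 M. l2_norm M f \<le> 1 \<and> (2/3) * op_norm M A \<le> l2_norm M (A f)"
proof -
  have "(2/3) * op_norm M A < op_norm M A" using pos by simp
  moreover have "{f \<in> L2 M. l2_norm M f \<le> 1} \<noteq> {}" using L2_zero[of M] l2_norm_zero[of M] by force
  ultimately have "\<exists>f\<in>{f \<in> L2 M. l2_norm M f \<le> 1}. (2/3) * op_norm M A < l2_norm M (A f)"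
    unfolding op_norm_def by (subst (asm) less_cSUP_iff[OF _ op_norm_bdd[OF A]])
  then show ?thesis by (auto intro: less_imp_le)
qed

text \<open>The gliding hump argument of Sokal.\<close>

lemma uniform_boundedness:
  assumes T: "\<And>k::nat. bounded_op M (T k)"
    and pb: "\<And>f. f \<in> L2 M \<Longrightarrow> \<exists>B. \<forall>k. l2_norm M (T k f) \<le> B"
  shows "\<exists>B. \<forall>k. op_norm M (T k) \<le> B"
proof (rule ccontr)
  assume "\<not> (\<exists>B. \<forall>k. op_norm M (T k) \<le> B)"
  then have "\<forall>j. \<exists>k. (4::real) ^ j < op_norm M (T k)" by (meson not_le)
  from choice[OF this] obtain \<kappa> where \<kappa>: "\<And>j. (4::real) ^ j < op_norm M (T (\<kappa> j))" by blast
  define S where "S j = T (\<kappa> j)" for j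
  define N where "N j = op_norm M (S j)" for j
  have S: "bounded_op M (S j)" for j unfolding S_def by (rule T)
  have N4: "4 ^ j < N j" for j unfolding N_def S_def by (rule \<kappa>)
  have Npos: "0 < N j" for j by (rule less_trans[OF _ N4]) simp
  \<comment> \<open>The j-th increment has length at most 3^-(j+1), and at the new point
    \<open>S j\<close> is large in comparison with this length and its norm.\<close>
  let ?Q = "\<lambda>j x y. l2_norm M (\<lambda>z. y z - x z) \<le> (1/3) ^ Suc j \<and> (2/3) * (1/3) ^ Suc j * N j \<le> l2_norm M (S j y)"
  have "\<exists>X. \<forall>j. X j \<in> L2 M \<and> ?Q j (X j) (X (Suc j))"
  proof (rule dependent_nat_choice)
    show "\<exists>x. x \<in> L2 M" using L2_zero by blast
    fix x j assume x: "x \<in> L2 M"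
    obtain f where f: "f \<in> L2 M" "l2_norm M f \<le> 1" "(2/3) * N j \<le> l2_norm M (S j f)"
      using op_norm_approx[OF S[of j]] Npos unfolding N_def by blast
    define q :: real where "q = (1/3) ^ Suc j"
    have q0: "0 < q" unfolding q_def by (rule zero_less_power) simp
    let ?c = "complex_of_real q"
    let ?g = "\<lambda>z. ?c * f z"
    have g: "?g \<in> L2 M" by (rule L2_scale[OF f(1)])
    have "l2_norm M (S j ?g) = l2_norm M (\<lambda>z. ?c * S j f z)"
      by (rule l2_norm_cong_AE[OF L2_measurable[OF bounded_op_L2[OF S g]]
            L2_measurable[OF L2_scale[OF bounded_op_L2[OF S f(1)]]] bounded_op_scale[OF S f(1)]])
    also have "\<dots> = q * l2_norm M (S j f)" unfolding l2_norm_scale norm_of_real using q0 by simp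
    finally have Sg_eq: "l2_norm M (S j ?g) = q * l2_norm M (S j f)" .
    have Sg: "(2/3) * q * N j \<le> l2_norm M (S j ?g)"
      unfolding Sg_eq mult.commute[of "2/3" q] mult.assoc
      by (rule mult_left_mono[OF f(3) less_imp_le[OF q0]])
    have ng: "l2_norm M ?g \<le> q"
      unfolding l2_norm_scale norm_of_real using mult_left_mono[OF f(2) less_imp_le[OF q0]] q0 by simp
    \<comment> \<open>The difference of the images of the two points x + g and x - g is twice the
      image of g, so at one of them \<open>S j\<close> is at least as large as at g.\<close>
    let ?y = "\<lambda>z. x z + ?g z" and ?y' = "\<lambda>z. x z - ?g z"
    have y: "?y \<in> L2 M" and y': "?y' \<in> L2 M" by (intro L2_add L2_diff x g)+
    have "l2_norm M (\<lambda>z. 2 * S j ?g z) = l2_norm M (\<lambda>z. S j ?y z - S j ?y' z)"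
    proof (rule l2_norm_cong_AE)
      show "(\<lambda>z. 2 * S j ?g z) \<in> borel_measurable M" "(\<lambda>z. S j ?y z - S j ?y' z) \<in> borel_measurable M"
        by (intro L2_measurable L2_scale L2_diff bounded_op_L2[OF S] g y y')+
      show "AE z in M. 2 * S j ?g z = S j ?y z - S j ?y' z"
        using bounded_op_add[OF S x g, of j] bounded_op_diff[OF S x g, of j] by eventually_elim simp
    qed
    also have "\<dots> \<le> l2_norm M (S j ?y) + l2_norm M (S j ?y')"
      by (intro l2_norm_triangle_diff bounded_op_L2[OF S] y y')
    finally have "2 * l2_norm M (S j ?g) \<le> l2_norm M (S j ?y) + l2_norm M (S j ?y')"
      unfolding l2_norm_scale by simp
    then consider "l2_norm M (S j ?g) \<le> l2_norm M (S j ?y)" | "l2_norm M (S j ?g) \<le> l2_norm M (S j ?y')" by linarith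
    then show "\<exists>y. y \<in> L2 M \<and> ?Q j x y"
      unfolding q_def[symmetric]
    proof cases
      case 1
      have "l2_norm M (\<lambda>z. ?y z - x z) \<le> q" unfolding add_diff_cancel_left' by (rule ng)
      with y order_trans[OF Sg 1]
      show "\<exists>y. y \<in> L2 M \<and> l2_norm M (\<lambda>z. y z - x z) \<le> q \<and> (2/3) * q * N j \<le> l2_norm M (S j y)" by blast
    next
      case 2
      have "l2_norm M (\<lambda>z. ?y' z - x z) = l2_norm M (\<lambda>z. - ?g z)" by simp
      then have "l2_norm M (\<lambda>z. ?y' z - x z) \<le> q" using ng by (simp only: l2_norm_uminus)
      with y' order_trans[OF Sg 2]
      show "\<exists>y. y \<in> L2 M \<and> l2_norm M (\<lambda>z. y z - x z) \<le> q \<and> (2/3) * q * N j \<le> l2_norm M (S j y)" by blast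
    qed
  qed
  then obtain X where X: "\<And>j. X j \<in> L2 M" and Xd: "\<And>j. l2_norm M (\<lambda>z. X (Suc j) z - X j z) \<le> (1/3) ^ Suc j"
    and XS: "\<And>j. (2/3) * (1/3) ^ Suc j * N j \<le> l2_norm M (S j (X (Suc j)))" by blast
  have near: "l2_norm M (\<lambda>z. X (k + i) z - X k z) \<le> (1/2) * (1/3) ^ k - (1/2) * (1/3) ^ (k + i)" for k i
  proof (induction i)
    case (Suc i)
    have "l2_norm M (\<lambda>z. X (k + Suc i) z - X k z)
        \<le> l2_norm M (\<lambda>z. X (k + Suc i) z - X (k + i) z) + l2_norm M (\<lambda>z. X (k + i) z - X k z)"
      by (rule l2_dist_triangle[OF X X X])
    then show ?case using Suc Xd[of "k + i"] by simp
  qed simp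
  have near': "l2_norm M (\<lambda>z. X m z - X k z) \<le> (1/2) * (1/3) ^ k" if "k \<le> m" for k m
  proof -
    have "l2_norm M (\<lambda>z. X m z - X k z) \<le> (1/2) * (1/3) ^ k - (1/2) * (1/3) ^ m"
      using near[of k "m - k"] that by simp
    moreover have "0 \<le> (1/3::real) ^ m" by simp
    ultimately show ?thesis by argo
  qed
  have "\<exists>x\<in>L2 M. (\<lambda>k. l2_norm M (\<lambda>z. X k z - x z)) \<longlonglongrightarrow> 0"
  proof (rule l2_complete[OF X])
    fix e :: real assume e: "0 < e"
    obtain k where k: "(1/3) ^ k < e" using real_arch_pow_inv[OF e, of "1/3"] by auto
    have "l2_norm M (\<lambda>z. X m z - X n z) < e" if "m \<ge> k" "n \<ge> k" for m n
      using l2_dist_triangle[OF X X X, of m n k] near'[OF that(1)] near'[OF that(2)] l2_norm_minus_commute[of M "X n" "X k"] k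
      by linarith
    then show "\<exists>N. \<forall>m\<ge>N. \<forall>n\<ge>N. l2_norm M (\<lambda>z. X m z - X n z) < e" by blast
  qed
  then obtain x where x: "x \<in> L2 M" and lim: "(\<lambda>k. l2_norm M (\<lambda>z. X k z - x z)) \<longlonglongrightarrow> 0" by blast
  have xk: "l2_norm M (\<lambda>z. x z - X k z) \<le> (1/2) * (1/3) ^ k" for k
  proof (rule LIMSEQ_le_const2)
    show "(\<lambda>m. l2_norm M (\<lambda>z. X m z - X k z)) \<longlonglongrightarrow> l2_norm M (\<lambda>z. x z - X k z)"
      by (rule tendsto_l2_norm[OF L2_diff[OF X X] L2_diff[OF x X]]) (use lim in simp)
    show "\<exists>N. \<forall>m\<ge>N. l2_norm M (\<lambda>z. X m z - X k z) \<le> (1/2) * (1/3) ^ k" by (intro exI[of _ k] allI impI near')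
  qed
  obtain B where B: "\<And>k. l2_norm M (T k x) \<le> B" using pb[OF x] by blast
  \<comment> \<open>All later increments move the point by at most half of 3^-(j+1), so
    \<open>S j\<close> at the limit keeps the factor 2/3 - 1/2 = 1/6. Together with 3^-(j+1) and the
    norm above 4^j this is at least (1/18)(4/3)^j, which is unbounded.\<close>
  have low: "(1/18) * (4/3) ^ j \<le> B" for j
  proof -
    have "l2_norm M (\<lambda>z. S j x z - S j (X (Suc j)) z) \<le> N j * ((1/2) * (1/3) ^ Suc j)"
      unfolding norm_bounded_op_diff[OF S x X] N_def
      by (rule order_trans[OF op_norm_upper[OF S L2_diff[OF x X]] mult_left_mono[OF xk]])
        (use Npos[of j] in \<open>simp add: N_def\<close>)
    moreover have "\<bar>l2_norm M (S j x) - l2_norm M (S j (X (Suc j)))\<bar> \<le> l2_norm M (\<lambda>z. S j x z - S j (X (Suc j)) z)"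
      by (rule l2_norm_diff_ineq[OF bounded_op_L2[OF S x] bounded_op_L2[OF S X]])
    ultimately have lo: "(2/3) * (1/3) ^ Suc j * N j - N j * ((1/2) * (1/3) ^ Suc j) \<le> l2_norm M (S j x)"
      using XS[of j] by linarith
    have "(1/18) * (4/3) ^ j = (1/18) * (1/3) ^ j * (4 ^ j :: real)"
      by (simp add: power_divide)
    also have "\<dots> \<le> (1/18) * (1/3) ^ j * N j"
      by (rule mult_left_mono[OF less_imp_le[OF N4]]) simp
    also have "\<dots> = (2/3) * (1/3) ^ Suc j * N j - N j * ((1/2) * (1/3) ^ Suc j)" by simp
    also note lo
    also have "l2_norm M (S j x) \<le> B" unfolding S_def by (rule B)
    finally show ?thesis .
  qed
  obtain j where "B * 18 < (4/3) ^ j" using real_arch_pow[of "4/3" "B * 18"] by auto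
  with low[of j] show False by simp
qed

section \<open>The semigroup acts on Fourier modes\<close>

context
  fixes P :: "real \<Rightarrow> ((real^2) \<times> (real^2) \<Rightarrow> complex) \<Rightarrow> ((real^2) \<times> (real^2) \<Rightarrow> complex)"
  assumes P: "generates phase (op_uminus C_op) P"
begin

lemma P_bounded: "0 \<le> t \<Longrightarrow> bounded_op phase (P t)"
  using P unfolding generates_def C0_semigroup_def by blast

lemma P_L2: "0 \<le> t \<Longrightarrow> f \<in> L2 phase \<Longrightarrow> P t f \<in> L2 phase"
  by (rule bounded_op_L2[OF P_bounded])

lemma P_0: "f \<in> L2 phase \<Longrightarrow> AE z in phase. P 0 f z = f z"
  using P unfolding generates_def C0_semigroup_def by blast

lemma P_add: "0 \<le> s \<Longrightarrow> 0 \<le> t \<Longrightarrow> f \<in> L2 phase \<Longrightarrow> AE z in phase. P (s + t) f z = P s (P t f) z"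
  using P unfolding generates_def C0_semigroup_def by blast

lemma P_continuous: "f \<in> L2 phase \<Longrightarrow> ((\<lambda>t. l2_norm phase (\<lambda>z. P t f z - f z)) \<longlongrightarrow> 0) (at_right 0)"
  using P unfolding generates_def C0_semigroup_def by blast

lemma P_generator:
  assumes "(f, c) \<in> C_op"
  shows "((\<lambda>t. l2_norm phase (\<lambda>z. (P t f z - f z) / complex_of_real t - (- c z))) \<longlongrightarrow> 0) (at_right 0)"
proof -
  have "(f, \<lambda>z. - c z) \<in> op_uminus C_op" unfolding op_uminus_def using assms by blast
  then have "(f, \<lambda>z. - c z) \<in> generator phase P" using P unfolding generates_def by simp
  then show ?thesis unfolding generator_def by simp
qed

text \<open>The definition of a semigroup bounds each \<open>P t\<close> separately and gives
  continuity at 0 on each vector. If the norms were unbounded near 0, times tending to 0 with norms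
  tending to infinity would contradict uniform boundedness, since on each vector these operators
  converge.\<close>

lemma P_small_times_bounded: "\<exists>\<delta>>0. \<exists>B. \<forall>t. 0 < t \<and> t \<le> \<delta> \<longrightarrow> op_norm phase (P t) \<le> B"
proof (rule ccontr)
  assume neg: "\<not> (\<exists>\<delta>>0. \<exists>B. \<forall>t. 0 < t \<and> t \<le> \<delta> \<longrightarrow> op_norm phase (P t) \<le> B)"
  have "\<exists>t. 0 < t \<and> t \<le> 1 / real (Suc k) \<and> real k < op_norm phase (P t)" for k
  proof (rule ccontr)
    assume "\<nexists>t. 0 < t \<and> t \<le> 1 / real (Suc k) \<and> real k < op_norm phase (P t)"
    then have "\<forall>t. 0 < t \<and> t \<le> 1 / real (Suc k) \<longrightarrow> op_norm phase (P t) \<le> real k" using not_less by blast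
    moreover have "0 < 1 / real (Suc k)" by simp
    ultimately show False using neg by blast
  qed
  then obtain \<tau> where \<tau>: "\<And>k. 0 < \<tau> k" "\<And>k. \<tau> k \<le> 1 / real (Suc k)" "\<And>k. real k < op_norm phase (P (\<tau> k))"
    by metis
  have "\<exists>B. \<forall>k. op_norm phase (P (\<tau> k)) \<le> B"
  proof (rule uniform_boundedness)
    show "bounded_op phase (P (\<tau> k))" for k by (rule P_bounded) (use \<tau>(1)[of k] in simp)
    fix f assume f: "f \<in> L2 phase"
    have "\<tau> \<longlonglongrightarrow> 0"
    proof (rule tendsto_sandwich[OF _ _ tendsto_const LIMSEQ_inverse_real_of_nat])
      show "\<forall>\<^sub>F k in sequentially. 0 \<le> \<tau> k" by (rule always_eventually) (use \<tau>(1) less_imp_le in blast)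
      show "\<forall>\<^sub>F k in sequentially. \<tau> k \<le> inverse (real (Suc k))"
        by (rule always_eventually) (use \<tau>(2) in \<open>simp add: inverse_eq_divide\<close>)
    qed
    then have "filterlim \<tau> (at_right 0) sequentially"
      by (rule tendsto_imp_filterlim_at_right) (use \<tau>(1) in \<open>simp add: always_eventually\<close>)
    then have "(\<lambda>k. l2_norm phase (\<lambda>z. P (\<tau> k) f z - f z)) \<longlonglongrightarrow> 0"
      by (rule filterlim_compose[OF P_continuous[OF f]])
    then have "Bseq (\<lambda>k. l2_norm phase (\<lambda>z. P (\<tau> k) f z - f z))" by (rule convergent_imp_Bseq[OF convergentI])
    then obtain B where B: "\<And>k. l2_norm phase (\<lambda>z. P (\<tau> k) f z - f z) \<le> B"
      unfolding Bseq_def by auto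
    have "l2_norm phase (P (\<tau> k) f) \<le> B + l2_norm phase f" for k
      using l2_norm_diff_ineq[OF P_L2[OF less_imp_le[OF \<tau>(1)] f, of k] f] B[of k] by linarith
    then show "\<exists>B. \<forall>k. l2_norm phase (P (\<tau> k) f) \<le> B" by blast
  qed
  then obtain B where B: "\<And>k. op_norm phase (P (\<tau> k)) \<le> B" by blast
  obtain k :: nat where "B < real k" using reals_Archimedean2 by blast
  with B[of k] \<tau>(3)[of k] show False by linarith
qed

text \<open>A bound for short times extends to any finite time by splitting it into short
  steps.\<close>

lemma P_locally_bounded: "\<exists>B\<ge>1. \<forall>t\<in>{0..T}. \<forall>f\<in>L2 phase. l2_norm phase (P t f) \<le> B * l2_norm phase f"
proof -
  obtain \<delta> B0 where \<delta>: "0 < \<delta>" and B0: "\<And>t. 0 < t \<Longrightarrow> t \<le> \<delta> \<Longrightarrow> op_norm phase (P t) \<le> B0"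
    using P_small_times_bounded by blast
  define B where "B = max 1 B0"
  have B1: "1 \<le> B" by (simp add: B_def)
  have small: "l2_norm phase (P t f) \<le> B * l2_norm phase f" if t: "0 \<le> t" "t \<le> \<delta>" and f: "f \<in> L2 phase" for t f
  proof (cases "t = 0")
    case True
    have "l2_norm phase (P 0 f) = l2_norm phase f"
      by (rule l2_norm_cong_AE[OF L2_measurable[OF P_L2[OF order_refl f]] L2_measurable[OF f] P_0[OF f]])
    then show ?thesis using mult_right_mono[OF B1, of "l2_norm phase f"] True by simp
  next
    case False
    have "op_norm phase (P t) \<le> B" unfolding B_def using B0[of t] False t by simp
    from mult_right_mono[OF this, of "l2_norm phase f"] op_norm_upper[OF P_bounded[OF t(1)] f]
    show ?thesis by simp
  qed
  have "l2_norm phase (P t f) \<le> B ^ Suc k * l2_norm phase f" if "0 \<le> t" "t \<le> real (Suc k) * \<delta>" "f \<in> L2 phase" for t f k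
    using that
  proof (induction k arbitrary: t)
    case 0
    then show ?case using small by simp
  next
    case (Suc k)
    show ?case
    proof (cases "t \<le> \<delta>")
      case True
      have "B ^ 1 \<le> B ^ Suc (Suc k)" by (rule power_increasing[OF _ B1]) simp
      from mult_right_mono[OF this, of "l2_norm phase f"] small[OF Suc.prems(1) True Suc.prems(3)]
      show ?thesis by simp
    next
      case False
      then have t: "0 \<le> t - \<delta>" "t - \<delta> \<le> real (Suc k) * \<delta>" using Suc.prems(2) by (simp_all add: algebra_simps)
      note L = P_L2[OF t(1) Suc.prems(3)]
      have "l2_norm phase (P (\<delta> + (t - \<delta>)) f) = l2_norm phase (P \<delta> (P (t - \<delta>) f))"
        by (rule l2_norm_cong_AE[OF L2_measurable L2_measurable P_add])
          (use \<delta> t Suc.prems L in \<open>auto intro: P_L2\<close>)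
      also have "\<dots> \<le> B * l2_norm phase (P (t - \<delta>) f)" by (rule small) (use \<delta> L in auto)
      also have "\<dots> \<le> B * (B ^ Suc k * l2_norm phase f)"
        by (rule mult_left_mono[OF Suc.IH[OF t Suc.prems(3)]]) (use B1 in simp)
      finally show ?thesis by (simp add: mult.assoc)
    qed
  qed
  note pow = this
  obtain k :: nat where "T / \<delta> < real k" using reals_Archimedean2 by blast
  then have T: "T \<le> real (Suc k) * \<delta>" using \<delta> by (simp add: divide_less_eq algebra_simps)
  have "1 \<le> B ^ Suc k" by (rule one_le_power[OF B1])
  moreover have "\<forall>t\<in>{0..T}. \<forall>f\<in>L2 phase. l2_norm phase (P t f) \<le> B ^ Suc k * l2_norm phase f"
    using pow T by fastforce
  ultimately show ?thesis by blast
qed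

text \<open>This is uniqueness for the evolution equation on a single mode. The generator is known
  through right limits at time 0 only, so increments of \<open>W\<close> to the right and to the
  left are estimated separately; the local bound on \<open>P\<close> carries the small errors
  through the outer operator.\<close>

lemma P_lift:
  assumes \<phi>: "\<phi> \<in> L2 circle" and t: "0 \<le> t"
  shows "AE z in phase. P t (lift n \<phi>) z = lift n (evol n \<phi> t) z"
proof -
  define u where "u = evol n \<phi>"
  define U where "U s = lift n (u s)" for s
  define W where "W s = P (t - s) (U s)" for s \<comment> \<open>is constant, since \<open>U\<close> solves the equation\<close>
  define G where "G s = lift n (\<lambda>v. - Cn n (u s) v)" for s
  have uL: "u s \<in> L2 circle" for s unfolding u_def by (rule evol_L2[OF \<phi>])
  have UL: "U s \<in> L2 phase" for s unfolding U_def by (rule lift_L2[OF uL])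
  have GL: "G s \<in> L2 phase" for s unfolding G_def by (intro lift_L2 L2_uminus Cn_L2 uL)
  have WL: "W s \<in> L2 phase" if "s \<le> t" for s unfolding W_def by (rule P_L2[OF _ UL]) (use that in simp)
  obtain M where M1: "1 \<le> M" and M: "\<And>r f. 0 \<le> r \<Longrightarrow> r \<le> t \<Longrightarrow> f \<in> L2 phase \<Longrightarrow> l2_norm phase (P r f) \<le> M * l2_norm phase f"
    using P_locally_bounded[of t] by (metis atLeastAtMost_iff)
  obtain K where K0: "0 \<le> K" and K: "\<And>s s'. \<bar>s\<bar> \<le> t \<Longrightarrow> \<bar>s'\<bar> \<le> t \<Longrightarrow>
    l2_norm circle (\<lambda>v. u s v - u s' v - of_real (s - s') * (- Cn n (u s') v)) \<le> K * (s - s')\<^sup>2"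
    using evol_taylor[OF \<phi>, of t n] unfolding u_def by blast
  define K' where "K' = 2 * pi * K"
  have K'0: "0 \<le> K'" unfolding K'_def using K0 by simp
  have tay: "l2_norm phase (\<lambda>z. U s z - (U s' z + of_real (s - s') * G s' z)) \<le> K' * (s - s')\<^sup>2"
    if "0 \<le> s" "s \<le> t" "0 \<le> s'" "s' \<le> t" for s s'
  proof -
    let ?D = "\<lambda>v. u s v - u s' v - of_real (s - s') * (- Cn n (u s') v)"
    have eq: "(\<lambda>z. U s z - (U s' z + of_real (s - s') * G s' z)) = lift n ?D"
      unfolding U_def G_def lift_def by (simp add: fun_eq_iff algebra_simps)
    have D: "?D \<in> L2 circle" by (intro L2_diff L2_scale L2_uminus Cn_L2 uL)
    have "l2_norm phase (\<lambda>z. U s z - (U s' z + of_real (s - s') * G s' z)) = 2 * pi * l2_norm circle ?D"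
      unfolding eq by (rule lift_L2(2)[OF D])
    also have "\<dots> \<le> 2 * pi * (K * (s - s')\<^sup>2)" by (rule mult_left_mono[OF K]) (use that in auto)
    finally show ?thesis by (simp add: K'_def mult.assoc)
  qed
  \<comment> \<open>Both limits are taken at the fixed time s: the difference quotient at
    \<open>U s\<close>, and plain continuity at the velocity \<open>G s\<close>, which the
    increments to the left need.\<close>
  have gen: "\<exists>d>0. \<forall>h. 0 < h \<and> h < d \<longrightarrow>
      l2_norm phase (\<lambda>z. P h (U s) z - (U s z + of_real h * G s z)) \<le> e * h \<and>
      l2_norm phase (\<lambda>z. P h (G s) z - G s z) \<le> e" if e: "0 < e" for s e
  proof -
    have "(U s, lift n (Cn n (u s))) \<in> C_op" unfolding U_def by (rule C_op_lift[OF uL])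
    from P_generator[OF this]
    have "((\<lambda>h. l2_norm phase (\<lambda>z. (P h (U s) z - U s z) / complex_of_real h - G s z)) \<longlongrightarrow> 0) (at_right 0)"
      unfolding G_def lift_def by simp
    then have 1: "\<forall>\<^sub>F h in at_right 0. l2_norm phase (\<lambda>z. (P h (U s) z - U s z) / complex_of_real h - G s z) < e"
      by (rule order_tendstoD(2)[OF _ e])
    have 2: "\<forall>\<^sub>F h in at_right 0. l2_norm phase (\<lambda>z. P h (G s) z - G s z) < e"
      by (rule order_tendstoD(2)[OF P_continuous[OF GL] e])
    from eventually_conj[OF 1 2] obtain d where d: "0 < d" "\<And>h. 0 < h \<Longrightarrow> h < d \<Longrightarrow>
      l2_norm phase (\<lambda>z. (P h (U s) z - U s z) / complex_of_real h - G s z) < e \<and> l2_norm phase (\<lambda>z. P h (G s) z - G s z) < e"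
      unfolding eventually_at_right_field by auto
    have "l2_norm phase (\<lambda>z. P h (U s) z - (U s z + of_real h * G s z)) \<le> e * h" if h: "0 < h" "h < d" for h
    proof -
      have "(\<lambda>z. P h (U s) z - (U s z + of_real h * G s z)) = (\<lambda>z. of_real h * ((P h (U s) z - U s z) / complex_of_real h - G s z))"
        using h by (simp add: fun_eq_iff field_simps)
      then have "l2_norm phase (\<lambda>z. P h (U s) z - (U s z + of_real h * G s z))
          = h * l2_norm phase (\<lambda>z. (P h (U s) z - U s z) / complex_of_real h - G s z)"
        using h by (simp only: l2_norm_scale norm_of_real abs_of_pos)
      also have "\<dots> \<le> h * e" by (rule mult_left_mono) (use d(2)[OF h] h in auto)
      finally show ?thesis by (simp add: mult.commute)
    qed
    then show ?thesis using d by (intro exI[of _ d]) (auto intro: less_imp_le)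
  qed
  have step: "\<exists>d>0. \<forall>s'\<in>{0..t}. \<bar>s' - s\<bar> < d \<longrightarrow> l2_norm phase (\<lambda>z. W s' z - W s z) \<le> e * \<bar>s' - s\<bar>"
    if s: "s \<in> {0..t}" and e: "0 < e" for s e
  proof -
    \<comment> \<open>Chosen so that the errors sum to e times the increment; the expression is
      large enough for both sides.\<close>
    define C where "C = M * (2 + (1 + M) * K')"
    have C: "0 < C" unfolding C_def using M1 K'0 by (intro mult_pos_pos add_pos_nonneg) simp_all
    define \<epsilon> where "\<epsilon> = e / C"
    have \<epsilon>: "0 < \<epsilon>" unfolding \<epsilon>_def using e C by simp
    obtain d where d: "0 < d" "\<And>h. 0 < h \<Longrightarrow> h < d \<Longrightarrow>
      l2_norm phase (\<lambda>z. P h (U s) z - (U s z + of_real h * G s z)) \<le> \<epsilon> * h \<and> l2_norm phase (\<lambda>z. P h (G s) z - G s z) \<le> \<epsilon>"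
      using gen[OF \<epsilon>, of s] by blast
    have Kh: "K' * h\<^sup>2 \<le> K' * (\<epsilon> * h)" if "0 < h" "h < \<epsilon>" for h
      using that K'0 by (intro mult_left_mono) (simp_all add: power2_eq_square mult_right_mono)
    have fin: "M * (2 * (\<epsilon> * h) + (1 + M) * (K' * (\<epsilon> * h))) = e * h" for h
    proof -
      have "M * (2 * (\<epsilon> * h) + (1 + M) * (K' * (\<epsilon> * h))) = C * \<epsilon> * h" unfolding C_def by (simp add: algebra_simps)
      then show ?thesis unfolding \<epsilon>_def using C by simp
    qed
    have right: "l2_norm phase (\<lambda>z. W (s + h) z - W s z) \<le> e * h" if h: "0 < h" "h < d" "h < \<epsilon>" "s + h \<le> t" for h
    proof -
      have r: "0 \<le> t - (s + h)" "t - (s + h) \<le> t" using h s by auto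
      note PU = P_L2[OF less_imp_le[OF h(1)] UL[of s]]
      have "AE z in phase. W s z = P (t - (s + h)) (P h (U s)) z"
        using P_add[OF r(1) less_imp_le[OF h(1)] UL[of s]] unfolding W_def by (simp add: algebra_simps)
      then have "l2_norm phase (\<lambda>z. W (s + h) z - W s z) = l2_norm phase (\<lambda>z. P (t - (s + h)) (U (s + h)) z - P (t - (s + h)) (P h (U s)) z)"
        unfolding W_def[of "s + h"]
        by (intro l2_norm_cong_AE L2_measurable L2_diff P_L2 r UL PU WL) (use s in auto)
      also have "\<dots> = l2_norm phase (P (t - (s + h)) (\<lambda>z. U (s + h) z - P h (U s) z))"
        by (rule norm_bounded_op_diff[OF P_bounded[OF r(1)] UL PU])
      also have "\<dots> \<le> M * l2_norm phase (\<lambda>z. U (s + h) z - P h (U s) z)" by (rule M[OF r L2_diff[OF UL PU]])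
      also have "\<dots> \<le> M * (2 * (\<epsilon> * h) + (1 + M) * (K' * (\<epsilon> * h)))"
      proof (rule mult_left_mono)
        let ?V = "\<lambda>z. U s z + of_real h * G s z"
        have V: "?V \<in> L2 phase" by (intro L2_add L2_scale UL GL)
        have "l2_norm phase (\<lambda>z. U (s + h) z - P h (U s) z) \<le> l2_norm phase (\<lambda>z. U (s + h) z - ?V z) + l2_norm phase (\<lambda>z. ?V z - P h (U s) z)"
          by (rule l2_dist_triangle[OF UL V PU])
        also have "l2_norm phase (\<lambda>z. ?V z - P h (U s) z) = l2_norm phase (\<lambda>z. P h (U s) z - ?V z)" by (rule l2_norm_minus_commute)
        also have "l2_norm phase (\<lambda>z. U (s + h) z - ?V z) + l2_norm phase (\<lambda>z. P h (U s) z - ?V z) \<le> K' * h\<^sup>2 + \<epsilon> * h"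
          using tay[of "s + h" s] d(2)[OF h(1,2)] s h by (intro add_mono) auto
        also have "\<dots> \<le> K' * (\<epsilon> * h) + 2 * (\<epsilon> * h)" using Kh[OF h(1,3)] \<epsilon> h by (intro add_mono) auto
        also have "\<dots> \<le> 2 * (\<epsilon> * h) + (1 + M) * (K' * (\<epsilon> * h))"
        proof -
          have "0 \<le> M * (K' * (\<epsilon> * h))" using M1 K'0 \<epsilon> h by simp
          then show ?thesis by (simp add: algebra_simps)
        qed
        finally show "l2_norm phase (\<lambda>z. U (s + h) z - P h (U s) z) \<le> 2 * (\<epsilon> * h) + (1 + M) * (K' * (\<epsilon> * h))" .
      qed (use M1 in simp)
      finally show ?thesis unfolding fin .
    qed
    have left: "l2_norm phase (\<lambda>z. W s z - W (s - h) z) \<le> e * h" if h: "0 < h" "h < d" "h < \<epsilon>" "0 \<le> s - h" for h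
    proof -
      have r: "0 \<le> t - s" "t - s \<le> t" using s by auto
      have hp: "0 \<le> h" "h \<le> t" using h s by auto
      let ?U' = "U (s - h)"
      note PU = P_L2[OF hp(1) UL[of "s - h"]]
      have "AE z in phase. W (s - h) z = P (t - s) (P h ?U') z"
        using P_add[OF r(1) hp(1) UL[of "s - h"]] unfolding W_def by (simp add: algebra_simps)
      then have "l2_norm phase (\<lambda>z. W s z - W (s - h) z) = l2_norm phase (\<lambda>z. P (t - s) (U s) z - P (t - s) (P h ?U') z)"
        unfolding W_def[of s]
        by (intro l2_norm_cong_AE L2_measurable L2_diff P_L2 r UL PU WL) (use s h in auto)
      also have "\<dots> = l2_norm phase (P (t - s) (\<lambda>z. U s z - P h ?U' z))"
        by (rule norm_bounded_op_diff[OF P_bounded[OF r(1)] UL PU])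
      also have "\<dots> \<le> M * l2_norm phase (\<lambda>z. U s z - P h ?U' z)" by (rule M[OF r L2_diff[OF UL PU]])
      also have "\<dots> \<le> M * (2 * (\<epsilon> * h) + (1 + M) * (K' * (\<epsilon> * h)))"
      proof (rule mult_left_mono)
        \<comment> \<open>Expanding \<open>U\<close> at s - h would require the difference quotient
          at a moving point. Replacing \<open>U (s - h)\<close> by its linearization at s leaves
          \<open>P h\<close> acting on \<open>U s\<close> and \<open>G s\<close>, where the two
          limits are known; the replacement error is quadratic in h.\<close>
        let ?V = "\<lambda>z. U s z - of_real h * G s z"
        have V: "?V \<in> L2 phase" by (intro L2_diff L2_scale UL GL)
        note PV = P_L2[OF hp(1) V] and PG = P_L2[OF hp(1) GL[of s]] and PUs = P_L2[OF hp(1) UL[of s]]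
        have "l2_norm phase (\<lambda>z. U s z - P h ?U' z) \<le> l2_norm phase (\<lambda>z. U s z - P h ?V z) + l2_norm phase (\<lambda>z. P h ?V z - P h ?U' z)"
          by (rule l2_dist_triangle[OF UL PV PU])
        also have "l2_norm phase (\<lambda>z. P h ?V z - P h ?U' z) \<le> M * (K' * (\<epsilon> * h))"
        proof -
          have "l2_norm phase (\<lambda>z. P h ?V z - P h ?U' z) = l2_norm phase (P h (\<lambda>z. ?V z - ?U' z))"
            by (rule norm_bounded_op_diff[OF P_bounded[OF hp(1)] V UL])
          also have "\<dots> \<le> M * l2_norm phase (\<lambda>z. ?V z - ?U' z)" by (rule M[OF hp L2_diff[OF V UL]])
          also have "l2_norm phase (\<lambda>z. ?V z - ?U' z) = l2_norm phase (\<lambda>z. ?U' z - ?V z)" by (rule l2_norm_minus_commute)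
          also have "l2_norm phase (\<lambda>z. ?U' z - ?V z) \<le> K' * h\<^sup>2"
            using tay[of "s - h" s] s h by simp
          also note Kh[OF h(1,3)]
          finally show ?thesis using M1 by (simp add: mult_left_mono)
        qed
        also have "l2_norm phase (\<lambda>z. U s z - P h ?V z) \<le> 2 * (\<epsilon> * h)"
        proof -
          have lin: "AE z in phase. P h ?V z = P h (U s) z - of_real h * P h (G s) z"
            using bounded_op_linear[OF P_bounded[OF hp(1)] UL[of s] GL[of s], of 1 "- of_real h"] by simp
          have "l2_norm phase (\<lambda>z. U s z - P h ?V z)
              = l2_norm phase (\<lambda>z. of_real h * (P h (G s) z - G s z) - (P h (U s) z - (U s z + of_real h * G s z)))"
          proof (rule l2_norm_cong_AE)
            show "(\<lambda>z. U s z - P h ?V z) \<in> borel_measurable phase"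
              "(\<lambda>z. of_real h * (P h (G s) z - G s z) - (P h (U s) z - (U s z + of_real h * G s z))) \<in> borel_measurable phase"
              by (intro L2_measurable L2_diff L2_scale L2_add UL GL PV PG PUs)+
            show "AE z in phase. U s z - P h ?V z = of_real h * (P h (G s) z - G s z) - (P h (U s) z - (U s z + of_real h * G s z))"
              using lin by eventually_elim (simp add: algebra_simps)
          qed
          also have "\<dots> \<le> l2_norm phase (\<lambda>z. of_real h * (P h (G s) z - G s z)) + l2_norm phase (\<lambda>z. P h (U s) z - (U s z + of_real h * G s z))"
            by (intro l2_norm_triangle_diff L2_scale L2_diff L2_add UL GL PG PUs)
          also have "l2_norm phase (\<lambda>z. of_real h * (P h (G s) z - G s z)) = h * l2_norm phase (\<lambda>z. P h (G s) z - G s z)"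
            unfolding l2_norm_scale norm_of_real using hp by simp
          also have "h * l2_norm phase (\<lambda>z. P h (G s) z - G s z) + l2_norm phase (\<lambda>z. P h (U s) z - (U s z + of_real h * G s z)) \<le> h * \<epsilon> + \<epsilon> * h"
            using d(2)[OF h(1,2)] hp by (intro add_mono mult_left_mono) auto
          finally show ?thesis by (simp add: mult_ac)
        qed
        finally have "l2_norm phase (\<lambda>z. U s z - P h ?U' z) \<le> 2 * (\<epsilon> * h) + M * (K' * (\<epsilon> * h))" by simp
        moreover have "0 \<le> K' * (\<epsilon> * h)" using K'0 \<epsilon> h by simp
        ultimately show "l2_norm phase (\<lambda>z. U s z - P h ?U' z) \<le> 2 * (\<epsilon> * h) + (1 + M) * (K' * (\<epsilon> * h))"
          by (simp add: distrib_right)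
      qed (use M1 in simp)
      finally show ?thesis unfolding fin .
    qed
    have "l2_norm phase (\<lambda>z. W s' z - W s z) \<le> e * \<bar>s' - s\<bar>" if s': "s' \<in> {0..t}" "\<bar>s' - s\<bar> < min d \<epsilon>" for s'
    proof -
      consider "s' = s" | "s < s'" | "s' < s" by linarith
      then show ?thesis
      proof cases
        case 1
        then show ?thesis by simp
      next
        case 2
        then show ?thesis using right[of "s' - s"] s' by simp
      next
        case 3
        then show ?thesis using left[of "s - s'"] s' by (subst l2_norm_minus_commute) simp
      qed
    qed
    then show ?thesis using d(1) \<epsilon> by (intro exI[of _ "min d \<epsilon>"]) simp
  qed
  \<comment> \<open>A real function whose increments are bounded by those of \<open>W\<close>; its
    derivative vanishes on the closed interval, so it keeps its value 0 from time 0.\<close>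
  define g where "g s = l2_norm phase (\<lambda>z. W s z - W 0 z)" for s
  have "(g has_real_derivative 0) (at s within {0..t})" if s: "s \<in> {0..t}" for s
    unfolding has_field_derivative_iff
  proof (rule tendstoI)
    fix e :: real assume e: "0 < e"
    obtain d where d: "0 < d" "\<And>s'. s' \<in> {0..t} \<Longrightarrow> \<bar>s' - s\<bar> < d \<Longrightarrow> l2_norm phase (\<lambda>z. W s' z - W s z) \<le> (e/2) * \<bar>s' - s\<bar>"
      using step[OF s, of "e/2"] e by auto
    show "\<forall>\<^sub>F s' in at s within {0..t}. dist ((g s' - g s) / (s' - s)) 0 < e"
      unfolding eventually_at
    proof (intro exI[of _ d] conjI ballI impI)
      fix s' assume s': "s' \<in> {0..t}" "s' \<noteq> s \<and> dist s' s < d"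
      have "\<bar>g s' - g s\<bar> \<le> l2_norm phase (\<lambda>z. (W s' z - W 0 z) - (W s z - W 0 z))"
        unfolding g_def by (rule l2_norm_diff_ineq) (use s s' t in \<open>auto intro!: L2_diff WL\<close>)
      also have "\<dots> = l2_norm phase (\<lambda>z. W s' z - W s z)" by simp
      also have "\<dots> \<le> (e/2) * \<bar>s' - s\<bar>" using d(2)[of s'] s' by (simp add: dist_real_def)
      finally have "\<bar>g s' - g s\<bar> / \<bar>s' - s\<bar> \<le> e / 2" using s' by (simp add: divide_le_eq)
      then have "\<bar>g s' - g s\<bar> / \<bar>s' - s\<bar> < e" using e by linarith
      then show "dist ((g s' - g s) / (s' - s)) 0 < e" by (simp add: dist_real_def abs_divide)
    qed (rule d(1))
  qed
  then have "\<exists>c. \<forall>s\<in>{0..t}. g s = c"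
    by (intro has_field_derivative_zero_constant) auto
  then have "g t = g 0" using t by fastforce
  then have "l2_norm phase (\<lambda>z. W t z - W 0 z) = 0" by (simp add: g_def)
  then have "AE z in phase. W t z - W 0 z = 0"
    using l2_norm_eq_0[OF L2_diff[OF WL WL], of t 0] t by simp
  moreover have "AE z in phase. W t z = U t z" unfolding W_def using P_0[OF UL[of t]] by simp
  moreover have "W 0 = P t (lift n \<phi>)"
  proof -
    have "u 0 = \<phi>" unfolding u_def by (rule ext) (rule evol_0)
    then show ?thesis unfolding W_def U_def by simp
  qed
  ultimately show ?thesis unfolding U_def u_def by (auto elim: eventually_elim2)
qed

lemma P_lsum:
  assumes \<phi>: "\<And>n. \<phi> n \<in> L2 circle" and t: "0 \<le> t" and I: "finite I"
  shows "AE z in phase. P t (lsum I \<phi>) z = lsum I (\<lambda>n. evol n (\<phi> n) t) z"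
  using I
proof induction
  case empty
  have "AE z in phase. P t (\<lambda>z. 0 * (0::complex)) z = 0 * P t (\<lambda>z. 0) z"
    by (rule bounded_op_scale[OF P_bounded[OF t] L2_zero])
  then show ?case unfolding lsum_def by simp
next
  case (insert n I)
  have "AE z in phase. P t (\<lambda>z. lift n (\<phi> n) z + lsum I \<phi> z) z = P t (lift n (\<phi> n)) z + P t (lsum I \<phi>) z"
    by (rule bounded_op_add[OF P_bounded[OF t] lift_L2(1)[OF \<phi>] lsum_L2[OF \<phi>]])
  moreover have "lsum (insert n I) \<phi> = (\<lambda>z. lift n (\<phi> n) z + lsum I \<phi> z)" for \<phi>
    unfolding lsum_def using insert by simp
  ultimately show ?case using P_lift[OF \<phi> t, of n n] insert.IH by (simp, elim AE_mp, intro AE_I2) simp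
qed

text \<open>The action is known on finite sums of modes; boundedness of \<open>P t\<close> extends
  it to the closure, which is everything by the Fourier expansion.\<close>

lemma fcoef_P:
  assumes f: "f \<in> L2 phase" and t: "0 \<le> t"
  shows "AE v in circle. fcoef n (P t f) v = evol n (fcoef n f) t v"
proof (rule fcoef_unique[OF P_L2[OF t f] evol_L2[OF fcoef_L2[OF f]]])
  fix \<psi> assume \<psi>: "\<psi> \<in> L2 circle"
  let ?\<phi> = "\<lambda>n. fcoef n f" and ?e = "\<lambda>n. evol n (fcoef n f) t"
  have c: "\<And>n. ?\<phi> n \<in> L2 circle" by (rule fcoef_L2[OF f])
  have e: "\<And>n. ?e n \<in> L2 circle" by (rule evol_L2[OF c])
  have S: "lsum (modes K) ?\<phi> \<in> L2 phase" for K by (rule lsum_L2[OF c])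
  have lim: "(\<lambda>K. l2_norm phase (\<lambda>z. P t (lsum (modes K) ?\<phi>) z - P t f z)) \<longlonglongrightarrow> 0"
  proof (rule Lim_null_comparison)
    show "(\<lambda>K. op_norm phase (P t) * l2_norm phase (\<lambda>z. lsum (modes K) ?\<phi> z - f z)) \<longlonglongrightarrow> 0"
      by (rule tendsto_mult_right_zero[OF fourier_expansion[OF f]])
    show "\<forall>\<^sub>F K in sequentially. norm (l2_norm phase (\<lambda>z. P t (lsum (modes K) ?\<phi>) z - P t f z))
        \<le> op_norm phase (P t) * l2_norm phase (\<lambda>z. lsum (modes K) ?\<phi> z - f z)"
      unfolding norm_bounded_op_diff[OF P_bounded[OF t] S f]
      using op_norm_upper[OF P_bounded[OF t] L2_diff[OF S f]] by (intro always_eventually) simp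
  qed
  have 1: "(\<lambda>K. l2_inner phase (P t (lsum (modes K) ?\<phi>)) (lift n \<psi>)) \<longlonglongrightarrow> l2_inner phase (P t f) (lift n \<psi>)"
    by (rule tendsto_l2_inner[OF P_L2[OF t S] P_L2[OF t f] lift_L2(1)[OF \<psi>] lim])
  have eq: "l2_inner phase (P t (lsum (modes K) ?\<phi>)) (lift n \<psi>) = l2_inner phase (lsum (modes K) ?e) (lift n \<psi>)" for K
    by (rule l2_inner_cong_AE[OF L2_measurable[OF P_L2[OF t S]] L2_measurable[OF lsum_L2[OF e]] P_lsum[OF c t finite_modes]
          L2_measurable[OF lift_L2(1)[OF \<psi>]] L2_measurable[OF lift_L2(1)[OF \<psi>]]]) simp
  obtain K0 where K0: "n \<in> modes K0" using in_modes by blast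
  have "\<forall>\<^sub>F K in sequentially. l2_inner phase (P t (lsum (modes K) ?\<phi>)) (lift n \<psi>) = of_real ((2 * pi)\<^sup>2) * l2_inner circle (?e n) \<psi>"
    using eventually_ge_at_top[of K0]
  proof eventually_elim
    fix K assume "K0 \<le> K"
    then have "n \<in> modes K" using K0 modes_mono by blast
    then show "l2_inner phase (P t (lsum (modes K) ?\<phi>)) (lift n \<psi>) = of_real ((2 * pi)\<^sup>2) * l2_inner circle (?e n) \<psi>"
      unfolding eq using inner_lsum_lift[of ?e, OF e \<psi> finite_modes, of K n] by simp
  qed
  from tendsto_cong[THEN iffD1, OF this 1]
  show "l2_inner phase (P t f) (lift n \<psi>) = of_real ((2 * pi)\<^sup>2) * l2_inner circle (?e n) \<psi>"
    by (rule LIMSEQ_unique[OF _ tendsto_const])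
qed

end

section \<open>The transcendental equations\<close>

text \<open>The functions in this and the next two lemmas vanish at 0 and each is the derivative of
  the following one. At 4t, up to positive factors, the first and the third are the numerators of
  the derivatives in the equations for \<open>\<tau>\<^sub>1\<close> and
  \<open>\<tau>\<^sub>3\<close>.\<close>

lemma exp_poly_1: fixes y :: real assumes "0 < y" shows "0 < (y - 1) * exp y + 1"
proof -
  have "1 - y < exp (- y)" using assms exp_minus_greater[of y] by simp
  then have "(1 - y) * exp y < exp (- y) * exp y" by (rule mult_strict_right_mono) simp
  then show ?thesis by (simp add: exp_minus algebra_simps)
qed

lemma exp_poly_2: fixes y :: real assumes "0 < y" shows "0 < (y - 2) * exp y + (2 + y)"
proof -
  have "(\<lambda>y::real. (y - 2) * exp y + (2 + y)) 0 < (\<lambda>y. (y - 2) * exp y + (2 + y)) y"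
  proof (rule DERIV_pos_imp_increasing_open[OF assms])
    fix x :: real assume "0 < x"
    moreover have "((\<lambda>y::real. (y - 2) * exp y + (2 + y)) has_real_derivative (x - 1) * exp x + 1) (at x)"
      by (auto intro!: derivative_eq_intros simp: algebra_simps)
    ultimately show "\<exists>d. ((\<lambda>y::real. (y - 2) * exp y + (2 + y)) has_real_derivative d) (at x) \<and> 0 < d"
      using exp_poly_1 by blast
  qed (intro continuous_intros)
  then show ?thesis by simp
qed

lemma exp_poly_3: fixes y :: real assumes "0 < y" shows "0 < (y - 3) * exp y + (3 + 2 * y + y\<^sup>2 / 2)"
proof -
  have "(\<lambda>y::real. (y - 3) * exp y + (3 + 2 * y + y\<^sup>2 / 2)) 0 < (\<lambda>y. (y - 3) * exp y + (3 + 2 * y + y\<^sup>2 / 2)) y"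
  proof (rule DERIV_pos_imp_increasing_open[OF assms])
    fix x :: real assume "0 < x"
    moreover have "((\<lambda>y::real. (y - 3) * exp y + (3 + 2 * y + y\<^sup>2 / 2)) has_real_derivative (x - 2) * exp x + (2 + x)) (at x)"
      by (auto intro!: derivative_eq_intros simp: algebra_simps)
    ultimately show "\<exists>d. ((\<lambda>y::real. (y - 3) * exp y + (3 + 2 * y + y\<^sup>2 / 2)) has_real_derivative d) (at x) \<and> 0 < d"
      using exp_poly_2 by blast
  qed (intro continuous_intros; simp)
  then show ?thesis by simp
qed

lemma ex1_positive_solution:
  fixes f f' :: "real \<Rightarrow> real"
  assumes d: "\<And>t. 0 < t \<Longrightarrow> (f has_real_derivative f' t) (at t)" and pos: "\<And>t. 0 < t \<Longrightarrow> 0 < f' t"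
    and zero: "(f \<longlongrightarrow> 0) (at_right 0)" and top: "filterlim f at_top at_top" and \<delta>: "0 < \<delta>"
  shows "\<exists>!t. 0 < t \<and> f t = \<delta>"
proof (rule ex_ex1I)
  have mono: "f a < f b" if "0 < a" "a < b" for a b
  proof (rule DERIV_pos_imp_increasing[OF that(2)])
    fix x assume "a \<le> x"
    then have "0 < x" using that by linarith
    then show "\<exists>y. (f has_real_derivative y) (at x) \<and> 0 < y" using d pos by blast
  qed
  obtain a where a: "0 < a" "f a < \<delta>"
  proof -
    obtain b where b: "0 < b" "\<And>y. 0 < y \<Longrightarrow> y < b \<Longrightarrow> f y < \<delta>"
      using order_tendstoD(2)[OF zero \<delta>] unfolding eventually_at_right_field by auto
    show ?thesis by (rule that[of "b / 2"]) (use b in auto)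
  qed
  have "\<forall>\<^sub>F t in at_top. \<delta> < f t" using top unfolding filterlim_at_top_dense by blast
  then obtain b where b: "\<delta> < f b" "a < b"
    using eventually_happens[OF eventually_conj[OF _ eventually_gt_at_top[of a]], of "\<lambda>t. \<delta> < f t"] by auto
  have "continuous_on {a..b} f"
  proof (rule continuous_at_imp_continuous_on, rule ballI)
    fix x assume "x \<in> {a..b}"
    then have "0 < x" using a by simp
    then show "isCont f x" using d DERIV_isCont by blast
  qed
  then obtain t where "a \<le> t" "t \<le> b" "f t = \<delta>"
    using IVT'[of f a \<delta> b] a b by auto
  then show "\<exists>t. 0 < t \<and> f t = \<delta>" using a by (intro exI[of _ t]) auto
  show "s = t" if "0 < s \<and> f s = \<delta>" "0 < t \<and> f t = \<delta>" for s t
    using mono[of s t] mono[of t s] that by (cases s t rule: linorder_cases) auto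
qed

lemma tau1_unique:
  assumes "(0::real) < \<delta>"
  shows "\<exists>!t. 0 < t \<and> (exp (4 * t) - 1 - 4 * t) / (2 * t) = \<delta>"
proof (rule ex1_positive_solution[OF _ _ _ _ assms])
  let ?f' = "\<lambda>t::real. ((4 * exp (4 * t) - 4) * (2 * t) - (exp (4 * t) - 1 - 4 * t) * 2) / ((2 * t) * (2 * t))"
  show "((\<lambda>t. (exp (4 * t) - 1 - 4 * t) / (2 * t)) has_real_derivative ?f' t) (at t)" if "0 < t" for t
    by (rule DERIV_divide) (use that in \<open>auto intro!: derivative_eq_intros\<close>)
  show "0 < ?f' t" if t: "0 < t" for t
  proof (rule divide_pos_pos)
    have "(4 * exp (4 * t) - 4) * (2 * t) - (exp (4 * t) - 1 - 4 * t) * 2 = 2 * ((4 * t - 1) * exp (4 * t) + 1)"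
      by (simp add: algebra_simps)
    then show "0 < (4 * exp (4 * t) - 4) * (2 * t) - (exp (4 * t) - 1 - 4 * t) * 2"
      using exp_poly_1[of "4 * t"] t by simp
  qed (use t in simp)
  show "((\<lambda>t::real. (exp (4 * t) - 1 - 4 * t) / (2 * t)) \<longlongrightarrow> 0) (at_right 0)" by real_asymp
  show "filterlim (\<lambda>t::real. (exp (4 * t) - 1 - 4 * t) / (2 * t)) at_top at_top" by real_asymp
qed

lemma tau3_unique:
  assumes "(0::real) < \<delta>"
  shows "\<exists>!t. 0 < t \<and> (exp (4 * t) - 1 - 4 * t - 8 * t\<^sup>2 - 32 / 3 * t ^ 3) / (2 * t ^ 3) = \<delta>"
proof (rule ex1_positive_solution[OF _ _ _ _ assms])
  let ?N = "\<lambda>t::real. exp (4 * t) - 1 - 4 * t - 8 * t\<^sup>2 - 32 / 3 * t ^ 3"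
  let ?N' = "\<lambda>t::real. 4 * exp (4 * t) - 4 - 16 * t - 32 * t\<^sup>2"
  let ?f' = "\<lambda>t::real. (?N' t * (2 * t ^ 3) - ?N t * (6 * t\<^sup>2)) / ((2 * t ^ 3) * (2 * t ^ 3))"
  show "((\<lambda>t. ?N t / (2 * t ^ 3)) has_real_derivative ?f' t) (at t)" if "0 < t" for t
    by (rule DERIV_divide) (use that in \<open>auto intro!: derivative_eq_intros\<close>)
  show "0 < ?f' t" if t: "0 < t" for t
  proof (rule divide_pos_pos)
    have "?N' t * (2 * t ^ 3) - ?N t * (6 * t\<^sup>2)
        = 2 * t\<^sup>2 * ((4 * t - 3) * exp (4 * t) + (3 + 2 * (4 * t) + (4 * t)\<^sup>2 / 2))"
      by (simp add: power2_eq_square power3_eq_cube algebra_simps)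
    then show "0 < ?N' t * (2 * t ^ 3) - ?N t * (6 * t\<^sup>2)"
      using exp_poly_3[of "4 * t"] t by (simp only: mult_pos_pos zero_less_power zero_less_numeral)
  qed (use t in simp)
  show "((\<lambda>t::real. ?N t / (2 * t ^ 3)) \<longlongrightarrow> 0) (at_right 0)" by real_asymp
  show "filterlim (\<lambda>t::real. ?N t / (2 * t ^ 3)) at_top at_top" by real_asymp
qed

text \<open>At r = 1 the first term alone equals \<open>\<tau>\<close> and the logarithm adds
  something positive; as r grows the left side decreases strictly to 0. The parameter
  \<open>\<mu>\<close> stands for 1 / (2 \<open>lambda0\<close>).\<close>

lemma r_unique:
  fixes \<tau> \<mu> :: real
  assumes \<tau>: "0 < \<tau>" and \<mu>: "0 < \<mu>"
  shows "\<exists>!r. 1 < r \<and> \<tau> / r + \<mu> * ln (1 + 1 / (r - 1 / 2)) = \<tau>"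
proof (rule ex_ex1I)
  define g where "g r = \<tau> / r + \<mu> * ln (1 + 1 / (r - 1 / 2))" for r
  have anti: "g b < g a" if "1 \<le> a" "a < b" for a b
  proof -
    have "\<tau> / b < \<tau> / a" using that \<tau> by (intro divide_strict_left_mono) auto
    moreover have "1 + 1 / (b - 1 / 2) < 1 + 1 / (a - 1 / 2)"
      using that by (intro add_strict_left_mono divide_strict_left_mono mult_pos_pos) auto
    then have "ln (1 + 1 / (b - 1 / 2)) < ln (1 + 1 / (a - 1 / 2))"
      using that by (subst ln_less_cancel_iff) (auto intro!: add_pos_pos)
    then have "\<mu> * ln (1 + 1 / (b - 1 / 2)) < \<mu> * ln (1 + 1 / (a - 1 / 2))" using \<mu> by simp
    ultimately show ?thesis unfolding g_def by linarith
  qed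
  have "(g \<longlongrightarrow> 0) at_top" unfolding g_def[abs_def] by real_asymp
  then have "\<forall>\<^sub>F r in at_top. g r < \<tau>" by (rule order_tendstoD(2)) (rule \<tau>)
  then obtain b where b: "g b < \<tau>" "1 < b"
    using eventually_happens[OF eventually_conj[OF _ eventually_gt_at_top[of 1]], of "\<lambda>t. g t < \<tau>"] by auto
  have c: "continuous_on {1..b} g"
    unfolding g_def[abs_def]
    by (intro continuous_intros ballI) (auto simp: add_pos_pos intro!: less_imp_neq[symmetric] add_pos_pos)
  have g1: "\<tau> < g 1" unfolding g_def using \<mu> by simp
  obtain r where r: "1 \<le> r" "r \<le> b" "g r = \<tau>"
    using IVT2'[of g b \<tau> 1, OF _ _ _ c] b g1 by auto
  have "r \<noteq> 1" using r g1 by auto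
  then show "\<exists>r. 1 < r \<and> \<tau> / r + \<mu> * ln (1 + 1 / (r - 1 / 2)) = \<tau>"
    using r unfolding g_def by (intro exI[of _ r]) auto
  show "s = t" if "1 < s \<and> \<tau> / s + \<mu> * ln (1 + 1 / (s - 1 / 2)) = \<tau>"
    "1 < t \<and> \<tau> / t + \<mu> * ln (1 + 1 / (t - 1 / 2)) = \<tau>" for s t
    using anti[of s t] anti[of t s] that unfolding g_def by (cases s t rule: linorder_cases) auto
qed

text \<open>After taking logarithms this is the equation for \<open>r\<close>: the square root and
  the exponential in the definition of \<open>c\<^sub>3\<close> cancel.\<close>

lemma r_equation_product:
  fixes \<tau> l r :: real
  assumes l: "0 < l" and r: "1 < r" and eq: "\<tau> / r + 1 / (2 * l) * ln (1 + 1 / (r - 1 / 2)) = \<tau>"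
  shows "sqrt (1 + 1 / (r - 1 / 2)) * exp (- l * ((r - 1) / r) * \<tau>) = 1"
proof -
  let ?x = "1 + 1 / (r - 1 / 2)"
  have x: "0 < ?x" using r by (intro add_pos_pos) simp_all
  have "(r - 1) / r * \<tau> = \<tau> - \<tau> / r" using r by (simp add: field_simps)
  also have "\<dots> = 1 / (2 * l) * ln ?x" using eq by linarith
  finally have "- l * ((r - 1) / r) * \<tau> = - l * (1 / (2 * l) * ln ?x)" by (simp only: mult.assoc)
  also have "\<dots> = - (ln ?x / 2)" using l by simp
  finally have "exp (- l * ((r - 1) / r) * \<tau>) = inverse (exp (ln ?x / 2))" by (simp only: exp_minus)
  moreover have "sqrt ?x = exp (ln ?x / 2)"
    using x by (simp add: ln_sqrt[symmetric])
  ultimately show ?thesis by simp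
qed

text \<open>To first order the left side is 1 - x/1920, and 1/4000 leaves a margin that absorbs the
  quadratic terms for x up to 1.\<close>

lemma cubic_rate_bound:
  fixes x c :: real
  assumes x: "0 \<le> x" "x \<le> 1" and c: "c \<le> 1 / 4000"
  shows "1 / sqrt (1 + x / 960) \<le> 1 - c * x"
proof -
  have "c * x \<le> 1 / 4000 * x" using c x by (intro mult_right_mono)
  then have m: "1 - x / 4000 \<le> 1 - c * x" by simp
  have p: "0 \<le> 1 - x / 4000" using x by simp
  have "(1 / sqrt (1 + x / 960))\<^sup>2 = 1 / (1 + x / 960)" using x by (simp add: power_divide)
  also have "\<dots> \<le> (1 - x / 4000)\<^sup>2"
  proof -
    have "x * x \<le> x * 1" using x by (intro mult_left_mono) auto
    then have "1 \<le> (1 - x / 2000) * (1 + x / 960)" using x by (simp add: algebra_simps)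
    also have "\<dots> \<le> (1 - x / 4000)\<^sup>2 * (1 + x / 960)"
      using x by (intro mult_right_mono) (simp_all add: power2_eq_square algebra_simps)
    finally show ?thesis using x by (simp add: divide_le_eq)
  qed
  finally have "1 / sqrt (1 + x / 960) \<le> 1 - x / 4000" by (rule power2_le_imp_le[OF _ p])
  with m show ?thesis by linarith
qed

section \<open>Decay estimates for the semigroup\<close>

text \<open>The value is about 0.086. The bound 1/10 is half of the rate 1/5 obtained for squared
  norms in \<open>mode_exponential_decay\<close>.\<close>

lemma lambda0_bounds: "0 < lambda0" "lambda0 \<le> 1 / 10"
proof -
  have s: "141 / 100 \<le> sqrt 2" "sqrt 2 \<le> 142 / 100"
    by (rule real_le_rsqrt, simp add: power2_eq_square) (rule real_le_lsqrt, simp_all add: power2_eq_square)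
  have s2: "sqrt 2 * sqrt 2 = 2" by simp
  have a: "1 / (6 * sqrt 2) = sqrt 2 / 12" using s2 by (simp add: divide_eq_eq)
  have "sqrt 8 = 2 * sqrt 2" using real_sqrt_mult[of 4 2] by simp
  then have b: "1 / sqrt 8 = sqrt 2 / 4" using s2 by (simp add: divide_eq_eq)
  have "sqrt (7 / 16 + sqrt 2 / 4) \<le> 9 / 10"
    by (rule real_le_lsqrt) (use s in \<open>simp_all add: power2_eq_square\<close>)
  moreover have "88 / 100 \<le> sqrt (7 / 16 + sqrt 2 / 4)"
    by (rule real_le_rsqrt) (use s in \<open>simp add: power2_eq_square\<close>)
  ultimately show "0 < lambda0" "lambda0 \<le> 1 / 10" unfolding lambda0_def a b using s by linarith+
qed

lemma Cpow_scale: "Cpow n (\<lambda>v. c * \<phi> v) k = (\<lambda>v. c * Cpow n \<phi> k v)"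
  unfolding Cpow_def by (induction k) (simp_all add: Cn_scale)

lemma evol_scale:
  assumes \<phi>: "\<phi> \<in> L2 circle" and v: "v \<in> space circle"
  shows "evol n (\<lambda>v. c * \<phi> v) t v = c * evol n \<phi> t v"
proof (rule LIMSEQ_unique)
  show "(\<lambda>N. evol_partial n (\<lambda>v. c * \<phi> v) t N v) \<longlonglongrightarrow> evol n (\<lambda>v. c * \<phi> v) t v"
    by (rule evol_pointwise(3)[OF L2_scale[OF \<phi>] v])
  have "evol_partial n (\<lambda>v. c * \<phi> v) t N v = c * evol_partial n \<phi> t N v" for N
    unfolding evol_partial_def Cpow_scale by (simp add: sum_distrib_left mult.assoc)
  then show "(\<lambda>N. evol_partial n (\<lambda>v. c * \<phi> v) t N v) \<longlonglongrightarrow> c * evol n \<phi> t v"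
    using tendsto_mult_left[OF evol_pointwise(3)[OF \<phi> v, of n t], of c] by simp
qed

lemma norm_evol_scale:
  assumes \<phi>: "\<phi> \<in> L2 circle"
  shows "l2_norm circle (evol n (\<lambda>v. c * \<phi> v) t) = cmod c * l2_norm circle (evol n \<phi> t)"
  unfolding l2_norm_scale[symmetric]
  by (intro l2_norm_cong_AE L2_measurable evol_L2 L2_scale \<phi> AE_I2 evol_scale)

lemma evol_0_const:
  assumes v: "v \<in> space circle" shows "evol 0 (\<lambda>v. c) t v = c"
proof (rule LIMSEQ_unique)
  show "(\<lambda>N. evol_partial 0 (\<lambda>v. c) t N v) \<longlonglongrightarrow> evol 0 (\<lambda>v. c) t v"
    by (rule evol_pointwise(3)[OF const_L2_circle v])
  have C: "Cn 0 (\<lambda>v. a) = (\<lambda>v. 0)" for a unfolding Cn_eq Rv_one v_dot_def rvec_0 by simp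
  have "Cpow 0 (\<lambda>v. c) (Suc k) = (\<lambda>v. 0)" for k
    unfolding Cpow_def by (induction k) (simp_all add: C)
  then have "evol_partial 0 (\<lambda>v. c) t (Suc N) v = c" for N
    unfolding evol_partial_def sum.lessThan_Suc_shift by (simp add: Cpow_def)
  then have "(\<lambda>N. evol_partial 0 (\<lambda>v. c) t (Suc N) v) \<longlonglongrightarrow> c" by simp
  then show "(\<lambda>N. evol_partial 0 (\<lambda>v. c) t N v) \<longlonglongrightarrow> c" by (rule LIMSEQ_imp_Suc)
qed

section \<open>The equilibrium and the projection onto constants\<close>

lemma equilibrium_mode_0:
  assumes "f \<in> L2 phase" shows "equilibrium f = v_mean (fcoef 0 f)"
  unfolding equilibrium_def integral_phase_eq_mode_0[OF assms] by simp

lemma integral_const_phase: "(LINT z|phase. (c :: complex)) = of_real ((2 * pi) ^ 3) * c"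
proof -
  have "fcoef 0 (\<lambda>z. c) = (\<lambda>v. c)" unfolding lift_0_const[symmetric] fcoef_lift by simp
  then show ?thesis unfolding integral_phase_eq_mode_0[OF const_L2_phase] by simp
qed

lemma fluctuation_L2: "f \<in> L2 phase \<Longrightarrow> (\<lambda>z. f z - equilibrium f) \<in> L2 phase"
  by (rule L2_diff[OF _ const_L2_phase])

lemma fluctuation_mean:
  assumes f: "f \<in> L2 phase"
  shows "v_mean (fcoef 0 (\<lambda>z. f z - equilibrium f)) = 0"
proof -
  have i: "integrable phase f" using L2_integrable_mult[OF f const_L2_phase[of 1]] by simp
  have "(LINT z|phase. f z - equilibrium f) = (LINT z|phase. f z) - (LINT z|phase. equilibrium f)"
    by (rule Bochner_Integration.integral_diff[OF i]) simp
  also have "\<dots> = 0" unfolding integral_const_phase by (simp add: equilibrium_def)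
  finally show ?thesis unfolding integral_phase_eq_mode_0[OF fluctuation_L2[OF f]] by simp
qed

lemma fluctuation_orthogonal:
  assumes f: "f \<in> L2 phase" shows "l2_inner phase (\<lambda>z. f z - equilibrium f) (\<lambda>z. c) = 0"
proof -
  have "l2_inner phase (\<lambda>z. f z - equilibrium f) (\<lambda>z. c) = cnj c * (LINT z|phase. f z - equilibrium f)"
    by (simp add: l2_inner_def)
  then show ?thesis
    unfolding integral_phase_eq_mode_0[OF fluctuation_L2[OF f]] fluctuation_mean[OF f] by simp
qed

lemma norm_fluctuation_le:
  assumes f: "f \<in> L2 phase" shows "l2_norm phase (\<lambda>z. f z - equilibrium f) \<le> l2_norm phase f"
proof (rule power2_le_imp_le)
  have "(l2_norm phase (\<lambda>z. (f z - equilibrium f) + equilibrium f))\<^sup>2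
    = (l2_norm phase (\<lambda>z. f z - equilibrium f))\<^sup>2 + 2 * Re (l2_inner phase (\<lambda>z. f z - equilibrium f) (\<lambda>z. equilibrium f))
      + (l2_norm phase (\<lambda>z. equilibrium f))\<^sup>2"
    by (rule l2_norm_add_power2[OF fluctuation_L2[OF f] const_L2_phase])
  then show "(l2_norm phase (\<lambda>z. f z - equilibrium f))\<^sup>2 \<le> (l2_norm phase f)\<^sup>2"
    unfolding fluctuation_orthogonal[OF f] by simp
qed simp

text \<open>Equality holds at every point: \<open>constants\<close> consists of genuinely constant
  functions, so the choice has a single candidate.\<close>

lemma orth_proj_constants:
  assumes f: "f \<in> L2 phase" shows "orth_proj phase constants f = (\<lambda>z. equilibrium f)"
  unfolding orth_proj_def
proof (rule some_equality)
  show "(\<lambda>z. equilibrium f) \<in> constants \<and> (\<forall>h\<in>constants. l2_inner phase (\<lambda>z. f z - equilibrium f) h = 0)"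
    using fluctuation_orthogonal[OF f] by (auto simp: constants_def)
  fix g assume g: "g \<in> constants \<and> (\<forall>h\<in>constants. l2_inner phase (\<lambda>z. f z - g z) h = 0)"
  then obtain a where a: "g = (\<lambda>z. a)" by (auto simp: constants_def)
  have i: "integrable phase f" using L2_integrable_mult[OF f const_L2_phase[of 1]] by simp
  have "(\<lambda>z. 1) \<in> constants" by (auto simp: constants_def)
  then have "0 = (LINT z|phase. f z - a)" using g by (auto simp: a l2_inner_def)
  also have "\<dots> = (LINT z|phase. f z) - (LINT z|phase. a)"
    by (rule Bochner_Integration.integral_diff[OF i]) simp
  finally have "(LINT z|phase. f z) = of_real ((2 * pi) ^ 3) * a" unfolding integral_const_phase by simp
  then show "g = (\<lambda>z. equilibrium f)" by (simp add: a equilibrium_def)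
qed

context
  fixes P :: "real \<Rightarrow> ((real^2) \<times> (real^2) \<Rightarrow> complex) \<Rightarrow> ((real^2) \<times> (real^2) \<Rightarrow> complex)"
  assumes P: "generates phase (op_uminus C_op) P"
begin

lemma P_fluctuation:
  assumes f: "f \<in> L2 phase" and t: "0 \<le> t"
  shows "AE z in phase. P t (\<lambda>z. f z - equilibrium f) z = P t f z - equilibrium f"
proof -
  have "AE z in phase. P t (lift 0 (\<lambda>v. equilibrium f)) z = lift 0 (evol 0 (\<lambda>v. equilibrium f) t) z"
    by (rule P_lift[OF P const_L2_circle t])
  moreover have "AE z in phase. lift 0 (evol 0 (\<lambda>v. equilibrium f) t) z = equilibrium f"
  proof (rule AE_I2)
    fix z assume "z \<in> space phase"
    then have "snd z \<in> space circle" by (auto simp: space_phase space_circle)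
    then show "lift 0 (evol 0 (\<lambda>v. equilibrium f) t) z = equilibrium f"
      unfolding lift_def rvec_0 by (simp add: evol_0_const)
  qed
  moreover have "AE z in phase. P t (\<lambda>z. f z - equilibrium f) z = P t f z - P t (\<lambda>z. equilibrium f) z"
    by (rule bounded_op_diff[OF P_bounded[OF P t] f const_L2_phase])
  ultimately show ?thesis unfolding lift_0_const by eventually_elim simp
qed

text \<open>Reduces a decay estimate on phase space to one factor valid in all modes. The mode 0 has
  to decay only for coefficients of mean zero, since subtracting the equilibrium removes the mean
  there and touches no other mode.\<close>

lemma P_fluctuation_decay:
  assumes f: "f \<in> L2 phase" and t: "0 \<le> t" and c: "0 \<le> c"
    and modes: "\<And>n \<phi>. n \<noteq> 0 \<Longrightarrow> \<phi> \<in> L2 circle \<Longrightarrow> l2_norm circle (evol n \<phi> t) \<le> c * l2_norm circle \<phi>"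
    and zero: "\<And>\<phi>. \<phi> \<in> L2 circle \<Longrightarrow> v_mean \<phi> = 0 \<Longrightarrow> l2_norm circle (evol 0 \<phi> t) \<le> c * l2_norm circle \<phi>"
  shows "l2_norm phase (\<lambda>z. P t f z - equilibrium f) \<le> c * l2_norm phase (\<lambda>z. f z - equilibrium f)"
proof -
  let ?g = "\<lambda>z. f z - equilibrium f"
  note g = fluctuation_L2[OF f]
  note Pf = P_L2[OF P t f] and Pg = P_L2[OF P t g]
  have "l2_norm phase (\<lambda>z. P t f z - equilibrium f) = l2_norm phase (P t ?g)"
    by (rule l2_norm_cong_AE[symmetric, OF L2_measurable[OF Pg] L2_measurable[OF L2_diff[OF Pf const_L2_phase]] P_fluctuation[OF f t]])
  also have "\<dots> \<le> c * l2_norm phase ?g"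
  proof (rule norm_le_by_modes[OF Pg g c])
    fix n
    have "l2_norm circle (fcoef n (P t ?g)) = l2_norm circle (evol n (fcoef n ?g) t)"
      by (rule l2_norm_cong_AE[OF L2_measurable[OF fcoef_L2[OF Pg]] L2_measurable[OF evol_L2[OF fcoef_L2[OF g]]] fcoef_P[OF P g t]])
    also have "\<dots> \<le> c * l2_norm circle (fcoef n ?g)"
    proof (cases "n = 0")
      case True
      show ?thesis unfolding True by (rule zero[OF fcoef_L2[OF g] fluctuation_mean[OF f]])
    qed (rule modes[OF _ fcoef_L2[OF g]])
    finally show "l2_norm circle (fcoef n (P t ?g)) \<le> c * l2_norm circle (fcoef n ?g)" .
  qed
  finally show ?thesis .
qed

lemma P_contraction:
  assumes "f \<in> L2 phase" "0 \<le> t"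
  shows "l2_norm phase (\<lambda>z. P t f z - equilibrium f) \<le> l2_norm phase f"
proof -
  have "l2_norm phase (\<lambda>z. P t f z - equilibrium f) \<le> 1 * l2_norm phase (\<lambda>z. f z - equilibrium f)"
    by (rule P_fluctuation_decay[OF assms]) (simp_all add: evol_contraction assms)
  then show ?thesis using norm_fluctuation_le[OF assms(1)] by simp
qed

lemma P_exponential_decay:
  assumes f: "f \<in> L2 phase" and t: "0 \<le> t"
  shows "l2_norm phase (\<lambda>z. P t f z - equilibrium f)
    \<le> sqrt 3 * exp (- lambda0 * t) * l2_norm phase (\<lambda>z. f z - equilibrium f)"
proof (rule P_fluctuation_decay[OF f t])
  have l: "lambda0 * t \<le> 1 / 10 * t" by (rule mult_right_mono[OF lambda0_bounds(2) t])
  have sq: "(sqrt 3 * exp (- lambda0 * t))\<^sup>2 = 3 * exp (- 2 * lambda0 * t)"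
    by (simp add: power_mult_distrib exp_double[symmetric] mult.assoc)
  {
    fix n :: "int^2" and \<phi> assume n: "n \<noteq> 0" and \<phi>: "\<phi> \<in> L2 circle"
    show "l2_norm circle (evol n \<phi> t) \<le> sqrt 3 * exp (- lambda0 * t) * l2_norm circle \<phi>"
    proof (rule power2_le_imp_le)
      have "(l2_norm circle (evol n \<phi> t))\<^sup>2 \<le> 3 * exp (- (1/5) * t) * (l2_norm circle \<phi>)\<^sup>2"
        by (rule mode_exponential_decay[OF n \<phi> t])
      also have "\<dots> \<le> 3 * exp (- 2 * lambda0 * t) * (l2_norm circle \<phi>)\<^sup>2"
        using l by (intro mult_right_mono mult_left_mono) simp_all
      finally show "(l2_norm circle (evol n \<phi> t))\<^sup>2 \<le> (sqrt 3 * exp (- lambda0 * t) * l2_norm circle \<phi>)\<^sup>2"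
        unfolding power_mult_distrib[of _ "l2_norm circle \<phi>"] sq .
    qed simp
  }
  fix \<phi> assume \<phi>: "\<phi> \<in> L2 circle" "v_mean \<phi> = 0"
  show "l2_norm circle (evol 0 \<phi> t) \<le> sqrt 3 * exp (- lambda0 * t) * l2_norm circle \<phi>"
  proof (rule power2_le_imp_le)
    have "exp (- 2 * t) \<le> 3 * exp (- 2 * lambda0 * t)"
    proof -
      have "exp (- 2 * t) \<le> exp (- 2 * lambda0 * t)" using l t by simp
      moreover have "0 \<le> exp (- 2 * lambda0 * t)" by simp
      ultimately show ?thesis by linarith
    qed
    then show "(l2_norm circle (evol 0 \<phi> t))\<^sup>2 \<le> (sqrt 3 * exp (- lambda0 * t) * l2_norm circle \<phi>)\<^sup>2"
      unfolding power_mult_distrib[of _ "l2_norm circle \<phi>"] sq mode_zero_decay[OF \<phi>]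
      by (rule mult_right_mono) simp
  qed simp
qed simp

lemma P_cubic_decay:
  assumes f: "f \<in> L2 phase" and t: "0 < t" "t \<le> 1" and c: "c \<le> 1 / 4000"
  shows "l2_norm phase (\<lambda>z. P t f z - equilibrium f) \<le> (1 - c * t ^ 3) * l2_norm phase f"
proof -
  have t3: "0 \<le> t ^ 3" "t ^ 3 \<le> 1" using t by (simp_all add: power_le_one)
  let ?d = "1 + t ^ 3 / 960"
  have d: "0 < ?d" using t3 by linarith
  have "l2_norm phase (\<lambda>z. P t f z - equilibrium f) \<le> 1 / sqrt ?d * l2_norm phase (\<lambda>z. f z - equilibrium f)"
  proof (rule P_fluctuation_decay[OF f])
    have le: "a \<le> 1 / sqrt ?d * b" if "?d * a\<^sup>2 \<le> b\<^sup>2" "0 \<le> b" for a b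
    proof (rule power2_le_imp_le)
      show "a\<^sup>2 \<le> (1 / sqrt ?d * b)\<^sup>2"
        using that d by (simp add: power_mult_distrib power_divide pos_le_divide_eq mult.commute)
      show "0 \<le> 1 / sqrt ?d * b" using that d by simp
    qed
    show "l2_norm circle (evol n \<phi> t) \<le> 1 / sqrt ?d * l2_norm circle \<phi>" if "n \<noteq> 0" "\<phi> \<in> L2 circle" for n :: "int^2" and \<phi>
      by (rule le[OF mode_cubic_decay[OF that t]]) simp
    show "l2_norm circle (evol 0 \<phi> t) \<le> 1 / sqrt ?d * l2_norm circle \<phi>" if \<phi>: "\<phi> \<in> L2 circle" "v_mean \<phi> = 0" for \<phi>
    proof (rule le)
      have "t ^ 3 \<le> t ^ 1" by (rule power_decreasing) (use t in simp_all)
      then have "?d \<le> 1 + 2 * t" using t by simp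
      also have "\<dots> \<le> exp (2 * t)" by (rule exp_ge_add_one_self)
      finally have "?d * exp (- 2 * t) \<le> exp (2 * t) * exp (- 2 * t)" by (rule mult_right_mono) simp
      also have "\<dots> = 1" by (simp add: exp_minus)
      finally have "?d * exp (- 2 * t) * (l2_norm circle \<phi>)\<^sup>2 \<le> 1 * (l2_norm circle \<phi>)\<^sup>2" by (rule mult_right_mono) simp
      then show "?d * (l2_norm circle (evol 0 \<phi> t))\<^sup>2 \<le> (l2_norm circle \<phi>)\<^sup>2"
        unfolding mode_zero_decay[OF \<phi>] by (simp only: mult.assoc mult_1)
    qed simp
  qed (use t d in simp_all)
  also have "\<dots> \<le> (1 - c * t ^ 3) * l2_norm phase f"
  proof (rule mult_mono)
    show "1 / sqrt ?d \<le> 1 - c * t ^ 3" by (rule cubic_rate_bound[OF t3 c])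
    moreover have "0 \<le> 1 / sqrt ?d" using d by simp
    ultimately show "0 \<le> 1 - c * t ^ 3" by linarith
  qed (simp_all add: norm_fluctuation_le[OF f])
  finally show ?thesis .
qed

abbreviation (input) deviation :: "real \<Rightarrow> ((real^2) \<times> (real^2) \<Rightarrow> complex) \<Rightarrow> (real^2) \<times> (real^2) \<Rightarrow> complex" where
  "deviation t \<equiv> (\<lambda>f z. P t f z - orth_proj phase constants f z)"

lemma norm_deviation: "f \<in> L2 phase \<Longrightarrow> l2_norm phase (deviation t f) = l2_norm phase (\<lambda>z. P t f z - equilibrium f)"
  by (simp add: orth_proj_constants)

lemma op_norm_deviation_le:
  assumes t: "0 \<le> t" "t \<le> 1" and c: "c \<le> 1 / 4000"
  shows "op_norm phase (deviation t) \<le> 1 - c * t ^ 3"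
  unfolding op_norm_def
proof (rule cSUP_least)
  show "{f \<in> L2 phase. l2_norm phase f \<le> 1} \<noteq> {}" using L2_zero[of phase] l2_norm_zero[of phase] by force
  fix f assume "f \<in> {f \<in> L2 phase. l2_norm phase f \<le> 1}"
  then have f: "f \<in> L2 phase" "l2_norm phase f \<le> 1" by simp_all
  show "l2_norm phase (deviation t f) \<le> 1 - c * t ^ 3"
  proof (cases "t = 0")
    \<comment> \<open>The cubic estimate needs a positive time, as its weight is divided by t; at t
      = 0 contraction suffices.\<close>
    case True
    then show ?thesis unfolding norm_deviation[OF f(1)] using P_contraction[OF f(1) t(1)] f(2) by simp
  next
    case False
    have "t ^ 3 \<le> 1" "0 \<le> t ^ 3" using t by (simp_all add: power_le_one)
    then have "c * t ^ 3 \<le> 1 / 4000 * 1" using c by (intro order_trans[OF mult_right_mono[OF c] mult_left_mono]) simp_all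
    then have "0 \<le> 1 - c * t ^ 3" by simp
    from mult_left_mono[OF f(2) this] show ?thesis
      unfolding norm_deviation[OF f(1)] using P_cubic_decay[OF f(1) _ t(2) c] False t(1) by simp
  qed
qed

text \<open>Divided by 2 pi, \<open>lift n\<close> embeds the circle isometrically; for n nonzero
  its range is orthogonal to the constants, and there \<open>P t\<close> acts as the flow of the
  mode.\<close>

lemma op_norm_exp_Cn_le:
  assumes n: "n \<noteq> 0" and t: "0 \<le> t"
  shows "op_norm circle (exp_Cn n t) \<le> op_norm phase (deviation t)"
  unfolding op_norm_def[of circle]
proof (rule cSUP_least)
  show "{f \<in> L2 circle. l2_norm circle f \<le> 1} \<noteq> {}" using L2_zero[of circle] l2_norm_zero[of circle] by force
  fix \<phi> assume "\<phi> \<in> {f \<in> L2 circle. l2_norm circle f \<le> 1}"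
  then have \<phi>: "\<phi> \<in> L2 circle" "l2_norm circle \<phi> \<le> 1" by simp_all
  let ?c = "complex_of_real (1 / (2 * pi))"
  let ?\<psi> = "\<lambda>v. ?c * \<phi> v" and ?f = "lift n (\<lambda>v. ?c * \<phi> v)"
  have c: "cmod ?c = 1 / (2 * pi)" unfolding norm_of_real by simp
  have \<psi>: "?\<psi> \<in> L2 circle" by (rule L2_scale[OF \<phi>(1)])
  note f = lift_L2(1)[OF \<psi>, of n]
  have fn: "l2_norm phase ?f \<le> 1" unfolding lift_L2(2)[OF \<psi>] l2_norm_scale c using \<phi>(2) by simp
  have e: "equilibrium ?f = 0" unfolding equilibrium_mode_0[OF f] fcoef_lift using n by simp
  have "l2_norm circle (exp_Cn n t \<phi>) = l2_norm circle (evol n \<phi> t)"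
    by (intro l2_norm_cong_AE L2_measurable exp_Cn_evol evol_L2 \<phi>)
  also have "\<dots> = l2_norm phase (lift n (evol n ?\<psi> t))"
    unfolding lift_L2(2)[OF evol_L2[OF \<psi>]] norm_evol_scale[OF \<phi>(1)] c by simp
  also have "\<dots> = l2_norm phase (P t ?f)"
    by (rule l2_norm_cong_AE[symmetric, OF L2_measurable[OF P_L2[OF P t f]] L2_measurable[OF lift_L2(1)[OF evol_L2[OF \<psi>]]] P_lift[OF P \<psi> t]])
  also have "\<dots> = l2_norm phase (deviation t ?f)" unfolding norm_deviation[OF f] e by simp
  also have "\<dots> \<le> op_norm phase (deviation t)" unfolding op_norm_def
  proof (rule cSUP_upper)
    show "?f \<in> {f \<in> L2 phase. l2_norm phase f \<le> 1}" using f fn by simp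
    show "bdd_above ((\<lambda>f. l2_norm phase (deviation t f)) ` {f \<in> L2 phase. l2_norm phase f \<le> 1})"
    proof (rule bdd_aboveI)
      fix x assume "x \<in> (\<lambda>f. l2_norm phase (deviation t f)) ` {f \<in> L2 phase. l2_norm phase f \<le> 1}"
      then obtain f where "f \<in> L2 phase" "l2_norm phase f \<le> 1" "x = l2_norm phase (deviation t f)" by blast
      then show "x \<le> 1" using norm_deviation[of f t] P_contraction[of f t] t by simp
    qed
  qed
  finally show "l2_norm circle (exp_Cn n t \<phi>) \<le> op_norm phase (deviation t)" .
qed

end

text \<open>The operator norm is tested with the constant function of norm one, along which little
  energy is lost for short times.\<close>

lemma op_norm_exp_Cn_lower:
  assumes r: "0 < r"
  shows "\<exists>c>0. \<forall>t\<in>{0..r}. 1 - c * t ^ 3 \<le> op_norm circle (exp_Cn n t)"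
proof -
  obtain c where c: "0 < c" "\<And>t. t \<in> {0..r} \<Longrightarrow> 1 - c * t ^ 3 \<le> l2_norm circle (evol n (\<lambda>v. 1) t) / sqrt (2 * pi)"
    using cubic_lower_bound_exists[OF r, of n] by blast
  have "1 - c * t ^ 3 \<le> op_norm circle (exp_Cn n t)" if t: "t \<in> {0..r}" for t
  proof -
    let ?c = "complex_of_real (1 / sqrt (2 * pi))"
    let ?\<phi> = "\<lambda>v :: real^2. ?c * 1"
    note one = const_L2_circle[of 1]
    have \<phi>: "?\<phi> \<in> L2 circle" by (rule L2_scale[OF one])
    have cn: "cmod ?c = 1 / sqrt (2 * pi)" unfolding norm_of_real by simp
    have eq: "l2_norm circle (exp_Cn n t \<phi>) = l2_norm circle (evol n \<phi> t)" if "\<phi> \<in> L2 circle" for \<phi>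
      by (intro l2_norm_cong_AE L2_measurable exp_Cn_evol evol_L2 that)
    have "l2_norm circle (\<lambda>v. 1) = sqrt (2 * pi)"
      by (rule real_sqrt_unique[symmetric]) (simp_all add: norm_one_circle)
    then have n1: "l2_norm circle ?\<phi> = 1" unfolding l2_norm_scale cn by simp
    have "1 - c * t ^ 3 \<le> l2_norm circle (exp_Cn n t ?\<phi>)"
      unfolding eq[OF \<phi>] norm_evol_scale[OF one] cn using c(2)[OF t] by simp
    also have "\<dots> \<le> op_norm circle (exp_Cn n t)" unfolding op_norm_def
    proof (rule cSUP_upper)
      show "?\<phi> \<in> {f \<in> L2 circle. l2_norm circle f \<le> 1}" using \<phi> n1 by simp
      show "bdd_above ((\<lambda>f. l2_norm circle (exp_Cn n t f)) ` {f \<in> L2 circle. l2_norm circle f \<le> 1})"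
      proof (rule bdd_aboveI)
        fix x assume "x \<in> (\<lambda>f. l2_norm circle (exp_Cn n t f)) ` {f \<in> L2 circle. l2_norm circle f \<le> 1}"
        then obtain f where f: "f \<in> L2 circle" "l2_norm circle f \<le> 1" "x = l2_norm circle (exp_Cn n t f)" by blast
        then show "x \<le> 1" using eq[OF f(1)] evol_contraction[OF f(1), of t n] t by simp
      qed
    qed
    finally show ?thesis .
  qed
  with c(1) show ?thesis by blast
qed

section \<open>The constants\<close>

lemma unit_constant: "\<exists>c. l2_norm circle (\<lambda>v. c) = 1"
proof -
  have "l2_norm circle (\<lambda>v. 1) = sqrt (2 * pi)"
    by (rule real_sqrt_unique[symmetric]) (simp_all add: norm_one_circle)
  then have "l2_norm circle (\<lambda>v. complex_of_real (1 / sqrt (2 * pi)) * 1) = 1"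
    unfolding l2_norm_scale norm_of_real by simp
  then show ?thesis by blast
qed

text \<open>Stated for an arbitrary map \<open>A\<close>, so that the square root of
  \<open>Rv\<close> stays opaque. A constant of norm one belongs to the set because
  \<open>Rv\<close> annihilates it; nonemptiness matters since the infimum of the empty set of reals
  has no known sign.\<close>

lemma Inf_norms_nonneg:
  assumes "0 \<le> \<delta>"
  shows "0 \<le> Inf {l2_norm circle (A \<phi>) |\<phi>. \<phi> \<in> L2 circle \<and> l2_norm circle \<phi> = 1 \<and> Re (l2_inner circle \<phi> (Rv \<phi>)) \<le> \<delta>}"
proof (rule cInf_greatest)
  obtain c where "l2_norm circle (\<lambda>v. c) = 1" using unit_constant by blast
  moreover have "Re (l2_inner circle (\<lambda>v. c) (Rv (\<lambda>v. c))) \<le> \<delta>"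
    unfolding Rv_one using assms by (simp add: l2_inner_def)
  ultimately show "{l2_norm circle (A \<phi>) |\<phi>. \<phi> \<in> L2 circle \<and> l2_norm circle \<phi> = 1 \<and> Re (l2_inner circle \<phi> (Rv \<phi>)) \<le> \<delta>} \<noteq> {}"
    using const_L2_circle[of c] by blast
qed auto

text \<open>By \<open>r_equation_product\<close> the left side is 1 - (\<open>\<delta>\<close> / (12
  r)) \<open>\<tau>\<close>^3, and comparing coefficients determines
  \<open>c\<^sub>3\<close>.\<close>

lemma c3_iff:
  assumes \<tau>: "0 < \<tau>" and r: "1 < r" "\<tau> / r + 1 / (2 * lambda0) * ln (1 + 1 / (r - 1 / 2)) = \<tau>"
  shows "(1 - \<delta> * \<tau> ^ 3 / (12 * r)) * sqrt (1 + 1 / (r - 1 / 2)) * exp (- lambda0 * ((r - 1) / r) * \<tau>) = 1 - c\<^sub>3 * \<tau> ^ 3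
    \<longleftrightarrow> c\<^sub>3 = \<delta> / (12 * r)"
proof -
  have cancel: "(1 - a * x = 1 - b * x) = (b = a)" if "x \<noteq> 0" for a b x :: real using that by auto
  have eq: "(1 - \<delta> * \<tau> ^ 3 / (12 * r)) * sqrt (1 + 1 / (r - 1 / 2)) * exp (- lambda0 * ((r - 1) / r) * \<tau>)
      = 1 - \<delta> / (12 * r) * \<tau> ^ 3"
    unfolding mult.assoc[of "1 - \<delta> * \<tau> ^ 3 / (12 * r)"] r_equation_product[OF lambda0_bounds(1) r] by simp
  show ?thesis unfolding eq by (rule cancel) (use \<tau> in simp)
qed

lemma delta_bounds:
  assumes "0 < \<kappa>\<^sub>1" "coercive_J \<kappa>\<^sub>1" "0 < \<kappa>\<^sub>3" "\<delta> = min (\<kappa>\<^sub>1 / 5) (\<kappa>\<^sub>3 / 2)"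
  shows "0 < \<delta>" "\<delta> \<le> 1 / 10"
proof -
  show "0 < \<delta>" using assms by simp
  have "\<delta> \<le> \<kappa>\<^sub>1 / 5" using assms(4) by simp
  with coercive_J_le_half[OF assms(2)] show "\<delta> \<le> 1 / 10" by linarith
qed

text \<open>Since \<open>lambda0\<close> times \<open>\<tau>\<close> is at most 1/10, the
  denominator is at least 10^3, which together with \<open>\<delta> \<le> 1/10\<close> is far more
  than the margin required.\<close>

lemma c2_bounds:
  assumes \<delta>: "0 < \<delta>" "\<delta> \<le> 1 / 10" and \<tau>: "0 < \<tau>" "\<tau> \<le> 1"
  shows "0 < \<delta> / 12 / (1 + 1 / (lambda0 * \<tau>)) ^ 3" "\<delta> / 12 / (1 + 1 / (lambda0 * \<tau>)) ^ 3 \<le> 1 / 4000"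
proof -
  have p: "0 < lambda0 * \<tau>" using lambda0_bounds \<tau> by simp
  have "lambda0 * \<tau> \<le> 1 / 10 * 1" using lambda0_bounds \<tau> by (intro mult_mono) simp_all
  then have "10 \<le> 1 / (lambda0 * \<tau>)" using p by (simp add: pos_le_divide_eq)
  then have b: "10 \<le> 1 + 1 / (lambda0 * \<tau>)" by simp
  then have "10 ^ 3 \<le> (1 + 1 / (lambda0 * \<tau>)) ^ 3" by (rule power_mono) simp
  then have "1000 \<le> (1 + 1 / (lambda0 * \<tau>)) ^ 3" by simp
  then have "\<delta> / 12 / (1 + 1 / (lambda0 * \<tau>)) ^ 3 \<le> (1 / 10) / 12 / 1000"
    using \<delta> by (intro frac_le divide_right_mono) simp_all
  also have "\<dots> \<le> 1 / 4000" by simp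
  finally show "\<delta> / 12 / (1 + 1 / (lambda0 * \<tau>)) ^ 3 \<le> 1 / 4000" .
  have "0 < 1 + 1 / (lambda0 * \<tau>)" using b by linarith
  then show "0 < \<delta> / 12 / (1 + 1 / (lambda0 * \<tau>)) ^ 3" using \<delta> by simp
qed

lemma tau_bounds:
  assumes "0 < \<tau>\<^sub>1" "0 < \<tau>\<^sub>3" "0 < \<delta>" "0 \<le> m" "\<tau>\<^sub>2 = sqrt (12 * \<delta>) / (m + sqrt \<delta>)" "\<tau> = Min {\<tau>\<^sub>1, \<tau>\<^sub>2, \<tau>\<^sub>3, 1}"
  shows "0 < \<tau>" "\<tau> \<le> 1"
proof -
  have "0 < m + sqrt \<delta>" using assms by (intro add_nonneg_pos) simp_all
  then have "0 < \<tau>\<^sub>2" using assms by simp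
  then show "0 < \<tau>" "\<tau> \<le> 1" using assms by simp_all
qed

lemma equilibrium_is_unique_stationary:
  assumes f: "f \<in> L2 phase"
  shows "((\<lambda>z. equilibrium f), (\<lambda>z. 0)) \<in> C_op \<and> (LINT z|phase. equilibrium f) = (LINT z|phase. f z) \<and>
    (\<forall>g. (g, (\<lambda>z. 0)) \<in> C_op \<and> (LINT z|phase. g z) = (LINT z|phase. f z) \<longrightarrow> (AE z in phase. g z = equilibrium f))"
proof (intro conjI allI impI)
  show "((\<lambda>z. equilibrium f), (\<lambda>z. 0)) \<in> C_op" by (rule const_C_op)
  show "(LINT z|phase. equilibrium f) = (LINT z|phase. f z)"
    unfolding integral_const_phase by (simp add: equilibrium_def)
  fix g assume g: "(g, (\<lambda>z. 0)) \<in> C_op \<and> (LINT z|phase. g z) = (LINT z|phase. f z)"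
  then have "(LINT z|phase. g z) = (LINT z|phase. f z)" by blast
  from equilibrium_unique[OF conjunct1[OF g]] show "AE z in phase. g z = equilibrium f"
    unfolding equilibrium_def \<open>(LINT z|phase. g z) = (LINT z|phase. f z)\<close> .
qed

lemma e1_nonzero: "(vector [1, 0] :: int^2) \<noteq> 0"
  by (auto simp: vec_eq_iff exI[of _ 1])

theorem proposition6p3:
  fixes P :: "real \<Rightarrow> ((real^2) \<times> (real^2) \<Rightarrow> complex) \<Rightarrow> ((real^2) \<times> (real^2) \<Rightarrow> complex)"
  assumes P: "generates phase (op_uminus C_op) P"
  shows
    "(hypocoercivity_index phase (D_circ \<inter> {f. (LINT z|phase. f z) = 0})
        J_op R_op (adj phase J_op) 1) \<and>
     (op_ge_on phase (D_circ \<inter> {f. (LINT z|phase. f z) = 0})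
        (hc_sum J_op R_op (adj phase J_op) 1) ((3 - sqrt 5) / 2)) \<and>
     (\<forall>f\<^sub>0\<in>L2 phase. \<forall>t\<ge>0.
        l2_norm phase (\<lambda>z. P t f\<^sub>0 z - equilibrium f\<^sub>0)
          \<le> sqrt 3 * exp (- lambda0 * t) * l2_norm phase (\<lambda>z. f\<^sub>0 z - equilibrium f\<^sub>0)) \<and>
     (\<forall>f\<^sub>0\<in>L2 phase.
        ((\<lambda>z. equilibrium f\<^sub>0), (\<lambda>z. 0)) \<in> C_op \<and>
        (LINT z|phase. equilibrium f\<^sub>0) = (LINT z|phase. f\<^sub>0 z) \<and>
        (\<forall>g. (g, (\<lambda>z. 0)) \<in> C_op \<and> (LINT z|phase. g z) = (LINT z|phase. f\<^sub>0 z) \<longrightarrow>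
           (AE z in phase. g z = equilibrium f\<^sub>0))) \<and>
     (\<exists>\<kappa>\<^sub>1>0. coercive_J \<kappa>\<^sub>1) \<and>
     (\<exists>\<kappa>\<^sub>3>0. coercive_C \<kappa>\<^sub>3) \<and>
     (hypocoercivity_index circle (L2 circle)
        (adj circle (graph_of circle (Cn (vector [1, 0])))) (graph_of circle Rv)
        (graph_of circle (Cn (vector [1, 0]))) 1) \<and>
     (\<forall>\<kappa>\<^sub>1 \<kappa>\<^sub>3 \<delta>. 0 < \<kappa>\<^sub>1 \<and> coercive_J \<kappa>\<^sub>1 \<and> 0 < \<kappa>\<^sub>3 \<and> coercive_C \<kappa>\<^sub>3 \<and> \<delta> = min (\<kappa>\<^sub>1 / 5) (\<kappa>\<^sub>3 / 2) \<longrightarrow>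
       (\<exists>!\<tau>\<^sub>1. 0 < \<tau>\<^sub>1 \<and> (exp (4 * \<tau>\<^sub>1) - 1 - 4 * \<tau>\<^sub>1) / (2 * \<tau>\<^sub>1) = \<delta>) \<and>
       (\<exists>!\<tau>\<^sub>3. 0 < \<tau>\<^sub>3 \<and>
          (exp (4 * \<tau>\<^sub>3) - 1 - 4 * \<tau>\<^sub>3 - 8 * \<tau>\<^sub>3\<^sup>2 - 32 / 3 * \<tau>\<^sub>3 ^ 3) / (2 * \<tau>\<^sub>3 ^ 3) = \<delta> / 12) \<and>
       (\<forall>\<tau>\<^sub>1 \<tau>\<^sub>2 \<tau>\<^sub>3 \<tau> c\<^sub>1 c\<^sub>2.
         0 < \<tau>\<^sub>1 \<and> (exp (4 * \<tau>\<^sub>1) - 1 - 4 * \<tau>\<^sub>1) / (2 * \<tau>\<^sub>1) = \<delta> \<and>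
         0 < \<tau>\<^sub>3 \<and>
         (exp (4 * \<tau>\<^sub>3) - 1 - 4 * \<tau>\<^sub>3 - 8 * \<tau>\<^sub>3\<^sup>2 - 32 / 3 * \<tau>\<^sub>3 ^ 3) / (2 * \<tau>\<^sub>3 ^ 3) = \<delta> / 12 \<and>
         \<tau>\<^sub>2 = sqrt (12 * \<delta>) /
           (Inf {l2_norm circle (nonneg_sqrt circle Rv (Jn (vector [1, 0]) \<phi>)) |\<phi>.
                  \<phi> \<in> L2 circle \<and> l2_norm circle \<phi> = 1 \<and> Re (l2_inner circle \<phi> (Rv \<phi>)) \<le> \<delta>}
            + sqrt \<delta>) \<and>
         \<tau> = Min {\<tau>\<^sub>1, \<tau>\<^sub>2, \<tau>\<^sub>3, 1} \<and>
         c\<^sub>1 = \<delta> / 12 \<and>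
         c\<^sub>2 = c\<^sub>1 / (1 + 1 / (lambda0 * \<tau>)) ^ 3 \<longrightarrow>
           0 < \<tau> \<and>
           (\<exists>!r. 1 < r \<and> \<tau> / r + 1 / (2 * lambda0) * ln (1 + 1 / (r - 1 / 2)) = \<tau>) \<and>
           (\<exists>c'>0. cubic_lower_bound \<tau> c') \<and>
           (\<forall>r. 1 < r \<and> \<tau> / r + 1 / (2 * lambda0) * ln (1 + 1 / (r - 1 / 2)) = \<tau> \<longrightarrow>
             (\<exists>!c\<^sub>3. (1 - \<delta> * \<tau> ^ 3 / (12 * r)) * sqrt (1 + 1 / (r - 1 / 2))
                      * exp (- lambda0 * ((r - 1) / r) * \<tau>) = 1 - c\<^sub>3 * \<tau> ^ 3) \<and>
             (\<forall>c\<^sub>3 c.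
               (1 - \<delta> * \<tau> ^ 3 / (12 * r)) * sqrt (1 + 1 / (r - 1 / 2))
                  * exp (- lambda0 * ((r - 1) / r) * \<tau>) = 1 - c\<^sub>3 * \<tau> ^ 3 \<and>
               c = min c\<^sub>2 c\<^sub>3 \<longrightarrow>
                 0 < c \<and>
                 (\<forall>c'>0. cubic_lower_bound \<tau> c' \<longrightarrow>
                   (\<forall>t\<in>{0..\<tau>}.
                     1 - c' * t ^ 3 \<le> op_norm phase (\<lambda>f z. P t f z - orth_proj phase constants f z) \<and>
                     op_norm phase (\<lambda>f z. P t f z - orth_proj phase constants f z) \<le> 1 - c * t ^ 3))))))"
proof (intro conjI allI impI ballI)
  show "hypocoercivity_index phase (D_circ \<inter> {f. (LINT z|phase. f z) = 0}) J_op R_op (adj phase J_op) 1"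
    by (rule hypocoercivity_index_phase)
  show "op_ge_on phase (D_circ \<inter> {f. (LINT z|phase. f z) = 0}) (hc_sum J_op R_op (adj phase J_op) 1) ((3 - sqrt 5) / 2)"
    by (rule op_ge_on_phase)
  show "\<exists>\<kappa>\<^sub>1>0. coercive_J \<kappa>\<^sub>1" using kappa_pos coercive_J_kappa by blast
  show "\<exists>\<kappa>\<^sub>3>0. coercive_C \<kappa>\<^sub>3"
    by (intro exI[of _ "(3 - sqrt 5) / 2 / 3"] conjI coercive_C_kappa divide_pos_pos[OF kappa_pos]) simp
  show "hypocoercivity_index circle (L2 circle) (adj circle (graph_of circle (Cn (vector [1, 0])))) (graph_of circle Rv)
      (graph_of circle (Cn (vector [1, 0]))) 1"
    by (rule hypocoercivity_index_C[OF e1_nonzero])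
next
  fix f\<^sub>0 and t :: real assume "f\<^sub>0 \<in> L2 phase" "0 \<le> t"
  then show "l2_norm phase (\<lambda>z. P t f\<^sub>0 z - equilibrium f\<^sub>0)
      \<le> sqrt 3 * exp (- lambda0 * t) * l2_norm phase (\<lambda>z. f\<^sub>0 z - equilibrium f\<^sub>0)"
    by (rule P_exponential_decay[OF P])
next
  fix f\<^sub>0 assume f: "f\<^sub>0 \<in> L2 phase"
  note * = equilibrium_is_unique_stationary[OF f]
  show "((\<lambda>z. equilibrium f\<^sub>0), (\<lambda>z. 0)) \<in> C_op" "(LINT z|phase. equilibrium f\<^sub>0) = (LINT z|phase. f\<^sub>0 z)"
    using * by blast+
  fix g assume "(g, (\<lambda>z. 0)) \<in> C_op \<and> (LINT z|phase. g z) = (LINT z|phase. f\<^sub>0 z)"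
  then show "AE z in phase. g z = equilibrium f\<^sub>0" using * by blast
next
  fix \<kappa>\<^sub>1 \<kappa>\<^sub>3 \<delta>
  assume "0 < \<kappa>\<^sub>1 \<and> coercive_J \<kappa>\<^sub>1 \<and> 0 < \<kappa>\<^sub>3 \<and> coercive_C \<kappa>\<^sub>3 \<and> \<delta> = min (\<kappa>\<^sub>1 / 5) (\<kappa>\<^sub>3 / 2)"
  then have \<delta>: "0 < \<delta>" "\<delta> \<le> 1 / 10" using delta_bounds[of \<kappa>\<^sub>1 \<kappa>\<^sub>3 \<delta>] by blast+
  show "\<exists>!\<tau>\<^sub>1. 0 < \<tau>\<^sub>1 \<and> (exp (4 * \<tau>\<^sub>1) - 1 - 4 * \<tau>\<^sub>1) / (2 * \<tau>\<^sub>1) = \<delta>"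
    by (rule tau1_unique[OF \<delta>(1)])
  show "\<exists>!\<tau>\<^sub>3. 0 < \<tau>\<^sub>3 \<and>
      (exp (4 * \<tau>\<^sub>3) - 1 - 4 * \<tau>\<^sub>3 - 8 * \<tau>\<^sub>3\<^sup>2 - 32 / 3 * \<tau>\<^sub>3 ^ 3) / (2 * \<tau>\<^sub>3 ^ 3) = \<delta> / 12"
    by (rule tau3_unique) (use \<delta> in simp)
  fix \<tau>\<^sub>1 \<tau>\<^sub>2 \<tau>\<^sub>3 \<tau> c\<^sub>1 c\<^sub>2
  let ?m = "Inf {l2_norm circle (nonneg_sqrt circle Rv (Jn (vector [1, 0]) \<phi>)) |\<phi>.
    \<phi> \<in> L2 circle \<and> l2_norm circle \<phi> = 1 \<and> Re (l2_inner circle \<phi> (Rv \<phi>)) \<le> \<delta>}"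
  assume A: "0 < \<tau>\<^sub>1 \<and> (exp (4 * \<tau>\<^sub>1) - 1 - 4 * \<tau>\<^sub>1) / (2 * \<tau>\<^sub>1) = \<delta> \<and> 0 < \<tau>\<^sub>3 \<and>
    (exp (4 * \<tau>\<^sub>3) - 1 - 4 * \<tau>\<^sub>3 - 8 * \<tau>\<^sub>3\<^sup>2 - 32 / 3 * \<tau>\<^sub>3 ^ 3) / (2 * \<tau>\<^sub>3 ^ 3) = \<delta> / 12 \<and>
    \<tau>\<^sub>2 = sqrt (12 * \<delta>) / (?m + sqrt \<delta>) \<and> \<tau> = Min {\<tau>\<^sub>1, \<tau>\<^sub>2, \<tau>\<^sub>3, 1} \<and>
    c\<^sub>1 = \<delta> / 12 \<and> c\<^sub>2 = c\<^sub>1 / (1 + 1 / (lambda0 * \<tau>)) ^ 3"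
  \<comment> \<open>Nonnegativity of the infimum makes the denominator of
    \<open>\<tau>\<^sub>2\<close>, and hence \<open>\<tau>\<close>, positive.\<close>
  have m: "0 \<le> ?m" by (rule Inf_norms_nonneg) (use \<delta> in simp)
  have \<tau>: "0 < \<tau>" "\<tau> \<le> 1" using tau_bounds[OF _ _ \<delta>(1) m] A by blast+
  have c2: "0 < c\<^sub>2" "c\<^sub>2 \<le> 1 / 4000" 
  proof -
    have "c\<^sub>1 = \<delta> / 12" "c\<^sub>2 = c\<^sub>1 / (1 + 1 / (lambda0 * \<tau>)) ^ 3" using A by blast+
    then show "0 < c\<^sub>2" "c\<^sub>2 \<le> 1 / 4000" using c2_bounds[OF \<delta> \<tau>] by (simp_all only:)
  qed
  show "0 < \<tau>" by (rule \<tau>)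
  show "\<exists>!r. 1 < r \<and> \<tau> / r + 1 / (2 * lambda0) * ln (1 + 1 / (r - 1 / 2)) = \<tau>"
    by (rule r_unique[OF \<tau>(1)]) (use lambda0_bounds in simp)
  show "\<exists>c'>0. cubic_lower_bound \<tau> c'"
    unfolding cubic_lower_bound_def by (rule op_norm_exp_Cn_lower[OF \<tau>(1)])
  fix r assume r: "1 < r \<and> \<tau> / r + 1 / (2 * lambda0) * ln (1 + 1 / (r - 1 / 2)) = \<tau>"
  note iff = c3_iff[OF \<tau>(1) conjunct1[OF r] conjunct2[OF r], of \<delta>]
  show "\<exists>!c\<^sub>3. (1 - \<delta> * \<tau> ^ 3 / (12 * r)) * sqrt (1 + 1 / (r - 1 / 2))
      * exp (- lambda0 * ((r - 1) / r) * \<tau>) = 1 - c\<^sub>3 * \<tau> ^ 3"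
    unfolding iff by blast
  fix c\<^sub>3 c
  assume c: "(1 - \<delta> * \<tau> ^ 3 / (12 * r)) * sqrt (1 + 1 / (r - 1 / 2))
    * exp (- lambda0 * ((r - 1) / r) * \<tau>) = 1 - c\<^sub>3 * \<tau> ^ 3 \<and> c = min c\<^sub>2 c\<^sub>3"
  have "0 < c\<^sub>3" using c r \<delta> unfolding iff by simp
  \<comment> \<open>The minimum inherits its upper bound from \<open>c\<^sub>2\<close>, while
    \<open>c\<^sub>3\<close> has to be known to be positive.\<close>
  then have cb: "0 < c" "c \<le> 1 / 4000" using c c2 by simp_all
  show "0 < c" by (rule cb)
  fix c' t :: real assume c': "cubic_lower_bound \<tau> c'" and t: "t \<in> {0..\<tau>}"
  then have t01: "0 \<le> t" "t \<le> 1" using \<tau> by auto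
  have "1 - c' * t ^ 3 \<le> op_norm circle (exp_Cn (vector [1, 0]) t)"
    using c' t unfolding cubic_lower_bound_def by blast
  also note op_norm_exp_Cn_le[OF P e1_nonzero t01(1)]
  finally show "1 - c' * t ^ 3 \<le> op_norm phase (\<lambda>f z. P t f z - orth_proj phase constants f z)" .
  show "op_norm phase (\<lambda>f z. P t f z - orth_proj phase constants f z) \<le> 1 - c * t ^ 3"
    by (rule op_norm_deviation_le[OF P t01 cb(2)])
qed

end
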